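(* There is a 2-fully-faithful embedding $\mathbf{UltCat}\hookrightarrow\mathbf{UltSp}$ whose essential image is spanned by those ultraconvergence spaces $A\colon\beta A_0\nrightarrow A_0$ such that $A=\Phi_\diamond$ for some pseudo-$\beta$-algebra $\Phi\colon\beta A_0\to A_0$.
   Context: Profunctors. For locally small categories, a profunctor $F\colon C\nrightarrow D$ is a functor $F\colon D^{\mathrm{op}}\times C\to\mathbf{Set}$; it is small if each $F(-,c)$ is a small colimit of representables; $(G\circ F)(e,c)=\int^dG(e,d)\times F(d,c)$; $f_\diamond(d,c)=D(d,fc)$ for a functor $f\colon C\to D$. Ultracompletion. For a locally small category $C$, $\beta C$ has as objects triples $(X,h,\nu)$ with $X$ a set, $h\colon X\to\mathrm{Ob}(C)$, $\nu$ an ultrafilter on $X$. Morphisms $(X,h,\nu)\to(X',h',\nu')$ are pairs $(g\colon X'\to X,\ (\alpha_x\colon h(gx)\to h'(x))_{x\in X'})$ with $g_*\nu'=\nu$, two pairs being identified if they agree on some member of $\nu'$. For $f\colon C\to D$, $\beta f(X,h,\nu)=(X,fh,\nu)$. Write $1$ for the singleton and for its unique ultrafilter. Unit: $\eta_C(c)=(1,c,1)$. Multiplication: for $(X,H,\nu)\in\beta^2C$, $H(x)=(X_x,h_x,\nu_x)$, $\mu_C(X,H,\nu)=(\sum_xX_x,\ (h_x(z))_{(x,z)},\ \sum_{x:\nu}\nu_x)$, where $S\in\sum_{x:\nu}\nu_x$ iff $\{x\mid S\cap X_x\in\nu_x\}\in\nu$. This is a pseudomonad on the 2-category $\mathbf{CAT}$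 of locally small categories, with canonical isomorphisms $\mu\eta_\beta\cong1\cong\mu\,\beta\eta$, $\mu\,\beta\mu\cong\mu\mu_\beta$. $\mathbf{UltCat}$ (ultracategories) is the 2-category of pseudo-$\beta$-algebras $(A_0,\Phi\colon\beta A_0\to A_0,\ 1\cong\Phi\eta,\ \Phi\,\beta\Phi\cong\Phi\mu)$, colax morphisms (functors $f$ with a coherent, not necessarily invertible, $f\Phi\Rightarrow\Phi'\,\beta f$) and algebra 2-cells. $\mathbf{UltSp}$ is here identified with the 2-category of normalized lax $\underline\beta$-algebras, representable colax morphisms and algebra 2-cells, as follows. The skew extension $\underline\beta$ of $\beta$ to profunctors: for $F\colon C\nrightarrow D$, $\underline\beta F((X,h,\nu),(Y,k,\xi))$ is the set of pairs $(t\colon Y\to X,\ (\zeta_y\in F(h(ty),k(y)))_{y\in Y})$ with $t_*\xi=\nu$, modulo agreement on a member of $\xi$; it is natural in $F$ via $\underline\beta(\alpha)(t,\zeta)=(t,(\alpha\zeta_y)_y)$. The lax compositor $\psi\colon\underline\beta G\circ\underline\beta F\Rightarrow\underline\beta(G\circ F)$ sends $[(p,\gamma),(p',\gamma')]$ to $(pp',([\gamma_{p'(y)},\gamma'_y])_y)$. One has $\underline\beta(G\circ f_\diamond)\cong\underline\beta G\circ(\beta f)_\diamond$ evidently. For $t=(p,(\gamma_y)_y)\in\underline\beta^2F((X,H,\nu),(Y,K,\xi))$ with $\gamma_y=(p_y,(\gamma_{y,w})_w)$, write $\mu(t)\in\underline\beta F(\mu(X,H,\nu),\mu(Y,K,\xi))$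 for the class of $((y,w)\mapsto(p(y),p_y(w)),(\gamma_{y,w}))$. A lax $\underline\beta$-algebra is a category $A_0$, a small profunctor $A\colon\beta A_0\nrightarrow A_0$, and natural transformations $\Gamma\colon A_0(a,a')\to A(a,\eta(a'))$ and $\Delta\colon A\circ\underline\beta A\Rightarrow A\circ(\mu_{A_0})_\diamond$; write $\Delta(r,s)\in A(a,\mu(Y))$ for $r\in A(a,x)$, $s\in\underline\beta A(x,Y)$. Axioms, for $r\in A(a,x)$, up to transport along the canonical isomorphisms of $\beta$: (1) $\Delta(\Gamma(\mathrm{id}_a),(\mathrm{id}_1,r))=r$; (2) for $x=(X,k,\nu)$, $\Delta(r,(\mathrm{id}_X,(\Gamma(\mathrm{id}_{k(z)}))_{z\in X}))=r$; (3) for $s\in\underline\beta A(x,Y)$, $t\in\underline\beta^2A(Y,Z)$: $\Delta(\Delta(r,s),\mu(t))=\Delta(r,\underline\beta\Delta(\psi(s,t)))$, where $\underline\beta\Delta(\psi(s,t))\in\underline\beta(A\circ(\mu_{A_0})_\diamond)(x,Z)\cong\underline\beta A(x,\beta\mu(Z))$. It is normalized if each $\Gamma\colon A_0(a,a')\to A(a,\eta(a'))$ is bijective. A representable colax morphism $A\to A'$ is a functor $f\colon A_0\to A_0'$ with a natural transformation $f_\diamond\circ A\Rightarrow A'\circ(\beta f)_\diamond$, i.e. a natural family $\Theta\colon A(a,x)\to A'(fa,\beta f(x))$, such that $\Theta(\Gamma(\mathrm{id}_a))=\Gamma'(\mathrm{id}_{fa})$ and $\Theta(\Delta(r,s))=\Delta'(\Theta(r),\Theta_*(s))$,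 where $\Theta_*(t,\zeta)=(t,(\Theta\zeta_y)_y)$. An algebra 2-cell $(f,\Theta)\Rightarrow(f',\Theta')$ is a natural transformation $\sigma\colon f\Rightarrow f'$ with $A'(fa,(\beta\sigma)_x)(\Theta(r))=A'(\sigma_a,\beta f'(x))(\Theta'(r))$ for all $r\in A(a,x)$. "$A=\Phi_\diamond$ for a pseudo-$\beta$-algebra $\Phi$" means that the lax algebra $A$ is the one given by the representable profunctor $\Phi_\diamond(a,x)=A_0(a,\Phi x)$ with $\Gamma,\Delta$ induced by the structural isomorphisms of the pseudoalgebra $\Phi$. *)

theory Defs
  imports Main "HOL-Library.FuncSet" "HOL-Library.Equipollence"
begin

section \<open>Sets and classes\<close>

text \<open>
  A type of class \<open>universe\<close> plays the role of the class of all sets: a collection is a (small) set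
  iff it has strictly smaller cardinality than the type, and the cardinality of the type is regular
  and a strong limit.  Uncountability is not required, so type \<open>nat\<close> (where ``set'' means
  ``finite set'') is an instance; inaccessible cardinals give the usual meaning.
\<close>

class universe =
  assumes universe_infinite: "infinite (UNIV :: 'a set)"
    and universe_Pow: "(A :: 'a set) \<prec> (UNIV :: 'a set) \<Longrightarrow> Pow A \<prec> (UNIV :: 'a set)"
    and universe_UN: "(A :: 'a set) \<prec> (UNIV :: 'a set) \<Longrightarrow>
          (\<And>i. i \<in> A \<Longrightarrow> (F i :: 'a set) \<prec> (UNIV :: 'a set)) \<Longrightarrow> (\<Union>i\<in>A. F i) \<prec> (UNIV :: 'a set)"

lemma finite_iff_lesspoll_nat: "finite A \<longleftrightarrow> A \<prec> (UNIV :: nat set)"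
proof
  assume "A \<prec> (UNIV :: nat set)"
  then show "finite A"
    using infinite_le_lepoll lepoll_antisym unfolding lesspoll_def by blast
qed (rule finite_lesspoll_infinite[OF infinite_UNIV_nat])

instance nat :: universe
proof
  show "infinite (UNIV :: nat set)" by simp
qed (auto simp flip: finite_iff_lesspoll_nat)

definition small :: "'u itself \<Rightarrow> 'a set \<Rightarrow> bool" where
  "small _ A \<longleftrightarrow> A \<prec> (UNIV :: 'u set)"

text \<open>A fixed point and a fixed pairing, used to code \<open>1\<close> and disjoint sums as subsets of \<open>'u\<close>.\<close>

definition pt :: 'u where "pt = (SOME x. True)"

definition enc :: "'u \<times> 'u \<Rightarrow> 'u" where "enc = (SOME e. inj e)"

definition dec :: "'u \<Rightarrow> 'u \<times> 'u" where "dec = inv enc"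

lemma inj_enc:
  includes cardinal_syntax
  shows "inj (enc :: 'u :: universe \<times> 'u \<Rightarrow> 'u)"
proof -
  have "|(UNIV :: 'u set) \<times> (UNIV :: 'u set)| \<le>o |UNIV :: 'u set|"
    using card_of_Times_same_infinite[OF universe_infinite] ordIso_imp_ordLeq by blast
  then obtain e :: "'u \<times> 'u \<Rightarrow> 'u" where "inj e"
    unfolding card_of_ordLeq[symmetric] by auto
  then show ?thesis unfolding enc_def by (rule someI[of inj e])
qed

lemma dec_enc [simp]: "dec (enc p) = (p :: 'u :: universe \<times> 'u)"
  by (simp add: dec_def inj_enc)

section \<open>Categories, functors, natural transformations\<close>

record ('o, 'm) cat =
  Obj :: "'o set"
  Arr :: "'m set"
  Dom :: "'m \<Rightarrow> 'o"
  Cod :: "'m \<Rightarrow> 'o"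
  Ide :: "'o \<Rightarrow> 'm"
  Comp :: "'m \<Rightarrow> 'm \<Rightarrow> 'm" (infixr "\<odot>\<index>" 70)

definition hom :: "('o, 'm) cat \<Rightarrow> 'o \<Rightarrow> 'o \<Rightarrow> 'm set" where
  "hom C a b = {f \<in> Arr C. Dom C f = a \<and> Cod C f = b}"

locale category =
  fixes C :: "('o, 'm) cat" (structure)
  assumes Dom_in: "f \<in> Arr C \<Longrightarrow> Dom C f \<in> Obj C"
    and Cod_in: "f \<in> Arr C \<Longrightarrow> Cod C f \<in> Obj C"
    and Ide_in: "a \<in> Obj C \<Longrightarrow> Ide C a \<in> hom C a a"
    and Comp_in: "g \<in> hom C b c \<Longrightarrow> f \<in> hom C a b \<Longrightarrow> g \<odot> f \<in> hom C a c"
    and Comp_Ide: "f \<in> hom C a b \<Longrightarrow> f \<odot> Ide C a = f"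
    and Ide_Comp: "f \<in> hom C a b \<Longrightarrow> Ide C b \<odot> f = f"
    and Comp_assoc: "h \<in> hom C c d \<Longrightarrow> g \<in> hom C b c \<Longrightarrow> f \<in> hom C a b \<Longrightarrow>
          (h \<odot> g) \<odot> f = h \<odot> (g \<odot> f)"

definition locally_small :: "'u itself \<Rightarrow> ('o, 'm) cat \<Rightarrow> bool" where
  "locally_small U C \<longleftrightarrow> (\<forall>a \<in> Obj C. \<forall>b \<in> Obj C. small U (hom C a b))"

definition iso_arr :: "('o, 'm) cat \<Rightarrow> 'm \<Rightarrow> bool" where
  "iso_arr C f \<longleftrightarrow> f \<in> Arr C \<and> (\<exists>g \<in> hom C (Cod C f) (Dom C f).
     g \<odot>\<^bsub>C\<^esub> f = Ide C (Dom C f) \<and> f \<odot>\<^bsub>C\<^esub> g = Ide C (Cod C f))"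

definition isomorphic :: "('o, 'm) cat \<Rightarrow> 'o \<Rightarrow> 'o \<Rightarrow> bool" where
  "isomorphic C a b \<longleftrightarrow> (\<exists>f \<in> hom C a b. iso_arr C f)"

definition prod_cat :: "('o, 'm) cat \<Rightarrow> ('p, 'n) cat \<Rightarrow> ('o \<times> 'p, 'm \<times> 'n) cat" where
  "prod_cat C D = \<lparr>Obj = Obj C \<times> Obj D, Arr = Arr C \<times> Arr D,
     Dom = map_prod (Dom C) (Dom D), Cod = map_prod (Cod C) (Cod D),
     Ide = map_prod (Ide C) (Ide D),
     Comp = (\<lambda>(g, g') (f, f'). (g \<odot>\<^bsub>C\<^esub> f, g' \<odot>\<^bsub>D\<^esub> f'))\<rparr>"

record ('o, 'm, 'p, 'n) func =
  fobj :: "'o \<Rightarrow> 'p"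
  farr :: "'m \<Rightarrow> 'n"

locale is_functor =
  fixes C :: "('o, 'm) cat" and D :: "('p, 'n) cat" and F :: "('o, 'm, 'p, 'n) func"
  assumes fobj_in: "a \<in> Obj C \<Longrightarrow> fobj F a \<in> Obj D"
    and farr_in: "f \<in> hom C a b \<Longrightarrow> farr F f \<in> hom D (fobj F a) (fobj F b)"
    and farr_Ide: "a \<in> Obj C \<Longrightarrow> farr F (Ide C a) = Ide D (fobj F a)"
    and farr_Comp: "g \<in> hom C b c \<Longrightarrow> f \<in> hom C a b \<Longrightarrow>
          farr F (g \<odot>\<^bsub>C\<^esub> f) = farr F g \<odot>\<^bsub>D\<^esub> farr F f"

text \<open>
  The data of pseudoalgebras, of 1-cells and of 2-cells below are required to be extensional, so
  that their HOL equality is the mathematical one.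
\<close>

definition ext_functor :: "('o, 'm) cat \<Rightarrow> ('p, 'n) cat \<Rightarrow> ('o, 'm, 'p, 'n) func \<Rightarrow> bool" where
  "ext_functor C D F \<longleftrightarrow> is_functor C D F \<and>
     fobj F \<in> extensional (Obj C) \<and> farr F \<in> extensional (Arr C)"

definition fid :: "('o, 'm) cat \<Rightarrow> ('o, 'm, 'o, 'm) func" where
  "fid C = \<lparr>fobj = restrict (\<lambda>a. a) (Obj C), farr = restrict (\<lambda>f. f) (Arr C)\<rparr>"

definition fcomp :: "('o, 'm) cat \<Rightarrow> ('p, 'n, 'q, 'k) func \<Rightarrow> ('o, 'm, 'p, 'n) func
    \<Rightarrow> ('o, 'm, 'q, 'k) func" where
  "fcomp C G F = \<lparr>fobj = restrict (fobj G \<circ> fobj F) (Obj C), farr = restrict (farr G \<circ> farr F) (Arr C)\<rparr>"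

definition nat_trans :: "('o, 'm) cat \<Rightarrow> ('p, 'n) cat \<Rightarrow> ('o, 'm, 'p, 'n) func \<Rightarrow>
    ('o, 'm, 'p, 'n) func \<Rightarrow> ('o \<Rightarrow> 'n) \<Rightarrow> bool" where
  "nat_trans C D F G \<sigma> \<longleftrightarrow> \<sigma> \<in> extensional (Obj C) \<and>
     (\<forall>a \<in> Obj C. \<sigma> a \<in> hom D (fobj F a) (fobj G a)) \<and>
     (\<forall>f \<in> Arr C. \<sigma> (Cod C f) \<odot>\<^bsub>D\<^esub> farr F f = farr G f \<odot>\<^bsub>D\<^esub> \<sigma> (Dom C f))"

definition nat_iso :: "('o, 'm) cat \<Rightarrow> ('p, 'n) cat \<Rightarrow> ('o, 'm, 'p, 'n) func \<Rightarrow>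
    ('o, 'm, 'p, 'n) func \<Rightarrow> ('o \<Rightarrow> 'n) \<Rightarrow> bool" where
  "nat_iso C D F G \<sigma> \<longleftrightarrow> nat_trans C D F G \<sigma> \<and> (\<forall>a \<in> Obj C. iso_arr D (\<sigma> a))"

section \<open>Small colimits of representable presheaves\<close>

record ('d, 'dm, 'e) psh =
  PS :: "'d \<Rightarrow> 'e set"
  PM :: "'dm \<Rightarrow> 'e \<Rightarrow> 'e"

definition presheaf :: "'u itself \<Rightarrow> ('d, 'dm) cat \<Rightarrow> ('d, 'dm, 'e) psh \<Rightarrow> bool" where
  "presheaf U D P \<longleftrightarrow>
     (\<forall>d \<in> Obj D. small U (PS P d)) \<and>
     (\<forall>f \<in> Arr D. \<forall>p \<in> PS P (Cod D f). PM P f p \<in> PS P (Dom D f)) \<and>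
     (\<forall>d \<in> Obj D. \<forall>p \<in> PS P d. PM P (Ide D d) p = p) \<and>
     (\<forall>f \<in> Arr D. \<forall>g \<in> Arr D. \<forall>p \<in> PS P (Cod D g). Cod D f = Dom D g \<longrightarrow>
        PM P (g \<odot>\<^bsub>D\<^esub> f) p = PM P f (PM P g p))"

definition psh_nat :: "('d, 'dm) cat \<Rightarrow> ('d, 'dm, 'e) psh \<Rightarrow> ('d, 'dm, 'q) psh \<Rightarrow>
    ('d \<Rightarrow> 'e \<Rightarrow> 'q) \<Rightarrow> bool" where
  "psh_nat D P Q \<tau> \<longleftrightarrow>
     \<tau> \<in> (\<Pi>\<^sub>E d \<in> Obj D. PS P d \<rightarrow>\<^sub>E PS Q d) \<and>
     (\<forall>f \<in> Arr D. \<forall>p \<in> PS P (Cod D f). \<tau> (Dom D f) (PM P f p) = PM Q f (\<tau> (Cod D f) p))"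

definition yoneda :: "('d, 'dm) cat \<Rightarrow> 'd \<Rightarrow> ('d, 'dm, 'dm) psh" where
  "yoneda D c = \<lparr>PS = (\<lambda>d. hom D d c), PM = (\<lambda>f h. h \<odot>\<^bsub>D\<^esub> f)\<rparr>"

text \<open>Cocones, in presheaves on \<open>D\<close>, under the diagram of representables \<open>i \<mapsto> D(-, H i)\<close>.\<close>

definition rep_cocone :: "('d, 'dm) cat \<Rightarrow> ('i, 'im) cat \<Rightarrow> ('i, 'im, 'd, 'dm) func \<Rightarrow>
    ('d, 'dm, 'e) psh \<Rightarrow> ('i \<Rightarrow> 'd \<Rightarrow> 'dm \<Rightarrow> 'e) \<Rightarrow> bool" where
  "rep_cocone D I H P \<kappa> \<longleftrightarrow>
     (\<forall>i \<in> Obj I. psh_nat D (yoneda D (fobj H i)) P (\<kappa> i)) \<and>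
     (\<forall>k \<in> Arr I. \<forall>d \<in> Obj D. \<forall>h \<in> hom D d (fobj H (Dom I k)).
        \<kappa> (Cod I k) d (farr H k \<odot>\<^bsub>D\<^esub> h) = \<kappa> (Dom I k) d h)"

text \<open>Here \<open>\<^bold>S\<^bold>e\<^bold>t\<close>-valued presheaves are tested among those with values in small subsets of \<open>'u\<close>.\<close>

definition small_colim_of_reps :: "'u itself \<Rightarrow> ('d, 'dm) cat \<Rightarrow> ('d, 'dm, 'e) psh \<Rightarrow> bool" where
  "small_colim_of_reps U D P \<longleftrightarrow>
     (\<exists>(I :: ('u, 'u) cat) H \<kappa>.
        category I \<and> small U (Obj I) \<and> small U (Arr I) \<and> is_functor I D H \<and> rep_cocone D I H P \<kappa> \<and>
        (\<forall>(Q :: ('d, 'dm, 'u) psh) \<kappa>'. presheaf U D Q \<longrightarrow> rep_cocone D I H Q \<kappa>' \<longrightarrow>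
           (\<exists>!\<tau>. psh_nat D P Q \<tau> \<and>
              (\<forall>i \<in> Obj I. \<forall>d \<in> Obj D. \<forall>h \<in> hom D d (fobj H i). \<tau> d (\<kappa> i d h) = \<kappa>' i d h))))"

section \<open>Profunctors\<close>

record ('d, 'dm, 'c, 'cm, 'e) prof =
  PEl :: "'d \<Rightarrow> 'c \<Rightarrow> 'e set"
  PAct :: "'dm \<Rightarrow> 'cm \<Rightarrow> 'e \<Rightarrow> 'e"

text \<open>\<open>profunctor U C D F\<close> means \<open>F : C \<nrightarrow> D\<close>, that is, a functor \<open>D\<^sup>o\<^sup>p \<times> C \<rightarrow> Set\<close>.\<close>

definition profunctor :: "'u itself \<Rightarrow> ('c, 'cm) cat \<Rightarrow> ('d, 'dm) cat \<Rightarrow>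
    ('d, 'dm, 'c, 'cm, 'e) prof \<Rightarrow> bool" where
  "profunctor U C D F \<longleftrightarrow>
     (\<forall>d \<in> Obj D. \<forall>c \<in> Obj C. small U (PEl F d c)) \<and>
     (\<forall>f \<in> Arr D. \<forall>g \<in> Arr C. \<forall>e \<in> PEl F (Cod D f) (Dom C g).
        PAct F f g e \<in> PEl F (Dom D f) (Cod C g)) \<and>
     (\<forall>d \<in> Obj D. \<forall>c \<in> Obj C. \<forall>e \<in> PEl F d c. PAct F (Ide D d) (Ide C c) e = e) \<and>
     (\<forall>f \<in> Arr D. \<forall>f' \<in> Arr D. \<forall>g \<in> Arr C. \<forall>g' \<in> Arr C. \<forall>e \<in> PEl F (Cod D f) (Dom C g).
        Cod D f' = Dom D f \<longrightarrow> Cod C g = Dom C g' \<longrightarrow>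
        PAct F (f \<odot>\<^bsub>D\<^esub> f') (g' \<odot>\<^bsub>C\<^esub> g) e = PAct F f' g' (PAct F f g e))"

definition small_profunctor :: "'u itself \<Rightarrow> ('c, 'cm) cat \<Rightarrow> ('d, 'dm) cat \<Rightarrow>
    ('d, 'dm, 'c, 'cm, 'e) prof \<Rightarrow> bool" where
  "small_profunctor U C D F \<longleftrightarrow> profunctor U C D F \<and>
     (\<forall>c \<in> Obj C. small_colim_of_reps U D
        \<lparr>PS = (\<lambda>d. PEl F d c), PM = (\<lambda>f. PAct F f (Ide C c))\<rparr>)"

definition prof_nat :: "('c, 'cm) cat \<Rightarrow> ('d, 'dm) cat \<Rightarrow> ('d, 'dm, 'c, 'cm, 'e) prof \<Rightarrow>
    ('d, 'dm, 'c, 'cm, 'f) prof \<Rightarrow> ('d \<Rightarrow> 'c \<Rightarrow> 'e \<Rightarrow> 'f) \<Rightarrow> bool" where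
  "prof_nat C D F G \<alpha> \<longleftrightarrow>
     \<alpha> \<in> (\<Pi>\<^sub>E d \<in> Obj D. \<Pi>\<^sub>E c \<in> Obj C. PEl F d c \<rightarrow>\<^sub>E PEl G d c) \<and>
     (\<forall>f \<in> Arr D. \<forall>g \<in> Arr C. \<forall>e \<in> PEl F (Cod D f) (Dom C g).
        \<alpha> (Dom D f) (Cod C g) (PAct F f g e) = PAct G f g (\<alpha> (Cod D f) (Dom C g) e))"

definition hom_prof :: "('o, 'm) cat \<Rightarrow> ('o, 'm, 'o, 'm, 'm) prof" where
  "hom_prof C = \<lparr>PEl = hom C, PAct = (\<lambda>f g h. g \<odot>\<^bsub>C\<^esub> h \<odot>\<^bsub>C\<^esub> f)\<rparr>"

text \<open>\<open>rep_prof D f\<close> is \<open>f\<^sub>\<diamond>\<close>, for a functor \<open>f\<close> with codomain \<open>D\<close>.\<close>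

definition rep_prof :: "('d, 'dm) cat \<Rightarrow> ('c, 'cm, 'd, 'dm) func \<Rightarrow> ('d, 'dm, 'c, 'cm, 'dm) prof" where
  "rep_prof D f = \<lparr>PEl = (\<lambda>d c. hom D d (fobj f c)), PAct = (\<lambda>u v h. farr f v \<odot>\<^bsub>D\<^esub> h \<odot>\<^bsub>D\<^esub> u)\<rparr>"

text \<open>
  \<open>pull_prof G h k\<close> is the profunctor \<open>(d, c) \<mapsto> G(h d, k c)\<close>.  With \<open>h\<close> the identity it is the
  canonical form of \<open>G \<circ> k\<^sub>\<diamond>\<close>; a transformation \<open>F \<Rightarrow> pull_prof G h k\<close> is the same thing as a
  transformation \<open>h\<^sub>\<diamond> \<circ> F \<Rightarrow> G \<circ> k\<^sub>\<diamond>\<close>.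
\<close>

definition pull_prof :: "('d, 'dm, 'c, 'cm, 'e) prof \<Rightarrow> ('d1, 'dm1, 'd, 'dm) func \<Rightarrow>
    ('c1, 'cm1, 'c, 'cm) func \<Rightarrow> ('d1, 'dm1, 'c1, 'cm1, 'e) prof" where
  "pull_prof G h k = \<lparr>PEl = (\<lambda>d c. PEl G (fobj h d) (fobj k c)),
     PAct = (\<lambda>u v. PAct G (farr h u) (farr k v))\<rparr>"

text \<open>The coend \<open>(G \<circ> F)(e, c) = \<integral>\<^sup>d G(e, d) \<times> F(d, c)\<close>, for \<open>F : C \<nrightarrow> D\<close> and \<open>G : D \<nrightarrow> E\<close>.\<close>

definition coend_rel :: "('c, 'cm) cat \<Rightarrow> ('d, 'dm) cat \<Rightarrow> ('e, 'em) cat \<Rightarrow>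
    ('e, 'em, 'd, 'dm, 'x) prof \<Rightarrow> ('d, 'dm, 'c, 'cm, 'y) prof \<Rightarrow> 'e \<Rightarrow> 'c \<Rightarrow>
    (('d \<times> 'x \<times> 'y) \<times> ('d \<times> 'x \<times> 'y)) set" where
  "coend_rel C D E G F e c =
     {((Cod D u, PAct G (Ide E e) u x, y), (Dom D u, x, PAct F u (Ide C c) y)) | u x y.
        u \<in> Arr D \<and> x \<in> PEl G e (Dom D u) \<and> y \<in> PEl F (Cod D u) c}"

definition coend_cls :: "('c, 'cm) cat \<Rightarrow> ('d, 'dm) cat \<Rightarrow> ('e, 'em) cat \<Rightarrow>
    ('e, 'em, 'd, 'dm, 'x) prof \<Rightarrow> ('d, 'dm, 'c, 'cm, 'y) prof \<Rightarrow> 'e \<Rightarrow> 'c \<Rightarrow>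
    'd \<times> 'x \<times> 'y \<Rightarrow> ('d \<times> 'x \<times> 'y) set" where
  "coend_cls C D E G F e c p =
     (let R = coend_rel C D E G F e c in (R \<union> R\<inverse>)\<^sup>* `` {p})"

definition prof_comp :: "('c, 'cm) cat \<Rightarrow> ('d, 'dm) cat \<Rightarrow> ('e, 'em) cat \<Rightarrow>
    ('e, 'em, 'd, 'dm, 'x) prof \<Rightarrow> ('d, 'dm, 'c, 'cm, 'y) prof \<Rightarrow>
    ('e, 'em, 'c, 'cm, ('d \<times> 'x \<times> 'y) set) prof" where
  "prof_comp C D E G F = \<lparr>
     PEl = (\<lambda>e c. coend_cls C D E G F e c ` (SIGMA d : Obj D. PEl G e d \<times> PEl F d c)),
     PAct = (\<lambda>u v k. let (d, x, y) = SOME p. p \<in> k in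
       coend_cls C D E G F (Dom E u) (Cod C v) (d, PAct G u (Ide D d) x, PAct F (Ide D d) v y))\<rparr>"

section \<open>Ultracompletion\<close>

text \<open>
  An ultrafilter on a set \<open>X \<subseteq> UNIV\<close> is represented by the ultrafilter on the type that it
  generates, so its members are the sets \<open>S\<close> with \<open>\<forall>\<^sub>F z in \<nu>. z \<in> S\<close>, among them \<open>X\<close> itself;
  pushforward is \<^const>\<open>filtermap\<close>.
\<close>

definition ultrafilter :: "'u filter \<Rightarrow> bool" where
  "ultrafilter \<nu> \<longleftrightarrow> \<nu> \<noteq> bot \<and> (\<forall>P. eventually P \<nu> \<or> eventually (\<lambda>z. \<not> P z) \<nu>)"

datatype ('u, 'o) bobj = BObj (idx: "'u set") (val: "'u \<Rightarrow> 'o") (ult: "'u filter")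

definition bObj :: "('o, 'm) cat \<Rightarrow> ('u, 'o) bobj set" where
  "bObj C = {x. small TYPE('u) (idx x) \<and> val x \<in> idx x \<rightarrow>\<^sub>E Obj C \<and>
     ultrafilter (ult x) \<and> (\<forall>\<^sub>F z in ult x. z \<in> idx x)}"

text \<open>
  For a family of sets \<open>E a b\<close>, \<open>bpairs E x y\<close> are the pairs \<open>(t, (\<zeta>\<^sub>z \<in> E (h (t z)) (k z))\<^sub>z)\<close> and
  \<open>bset E x y\<close> is their quotient by agreement on a member of the ultrafilter of \<open>y\<close>; with \<open>E\<close> the
  hom-sets of \<open>C\<close> these are the morphisms of \<open>\<beta>C\<close>, and with \<open>E\<close> the values of a profunctor \<open>F\<close>
  they are the elements of its extension to \<open>\<beta>\<close>.  An element records \<open>x\<close>, \<open>y\<close> and the class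
  of all pairs of functions (of the given types) that agree almost everywhere with a given pair.
\<close>

datatype ('u, 'd, 'c, 'e) bel =
  BEl (src: "('u, 'd) bobj") (tgt: "('u, 'c) bobj") (cls: "(('u \<Rightarrow> 'u) \<times> ('u \<Rightarrow> 'e)) set")

definition bel_of :: "('u, 'd) bobj \<Rightarrow> ('u, 'c) bobj \<Rightarrow> ('u \<Rightarrow> 'u) \<Rightarrow> ('u \<Rightarrow> 'e) \<Rightarrow>
    ('u, 'd, 'c, 'e) bel" where
  "bel_of x y t \<zeta> = BEl x y {(t', \<zeta>'). \<forall>\<^sub>F z in ult y. t' z = t z \<and> \<zeta>' z = \<zeta> z}"

definition bpairs :: "('d \<Rightarrow> 'c \<Rightarrow> 'e set) \<Rightarrow> ('u, 'd) bobj \<Rightarrow> ('u, 'c) bobj \<Rightarrow>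
    (('u \<Rightarrow> 'u) \<times> ('u \<Rightarrow> 'e)) set" where
  "bpairs E x y = {(t, \<zeta>). t \<in> idx y \<rightarrow> idx x \<and> filtermap t (ult y) = ult x \<and>
     (\<forall>z \<in> idx y. \<zeta> z \<in> E (val x (t z)) (val y z))}"

definition bset :: "('d \<Rightarrow> 'c \<Rightarrow> 'e set) \<Rightarrow> ('u, 'd) bobj \<Rightarrow> ('u, 'c) bobj \<Rightarrow>
    ('u, 'd, 'c, 'e) bel set" where
  "bset E x y = (\<lambda>(t, \<zeta>). bel_of x y t \<zeta>) ` bpairs E x y"

text \<open>Components of a representative; all uses below depend on them only almost everywhere.\<close>

definition rmap :: "('u, 'd, 'c, 'e) bel \<Rightarrow> 'u \<Rightarrow> 'u" where
  "rmap s = fst (SOME p. p \<in> cls s)"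

definition rcmp :: "('u, 'd, 'c, 'e) bel \<Rightarrow> 'u \<Rightarrow> 'e" where
  "rcmp s = snd (SOME p. p \<in> cls s)"

definition retgt :: "('u, 'c) bobj \<Rightarrow> ('u, 'd, 'b, 'e) bel \<Rightarrow> ('u, 'd, 'c, 'e) bel" where
  "retgt y s = BEl (src s) y (cls s)"

definition bcat :: "('o, 'm) cat \<Rightarrow> (('u, 'o) bobj, ('u, 'o, 'o, 'm) bel) cat" where
  "bcat C = \<lparr>Obj = bObj C,
     Arr = (\<Union>x \<in> bObj C. \<Union>y \<in> bObj C. bset (hom C) x y),
     Dom = src, Cod = tgt,
     Ide = (\<lambda>x. bel_of x x id (\<lambda>z. Ide C (val x z))),
     Comp = (\<lambda>t s. bel_of (src s) (tgt t) (rmap s \<circ> rmap t)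
        (\<lambda>z. rcmp t z \<odot>\<^bsub>C\<^esub> rcmp s (rmap t z)))\<rparr>"

definition bmap :: "('o \<Rightarrow> 'p) \<Rightarrow> ('u, 'o) bobj \<Rightarrow> ('u, 'p) bobj" where
  "bmap f x = BObj (idx x) (restrict (f \<circ> val x) (idx x)) (ult x)"

definition bfun :: "('o, 'm, 'p, 'n) func \<Rightarrow>
    (('u, 'o) bobj, ('u, 'o, 'o, 'm) bel, ('u, 'p) bobj, ('u, 'p, 'p, 'n) bel) func" where
  "bfun f = \<lparr>fobj = bmap (fobj f),
     farr = (\<lambda>s. bel_of (bmap (fobj f) (src s)) (bmap (fobj f) (tgt s)) (rmap s) (farr f \<circ> rcmp s))\<rparr>"

text \<open>\<open>\<beta>\<sigma>\<close>, for a natural transformation \<open>\<sigma> : f \<Rightarrow> f'\<close>.\<close>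

definition bnt :: "('o, 'm, 'p, 'n) func \<Rightarrow> ('o, 'm, 'p, 'n) func \<Rightarrow> ('o \<Rightarrow> 'n) \<Rightarrow>
    ('u, 'o) bobj \<Rightarrow> ('u, 'p, 'p, 'n) bel" where
  "bnt f f' \<sigma> x = bel_of (bmap (fobj f) x) (bmap (fobj f') x) id (\<lambda>z. \<sigma> (val x z))"

definition single :: "'o \<Rightarrow> ('u, 'o) bobj" where
  "single a = BObj {pt} (restrict (\<lambda>_. a) {pt}) (principal {pt})"

definition bsingle :: "'d \<Rightarrow> 'c \<Rightarrow> 'e \<Rightarrow> ('u, 'd, 'c, 'e) bel" where
  "bsingle d c r = bel_of (single d) (single c) id (\<lambda>_. r)"

definition bunit :: "('o, 'm) cat \<Rightarrow> ('o, 'm, ('u, 'o) bobj, ('u, 'o, 'o, 'm) bel) func" where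
  "bunit C = \<lparr>fobj = single, farr = (\<lambda>f. bsingle (Dom C f) (Cod C f) f)\<rparr>"

definition sum_filter :: "'u filter \<Rightarrow> ('u \<Rightarrow> 'u filter) \<Rightarrow> 'u filter" where
  "sum_filter \<nu> \<nu>' = Abs_filter (\<lambda>P. \<forall>\<^sub>F x in \<nu>. \<forall>\<^sub>F z in \<nu>' x. P (enc (x, z)))"

lemma eventually_sum_filter:
  "eventually P (sum_filter \<nu> \<nu>') \<longleftrightarrow> (\<forall>\<^sub>F x in \<nu>. \<forall>\<^sub>F z in \<nu>' x. P (enc (x, z)))"
  unfolding sum_filter_def
proof (subst eventually_Abs_filter)
  show "is_filter (\<lambda>P. \<forall>\<^sub>F x in \<nu>. \<forall>\<^sub>F z in \<nu>' x. P (enc (x, z)))"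
  proof
    fix P Q assume "\<forall>\<^sub>F x in \<nu>. \<forall>\<^sub>F z in \<nu>' x. P (enc (x, z))" and PQ: "\<forall>v. P v \<longrightarrow> Q v"
    then show "\<forall>\<^sub>F x in \<nu>. \<forall>\<^sub>F z in \<nu>' x. Q (enc (x, z))"
      by (elim eventually_mono) (use PQ in auto)
  qed (simp_all add: eventually_conj_iff)
qed simp

definition bmu_obj :: "('u, ('u, 'o) bobj) bobj \<Rightarrow> ('u, 'o) bobj" where
  "bmu_obj Y = (let X = enc ` (SIGMA x : idx Y. idx (val Y x)) in
     BObj X (restrict (\<lambda>w. case dec w of (x, z) \<Rightarrow> val (val Y x) z) X)
       (sum_filter (ult Y) (\<lambda>x. ult (val Y x))))"

text \<open>The class of \<open>((y, w) \<mapsto> (p y, p\<^sub>y w), (\<gamma>\<^sub>y\<^sub>,\<^sub>w))\<close>, for \<open>t = (p, (\<gamma>\<^sub>y)\<^sub>y)\<close> and \<open>\<gamma>\<^sub>y = (p\<^sub>y, (\<gamma>\<^sub>y\<^sub>,\<^sub>w)\<^sub>w)\<close>.\<close>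

definition bmu_el :: "('u, ('u, 'd) bobj, ('u, 'c) bobj, ('u, 'd, 'c, 'e) bel) bel \<Rightarrow>
    ('u, 'd, 'c, 'e) bel" where
  "bmu_el t = bel_of (bmu_obj (src t)) (bmu_obj (tgt t))
     (\<lambda>v. case dec v of (y, w) \<Rightarrow> enc (rmap t y, rmap (rcmp t y) w))
     (\<lambda>v. case dec v of (y, w) \<Rightarrow> rcmp (rcmp t y) w)"

definition bmu :: "(('u, ('u, 'o) bobj) bobj, ('u, ('u, 'o) bobj, ('u, 'o) bobj, ('u, 'o, 'o, 'm) bel) bel,
    ('u, 'o) bobj, ('u, 'o, 'o, 'm) bel) func" where
  "bmu = \<lparr>fobj = bmu_obj, farr = bmu_el\<rparr>"

text \<open>
  The canonical isomorphisms \<open>\<mu> \<eta>\<^sub>\<beta> \<cong> 1\<close>, \<open>\<mu> \<beta>\<eta> \<cong> 1\<close> and \<open>\<mu> \<mu>\<^sub>\<beta> \<cong> \<mu> \<beta>\<mu>\<close>, as morphisms from the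
  left-hand to the right-hand side (so the reindexing map goes the other way).
\<close>

definition lunit :: "('o, 'm) cat \<Rightarrow> ('u, 'o) bobj \<Rightarrow> ('u, 'o, 'o, 'm) bel" where
  "lunit C x = bel_of (bmu_obj (single x)) x (\<lambda>z. enc (pt, z)) (\<lambda>z. Ide C (val x z))"

definition runit :: "('o, 'm) cat \<Rightarrow> ('u, 'o) bobj \<Rightarrow> ('u, 'o, 'o, 'm) bel" where
  "runit C x = bel_of (bmu_obj (bmap single x)) x (\<lambda>z. enc (z, pt)) (\<lambda>z. Ide C (val x z))"

definition bassoc :: "('o, 'm) cat \<Rightarrow> ('u, ('u, ('u, 'o) bobj) bobj) bobj \<Rightarrow> ('u, 'o, 'o, 'm) bel" where
  "bassoc C Z = bel_of (bmu_obj (bmu_obj Z)) (bmu_obj (bmap bmu_obj Z))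
     (\<lambda>v. case dec v of (x, w) \<Rightarrow> case dec w of (y, z) \<Rightarrow> enc (enc (x, y), z))
     (\<lambda>v. Ide C (val (bmu_obj (bmap bmu_obj Z)) v))"

section \<open>Ultracategories\<close>

record ('u, 'o, 'm) palg =
  pcat :: "('o, 'm) cat"
  pact :: "(('u, 'o) bobj, ('u, 'o, 'o, 'm) bel, 'o, 'm) func"
  punit :: "'o \<Rightarrow> 'm"
  pmult :: "('u, ('u, 'o) bobj) bobj \<Rightarrow> 'm"

definition pseudo_algebra :: "('u, 'o, 'm) palg \<Rightarrow> bool" where
  "pseudo_algebra P \<longleftrightarrow> (let A = pcat P; \<Phi> = pact P; \<upsilon> = punit P; m = pmult P;
       bA = bcat A; bbA = bcat bA; bbbA = bcat bbA;
       \<Phi>\<eta> = fcomp A \<Phi> (bunit A); \<Phi>\<beta>\<Phi> = fcomp bbA \<Phi> (bfun \<Phi>); \<Phi>\<mu> = fcomp bbA \<Phi> bmu in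
     category A \<and> locally_small TYPE('u) A \<and> ext_functor bA A \<Phi> \<and>
     nat_iso A A (fid A) \<Phi>\<eta> \<upsilon> \<and> nat_iso bbA A \<Phi>\<beta>\<Phi> \<Phi>\<mu> m \<and>
     (\<forall>x \<in> Obj bA. farr \<Phi> (lunit A x) \<odot>\<^bsub>A\<^esub> m (single x) \<odot>\<^bsub>A\<^esub> \<upsilon> (fobj \<Phi> x) = Ide A (fobj \<Phi> x)) \<and>
     (\<forall>x \<in> Obj bA. farr \<Phi> (runit A x) \<odot>\<^bsub>A\<^esub> m (bmap single x) \<odot>\<^bsub>A\<^esub> farr \<Phi> (bnt (fid A) \<Phi>\<eta> \<upsilon> x)
        = Ide A (fobj \<Phi> x)) \<and>
     (\<forall>Z \<in> Obj bbbA. farr \<Phi> (bassoc A Z) \<odot>\<^bsub>A\<^esub> m (bmu_obj Z) \<odot>\<^bsub>A\<^esub> m (bmap (bmap (fobj \<Phi>)) Z)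
        = m (bmap bmu_obj Z) \<odot>\<^bsub>A\<^esub> farr \<Phi> (bnt \<Phi>\<beta>\<Phi> \<Phi>\<mu> m Z)))"

record ('u, 'o, 'm) colax =
  cfun :: "('o, 'm, 'o, 'm) func"
  cnat :: "('u, 'o) bobj \<Rightarrow> 'm"

definition colax_morphism :: "('u, 'o, 'm) palg \<Rightarrow> ('u, 'o, 'm) palg \<Rightarrow> ('u, 'o, 'm) colax \<Rightarrow> bool" where
  "colax_morphism P Q F \<longleftrightarrow> (let A = pcat P; B = pcat Q; f = cfun F; \<phi> = cnat F; \<Phi> = pact P; \<Psi> = pact Q;
       bA = bcat A; bbA = bcat bA; f\<Phi> = fcomp bA f \<Phi>; \<Psi>\<beta>f = fcomp bA \<Psi> (bfun f) in
     ext_functor A B f \<and> nat_trans bA B f\<Phi> \<Psi>\<beta>f \<phi> \<and>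
     (\<forall>a \<in> Obj A. \<phi> (single a) \<odot>\<^bsub>B\<^esub> farr f (punit P a) = punit Q (fobj f a)) \<and>
     (\<forall>Y \<in> Obj bbA. \<phi> (bmu_obj Y) \<odot>\<^bsub>B\<^esub> farr f (pmult P Y)
        = pmult Q (bmap (bmap (fobj f)) Y) \<odot>\<^bsub>B\<^esub> farr \<Psi> (bnt f\<Phi> \<Psi>\<beta>f \<phi> Y) \<odot>\<^bsub>B\<^esub> \<phi> (bmap (fobj \<Phi>) Y)))"

definition colax_2cell :: "('u, 'o, 'm) palg \<Rightarrow> ('u, 'o, 'm) palg \<Rightarrow> ('u, 'o, 'm) colax \<Rightarrow>
    ('u, 'o, 'm) colax \<Rightarrow> ('o \<Rightarrow> 'm) \<Rightarrow> bool" where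
  "colax_2cell P Q F G \<sigma> \<longleftrightarrow> nat_trans (pcat P) (pcat Q) (cfun F) (cfun G) \<sigma> \<and>
     (\<forall>x \<in> Obj (bcat (pcat P)).
        farr (pact Q) (bnt (cfun F) (cfun G) \<sigma> x) \<odot>\<^bsub>pcat Q\<^esub> cnat F x
        = cnat G x \<odot>\<^bsub>pcat Q\<^esub> \<sigma> (fobj (pact P) x))"

section \<open>Ultraconvergence spaces\<close>

text \<open>The extension of a profunctor to \<open>\<beta>\<close>.\<close>

definition bprof :: "('d, 'dm, 'c, 'cm, 'e) prof \<Rightarrow>
    (('u, 'd) bobj, ('u, 'd, 'd, 'dm) bel, ('u, 'c) bobj, ('u, 'c, 'c, 'cm) bel, ('u, 'd, 'c, 'e) bel) prof" where
  "bprof F = \<lparr>PEl = bset (PEl F),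
     PAct = (\<lambda>f g t. bel_of (src f) (tgt g) (rmap f \<circ> rmap t \<circ> rmap g)
       (\<lambda>w. PAct F (rcmp f (rmap t (rmap g w))) (rcmp g w) (rcmp t (rmap g w))))\<rparr>"

definition bprof_map :: "('d \<Rightarrow> 'c \<Rightarrow> 'e \<Rightarrow> 'f) \<Rightarrow> ('u, 'd, 'c, 'e) bel \<Rightarrow> ('u, 'd, 'c, 'f) bel" where
  "bprof_map \<alpha> t = bel_of (src t) (tgt t) (rmap t)
     (\<lambda>z. \<alpha> (val (src t) (rmap t z)) (val (tgt t) z) (rcmp t z))"

text \<open>The lax compositor \<open>\<psi>\<close>.\<close>

definition compositor :: "('c, 'cm) cat \<Rightarrow> ('d, 'dm) cat \<Rightarrow> ('e, 'em) cat \<Rightarrow>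
    ('e, 'em, 'd, 'dm, 'x) prof \<Rightarrow> ('d, 'dm, 'c, 'cm, 'y) prof \<Rightarrow>
    ('u, 'e, 'd, 'x) bel \<Rightarrow> ('u, 'd, 'c, 'y) bel \<Rightarrow> ('u, 'e, 'c, ('d \<times> 'x \<times> 'y) set) bel" where
  "compositor C D E G F s t = bel_of (src s) (tgt t) (rmap s \<circ> rmap t)
     (\<lambda>z. coend_cls C D E G F (val (src s) (rmap s (rmap t z))) (val (tgt t) z)
        (val (tgt s) (rmap t z), rcmp s (rmap t z), rcmp t z))"

record ('u, 'o, 'm, 'e) lax =
  lcat :: "('o, 'm) cat"
  lprof :: "('o, 'm, ('u, 'o) bobj, ('u, 'o, 'o, 'm) bel, 'e) prof"
  lunitor :: "'o \<Rightarrow> 'o \<Rightarrow> 'm \<Rightarrow> 'e"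
  lmult :: "'o \<Rightarrow> ('u, ('u, 'o) bobj) bobj \<Rightarrow> (('u, 'o) bobj \<times> 'e \<times> ('u, 'o, ('u, 'o) bobj, 'e) bel) set \<Rightarrow> 'e"

text \<open>\<open>delta L a r s\<close> is \<open>\<Delta>(r, s) \<in> A(a, \<mu> Y)\<close>, for \<open>r \<in> A(a, x)\<close> and \<open>s : x \<rightarrow> Y\<close>.\<close>

definition delta :: "('u, 'o, 'm, 'e) lax \<Rightarrow> 'o \<Rightarrow> 'e \<Rightarrow> ('u, 'o, ('u, 'o) bobj, 'e) bel \<Rightarrow> 'e" where
  "delta L a r s = lmult L a (tgt s)
     (coend_cls (bcat (bcat (lcat L))) (bcat (lcat L)) (lcat L) (lprof L) (bprof (lprof L)) a (tgt s)
       (src s, r, s))"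

text \<open>
  In the last axiom, \<^const>\<open>retgt\<close> is the identification of the extension of
  \<open>(a, Y) \<mapsto> A(a, \<mu> Y)\<close> at \<open>Z\<close> with the extension of \<open>A\<close> at \<open>\<beta>\<mu> Z\<close>.
\<close>

definition lax_algebra :: "('u, 'o, 'm, 'e) lax \<Rightarrow> bool" where
  "lax_algebra L \<longleftrightarrow> (let A0 = lcat L; A = lprof L; \<Gamma> = lunitor L; \<Delta> = lmult L;
       bA = bcat A0; bbA = bcat bA; bbbA = bcat bbA in
     category A0 \<and> locally_small TYPE('u) A0 \<and> small_profunctor TYPE('u) bA A0 A \<and>
     prof_nat A0 A0 (hom_prof A0) (pull_prof A (fid A0) (bunit A0)) \<Gamma> \<and>
     prof_nat bbA A0 (prof_comp bbA bA A0 A (bprof A)) (pull_prof A (fid A0) bmu) \<Delta> \<and>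
     (\<forall>a \<in> Obj A0. \<forall>x \<in> Obj bA. \<forall>r \<in> PEl A a x.
        PAct A (Ide A0 a) (lunit A0 x) (delta L a (\<Gamma> a a (Ide A0 a)) (bsingle a x r)) = r) \<and>
     (\<forall>a \<in> Obj A0. \<forall>x \<in> Obj bA. \<forall>r \<in> PEl A a x.
        PAct A (Ide A0 a) (runit A0 x) (delta L a r
          (bel_of x (bmap single x) id (\<lambda>z. \<Gamma> (val x z) (val x z) (Ide A0 (val x z))))) = r) \<and>
     (\<forall>a \<in> Obj A0. \<forall>x \<in> Obj bA. \<forall>Y \<in> Obj bbA. \<forall>Z \<in> Obj bbbA.
        \<forall>r \<in> PEl A a x. \<forall>s \<in> PEl (bprof A) x Y. \<forall>t \<in> PEl (bprof (bprof A)) Y Z.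
        PAct A (Ide A0 a) (bassoc A0 Z) (delta L a (delta L a r s) (bmu_el t)) =
        delta L a r (retgt (bmap bmu_obj Z)
          (bprof_map \<Delta> (compositor bbA bA A0 A (bprof A) s t)))))"

definition normalized :: "('u, 'o, 'm, 'e) lax \<Rightarrow> bool" where
  "normalized L \<longleftrightarrow> (\<forall>a \<in> Obj (lcat L). \<forall>a' \<in> Obj (lcat L).
     bij_betw (lunitor L a a') (hom (lcat L) a a') (PEl (lprof L) a (single a')))"

record ('u, 'o, 'm, 'e) rcolax =
  rfun :: "('o, 'm, 'o, 'm) func"
  rnat :: "'o \<Rightarrow> ('u, 'o) bobj \<Rightarrow> 'e \<Rightarrow> 'e"

definition theta_push :: "('o, 'm, 'p, 'n) func \<Rightarrow> ('o \<Rightarrow> ('u, 'o) bobj \<Rightarrow> 'e \<Rightarrow> 'f) \<Rightarrow>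
    ('u, 'o, ('u, 'o) bobj, 'e) bel \<Rightarrow> ('u, 'p, ('u, 'p) bobj, 'f) bel" where
  "theta_push f \<Theta> s = bel_of (bmap (fobj f) (src s)) (bmap (bmap (fobj f)) (tgt s)) (rmap s)
     (\<lambda>y. \<Theta> (val (src s) (rmap s y)) (val (tgt s) y) (rcmp s y))"

definition rcolax_morphism :: "('u, 'o, 'm, 'e) lax \<Rightarrow> ('u, 'o, 'm, 'e) lax \<Rightarrow>
    ('u, 'o, 'm, 'e) rcolax \<Rightarrow> bool" where
  "rcolax_morphism L M F \<longleftrightarrow> (let A0 = lcat L; B0 = lcat M; A = lprof L; B = lprof M;
       f = rfun F; \<Theta> = rnat F; bA = bcat A0; bbA = bcat bA in
     ext_functor A0 B0 f \<and> prof_nat bA A0 A (pull_prof B f (bfun f)) \<Theta> \<and>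
     (\<forall>a \<in> Obj A0. \<Theta> a (single a) (lunitor L a a (Ide A0 a))
        = lunitor M (fobj f a) (fobj f a) (Ide B0 (fobj f a))) \<and>
     (\<forall>a \<in> Obj A0. \<forall>x \<in> Obj bA. \<forall>Y \<in> Obj bbA. \<forall>r \<in> PEl A a x. \<forall>s \<in> PEl (bprof A) x Y.
        \<Theta> a (bmu_obj Y) (delta L a r s) = delta M (fobj f a) (\<Theta> a x r) (theta_push f \<Theta> s)))"

definition rcolax_2cell :: "('u, 'o, 'm, 'e) lax \<Rightarrow> ('u, 'o, 'm, 'e) lax \<Rightarrow>
    ('u, 'o, 'm, 'e) rcolax \<Rightarrow> ('u, 'o, 'm, 'e) rcolax \<Rightarrow> ('o \<Rightarrow> 'm) \<Rightarrow> bool" where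
  "rcolax_2cell L M F G \<sigma> \<longleftrightarrow> nat_trans (lcat L) (lcat M) (rfun F) (rfun G) \<sigma> \<and>
     (\<forall>a \<in> Obj (lcat L). \<forall>x \<in> Obj (bcat (lcat L)). \<forall>r \<in> PEl (lprof L) a x.
        PAct (lprof M) (Ide (lcat M) (fobj (rfun F) a)) (bnt (rfun F) (rfun G) \<sigma> x) (rnat F a x r)
        = PAct (lprof M) (\<sigma> a) (Ide (bcat (lcat M)) (bmap (fobj (rfun G)) x)) (rnat G a x r))"

section \<open>2-categories\<close>

text \<open>Strict 2-categories, as categories enriched in categories.\<close>

record ('a, 'f, 's) two_cat =
  Ob :: "'a set"
  HOM :: "'a \<Rightarrow> 'a \<Rightarrow> ('f, 's) cat"
  Id1 :: "'a \<Rightarrow> 'f"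
  HC :: "'a \<Rightarrow> 'a \<Rightarrow> 'a \<Rightarrow> ('f \<times> 'f, 's \<times> 's, 'f, 's) func"

abbreviation comp1 :: "('a, 'f, 's) two_cat \<Rightarrow> 'a \<Rightarrow> 'a \<Rightarrow> 'a \<Rightarrow> 'f \<Rightarrow> 'f \<Rightarrow> 'f" where
  "comp1 T a b c g f \<equiv> fobj (HC T a b c) (g, f)"

abbreviation comp2 :: "('a, 'f, 's) two_cat \<Rightarrow> 'a \<Rightarrow> 'a \<Rightarrow> 'a \<Rightarrow> 's \<Rightarrow> 's \<Rightarrow> 's" where
  "comp2 T a b c g f \<equiv> farr (HC T a b c) (g, f)"

locale two_category =
  fixes T :: "('a, 'f, 's) two_cat"
  assumes HOM_category: "a \<in> Ob T \<Longrightarrow> b \<in> Ob T \<Longrightarrow> category (HOM T a b)"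
    and Id1_in: "a \<in> Ob T \<Longrightarrow> Id1 T a \<in> Obj (HOM T a a)"
    and HC_functor: "a \<in> Ob T \<Longrightarrow> b \<in> Ob T \<Longrightarrow> c \<in> Ob T \<Longrightarrow>
          is_functor (prod_cat (HOM T b c) (HOM T a b)) (HOM T a c) (HC T a b c)"
    and comp1_Id1: "a \<in> Ob T \<Longrightarrow> b \<in> Ob T \<Longrightarrow> f \<in> Obj (HOM T a b) \<Longrightarrow>
          comp1 T a a b f (Id1 T a) = f \<and> comp1 T a b b (Id1 T b) f = f"
    and comp2_Id1: "a \<in> Ob T \<Longrightarrow> b \<in> Ob T \<Longrightarrow> s \<in> Arr (HOM T a b) \<Longrightarrow>
          comp2 T a a b s (Ide (HOM T a a) (Id1 T a)) = s \<and>
          comp2 T a b b (Ide (HOM T b b) (Id1 T b)) s = s"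
    and comp1_assoc: "a \<in> Ob T \<Longrightarrow> b \<in> Ob T \<Longrightarrow> c \<in> Ob T \<Longrightarrow> d \<in> Ob T \<Longrightarrow>
          f \<in> Obj (HOM T a b) \<Longrightarrow> g \<in> Obj (HOM T b c) \<Longrightarrow> h \<in> Obj (HOM T c d) \<Longrightarrow>
          comp1 T a b d (comp1 T b c d h g) f = comp1 T a c d h (comp1 T a b c g f)"
    and comp2_assoc: "a \<in> Ob T \<Longrightarrow> b \<in> Ob T \<Longrightarrow> c \<in> Ob T \<Longrightarrow> d \<in> Ob T \<Longrightarrow>
          s \<in> Arr (HOM T a b) \<Longrightarrow> t \<in> Arr (HOM T b c) \<Longrightarrow> u \<in> Arr (HOM T c d) \<Longrightarrow>
          comp2 T a b d (comp2 T b c d u t) s = comp2 T a c d u (comp2 T a b c t s)"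

definition equivalent :: "('a, 'f, 's) two_cat \<Rightarrow> 'a \<Rightarrow> 'a \<Rightarrow> bool" where
  "equivalent T a b \<longleftrightarrow> (\<exists>f \<in> Obj (HOM T a b). \<exists>g \<in> Obj (HOM T b a).
     isomorphic (HOM T a a) (comp1 T a b a g f) (Id1 T a) \<and>
     isomorphic (HOM T b b) (comp1 T b a b f g) (Id1 T b))"

record ('a, 'f, 's, 'b, 'g, 't) two_func =
  jobj :: "'a \<Rightarrow> 'b"
  jhom :: "'a \<Rightarrow> 'a \<Rightarrow> ('f, 's, 'g, 't) func"

locale two_functor = S: two_category S + T: two_category T
  for S :: "('a, 'f, 's) two_cat" and T :: "('b, 'g, 't) two_cat" +
  fixes J :: "('a, 'f, 's, 'b, 'g, 't) two_func"
  assumes jobj_in: "a \<in> Ob S \<Longrightarrow> jobj J a \<in> Ob T"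
    and jhom_functor: "a \<in> Ob S \<Longrightarrow> b \<in> Ob S \<Longrightarrow>
          is_functor (HOM S a b) (HOM T (jobj J a) (jobj J b)) (jhom J a b)"
    and jhom_Id1: "a \<in> Ob S \<Longrightarrow> fobj (jhom J a a) (Id1 S a) = Id1 T (jobj J a)"
    and jhom_comp1: "a \<in> Ob S \<Longrightarrow> b \<in> Ob S \<Longrightarrow> c \<in> Ob S \<Longrightarrow>
          f \<in> Obj (HOM S a b) \<Longrightarrow> g \<in> Obj (HOM S b c) \<Longrightarrow>
          fobj (jhom J a c) (comp1 S a b c g f)
          = comp1 T (jobj J a) (jobj J b) (jobj J c) (fobj (jhom J b c) g) (fobj (jhom J a b) f)"
    and jhom_comp2: "a \<in> Ob S \<Longrightarrow> b \<in> Ob S \<Longrightarrow> c \<in> Ob S \<Longrightarrow>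
          s \<in> Arr (HOM S a b) \<Longrightarrow> t \<in> Arr (HOM S b c) \<Longrightarrow>
          farr (jhom J a c) (comp2 S a b c t s)
          = comp2 T (jobj J a) (jobj J b) (jobj J c) (farr (jhom J b c) t) (farr (jhom J a b) s)"

text \<open>Each functor on hom-categories is an isomorphism of categories.\<close>

definition two_fully_faithful :: "('a, 'f, 's) two_cat \<Rightarrow> ('b, 'g, 't) two_cat \<Rightarrow>
    ('a, 'f, 's, 'b, 'g, 't) two_func \<Rightarrow> bool" where
  "two_fully_faithful S T J \<longleftrightarrow> (\<forall>a \<in> Ob S. \<forall>b \<in> Ob S.
     bij_betw (fobj (jhom J a b)) (Obj (HOM S a b)) (Obj (HOM T (jobj J a) (jobj J b))) \<and>
     bij_betw (farr (jhom J a b)) (Arr (HOM S a b)) (Arr (HOM T (jobj J a) (jobj J b))))"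

definition essential_image :: "('a, 'f, 's) two_cat \<Rightarrow> ('b, 'g, 't) two_cat \<Rightarrow>
    ('a, 'f, 's, 'b, 'g, 't) two_func \<Rightarrow> 'b set" where
  "essential_image S T J = {b \<in> Ob T. \<exists>a \<in> Ob S. equivalent T (jobj J a) b}"

section \<open>The 2-categories of ultracategories and of ultraconvergence spaces\<close>

text \<open>
  2-cells are triples of source, target and underlying natural transformation between functors
  \<open>A \<rightarrow> B\<close>; \<open>cell_hcomp\<close> is the horizontal composite of the underlying transformations.
\<close>

definition cell_cat :: "('o, 'm) cat \<Rightarrow> ('o, 'm) cat \<Rightarrow> ('f \<Rightarrow> ('o, 'm, 'o, 'm) func) \<Rightarrow>
    ('f \<Rightarrow> bool) \<Rightarrow> ('f \<Rightarrow> 'f \<Rightarrow> ('o \<Rightarrow> 'm) \<Rightarrow> bool) \<Rightarrow> ('f, 'f \<times> 'f \<times> ('o \<Rightarrow> 'm)) cat" where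
  "cell_cat A B und one two = \<lparr>Obj = {F. one F},
     Arr = {(F, G, \<sigma>). one F \<and> one G \<and> two F G \<sigma>},
     Dom = (\<lambda>(F, G, \<sigma>). F), Cod = (\<lambda>(F, G, \<sigma>). G),
     Ide = (\<lambda>F. (F, F, restrict (\<lambda>a. Ide B (fobj (und F) a)) (Obj A))),
     Comp = (\<lambda>(F', G', \<tau>) (F, G, \<sigma>). (F, G', restrict (\<lambda>a. \<tau> a \<odot>\<^bsub>B\<^esub> \<sigma> a) (Obj A)))\<rparr>"

definition cell_hcomp :: "('o, 'm) cat \<Rightarrow> ('o, 'm) cat \<Rightarrow> ('o, 'm, 'o, 'm) func \<Rightarrow> ('o, 'm, 'o, 'm) func \<Rightarrow>
    ('o \<Rightarrow> 'm) \<Rightarrow> ('o \<Rightarrow> 'm) \<Rightarrow> 'o \<Rightarrow> 'm" where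
  "cell_hcomp A C f' g \<tau> \<sigma> = restrict (\<lambda>a. \<tau> (fobj f' a) \<odot>\<^bsub>C\<^esub> farr g (\<sigma> a)) (Obj A)"

definition colax_comp :: "('u, 'o, 'm) palg \<Rightarrow> ('u, 'o, 'm) palg \<Rightarrow>
    ('u, 'o, 'm) colax \<Rightarrow> ('u, 'o, 'm) colax \<Rightarrow> ('u, 'o, 'm) colax" where
  "colax_comp P R G F = \<lparr>cfun = fcomp (pcat P) (cfun G) (cfun F),
     cnat = restrict (\<lambda>x. cnat G (bmap (fobj (cfun F)) x) \<odot>\<^bsub>pcat R\<^esub> farr (cfun G) (cnat F x)) (Obj (bcat (pcat P)))\<rparr>"

definition UltCat :: "(('u, 'o, 'm) palg, ('u, 'o, 'm) colax,
    ('u, 'o, 'm) colax \<times> ('u, 'o, 'm) colax \<times> ('o \<Rightarrow> 'm)) two_cat" where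
  "UltCat = \<lparr>Ob = {P. pseudo_algebra P},
     HOM = (\<lambda>P Q. cell_cat (pcat P) (pcat Q) cfun (colax_morphism P Q) (colax_2cell P Q)),
     Id1 = (\<lambda>P. \<lparr>cfun = fid (pcat P),
       cnat = restrict (\<lambda>x. Ide (pcat P) (fobj (pact P) x)) (Obj (bcat (pcat P)))\<rparr>),
     HC = (\<lambda>P Q R. \<lparr>fobj = (\<lambda>(G, F). colax_comp P R G F),
       farr = (\<lambda>((G, G', \<tau>), (F, F', \<sigma>)). (colax_comp P R G F, colax_comp P R G' F',
         cell_hcomp (pcat P) (pcat R) (cfun F') (cfun G) \<tau> \<sigma>))\<rparr>)\<rparr>"

definition rcolax_comp :: "('u, 'o, 'm, 'e) lax \<Rightarrow>
    ('u, 'o, 'm, 'e) rcolax \<Rightarrow> ('u, 'o, 'm, 'e) rcolax \<Rightarrow> ('u, 'o, 'm, 'e) rcolax" where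
  "rcolax_comp L G F = \<lparr>rfun = fcomp (lcat L) (rfun G) (rfun F),
     rnat = (\<lambda>a \<in> Obj (lcat L). \<lambda>x \<in> Obj (bcat (lcat L)). \<lambda>r \<in> PEl (lprof L) a x.
       rnat G (fobj (rfun F) a) (bmap (fobj (rfun F)) x) (rnat F a x r))\<rparr>"

definition rcolax_id :: "('u, 'o, 'm, 'e) lax \<Rightarrow> ('u, 'o, 'm, 'e) rcolax" where
  "rcolax_id L = \<lparr>rfun = fid (lcat L),
     rnat = (\<lambda>a \<in> Obj (lcat L). \<lambda>x \<in> Obj (bcat (lcat L)). \<lambda>r \<in> PEl (lprof L) a x. r)\<rparr>"

definition UltSp :: "(('u, 'o, 'm, 'e) lax, ('u, 'o, 'm, 'e) rcolax,
    ('u, 'o, 'm, 'e) rcolax \<times> ('u, 'o, 'm, 'e) rcolax \<times> ('o \<Rightarrow> 'm)) two_cat" where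
  "UltSp = \<lparr>Ob = {L. lax_algebra L \<and> normalized L},
     HOM = (\<lambda>L M. cell_cat (lcat L) (lcat M) rfun (rcolax_morphism L M) (rcolax_2cell L M)),
     Id1 = rcolax_id,
     HC = (\<lambda>L M N. \<lparr>fobj = (\<lambda>(G, F). rcolax_comp L G F),
       farr = (\<lambda>((G, G', \<tau>), (F, F', \<sigma>)). (rcolax_comp L G F, rcolax_comp L G' F',
         cell_hcomp (lcat L) (lcat N) (rfun F') (rfun G) \<tau> \<sigma>))\<rparr>)\<rparr>"

section \<open>Representable ultraconvergence spaces\<close>

text \<open>
  The lax algebra \<open>\<Phi>\<^sub>\<diamond>\<close>; its values are hom-sets, so the elements of its profunctor live in the type
  of arrows.  An element \<open>s\<close> of the extension of \<open>\<Phi>\<^sub>\<diamond>\<close> at \<open>(x, Y)\<close> is a morphism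
  \<open>x \<rightarrow> \<beta>\<Phi> Y\<close> of \<open>\<beta>A\<close> (this is \<^const>\<open>retgt\<close>), and \<open>\<Delta>(r, s)\<close> is the composite
  \<open>a \<rightarrow> \<Phi> x \<rightarrow> \<Phi> (\<beta>\<Phi> Y) \<cong> \<Phi> (\<mu> Y)\<close>.
\<close>

definition rep_lax :: "('u, 'o, 'm) palg \<Rightarrow> ('u, 'o, 'm, 'm) lax" where
  "rep_lax P = (let A = pcat P; \<Phi> = pact P; bA = bcat A; bbA = bcat bA; R = rep_prof A \<Phi> in
     \<lparr>lcat = A, lprof = R,
      lunitor = (\<lambda>a \<in> Obj A. \<lambda>a' \<in> Obj A. \<lambda>h \<in> hom A a a'. punit P a' \<odot>\<^bsub>A\<^esub> h),
      lmult = (\<lambda>a \<in> Obj A. \<lambda>Y \<in> Obj bbA. \<lambda>k \<in> PEl (prof_comp bbA bA A R (bprof R)) a Y.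
        let (x, r, s) = SOME p. p \<in> k in
        pmult P Y \<odot>\<^bsub>A\<^esub> farr \<Phi> (retgt (bmap (fobj \<Phi>) Y) s) \<odot>\<^bsub>A\<^esub> r)\<rparr>)"

text \<open>
  ``\<open>A = \<Phi>\<^sub>\<diamond>\<close>'': \<open>A\<close> has the same underlying category as \<open>\<Phi>\<close>, and there is a natural family of bijections
  \<open>A(a, x) \<cong> A\<^sub>0(a, \<Phi> x)\<close> identifying the lax algebra structures.
\<close>

definition is_rep_lax :: "('u, 'o, 'm, 'm) lax \<Rightarrow> ('u, 'o, 'm) palg \<Rightarrow> bool" where
  "is_rep_lax L P \<longleftrightarrow> lcat L = pcat P \<and>
     (\<exists>\<Theta>. rcolax_morphism L (rep_lax P) \<lparr>rfun = fid (lcat L), rnat = \<Theta>\<rparr> \<and>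
        (\<forall>a \<in> Obj (lcat L). \<forall>x \<in> Obj (bcat (lcat L)).
           bij_betw (\<Theta> a x) (PEl (lprof L) a x) (PEl (lprof (rep_lax P)) a x)))"

end

theory Submission
  imports Defs
begin

text \<open>
  The embedding sends a pseudoalgebra \<open>\<Phi>\<close> to \<open>\<Phi>\<^sub>\<diamond>\<close>.  By the Yoneda lemma a natural family
  \<open>A\<^sub>0(a, \<Phi> x) \<rightarrow> A\<^sub>0'(f a, \<Phi>' (\<beta>f x))\<close> is \<open>r \<mapsto> \<phi>\<^sub>x \<circ> f r\<close> for a unique family
  \<open>\<phi>\<^sub>x : f (\<Phi> x) \<rightarrow> \<Phi>' (\<beta>f x)\<close>, and the axioms of a morphism of lax algebras, evaluated at identities,
  become those of a colax morphism; similarly for 2-cells.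

  For the essential image, let \<open>G\<close> be an equivalence from a lax algebra \<open>L\<close> to \<open>\<Phi>\<^sub>\<diamond>\<close>.  Its structure maps
  \<open>L(a, x) \<rightarrow> A\<^sub>0(G a, \<Phi> (\<beta>G x))\<close> are bijective, so that an element sent to an isomorphism is
  universal, that is, exhibits \<open>a\<close> as a representing object of \<open>L(-, x)\<close>; by essential surjectivity such
  elements \<open>u\<^sub>x \<in> L(\<Phi>' x, x)\<close> exist.  Factorizing \<open>v \<cdot> u\<^sub>x\<close>, \<open>\<Gamma>(id)\<close> and \<open>\<Delta>(u, (u\<^sub>i)\<^sub>i)\<close> through the
  universal elements defines a functor \<open>\<Phi>'\<close>, a unit and a multiplication.  The last two are invertible
  because \<open>\<Gamma>(id)\<close> and \<open>\<Delta>(u, (u\<^sub>i)\<^sub>i)\<close> are themselves sent to isomorphisms, and the axioms of a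
  pseudoalgebra are those of \<open>L\<close> evaluated at universal elements.
\<close>

section \<open>Categories and functors\<close>

text \<open>Three points shape the proof. Composition in \<open>UltSp\<close> is composition of
  functions on elements, so its laws are short, while those of \<open>UltCat\<close> would need
  pasting of diagrams. The Yoneda correspondence is therefore set up on data without axioms; being
  injective and compatible with composition, it pulls the laws of \<open>UltCat\<close> back from
  \<open>UltSp\<close>. An equivalence may change the underlying category, whereas a representation
  of a lax algebra keeps it. Hence \<Phi> itself cannot serve, and a pseudoalgebra is built anew on
  the category of L from chosen representing objects. That an element with invertible image is
  universal needs more than bijective structure maps: G must be fully faithful on underlying
  categories. The proof gets this from normalization, which makes L(a, single b) a copy of hom(a,
  b), and from invertibility of the unit of \<Phi>. Throughout, elements of extensions are classes
  modulo agreement almost everywhere, and equations between them are proved by computing with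
  representatives.\<close>

lemma homI: "f \<in> Arr C \<Longrightarrow> Dom C f = a \<Longrightarrow> Cod C f = b \<Longrightarrow> f \<in> hom C a b"
  by (simp add: hom_def)

lemma homD:
  assumes "f \<in> hom C a b"
  shows "f \<in> Arr C" "Dom C f = a" "Cod C f = b"
  using assms by (auto simp: hom_def)

context category
begin

lemma Arr_hom: "f \<in> Arr C \<Longrightarrow> f \<in> hom C (Dom C f) (Cod C f)"
  by (simp add: hom_def)

lemma hom_Obj: "f \<in> hom C a b \<Longrightarrow> a \<in> Obj C" "f \<in> hom C a b \<Longrightarrow> b \<in> Obj C"
  using Dom_in Cod_in by (auto simp: hom_def)

lemma Ide_simps:
  assumes "a \<in> Obj C"
  shows "Ide C a \<in> Arr C" "Dom C (Ide C a) = a" "Cod C (Ide C a) = a"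
  using Ide_in[OF assms] by (auto simp: hom_def)

text \<open>These forms, and \<open>cat_simps\<close> built from them, speak of \<open>Arr\<close>,
  \<open>Dom\<close> and \<open>Cod\<close> rather than of hom-sets: a premise
  \<open>f \<in> hom C a b\<close> would leave the middle object of a composite undetermined for the
  simplifier.\<close>

lemma Comp_simps:
  assumes "g \<in> Arr C" "f \<in> Arr C" "Dom C g = Cod C f"
  shows "g \<odot> f \<in> Arr C" "Dom C (g \<odot> f) = Dom C f" "Cod C (g \<odot> f) = Cod C g"
  using Comp_in[of g "Cod C f" "Cod C g" f "Dom C f"] assms by (auto simp: hom_def)

lemma Comp_assoc_Arr:
  assumes "h \<in> Arr C" "g \<in> Arr C" "f \<in> Arr C" "Dom C h = Cod C g" "Dom C g = Cod C f"
  shows "(h \<odot> g) \<odot> f = h \<odot> (g \<odot> f)"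
  using Comp_assoc[of h "Dom C h" "Cod C h" g "Dom C g" f "Dom C f"] assms by (auto simp: hom_def)

lemma Ide_laws:
  assumes "f \<in> Arr C"
  shows "Dom C f = a \<Longrightarrow> f \<odot> Ide C a = f" "Cod C f = b \<Longrightarrow> Ide C b \<odot> f = f"
  using Comp_Ide Ide_Comp assms by (auto simp: hom_def)

lemmas cat_simps = Dom_in Cod_in Ide_simps Comp_simps Comp_assoc_Arr Ide_laws

lemma iso_arrE:
  assumes "iso_arr C f" "f \<in> hom C a b"
  obtains g where "g \<in> hom C b a" "g \<odot> f = Ide C a" "f \<odot> g = Ide C b"
  using assms unfolding iso_arr_def hom_def by auto

lemma iso_arrI:
  assumes "f \<in> hom C a b" "g \<in> hom C b a" "g \<odot> f = Ide C a" "f \<odot> g = Ide C b"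
  shows "iso_arr C f"
  using assms unfolding iso_arr_def hom_def by auto

lemma iso_Ide: "a \<in> Obj C \<Longrightarrow> iso_arr C (Ide C a)"
  by (rule iso_arrI[of _ a a "Ide C a"]) (simp_all add: Ide_in cat_simps)

lemma iso_Comp:
  assumes f: "f \<in> hom C a b" "iso_arr C f" and g: "g \<in> hom C b c" "iso_arr C g"
  shows "iso_arr C (g \<odot> f)"
proof -
  obtain f' where f': "f' \<in> hom C b a" "f' \<odot> f = Ide C a" "f \<odot> f' = Ide C b"
    using iso_arrE f by metis
  obtain g' where g': "g' \<in> hom C c b" "g' \<odot> g = Ide C b" "g \<odot> g' = Ide C c"
    using iso_arrE g by metis
  have gf: "g \<odot> f \<in> hom C a c" and fg: "f' \<odot> g' \<in> hom C c a"
    using f g f' g' Comp_in by blast+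
  have "(f' \<odot> g') \<odot> (g \<odot> f) = f' \<odot> ((g' \<odot> g) \<odot> f)"
    using homD[OF f(1)] homD[OF g(1)] homD[OF f'(1)] homD[OF g'(1)] by (simp add: cat_simps)
  also have "\<dots> = Ide C a" using f f' g' Ide_Comp by simp
  finally have 1: "(f' \<odot> g') \<odot> (g \<odot> f) = Ide C a" .
  have "(g \<odot> f) \<odot> (f' \<odot> g') = g \<odot> ((f \<odot> f') \<odot> g')"
    using homD[OF f(1)] homD[OF g(1)] homD[OF f'(1)] homD[OF g'(1)] by (simp add: cat_simps)
  also have "\<dots> = Ide C c" using g f' g' Ide_Comp by simp
  finally have 2: "(g \<odot> f) \<odot> (f' \<odot> g') = Ide C c" .
  show ?thesis by (rule iso_arrI[OF gf fg 1 2])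
qed

lemma iso_bij_post:
  assumes f: "f \<in> hom C a b" "iso_arr C f" and c: "c \<in> Obj C"
  shows "bij_betw (\<lambda>h. f \<odot> h) (hom C c a) (hom C c b)"
proof -
  obtain g where g: "g \<in> hom C b a" "g \<odot> f = Ide C a" "f \<odot> g = Ide C b"
    using iso_arrE f by metis
  show ?thesis
  proof (rule bij_betwI[where g = "\<lambda>h. g \<odot> h"])
    fix h assume h: "h \<in> hom C c a"
    have "g \<odot> (f \<odot> h) = (g \<odot> f) \<odot> h"
      using homD[OF h] homD[OF f(1)] homD[OF g(1)] by (simp add: cat_simps)
    then show "g \<odot> (f \<odot> h) = h" using g h by (simp add: Ide_Comp)
  next
    fix h assume h: "h \<in> hom C c b"
    have "f \<odot> (g \<odot> h) = (f \<odot> g) \<odot> h"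
      using homD[OF h] homD[OF f(1)] homD[OF g(1)] by (simp add: cat_simps)
    then show "f \<odot> (g \<odot> h) = h" using g h by (simp add: Ide_Comp)
  qed (use f g Comp_in in auto)
qed

text \<open>f is the inverse of g after the invertible composite. This will show that g(h) is
  invertible when its composite with the invertible image of a universal element is.\<close>

lemma iso_cancel_left:
  assumes g: "g \<in> hom C b c" "iso_arr C g" and f: "f \<in> hom C a b" and gf: "iso_arr C (g \<odot> f)"
  shows "iso_arr C f"
proof -
  obtain g' where g': "g' \<in> hom C c b" "g' \<odot> g = Ide C b" "g \<odot> g' = Ide C c"
    using iso_arrE g by metis
  have "iso_arr C g'" by (rule iso_arrI[OF g'(1) g(1) g'(3,2)])
  then have "iso_arr C (g' \<odot> (g \<odot> f))"
    using iso_Comp[OF _ gf g'(1)] Comp_in[OF g(1) f] by blast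
  moreover have "g' \<odot> (g \<odot> f) = (g' \<odot> g) \<odot> f"
    using homD[OF f] homD[OF g(1)] homD[OF g'(1)] by (simp add: cat_simps)
  ultimately show ?thesis using g' f by (simp add: Ide_Comp)
qed

end

text \<open>Composites are bracketed to the right, so a commuting square of binary composites does
  not match inside a longer chain; the tail h makes the square applicable there.\<close>

lemma (in category) Comp_swap:
  assumes "g \<odot> f = g' \<odot> f'" "f \<in> hom C a b" "g \<in> hom C b c" "f' \<in> hom C a b'" "g' \<in> hom C b' c" "h \<in> hom C d a"
  shows "g \<odot> f \<odot> h = g' \<odot> f' \<odot> h"
  using Comp_assoc[OF assms(3,2,6)] Comp_assoc[OF assms(5,4,6)] assms(1) by simp

section \<open>Functors and their composition\<close>

context is_functor
begin

lemma farr_simps: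
  assumes "f \<in> Arr C"
  shows "farr F f \<in> Arr D" "Dom D (farr F f) = fobj F (Dom C f)" "Cod D (farr F f) = fobj F (Cod C f)"
  using farr_in[of f "Dom C f" "Cod C f"] assms by (auto simp: hom_def)

lemma farr_Comp_Arr:
  "g \<in> Arr C \<Longrightarrow> f \<in> Arr C \<Longrightarrow> Dom C g = Cod C f \<Longrightarrow>
    farr F (g \<odot>\<^bsub>C\<^esub> f) = farr F g \<odot>\<^bsub>D\<^esub> farr F f"
  using farr_Comp by (auto simp: hom_def)

lemmas functor_simps = fobj_in farr_simps farr_Ide farr_Comp_Arr

lemma iso_farr:
  assumes "category C" "category D" and f: "f \<in> Arr C" "iso_arr C f"
  shows "iso_arr D (farr F f)"
proof -
  interpret C: category C by fact
  interpret D: category D by fact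
  obtain g where g: "g \<in> hom C (Cod C f) (Dom C f)" "g \<odot>\<^bsub>C\<^esub> f = Ide C (Dom C f)" "f \<odot>\<^bsub>C\<^esub> g = Ide C (Cod C f)"
    using C.iso_arrE[OF f(2) C.Arr_hom[OF f(1)]] by blast
  show ?thesis
  proof (rule D.iso_arrI[OF farr_in[OF C.Arr_hom[OF f(1)]] farr_in[OF g(1)]])
    show "farr F g \<odot>\<^bsub>D\<^esub> farr F f = Ide D (fobj F (Dom C f))"
      using farr_Comp[OF g(1) C.Arr_hom[OF f(1)]] g(2) f by (simp add: farr_Ide C.cat_simps)
    show "farr F f \<odot>\<^bsub>D\<^esub> farr F g = Ide D (fobj F (Cod C f))"
      using farr_Comp[OF C.Arr_hom[OF f(1)] g(1)] g(3) f by (simp add: farr_Ide C.cat_simps)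
  qed
qed

end

lemma fid_simps:
  "a \<in> Obj C \<Longrightarrow> fobj (fid C) a = a" "f \<in> Arr C \<Longrightarrow> farr (fid C) f = f"
  by (simp_all add: fid_def)

lemma fcomp_simps:
  "a \<in> Obj C \<Longrightarrow> fobj (fcomp C G F) a = fobj G (fobj F a)"
  "f \<in> Arr C \<Longrightarrow> farr (fcomp C G F) f = farr G (farr F f)"
  by (simp_all add: fcomp_def)

lemma ext_functor_fid: "category C \<Longrightarrow> ext_functor C C (fid C)"
  unfolding ext_functor_def
proof (intro conjI)
  assume "category C"
  then interpret category C .
  show "is_functor C C (fid C)"
  proof
    fix g b c f a assume "g \<in> hom C b c" "f \<in> hom C a b"
    then show "farr (fid C) (g \<odot>\<^bsub>C\<^esub> f) = farr (fid C) g \<odot>\<^bsub>C\<^esub> farr (fid C) f"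
      by (simp add: hom_def fid_simps cat_simps)
  qed (auto simp: fid_simps Ide_in cat_simps hom_def)
qed (simp_all add: fid_def)

lemma is_functor_fcomp:
  assumes C: "category C" and F: "is_functor C D F" and G: "is_functor D E G"
  shows "is_functor C E (fcomp C G F)"
proof -
  interpret C: category C by fact
  interpret F: is_functor C D F by fact
  interpret G: is_functor D E G by fact
  show ?thesis
  proof
    fix g b c f a assume "g \<in> hom C b c" "f \<in> hom C a b"
    then show "farr (fcomp C G F) (g \<odot>\<^bsub>C\<^esub> f) = farr (fcomp C G F) g \<odot>\<^bsub>E\<^esub> farr (fcomp C G F) f"
      by (simp add: hom_def fcomp_simps C.cat_simps F.functor_simps G.functor_simps)
  qed (auto simp: fcomp_simps C.cat_simps F.functor_simps G.functor_simps hom_def)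
qed

lemma ext_functor_fcomp:
  assumes "category C" "ext_functor C D F" "ext_functor D E G"
  shows "ext_functor C E (fcomp C G F)"
  using is_functor_fcomp[of C D F E G] assms by (simp add: ext_functor_def fcomp_def)

lemma func_eqI:
  assumes "ext_functor C D F" "ext_functor C D G"
    and "\<And>a. a \<in> Obj C \<Longrightarrow> fobj F a = fobj G a" "\<And>f. f \<in> Arr C \<Longrightarrow> farr F f = farr G f"
  shows "F = G"
proof -
  have "fobj F = fobj G" "farr F = farr G"
    using assms unfolding ext_functor_def by (auto intro: extensionalityI)
  then show ?thesis by simp
qed

lemma fcomp_assoc:
  assumes "is_functor C D F"
  shows "fcomp C (fcomp D H G) F = fcomp C H (fcomp C G F)"
proof -
  interpret is_functor C D F by fact
  show ?thesis
    by (auto simp: fcomp_def functor_simps intro!: restrict_ext)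
qed

lemma fcomp_fid:
  assumes "category C" "ext_functor C D F"
  shows "fcomp C F (fid C) = F" "fcomp C (fid D) F = F"
proof -
  interpret F: is_functor C D F using assms(2) by (simp add: ext_functor_def)
  have ext: "fobj F \<in> extensional (Obj C)" "farr F \<in> extensional (Arr C)"
    using assms(2) by (simp_all add: ext_functor_def)
  have "fobj (fcomp C F (fid C)) = fobj F"
    by (rule extensionalityI[of _ "Obj C"]) (auto simp: ext fcomp_def fid_def)
  moreover have "farr (fcomp C F (fid C)) = farr F"
    by (rule extensionalityI[of _ "Arr C"]) (auto simp: ext fcomp_def fid_def)
  moreover have "fobj (fcomp C (fid D) F) = fobj F"
    by (rule extensionalityI[of _ "Obj C"]) (auto simp: ext fcomp_def fid_def F.functor_simps)
  moreover have "farr (fcomp C (fid D) F) = farr F"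
    by (rule extensionalityI[of _ "Arr C"]) (auto simp: ext fcomp_def fid_def F.functor_simps)
  ultimately show "fcomp C F (fid C) = F" "fcomp C (fid D) F = F" by simp_all
qed

section \<open>Natural transformations and their vertical and horizontal composition\<close>

lemma nat_transD:
  assumes "nat_trans C D F G \<sigma>"
  shows "a \<in> Obj C \<Longrightarrow> \<sigma> a \<in> hom D (fobj F a) (fobj G a)"
    and "f \<in> hom C a b \<Longrightarrow> \<sigma> b \<odot>\<^bsub>D\<^esub> farr F f = farr G f \<odot>\<^bsub>D\<^esub> \<sigma> a"
    and "\<sigma> \<in> extensional (Obj C)"
  using assms by (auto simp: nat_trans_def hom_def)

lemma nat_transI:
  assumes "\<sigma> \<in> extensional (Obj C)" "\<And>a. a \<in> Obj C \<Longrightarrow> \<sigma> a \<in> hom D (fobj F a) (fobj G a)"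
    "\<And>f a b. f \<in> hom C a b \<Longrightarrow> \<sigma> b \<odot>\<^bsub>D\<^esub> farr F f = farr G f \<odot>\<^bsub>D\<^esub> \<sigma> a"
  shows "nat_trans C D F G \<sigma>"
  using assms by (auto simp: nat_trans_def hom_def)

lemma nat_trans_id:
  assumes "category C" "category D" "is_functor C D F"
  shows "nat_trans C D F F (restrict (\<lambda>a. Ide D (fobj F a)) (Obj C))"
proof -
  interpret C: category C by fact
  interpret D: category D by fact
  interpret F: is_functor C D F by fact
  show ?thesis
  proof (rule nat_transI)
    fix f a b assume f: "f \<in> hom C a b"
    show "restrict (\<lambda>a. Ide D (fobj F a)) (Obj C) b \<odot>\<^bsub>D\<^esub> farr F f =
        farr F f \<odot>\<^bsub>D\<^esub> restrict (\<lambda>a. Ide D (fobj F a)) (Obj C) a"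
      using F.farr_in[OF f] C.hom_Obj[OF f] by (simp add: D.Comp_Ide D.Ide_Comp)
  qed (auto simp: D.Ide_in F.fobj_in)
qed

lemma nat_trans_vcomp:
  assumes "category C" "category D" "is_functor C D F" "is_functor C D G" "is_functor C D H"
    and \<sigma>: "nat_trans C D F G \<sigma>" and \<tau>: "nat_trans C D G H \<tau>"
  shows "nat_trans C D F H (restrict (\<lambda>a. \<tau> a \<odot>\<^bsub>D\<^esub> \<sigma> a) (Obj C))"
proof -
  interpret C: category C by fact
  interpret D: category D by fact
  interpret F: is_functor C D F by fact
  interpret G: is_functor C D G by fact
  interpret H: is_functor C D H by fact
  show ?thesis
  proof (rule nat_transI)
    fix f a b assume f: "f \<in> hom C a b"
    note a = C.hom_Obj(1)[OF f] and b = C.hom_Obj(2)[OF f]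
    note hs = nat_transD(1)[OF \<sigma> a] nat_transD(1)[OF \<sigma> b] nat_transD(1)[OF \<tau> a] nat_transD(1)[OF \<tau> b]
    have "(\<tau> b \<odot>\<^bsub>D\<^esub> \<sigma> b) \<odot>\<^bsub>D\<^esub> farr F f = \<tau> b \<odot>\<^bsub>D\<^esub> (\<sigma> b \<odot>\<^bsub>D\<^esub> farr F f)"
      by (rule D.Comp_assoc[OF hs(4) hs(2) F.farr_in[OF f]])
    also have "\<dots> = \<tau> b \<odot>\<^bsub>D\<^esub> farr G f \<odot>\<^bsub>D\<^esub> \<sigma> a" by (simp add: nat_transD(2)[OF \<sigma> f])
    also have "\<dots> = farr H f \<odot>\<^bsub>D\<^esub> \<tau> a \<odot>\<^bsub>D\<^esub> \<sigma> a"
      by (rule D.Comp_swap[OF nat_transD(2)[OF \<tau> f] G.farr_in[OF f] hs(4) hs(3) H.farr_in[OF f] hs(1)])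
    finally show "restrict (\<lambda>a. \<tau> a \<odot>\<^bsub>D\<^esub> \<sigma> a) (Obj C) b \<odot>\<^bsub>D\<^esub> farr F f =
        farr H f \<odot>\<^bsub>D\<^esub> restrict (\<lambda>a. \<tau> a \<odot>\<^bsub>D\<^esub> \<sigma> a) (Obj C) a"
      using a b by simp
  qed (auto intro: D.Comp_in nat_transD(1)[OF \<sigma>] nat_transD(1)[OF \<tau>])
qed

lemma nat_trans_hcomp:
  assumes "category C" "category D" "category E" "is_functor C D F" "is_functor C D F'"
    "is_functor D E G" "is_functor D E G'"
    and \<sigma>: "nat_trans C D F F' \<sigma>" and \<tau>: "nat_trans D E G G' \<tau>"
  shows "nat_trans C E (fcomp C G F) (fcomp C G' F') (cell_hcomp C E F' G \<tau> \<sigma>)"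
proof -
  interpret C: category C by fact
  interpret D: category D by fact
  interpret E: category E by fact
  interpret F: is_functor C D F by fact
  interpret F': is_functor C D F' by fact
  interpret G: is_functor D E G by fact
  interpret G': is_functor D E G' by fact
  show ?thesis
  proof (rule nat_transI)
    fix f a b assume f: "f \<in> hom C a b"
    note a = C.hom_Obj(1)[OF f] and b = C.hom_Obj(2)[OF f]
    note hs = G.farr_in[OF nat_transD(1)[OF \<sigma> a]] G.farr_in[OF nat_transD(1)[OF \<sigma> b]]
      nat_transD(1)[OF \<tau> F'.fobj_in[OF a]] nat_transD(1)[OF \<tau> F'.fobj_in[OF b]]
    have "(\<tau> (fobj F' b) \<odot>\<^bsub>E\<^esub> farr G (\<sigma> b)) \<odot>\<^bsub>E\<^esub> farr G (farr F f) = \<tau> (fobj F' b) \<odot>\<^bsub>E\<^esub> farr G (\<sigma> b \<odot>\<^bsub>D\<^esub> farr F f)"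
      using E.Comp_assoc[OF hs(4) hs(2) G.farr_in[OF F.farr_in[OF f]]]
        G.farr_Comp[OF nat_transD(1)[OF \<sigma> b] F.farr_in[OF f]] by simp
    also have "\<dots> = \<tau> (fobj F' b) \<odot>\<^bsub>E\<^esub> farr G (farr F' f) \<odot>\<^bsub>E\<^esub> farr G (\<sigma> a)"
      using G.farr_Comp[OF F'.farr_in[OF f] nat_transD(1)[OF \<sigma> a]] by (simp add: nat_transD(2)[OF \<sigma> f])
    also have "\<dots> = farr G' (farr F' f) \<odot>\<^bsub>E\<^esub> \<tau> (fobj F' a) \<odot>\<^bsub>E\<^esub> farr G (\<sigma> a)"
      by (rule E.Comp_swap[OF nat_transD(2)[OF \<tau> F'.farr_in[OF f]] G.farr_in[OF F'.farr_in[OF f]] hs(4) hs(3)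
            G'.farr_in[OF F'.farr_in[OF f]] hs(1)])
    finally show "cell_hcomp C E F' G \<tau> \<sigma> b \<odot>\<^bsub>E\<^esub> farr (fcomp C G F) f =
        farr (fcomp C G' F') f \<odot>\<^bsub>E\<^esub> cell_hcomp C E F' G \<tau> \<sigma> a"
      using a b homD(1)[OF f] by (simp add: cell_hcomp_def fcomp_simps)
  qed (auto simp: cell_hcomp_def fcomp_simps intro!: E.Comp_in G.farr_in F'.fobj_in nat_transD(1)[OF \<sigma>] nat_transD(1)[OF \<tau>])
qed

lemma restrict_eqI: "\<sigma> \<in> extensional S \<Longrightarrow> (\<And>a. a \<in> S \<Longrightarrow> g a = \<sigma> a) \<Longrightarrow> restrict g S = \<sigma>"
  by (rule extensionalityI[OF restrict_extensional]) auto

section \<open>The ultracompletion as a category\<close>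

lemma bel_of_simps [simp]:
  "src (bel_of x y t \<zeta>) = x" "tgt (bel_of x y t \<zeta>) = y"
  "cls (bel_of x y t \<zeta>) = {(t', \<zeta>'). \<forall>\<^sub>F z in ult y. t' z = t z \<and> \<zeta>' z = \<zeta> z}"
  by (simp_all add: bel_of_def)

text \<open>The stored class contains the pair it was formed from, so equal classes force agreement
  almost everywhere. Conversely, under the filter of y, agreement with one pair can be replaced by
  agreement with the other.\<close>

lemma bel_of_eq_iff:
  "bel_of x y t \<zeta> = bel_of x' y' t' \<zeta>' \<longleftrightarrow>
    x = x' \<and> y = y' \<and> (\<forall>\<^sub>F z in ult y. t z = t' z \<and> \<zeta> z = \<zeta>' z)"
proof
  assume eq: "bel_of x y t \<zeta> = bel_of x' y' t' \<zeta>'"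
  then have "cls (bel_of x y t \<zeta>) = cls (bel_of x' y' t' \<zeta>')" by simp
  moreover have "(t, \<zeta>) \<in> cls (bel_of x y t \<zeta>)" by simp
  ultimately have "(t, \<zeta>) \<in> cls (bel_of x' y' t' \<zeta>')" by simp
  with eq show "x = x' \<and> y = y' \<and> (\<forall>\<^sub>F z in ult y. t z = t' z \<and> \<zeta> z = \<zeta>' z)"
    by (auto simp: bel_of_def)
next
  assume "x = x' \<and> y = y' \<and> (\<forall>\<^sub>F z in ult y. t z = t' z \<and> \<zeta> z = \<zeta>' z)"
  then have xy: "x = x'" "y = y'" and ev: "\<forall>\<^sub>F z in ult y. t z = t' z \<and> \<zeta> z = \<zeta>' z" by auto
  have "(\<forall>\<^sub>F z in ult y. u z = t z \<and> v z = \<zeta> z) \<longleftrightarrow> (\<forall>\<^sub>F z in ult y. u z = t' z \<and> v z = \<zeta>' z)"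
    for u v
    by (rule eventually_subst[OF eventually_mono[OF ev]]) auto
  then show "bel_of x y t \<zeta> = bel_of x' y' t' \<zeta>'"
    using xy by (auto simp: bel_of_def)
qed

text \<open>All that is known of the representative picked by \<open>rmap\<close> and
  \<open>rcmp\<close>. An operation on classes is evaluated by intersecting the set given here with
  other members of the filter, which also shows independence of the choice.\<close>

lemma rep_bel_of:
  "\<forall>\<^sub>F z in ult y. rmap (bel_of x y t \<zeta>) z = t z \<and> rcmp (bel_of x y t \<zeta>) z = \<zeta> z"
proof -
  have "(t, \<zeta>) \<in> cls (bel_of x y t \<zeta>)" by simp
  then have "(SOME p. p \<in> cls (bel_of x y t \<zeta>)) \<in> cls (bel_of x y t \<zeta>)" by (rule someI)
  then show ?thesis unfolding rmap_def rcmp_def by (auto simp: case_prod_beta)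
qed

lemma bsetI:
  assumes "t \<in> idx y \<rightarrow> idx x" "filtermap t (ult y) = ult x"
    and "\<And>z. z \<in> idx y \<Longrightarrow> \<zeta> z \<in> E (val x (t z)) (val y z)"
  shows "bel_of x y t \<zeta> \<in> bset E x y"
  using assms unfolding bset_def bpairs_def by force

lemma bsetE:
  assumes "s \<in> bset E x y"
  obtains t \<zeta> where "s = bel_of x y t \<zeta>" "t \<in> idx y \<rightarrow> idx x" "filtermap t (ult y) = ult x"
    "\<And>z. z \<in> idx y \<Longrightarrow> \<zeta> z \<in> E (val x (t z)) (val y z)"
  using assms unfolding bset_def bpairs_def by force

lemma bset_src_tgt: "s \<in> bset E x y \<Longrightarrow> src s = x" "s \<in> bset E x y \<Longrightarrow> tgt s = y"
  by (auto simp: bset_def)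

text \<open>Serves to read a morphism of \<beta>\<beta>C, whose components lie in
  \<open>hom (bcat C)\<close>, as an element of an iterated \<open>bset\<close>, the form on which
  \<open>bmu_el\<close> is computed.\<close>

lemma bset_mono:
  assumes "s \<in> bset E x y" "\<And>a b. a \<in> val x ` idx x \<Longrightarrow> b \<in> val y ` idx y \<Longrightarrow> E a b \<subseteq> E' a b"
  shows "s \<in> bset E' x y"
  using assms(1)
proof (rule bsetE)
  fix t \<zeta> assume *: "s = bel_of x y t \<zeta>" "t \<in> idx y \<rightarrow> idx x" "filtermap t (ult y) = ult x"
    "\<And>z. z \<in> idx y \<Longrightarrow> \<zeta> z \<in> E (val x (t z)) (val y z)"
  show "s \<in> bset E' x y" unfolding *(1)
  proof (rule bsetI[OF *(2,3)])
    fix z assume z: "z \<in> idx y"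
    then have "val x (t z) \<in> val x ` idx x" using *(2) by auto
    then show "\<zeta> z \<in> E' (val x (t z)) (val y z)" using assms(2) *(4)[OF z] z by blast
  qed
qed

lemma filtermap_id' [simp]: "filtermap id F = F" "filtermap (\<lambda>z. z) F = F"
  by (simp_all add: id_def filtermap_ident)

lemma filtermap_comp: "filtermap q F = G \<Longrightarrow> filtermap p G = H \<Longrightarrow> filtermap (p \<circ> q) F = H"
  by (auto simp: filtermap_filtermap comp_def)

lemma bel_of_cong:
  assumes "\<forall>\<^sub>F z in ult y. z \<in> idx y" "\<And>z. z \<in> idx y \<Longrightarrow> t z = t' z \<and> \<zeta> z = \<zeta>' z"
  shows "bel_of x y t \<zeta> = bel_of x y t' \<zeta>'"
  unfolding bel_of_eq_iff using assms by (auto elim: eventually_mono)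

lemma bObjD:
  assumes "x \<in> bObj C"
  shows "\<forall>\<^sub>F z in ult x. z \<in> idx x" "z \<in> idx x \<Longrightarrow> val x z \<in> Obj C"
    "ultrafilter (ult x)" "small TYPE('u) (idx (x :: ('u, 'o) bobj))" "val x \<in> extensional (idx x)"
  using assms by (auto simp: bObj_def PiE_def)

lemma bObjI:
  fixes x :: "('u, 'o) bobj"
  assumes "\<forall>\<^sub>F z in ult x. z \<in> idx x" "\<And>z. z \<in> idx x \<Longrightarrow> val x z \<in> Obj C"
    "ultrafilter (ult x)" "small TYPE('u) (idx x)" "val x \<in> extensional (idx x)"
  shows "x \<in> bObj C"
  using assms by (auto simp: bObj_def PiE_def)

lemma bobj_eqI:
  assumes "idx x = idx y" "\<And>z. z \<in> idx y \<Longrightarrow> val x z = val y z" "ult x = ult y"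
    "val x \<in> extensional (idx x)" "val y \<in> extensional (idx y)"
  shows "x = y"
proof -
  have "val x = val y" using assms by (metis extensionalityI)
  then show ?thesis using assms by (simp add: bobj.expand)
qed

section \<open>Composition in \<beta>C\<close>

lemma bcat_simps [simp]:
  "Obj (bcat C) = bObj C" "Dom (bcat C) = src" "Cod (bcat C) = tgt"
  "Ide (bcat C) x = bel_of x x id (\<lambda>z. Ide C (val x z))"
  by (simp_all add: bcat_def)

lemma src_tgt_Comp [simp]: "src (t \<odot>\<^bsub>bcat C\<^esub> s) = src s" "tgt (t \<odot>\<^bsub>bcat C\<^esub> s) = tgt t"
  by (simp_all add: bcat_def)

lemma hom_bcat:
  assumes "x \<in> bObj C" "y \<in> bObj C"
  shows "hom (bcat C) x y = bset (hom C) x y"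
  using assms by (auto simp: hom_def bcat_def bset_src_tgt)

lemma Arr_bcatD:
  assumes "s \<in> Arr (bcat C)"
  shows "src s \<in> bObj C" "tgt s \<in> bObj C" "s \<in> bset (hom C) (src s) (tgt s)"
  using assms by (auto simp: bcat_def bset_src_tgt)

lemma hom_bcatD:
  assumes "s \<in> hom (bcat C) x y"
  shows "x \<in> bObj C" "y \<in> bObj C" "s \<in> bset (hom C) x y"
  using Arr_bcatD[OF homD(1)[OF assms]] homD(2,3)[OF assms] by auto

text \<open>The representative of the first factor is controlled only almost everywhere on y, but it
  is evaluated at q i. Since q pushes the ultrafilter of z forward to that of y, the exceptional i
  are negligible in z.\<close>

lemma Comp_bel_of:
  assumes q: "filtermap q (ult z) = ult y"
  shows "bel_of y z q \<gamma> \<odot>\<^bsub>bcat C\<^esub> bel_of x y p \<alpha> = bel_of x z (p \<circ> q) (\<lambda>i. \<gamma> i \<odot>\<^bsub>C\<^esub> \<alpha> (q i))"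
proof -
  have "\<forall>\<^sub>F i in ult z. rmap (bel_of x y p \<alpha>) (q i) = p (q i) \<and> rcmp (bel_of x y p \<alpha>) (q i) = \<alpha> (q i)"
    using rep_bel_of[of x y p \<alpha>] unfolding q[symmetric] eventually_filtermap .
  moreover have "\<forall>\<^sub>F i in ult z. rmap (bel_of y z q \<gamma>) i = q i \<and> rcmp (bel_of y z q \<gamma>) i = \<gamma> i"
    by (rule rep_bel_of)
  ultimately have "\<forall>\<^sub>F i in ult z. (rmap (bel_of x y p \<alpha>) \<circ> rmap (bel_of y z q \<gamma>)) i = (p \<circ> q) i \<and>
      rcmp (bel_of y z q \<gamma>) i \<odot>\<^bsub>C\<^esub> rcmp (bel_of x y p \<alpha>) (rmap (bel_of y z q \<gamma>) i) = \<gamma> i \<odot>\<^bsub>C\<^esub> \<alpha> (q i)"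
    by eventually_elim simp
  then show ?thesis
    by (simp add: bcat_def bel_of_eq_iff)
qed

lemma category_bcat:
  assumes "category C"
  shows "category (bcat C)"
proof -
  interpret category C by fact
  show ?thesis
  proof
    fix x assume "x \<in> Obj (bcat C)"
    then show "Ide (bcat C) x \<in> hom (bcat C) x x"
      by (auto simp: hom_bcat Ide_in bObjD intro!: bsetI)
  next
    fix g y z f x assume g: "g \<in> hom (bcat C) y z" and f: "f \<in> hom (bcat C) x y"
    note 1 = hom_bcatD[OF g] and 2 = hom_bcatD[OF f]
    obtain q \<gamma> where q: "g = bel_of y z q \<gamma>" "q \<in> idx z \<rightarrow> idx y" "filtermap q (ult z) = ult y"
      "\<And>i. i \<in> idx z \<Longrightarrow> \<gamma> i \<in> hom C (val y (q i)) (val z i)" using 1(3) by (rule bsetE) blast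
    obtain p \<alpha> where p: "f = bel_of x y p \<alpha>" "p \<in> idx y \<rightarrow> idx x" "filtermap p (ult y) = ult x"
      "\<And>i. i \<in> idx y \<Longrightarrow> \<alpha> i \<in> hom C (val x (p i)) (val y i)" using 2(3) by (rule bsetE) blast
    show "g \<odot>\<^bsub>bcat C\<^esub> f \<in> hom (bcat C) x z"
      unfolding q(1) p(1) Comp_bel_of[OF q(3)] hom_bcat[OF 2(1) 1(2)]
    proof (rule bsetI[OF _ filtermap_comp[OF q(3) p(3)]])
      fix i assume "i \<in> idx z"
      then show "\<gamma> i \<odot>\<^bsub>C\<^esub> \<alpha> (q i) \<in> hom C (val x ((p \<circ> q) i)) (val z i)"
        using q(2) Comp_in[OF q(4) p(4)] by auto
    qed (use p(2) q(2) in auto)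
  next
    fix f x y assume f: "f \<in> hom (bcat C) x y"
    note 2 = hom_bcatD[OF f]
    obtain p \<alpha> where p: "f = bel_of x y p \<alpha>" "p \<in> idx y \<rightarrow> idx x" "filtermap p (ult y) = ult x"
      "\<And>i. i \<in> idx y \<Longrightarrow> \<alpha> i \<in> hom C (val x (p i)) (val y i)" using 2(3) by (rule bsetE) blast
    show "f \<odot>\<^bsub>bcat C\<^esub> Ide (bcat C) x = f"
      using p Comp_Ide[OF p(4)] by (auto simp: Comp_bel_of intro!: bel_of_cong bObjD[OF 2(2)])
    have "filtermap id (ult y) = ult y" by (simp add: id_def filtermap_ident)
    then show "Ide (bcat C) y \<odot>\<^bsub>bcat C\<^esub> f = f"
      using p Ide_Comp[OF p(4)] by (auto simp: Comp_bel_of intro!: bel_of_cong bObjD[OF 2(2)])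
  next
    fix h z w g y f x
    assume h: "h \<in> hom (bcat C) z w" and g: "g \<in> hom (bcat C) y z" and f: "f \<in> hom (bcat C) x y"
    note 1 = hom_bcatD[OF g] and 2 = hom_bcatD[OF f] and 3 = hom_bcatD[OF h]
    obtain r \<delta> where r: "h = bel_of z w r \<delta>" "r \<in> idx w \<rightarrow> idx z" "filtermap r (ult w) = ult z"
      "\<And>i. i \<in> idx w \<Longrightarrow> \<delta> i \<in> hom C (val z (r i)) (val w i)" using 3(3) by (rule bsetE) blast
    obtain q \<gamma> where q: "g = bel_of y z q \<gamma>" "q \<in> idx z \<rightarrow> idx y" "filtermap q (ult z) = ult y"
      "\<And>i. i \<in> idx z \<Longrightarrow> \<gamma> i \<in> hom C (val y (q i)) (val z i)" using 1(3) by (rule bsetE) blast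
    obtain p \<alpha> where p: "f = bel_of x y p \<alpha>" "p \<in> idx y \<rightarrow> idx x" "filtermap p (ult y) = ult x"
      "\<And>i. i \<in> idx y \<Longrightarrow> \<alpha> i \<in> hom C (val x (p i)) (val y i)" using 2(3) by (rule bsetE) blast
    have "(\<delta> i \<odot>\<^bsub>C\<^esub> \<gamma> (r i)) \<odot>\<^bsub>C\<^esub> \<alpha> (q (r i)) = \<delta> i \<odot>\<^bsub>C\<^esub> \<gamma> (r i) \<odot>\<^bsub>C\<^esub> \<alpha> (q (r i))" if "i \<in> idx w" for i
      using that r(2) q(2) by (intro Comp_assoc[OF r(4) q(4) p(4)]) auto
    then show "(h \<odot>\<^bsub>bcat C\<^esub> g) \<odot>\<^bsub>bcat C\<^esub> f = h \<odot>\<^bsub>bcat C\<^esub> (g \<odot>\<^bsub>bcat C\<^esub> f)"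
      unfolding r(1) q(1) p(1) Comp_bel_of[OF q(3)] Comp_bel_of[OF r(3)]
        Comp_bel_of[OF filtermap_comp[OF r(3) q(3)]]
      by (intro bel_of_cong bObjD[OF 3(2)]) auto
  qed (auto dest: Arr_bcatD)
qed

text \<open>A class depends on its target only through the ultrafilter, so it can be read over any
  other target with the same one.\<close>

lemma retgt_bel_of: "ult y' = ult y \<Longrightarrow> retgt y' (bel_of x y t \<zeta>) = bel_of x y' t \<zeta>"
  by (simp add: retgt_def bel_of_def)

section \<open>The action of \<beta> on functors and natural transformations\<close>

lemma bmap_simps [simp]:
  "idx (bmap f x) = idx x" "ult (bmap f x) = ult x" "z \<in> idx x \<Longrightarrow> val (bmap f x) z = f (val x z)"
  by (simp_all add: bmap_def)

lemma bmap_in: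
  "x \<in> bObj C \<Longrightarrow> (\<And>a. a \<in> Obj C \<Longrightarrow> f a \<in> Obj D) \<Longrightarrow> bmap f x \<in> bObj D"
  by (rule bObjI) (auto simp: bObjD bmap_def)

lemma val_bmap_ext: "val (bmap f x) \<in> extensional (idx x)"
  by (simp add: bmap_def)

lemma bmap_bmap:
  "(\<And>z. z \<in> idx x \<Longrightarrow> h (val x z) = g (f (val x z))) \<Longrightarrow> bmap g (bmap f x) = bmap h x"
  by (rule bobj_eqI) (auto simp: bmap_def)

lemma bmap_ident:
  "x \<in> bObj C \<Longrightarrow> (\<And>a. a \<in> Obj C \<Longrightarrow> f a = a) \<Longrightarrow> bmap f x = x"
  by (rule bobj_eqI) (auto simp: bObjD bmap_def)

lemma fobj_bfun [simp]: "fobj (bfun f) = bmap (fobj f)"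
  by (simp add: bfun_def)

lemma bfun_bel_of:
  "farr (bfun f) (bel_of x y t \<zeta>) = bel_of (bmap (fobj f) x) (bmap (fobj f) y) t (\<lambda>z. farr f (\<zeta> z))"
  unfolding bfun_def
  by (simp add: bel_of_eq_iff) (use rep_bel_of[of x y t \<zeta>] in \<open>auto elim: eventually_mono\<close>)

lemma is_functor_bfun:
  assumes "is_functor C D f"
  shows "is_functor (bcat C) (bcat D) (bfun f)"
proof -
  interpret is_functor C D f by fact
  have obj: "bmap (fobj f) x \<in> bObj D" if "x \<in> bObj C" for x
    using that fobj_in by (rule bmap_in)
  show ?thesis
  proof
    fix s x y assume "s \<in> hom (bcat C) x y"
    note 1 = hom_bcatD[OF this]
    obtain p \<alpha> where p: "s = bel_of x y p \<alpha>" "p \<in> idx y \<rightarrow> idx x" "filtermap p (ult y) = ult x"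
      "\<And>i. i \<in> idx y \<Longrightarrow> \<alpha> i \<in> hom C (val x (p i)) (val y i)" using 1(3) by (rule bsetE) blast
    show "farr (bfun f) s \<in> hom (bcat D) (fobj (bfun f) x) (fobj (bfun f) y)"
      using p farr_in[OF p(4)] by (auto simp: hom_bcat obj 1 bfun_bel_of Pi_iff intro!: bsetI)
  next
    fix x assume "x \<in> Obj (bcat C)"
    then show "farr (bfun f) (Ide (bcat C) x) = Ide (bcat D) (fobj (bfun f) x)"
      by (auto simp: bfun_bel_of farr_Ide bObjD intro!: bel_of_cong)
  next
    fix t y z s x assume t: "t \<in> hom (bcat C) y z" and s: "s \<in> hom (bcat C) x y"
    note 1 = hom_bcatD[OF t] and 2 = hom_bcatD[OF s]
    obtain q \<gamma> where q: "t = bel_of y z q \<gamma>" "q \<in> idx z \<rightarrow> idx y" "filtermap q (ult z) = ult y"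
      "\<And>i. i \<in> idx z \<Longrightarrow> \<gamma> i \<in> hom C (val y (q i)) (val z i)" using 1(3) by (rule bsetE) blast
    obtain p \<alpha> where p: "s = bel_of x y p \<alpha>" "p \<in> idx y \<rightarrow> idx x" "filtermap p (ult y) = ult x"
      "\<And>i. i \<in> idx y \<Longrightarrow> \<alpha> i \<in> hom C (val x (p i)) (val y i)" using 2(3) by (rule bsetE) blast
    have "farr f (\<gamma> i \<odot>\<^bsub>C\<^esub> \<alpha> (q i)) = farr f (\<gamma> i) \<odot>\<^bsub>D\<^esub> farr f (\<alpha> (q i))" if "i \<in> idx z" for i
      using that q(2) by (intro farr_Comp[OF q(4) p(4)]) auto
    then show "farr (bfun f) (t \<odot>\<^bsub>bcat C\<^esub> s) = farr (bfun f) t \<odot>\<^bsub>bcat D\<^esub> farr (bfun f) s"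
      unfolding q(1) p(1) Comp_bel_of[OF q(3)] bfun_bel_of
      by (subst Comp_bel_of) (auto simp: q bObjD[OF 1(2)] intro!: bel_of_cong)
  qed (simp add: obj)
qed

lemma bfun_fcomp:
  assumes "s \<in> Arr (bcat C)"
  shows "farr (bfun (fcomp C g f)) s = farr (bfun g) (farr (bfun f) s)"
proof -
  note 1 = Arr_bcatD[OF assms]
  obtain p \<alpha> where p: "s = bel_of (src s) (tgt s) p \<alpha>"
    "p \<in> idx (tgt s) \<rightarrow> idx (src s)"
    "\<And>i. i \<in> idx (tgt s) \<Longrightarrow> \<alpha> i \<in> hom C (val (src s) (p i)) (val (tgt s) i)" using 1(3) by (rule bsetE) blast
  have b: "bmap (fobj (fcomp C g f)) x = bmap (fobj g) (bmap (fobj f) x)" if "x \<in> bObj C" for x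
    by (rule sym, rule bmap_bmap) (use that in \<open>auto simp: fcomp_simps bObjD\<close>)
  have "farr (bfun (fcomp C g f)) (bel_of (src s) (tgt s) p \<alpha>) =
      farr (bfun g) (farr (bfun f) (bel_of (src s) (tgt s) p \<alpha>))"
    unfolding bfun_bel_of b[OF 1(1)] b[OF 1(2)]
    by (rule bel_of_cong) (use 1 homD(1)[OF p(3)] in \<open>auto simp: bObjD fcomp_simps\<close>)
  then show ?thesis using p(1) by simp
qed

lemma bmap_fcomp:
  "x \<in> bObj C \<Longrightarrow> bmap (fobj (fcomp C g f)) x = bmap (fobj g) (bmap (fobj f) x)"
  by (rule sym, rule bmap_bmap) (auto simp: fcomp_simps bObjD)

lemma bmap_fid: "x \<in> bObj C \<Longrightarrow> bmap (fobj (fid C)) x = x"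
  by (rule bmap_ident) (auto simp: fid_simps)

lemma bfun_fid:
  assumes "s \<in> Arr (bcat C)"
  shows "farr (bfun (fid C)) s = s"
proof -
  note 1 = Arr_bcatD[OF assms]
  obtain p \<alpha> where p: "s = bel_of (src s) (tgt s) p \<alpha>"
    "\<And>i. i \<in> idx (tgt s) \<Longrightarrow> \<alpha> i \<in> hom C (val (src s) (p i)) (val (tgt s) i)" using 1(3) by (rule bsetE) blast
  have "farr (bfun (fid C)) (bel_of (src s) (tgt s) p \<alpha>) = bel_of (src s) (tgt s) p \<alpha>"
    unfolding bfun_bel_of bmap_fid[OF 1(1)] bmap_fid[OF 1(2)]
    by (rule bel_of_cong) (use 1 homD(1)[OF p(2)] in \<open>auto simp: bObjD fid_simps\<close>)
  then show ?thesis using p(1) by simp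
qed

lemma bnt_in:
  assumes "x \<in> bObj C" "\<And>a. a \<in> Obj C \<Longrightarrow> \<sigma> a \<in> hom D (fobj F a) (fobj G a)"
  shows "bnt F G \<sigma> x \<in> bset (hom D) (bmap (fobj F) x) (bmap (fobj G) x)"
  unfolding bnt_def by (rule bsetI) (use assms in \<open>auto simp: bObjD id_def filtermap_ident\<close>)

lemma is_functor_obj_bObj:
  "is_functor C D f \<Longrightarrow> x \<in> bObj C \<Longrightarrow> bmap (fobj f) x \<in> bObj D"
  using is_functor.fobj_in by (metis bmap_in)

section \<open>Profunctors, their extension to the ultracompletion, and coends\<close>

text \<open>A profunctor without the smallness condition on its values, which is not needed for coends
  and is not claimed for extensions to \<open>\<beta>\<close>.\<close>

locale pre_prof = C: category C + D: category D
  for C :: "('c, 'cm) cat" and D :: "('d, 'dm) cat" +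
  fixes F :: "('d, 'dm, 'c, 'cm, 'e) prof"
  assumes act_in: "f \<in> hom D d' d \<Longrightarrow> g \<in> hom C c c' \<Longrightarrow> e \<in> PEl F d c \<Longrightarrow> PAct F f g e \<in> PEl F d' c'"
    and act_Ide: "d \<in> Obj D \<Longrightarrow> c \<in> Obj C \<Longrightarrow> e \<in> PEl F d c \<Longrightarrow> PAct F (Ide D d) (Ide C c) e = e"
    and act_Comp: "f \<in> hom D d' d \<Longrightarrow> f' \<in> hom D d'' d' \<Longrightarrow> g \<in> hom C c c' \<Longrightarrow> g' \<in> hom C c' c'' \<Longrightarrow>
          e \<in> PEl F d c \<Longrightarrow> PAct F (f \<odot>\<^bsub>D\<^esub> f') (g' \<odot>\<^bsub>C\<^esub> g) e = PAct F f' g' (PAct F f g e)"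
begin

text \<open>Functoriality in both variables, with an identity inserted on either side. Comparing the
  two equations gives \<open>act_comm\<close>, the interchange of left and right actions.\<close>

lemma act_split:
  assumes f: "f \<in> hom D d' d" and g: "g \<in> hom C c c'" and e: "e \<in> PEl F d c"
  shows "PAct F f (Ide C c') (PAct F (Ide D d) g e) = PAct F f g e"
    and "PAct F (Ide D d') g (PAct F f (Ide C c) e) = PAct F f g e"
  using act_Comp[OF D.Ide_in f g C.Ide_in e] act_Comp[OF f D.Ide_in C.Ide_in g e]
    D.hom_Obj[OF f] C.hom_Obj[OF g] homD[OF f] homD[OF g]
  by (simp_all add: C.cat_simps D.cat_simps)

lemma act_left_Comp:
  assumes "f \<in> hom D d' d" "f' \<in> hom D d'' d'" "c \<in> Obj C" "e \<in> PEl F d c"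
  shows "PAct F (f \<odot>\<^bsub>D\<^esub> f') (Ide C c) e = PAct F f' (Ide C c) (PAct F f (Ide C c) e)"
  using act_Comp[OF assms(1,2) C.Ide_in C.Ide_in assms(4)] assms by (simp add: C.cat_simps)

lemma act_right_Comp:
  assumes "g \<in> hom C c c'" "g' \<in> hom C c' c''" "d \<in> Obj D" "e \<in> PEl F d c"
  shows "PAct F (Ide D d) (g' \<odot>\<^bsub>C\<^esub> g) e = PAct F (Ide D d) g' (PAct F (Ide D d) g e)"
  using act_Comp[OF D.Ide_in D.Ide_in assms(1,2,4)] assms by (simp add: D.cat_simps)

lemma act_left_in:
  "f \<in> hom D d' d \<Longrightarrow> c \<in> Obj C \<Longrightarrow> e \<in> PEl F d c \<Longrightarrow> PAct F f (Ide C c) e \<in> PEl F d' c"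
  using act_in C.Ide_in by blast

lemma act_right_in:
  "g \<in> hom C c c' \<Longrightarrow> d \<in> Obj D \<Longrightarrow> e \<in> PEl F d c \<Longrightarrow> PAct F (Ide D d) g e \<in> PEl F d c'"
  using act_in D.Ide_in by blast

lemma act_comm:
  assumes "f \<in> hom D d' d" "g \<in> hom C c c'" "e \<in> PEl F d c"
  shows "PAct F f (Ide C c') (PAct F (Ide D d) g e) = PAct F (Ide D d') g (PAct F f (Ide C c) e)"
  using act_split[OF assms] by simp

lemma bij_act_right:
  assumes g: "g \<in> hom C c c'" "iso_arr C g" and d: "d \<in> Obj D"
  shows "bij_betw (PAct F (Ide D d) g) (PEl F d c) (PEl F d c')"
proof -
  obtain g' where g': "g' \<in> hom C c' c" "g' \<odot>\<^bsub>C\<^esub> g = Ide C c" "g \<odot>\<^bsub>C\<^esub> g' = Ide C c'"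
    using C.iso_arrE[OF g(2,1)] by blast
  show ?thesis
  proof (rule bij_betwI[where g = "PAct F (Ide D d) g'"])
    fix e assume "e \<in> PEl F d c"
    then show "PAct F (Ide D d) g' (PAct F (Ide D d) g e) = e"
      using act_right_Comp[OF g(1) g'(1) d] g' d C.hom_Obj[OF g(1)] act_Ide by metis
  next
    fix e assume "e \<in> PEl F d c'"
    then show "PAct F (Ide D d) g (PAct F (Ide D d) g' e) = e"
      using act_right_Comp[OF g'(1) g(1) d] g' d C.hom_Obj[OF g(1)] act_Ide by metis
  qed (use act_right_in g g' d in auto)
qed

lemma bij_act_left:
  assumes f: "f \<in> hom D d' d" "iso_arr D f" and c: "c \<in> Obj C"
  shows "bij_betw (PAct F f (Ide C c)) (PEl F d c) (PEl F d' c)"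
proof -
  obtain f' where f': "f' \<in> hom D d d'" "f' \<odot>\<^bsub>D\<^esub> f = Ide D d'" "f \<odot>\<^bsub>D\<^esub> f' = Ide D d"
    using D.iso_arrE[OF f(2,1)] by blast
  show ?thesis
  proof (rule bij_betwI[where g = "PAct F f' (Ide C c)"])
    fix e assume "e \<in> PEl F d c"
    then show "PAct F f' (Ide C c) (PAct F f (Ide C c) e) = e"
      using act_left_Comp[OF f(1) f'(1) c] f' c D.hom_Obj[OF f(1)] act_Ide by metis
  next
    fix e assume "e \<in> PEl F d' c"
    then show "PAct F f (Ide C c) (PAct F f' (Ide C c) e) = e"
      using act_left_Comp[OF f'(1) f(1) c] f' c D.hom_Obj[OF f(1)] act_Ide by metis
  qed (use act_left_in f f' c in auto)
qed

end

lemma pre_prof_profunctor: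
  assumes C: "category C" and D: "category D" and F: "profunctor U C D F"
  shows "pre_prof C D F"
proof -
  interpret C: category C by fact
  interpret D: category D by fact
  show ?thesis
  proof
    fix f d' d g c c' e
    assume "f \<in> hom D d' d" "g \<in> hom C c c'" "e \<in> PEl F d c"
    then show "PAct F f g e \<in> PEl F d' c'"
      using F unfolding profunctor_def hom_def by blast
  next
    fix f d' d f' d'' g c c' g' c'' e
    assume "f \<in> hom D d' d" "f' \<in> hom D d'' d'" "g \<in> hom C c c'" "g' \<in> hom C c' c''" "e \<in> PEl F d c"
    then show "PAct F (f \<odot>\<^bsub>D\<^esub> f') (g' \<odot>\<^bsub>C\<^esub> g) e = PAct F f' g' (PAct F f g e)"
      using F unfolding profunctor_def hom_def mem_Collect_eq by metis
  qed (use F in \<open>auto simp: profunctor_def\<close>)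
qed

lemma profunctorI:
  assumes "pre_prof C D F" "\<And>d c. d \<in> Obj D \<Longrightarrow> c \<in> Obj C \<Longrightarrow> small U (PEl F d c)"
  shows "profunctor U C D F"
proof -
  interpret pre_prof C D F by fact
  show ?thesis
    unfolding profunctor_def using assms(2)
    by (auto simp: act_Ide intro!: act_in[OF D.Arr_hom C.Arr_hom]
        act_Comp[OF D.Arr_hom homI C.Arr_hom homI])
qed

section \<open>The extension of a profunctor to \<beta>\<close>

lemma PEl_bprof [simp]: "PEl (bprof F) = bset (PEl F)"
  by (simp add: bprof_def)

text \<open>Three representatives meet: that of the left arrow is evaluated at t (q i) and that of
  the element at q i. The two pushforward equations carry what holds almost everywhere on x and on y
  back to the ultrafilter of y'.\<close>

lemma bprof_act_bel_of:
  assumes q: "filtermap q (ult y') = ult y" and t: "filtermap t (ult y) = ult x"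
  shows "PAct (bprof F) (bel_of x' x p \<alpha>) (bel_of y y' q \<gamma>) (bel_of x y t \<zeta>) =
    bel_of x' y' (p \<circ> t \<circ> q) (\<lambda>w. PAct F (\<alpha> (t (q w))) (\<gamma> w) (\<zeta> (q w)))"
proof -
  have "\<forall>\<^sub>F i in ult y'. rmap (bel_of x y t \<zeta>) (q i) = t (q i) \<and> rcmp (bel_of x y t \<zeta>) (q i) = \<zeta> (q i)"
    using rep_bel_of[of x y t \<zeta>] unfolding q[symmetric] eventually_filtermap .
  moreover have "\<forall>\<^sub>F i in ult y'. rmap (bel_of x' x p \<alpha>) (t (q i)) = p (t (q i)) \<and>
      rcmp (bel_of x' x p \<alpha>) (t (q i)) = \<alpha> (t (q i))"
    using rep_bel_of[of x' x p \<alpha>] unfolding t[symmetric] q[symmetric] eventually_filtermap .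
  moreover have "\<forall>\<^sub>F i in ult y'. rmap (bel_of y y' q \<gamma>) i = q i \<and> rcmp (bel_of y y' q \<gamma>) i = \<gamma> i"
    by (rule rep_bel_of)
  ultimately have "\<forall>\<^sub>F w in ult y'.
      (rmap (bel_of x' x p \<alpha>) \<circ> rmap (bel_of x y t \<zeta>) \<circ> rmap (bel_of y y' q \<gamma>)) w = (p \<circ> t \<circ> q) w \<and>
      PAct F (rcmp (bel_of x' x p \<alpha>) (rmap (bel_of x y t \<zeta>) (rmap (bel_of y y' q \<gamma>) w)))
        (rcmp (bel_of y y' q \<gamma>) w) (rcmp (bel_of x y t \<zeta>) (rmap (bel_of y y' q \<gamma>) w)) =
      PAct F (\<alpha> (t (q w))) (\<gamma> w) (\<zeta> (q w))"
    by eventually_elim simp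
  then show ?thesis
    unfolding bprof_def by (simp add: bel_of_eq_iff)
qed

lemma pre_prof_bprof:
  assumes "pre_prof C D F"
  shows "pre_prof (bcat C) (bcat D) (bprof F)"
proof -
  interpret pre_prof C D F by fact
  interpret bC: category "bcat C" by (rule category_bcat) (rule C.category_axioms)
  interpret bD: category "bcat D" by (rule category_bcat) (rule D.category_axioms)
  show ?thesis
  proof
    fix f x' x g y y' e
    assume f: "f \<in> hom (bcat D) x' x" and g: "g \<in> hom (bcat C) y y'" and e: "e \<in> PEl (bprof F) x y"
    obtain p \<alpha> where p: "f = bel_of x' x p \<alpha>" "p \<in> idx x \<rightarrow> idx x'" "filtermap p (ult x) = ult x'"
      "\<And>i. i \<in> idx x \<Longrightarrow> \<alpha> i \<in> hom D (val x' (p i)) (val x i)"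
      using hom_bcatD(3)[OF f] by (rule bsetE) blast
    obtain q \<gamma> where q: "g = bel_of y y' q \<gamma>" "q \<in> idx y' \<rightarrow> idx y" "filtermap q (ult y') = ult y"
      "\<And>i. i \<in> idx y' \<Longrightarrow> \<gamma> i \<in> hom C (val y (q i)) (val y' i)"
      using hom_bcatD(3)[OF g] by (rule bsetE) blast
    obtain t \<zeta> where t: "e = bel_of x y t \<zeta>" "t \<in> idx y \<rightarrow> idx x" "filtermap t (ult y) = ult x"
      "\<And>z. z \<in> idx y \<Longrightarrow> \<zeta> z \<in> PEl F (val x (t z)) (val y z)"
      using e unfolding PEl_bprof by (rule bsetE) blast
    have "PAct F (\<alpha> (t (q i))) (\<gamma> i) (\<zeta> (q i)) \<in> PEl F (val x' ((p \<circ> t \<circ> q) i)) (val y' i)" if "i \<in> idx y'" for i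
      using that q(2) t(2) by (auto intro!: act_in[OF p(4) q(4) t(4)])
    moreover have "p \<circ> t \<circ> q \<in> idx y' \<rightarrow> idx x'" using p(2) q(2) t(2) by (simp add: Pi_iff)
    ultimately show "PAct (bprof F) f g e \<in> PEl (bprof F) x' y'"
      unfolding p(1) q(1) t(1) bprof_act_bel_of[OF q(3) t(3)] PEl_bprof
      by (intro bsetI filtermap_comp[OF q(3)] filtermap_comp[OF t(3)] p(3)) auto
  next
    fix x y e assume x: "x \<in> Obj (bcat D)" and y: "y \<in> Obj (bcat C)" and e: "e \<in> PEl (bprof F) x y"
    obtain t \<zeta> where t: "e = bel_of x y t \<zeta>" "t \<in> idx y \<rightarrow> idx x" "filtermap t (ult y) = ult x"
      "\<And>z. z \<in> idx y \<Longrightarrow> \<zeta> z \<in> PEl F (val x (t z)) (val y z)"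
      using e unfolding PEl_bprof by (rule bsetE) blast
    have "val x (t z) \<in> Obj D" if "z \<in> idx y" for z
      using that t(2) x by (auto intro!: bObjD(2))
    then show "PAct (bprof F) (Ide (bcat D) x) (Ide (bcat C) y) e = e"
      unfolding t(1) using t x y
      by (auto simp: bprof_act_bel_of bObjD intro!: bel_of_cong act_Ide)
  next
    fix f x' x f' x'' g y y' g' y'' e
    assume f: "f \<in> hom (bcat D) x' x" and f': "f' \<in> hom (bcat D) x'' x'"
      and g: "g \<in> hom (bcat C) y y'" and g': "g' \<in> hom (bcat C) y' y''" and e: "e \<in> PEl (bprof F) x y"
    obtain p \<alpha> where p: "f = bel_of x' x p \<alpha>" "p \<in> idx x \<rightarrow> idx x'" "filtermap p (ult x) = ult x'"
      "\<And>i. i \<in> idx x \<Longrightarrow> \<alpha> i \<in> hom D (val x' (p i)) (val x i)"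
      using hom_bcatD(3)[OF f] by (rule bsetE) blast
    obtain p' \<alpha>' where p': "f' = bel_of x'' x' p' \<alpha>'" "p' \<in> idx x' \<rightarrow> idx x''" "filtermap p' (ult x') = ult x''"
      "\<And>i. i \<in> idx x' \<Longrightarrow> \<alpha>' i \<in> hom D (val x'' (p' i)) (val x' i)"
      using hom_bcatD(3)[OF f'] by (rule bsetE) blast
    obtain q \<gamma> where q: "g = bel_of y y' q \<gamma>" "q \<in> idx y' \<rightarrow> idx y" "filtermap q (ult y') = ult y"
      "\<And>i. i \<in> idx y' \<Longrightarrow> \<gamma> i \<in> hom C (val y (q i)) (val y' i)"
      using hom_bcatD(3)[OF g] by (rule bsetE) blast
    obtain q' \<gamma>' where q': "g' = bel_of y' y'' q' \<gamma>'" "q' \<in> idx y'' \<rightarrow> idx y'" "filtermap q' (ult y'') = ult y'"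
      "\<And>i. i \<in> idx y'' \<Longrightarrow> \<gamma>' i \<in> hom C (val y' (q' i)) (val y'' i)"
      using hom_bcatD(3)[OF g'] by (rule bsetE) blast
    obtain t \<zeta> where t: "e = bel_of x y t \<zeta>" "t \<in> idx y \<rightarrow> idx x" "filtermap t (ult y) = ult x"
      "\<And>z. z \<in> idx y \<Longrightarrow> \<zeta> z \<in> PEl F (val x (t z)) (val y z)"
      using e unfolding PEl_bprof by (rule bsetE) blast
    have "PAct F (\<alpha> (t (q (q' i))) \<odot>\<^bsub>D\<^esub> \<alpha>' (p (t (q (q' i))))) (\<gamma>' i \<odot>\<^bsub>C\<^esub> \<gamma> (q' i)) (\<zeta> (q (q' i))) =
        PAct F (\<alpha>' (p (t (q (q' i))))) (\<gamma>' i) (PAct F (\<alpha> (t (q (q' i)))) (\<gamma> (q' i)) (\<zeta> (q (q' i))))"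
      if "i \<in> idx y''" for i
      using that q(2) q'(2) t(2) p(2) by (intro act_Comp[OF p(4) p'(4) q(4) q'(4) t(4)]) auto
    then show "PAct (bprof F) (f \<odot>\<^bsub>bcat D\<^esub> f') (g' \<odot>\<^bsub>bcat C\<^esub> g) e = PAct (bprof F) f' g' (PAct (bprof F) f g e)"
      unfolding p(1) p'(1) q(1) q'(1) t(1) Comp_bel_of[OF p(3)] Comp_bel_of[OF q'(3)]
        bprof_act_bel_of[OF q(3) t(3)] bprof_act_bel_of[OF filtermap_comp[OF q'(3) q(3)] t(3)]
        bprof_act_bel_of[OF q'(3) filtermap_comp[OF q(3) filtermap_comp[OF t(3) p(3)]]]
      by (intro bel_of_cong bObjD(1)[OF hom_bcatD(2)[OF g']]) auto
  qed
qed

section \<open>Coends\<close>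

locale coend = G: pre_prof D E G + F: pre_prof C D F
  for C :: "('c, 'cm) cat" and D :: "('d, 'dm) cat" and E :: "('e, 'em) cat"
    and G :: "('e, 'em, 'd, 'dm, 'x) prof" and F :: "('d, 'dm, 'c, 'cm, 'y) prof"
begin

abbreviation "cl \<equiv> coend_cls C D E G F"

lemma cl_self: "p \<in> cl e c p"
  by (simp add: coend_cls_def Let_def)

lemma cl_eq: "q \<in> cl e c p \<Longrightarrow> cl e c q = cl e c p"
proof -
  assume q: "q \<in> cl e c p"
  define R where "R = (coend_rel C D E G F e c \<union> (coend_rel C D E G F e c)\<inverse>)\<^sup>*"
  have "sym R" "trans R"
    unfolding R_def by (intro sym_rtrancl sym_Un_converse) (rule trans_rtrancl)
  moreover have "(p, q) \<in> R" using q by (simp add: coend_cls_def Let_def R_def)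
  ultimately have "R `` {q} = R `` {p}" by (auto dest: symD transD)
  then show ?thesis by (simp add: coend_cls_def Let_def R_def)
qed

text \<open>The universal property of the coend in the form needed below: operations on coends are
  defined through an arbitrary representative, and a function respecting the generating relation
  takes the same value on all of them, by induction along a chain of generators.\<close>

lemma cl_invariant:
  assumes inv: "\<And>d d' u x y. u \<in> hom D d d' \<Longrightarrow> x \<in> PEl G e d \<Longrightarrow> y \<in> PEl F d' c \<Longrightarrow>
      \<phi> (d', PAct G (Ide E e) u x, y) = \<phi> (d, x, PAct F u (Ide C c) y)"
    and "q \<in> cl e c p"
  shows "\<phi> q = \<phi> p"
proof -
  have "(p, q) \<in> (coend_rel C D E G F e c \<union> (coend_rel C D E G F e c)\<inverse>)\<^sup>*"
    using assms(2) by (simp add: coend_cls_def Let_def)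
  then show ?thesis
  proof (induction rule: rtrancl_induct)
    case (step q r)
    have "\<phi> r = \<phi> q"
      using step(2) inv[OF homI] unfolding coend_rel_def by auto
    then show ?case using step by simp
  qed simp
qed

lemma cl_rel:
  assumes "u \<in> hom D d d'" "x \<in> PEl G e d" "y \<in> PEl F d' c"
  shows "cl e c (d', PAct G (Ide E e) u x, y) = cl e c (d, x, PAct F u (Ide C c) y)"
proof -
  have "((d', PAct G (Ide E e) u x, y), (d, x, PAct F u (Ide C c) y)) \<in> coend_rel C D E G F e c"
    using assms unfolding coend_rel_def hom_def by blast
  then have "(d, x, PAct F u (Ide C c) y) \<in> cl e c (d', PAct G (Ide E e) u x, y)"
    unfolding coend_cls_def Let_def Image_singleton_iff by (rule r_into_rtrancl[OF UnI1])
  from cl_eq[OF this] show ?thesis by simp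
qed

lemma some_cl: "(SOME q. q \<in> cl e c p) \<in> cl e c p"
  by (rule someI) (rule cl_self)

lemma act_prof_comp:
  assumes u: "u \<in> hom E e' e" and v: "v \<in> hom C c c'"
    and d: "d \<in> Obj D" and x: "x \<in> PEl G e d" and y: "y \<in> PEl F d c"
  shows "PAct (prof_comp C D E G F) u v (cl e c (d, x, y)) =
    cl e' c' (d, PAct G u (Ide D d) x, PAct F (Ide D d) v y)"
proof -
  \<comment> \<open>The result of the action as a function of the representative that
    \<open>prof_comp\<close> picks. It respects the relation because left and right actions
    commute.\<close>
  define \<phi> where "\<phi> = (\<lambda>(d, x, y). cl e' c' (d, PAct G u (Ide D d) x, PAct F (Ide D d) v y))"
  have "\<phi> (SOME q. q \<in> cl e c (d, x, y)) = \<phi> (d, x, y)"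
  proof (rule cl_invariant[OF _ some_cl])
    fix d d' w x y assume w: "w \<in> hom D d d'" and x: "x \<in> PEl G e d" and y: "y \<in> PEl F d' c"
    have "\<phi> (d', PAct G (Ide E e) w x, y) = cl e' c' (d', PAct G (Ide E e') w (PAct G u (Ide D d) x), PAct F (Ide D d') v y)"
      unfolding \<phi>_def using G.act_comm[OF u w x] by simp
    also have "\<dots> = cl e' c' (d, PAct G u (Ide D d) x, PAct F w (Ide C c') (PAct F (Ide D d') v y))"
      by (rule cl_rel[OF w]) (use G.act_left_in[OF u _ x] F.act_right_in[OF v _ y] G.C.hom_Obj[OF w] in auto)
    also have "\<dots> = \<phi> (d, x, PAct F w (Ide C c) y)"
      unfolding \<phi>_def using F.act_comm[OF w v y] by simp
    finally show "\<phi> (d', PAct G (Ide E e) w x, y) = \<phi> (d, x, PAct F w (Ide C c) y)" .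
  qed
  moreover have "PAct (prof_comp C D E G F) u v (cl e c (d, x, y)) = \<phi> (SOME q. q \<in> cl e c (d, x, y))"
    using homD[OF u] homD[OF v] by (simp add: prof_comp_def \<phi>_def)
  ultimately show ?thesis by (simp add: \<phi>_def)
qed

lemma PEl_prof_comp: "PEl (prof_comp C D E G F) e c = cl e c ` (SIGMA d : Obj D. PEl G e d \<times> PEl F d c)"
  by (simp add: prof_comp_def)

end

section \<open>Whiskering, unit and multiplication of the ultracompletion\<close>

text \<open>Pointwise inverses, chosen for all indices at once, form a morphism back because the
  reindexing map is the identity.\<close>

lemma iso_bel_of:
  assumes "category D" and x: "x \<in> bObj D" and y: "y \<in> bObj D"
    and xy: "idx x = idx y" "ult x = ult y"
    and \<zeta>: "\<And>z. z \<in> idx y \<Longrightarrow> \<zeta> z \<in> hom D (val x z) (val y z)" "\<And>z. z \<in> idx y \<Longrightarrow> iso_arr D (\<zeta> z)"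
  shows "iso_arr (bcat D) (bel_of x y id \<zeta>)"
proof -
  interpret D: category D by fact
  interpret bD: category "bcat D" by (rule category_bcat) fact
  have "\<forall>z. \<exists>g. z \<in> idx y \<longrightarrow> g \<in> hom D (val y z) (val x z) \<and> g \<odot>\<^bsub>D\<^esub> \<zeta> z = Ide D (val x z) \<and> \<zeta> z \<odot>\<^bsub>D\<^esub> g = Ide D (val y z)"
    using D.iso_arrE[OF \<zeta>(2,1)] by metis
  then obtain \<xi> where \<xi>: "\<And>z. z \<in> idx y \<Longrightarrow> \<xi> z \<in> hom D (val y z) (val x z)"
    "\<And>z. z \<in> idx y \<Longrightarrow> \<xi> z \<odot>\<^bsub>D\<^esub> \<zeta> z = Ide D (val x z)" "\<And>z. z \<in> idx y \<Longrightarrow> \<zeta> z \<odot>\<^bsub>D\<^esub> \<xi> z = Ide D (val y z)"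
    by metis
  show ?thesis
  proof (rule bD.iso_arrI)
    show "bel_of x y id \<zeta> \<in> hom (bcat D) x y" "bel_of y x id \<xi> \<in> hom (bcat D) y x"
      using xy \<zeta> \<xi> by (auto simp: hom_bcat x y intro!: bsetI)
    show "bel_of y x id \<xi> \<odot>\<^bsub>bcat D\<^esub> bel_of x y id \<zeta> = Ide (bcat D) x"
      "bel_of x y id \<zeta> \<odot>\<^bsub>bcat D\<^esub> bel_of y x id \<xi> = Ide (bcat D) y"
      using xy \<xi> bObjD(1)[OF y] by (auto simp: Comp_bel_of intro!: bel_of_cong)
  qed
qed

lemma bnt_hom:
  assumes "is_functor C D F" "is_functor C D G" "x \<in> bObj C"
    and "\<And>a. a \<in> Obj C \<Longrightarrow> \<sigma> a \<in> hom D (fobj F a) (fobj G a)"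
  shows "bnt F G \<sigma> x \<in> hom (bcat D) (bmap (fobj F) x) (bmap (fobj G) x)"
  using bnt_in[OF assms(3,4)] assms is_functor_obj_bObj by (metis hom_bcat)

lemma iso_bnt:
  assumes "category D" "is_functor C D F" "is_functor C D G" "x \<in> bObj C"
    and "\<And>a. a \<in> Obj C \<Longrightarrow> \<sigma> a \<in> hom D (fobj F a) (fobj G a)" "\<And>a. a \<in> Obj C \<Longrightarrow> iso_arr D (\<sigma> a)"
  shows "iso_arr (bcat D) (bnt F G \<sigma> x)"
  unfolding bnt_def
  by (rule iso_bel_of[OF assms(1)]) (use assms is_functor_obj_bObj in \<open>auto simp: bObjD\<close>)

lemma bnt_Ide:
  assumes "x \<in> bObj C" "\<And>a. a \<in> Obj C \<Longrightarrow> \<sigma> a = Ide D (fobj F a)"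
  shows "bnt F F \<sigma> x = Ide (bcat D) (bmap (fobj F) x)"
  using assms by (auto simp: bnt_def bObjD intro!: bel_of_cong)

lemma bnt_Comp:
  assumes "x \<in> bObj C" "\<And>a. a \<in> Obj C \<Longrightarrow> \<rho> a = \<tau> a \<odot>\<^bsub>D\<^esub> \<sigma> a"
  shows "bnt G H \<tau> x \<odot>\<^bsub>bcat D\<^esub> bnt F G \<sigma> x = bnt F H \<rho> x"
  using assms by (auto simp: bnt_def Comp_bel_of bObjD intro!: bel_of_cong)

lemma bnt_hcomp:
  assumes "x \<in> bObj C" "is_functor C D F" "is_functor C D F'"
    and "\<And>a. a \<in> Obj C \<Longrightarrow> \<rho> a = \<tau> (fobj F' a) \<odot>\<^bsub>E\<^esub> farr G (\<sigma> a)"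
  shows "bnt G G' \<tau> (bmap (fobj F') x) \<odot>\<^bsub>bcat E\<^esub> farr (bfun G) (bnt F F' \<sigma> x) =
    bnt (fcomp C G F) (fcomp C G' F') \<rho> x"
  using assms unfolding bnt_def bfun_bel_of bmap_fcomp[OF assms(1)]
  by (subst Comp_bel_of) (auto simp: bObjD intro!: bel_of_cong)

lemma small_image: "small U A \<Longrightarrow> small U (f ` A)"
  unfolding small_def by (rule lesspoll_trans1[OF image_lepoll])

lemma small_finite: "finite A \<Longrightarrow> small TYPE('u :: universe) A"
  unfolding small_def by (rule finite_lesspoll_infinite[OF universe_infinite])

section \<open>The unit of the ultracompletion\<close>

lemma single_simps [simp]:
  "idx (single a) = {pt}" "val (single a) pt = a" "ult (single a) = principal {pt}"
  by (simp_all add: single_def)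

lemma ultrafilter_principal: "ultrafilter (principal {z})"
  by (simp add: ultrafilter_def eventually_principal principal_eq_bot_iff)

lemma single_in: "a \<in> Obj C \<Longrightarrow> (single a :: ('u :: universe, 'o) bobj) \<in> bObj C"
  by (rule bObjI) (auto simp: ultrafilter_principal eventually_principal small_finite single_def)

lemma bel_of_single_eq_iff:
  "bel_of x (single c) t \<zeta> = bel_of x' (single c) t' \<zeta>' \<longleftrightarrow> x = x' \<and> t pt = t' pt \<and> \<zeta> pt = \<zeta>' pt"
  by (simp add: bel_of_eq_iff eventually_principal)

lemma bsingle_in: "r \<in> E d c \<Longrightarrow> bsingle d c r \<in> bset E (single d) (single c)"
  unfolding bsingle_def by (rule bsetI) auto

lemma bmap_single: "bmap f (single a) = single (f a)"
  by (rule bobj_eqI) (auto simp: single_def bmap_def)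

lemma bunit_simps [simp]: "fobj (bunit C) = single" "farr (bunit C) f = bsingle (Dom C f) (Cod C f) f"
  by (simp_all add: bunit_def)

lemma bsingle_Ide: "bsingle a a (Ide C a) = Ide (bcat C) (single a)"
  by (simp add: bsingle_def bel_of_single_eq_iff)

section \<open>The multiplication of the ultracompletion: sums of ultrafilters\<close>

lemma bmu_obj_simps:
  "idx (bmu_obj Y) = enc ` (SIGMA x : idx Y. idx (val Y x))"
  "x \<in> idx Y \<Longrightarrow> z \<in> idx (val Y x) \<Longrightarrow>
    val (bmu_obj Y :: ('u :: universe, 'o) bobj) (enc (x, z)) = val (val Y x) z"
  "ult (bmu_obj Y) = sum_filter (ult Y) (\<lambda>x. ult (val Y x))"
  by (auto simp: bmu_obj_def Let_def restrict_apply)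

lemma sum_filter_cong:
  assumes "\<forall>\<^sub>F x in \<nu>. f x = g x"
  shows "sum_filter \<nu> f = sum_filter \<nu> g"
  unfolding filter_eq_iff eventually_sum_filter
  by (intro allI eventually_subst) (use assms in \<open>auto elim: eventually_mono\<close>)

text \<open>The inner ultrafilters decide P on their fibres, and the outer one decides which of the
  two answers prevails among the fibres.\<close>

lemma ultrafilter_sum_filter:
  assumes "ultrafilter \<nu>" "\<forall>\<^sub>F x in \<nu>. ultrafilter (f x)"
  shows "ultrafilter (sum_filter \<nu> f)"
  unfolding ultrafilter_def
proof (intro conjI allI)
  have "\<not> (\<forall>\<^sub>F x in \<nu>. \<forall>\<^sub>F z in f x. False)"
  proof
    assume "\<forall>\<^sub>F x in \<nu>. \<forall>\<^sub>F z in f x. False"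
    then have "\<forall>\<^sub>F x in \<nu>. False"
      using assms(2) by eventually_elim (auto simp: ultrafilter_def trivial_limit_def)
    then show False using assms(1) by (simp add: ultrafilter_def trivial_limit_def)
  qed
  then show "sum_filter \<nu> f \<noteq> bot"
    by (simp add: trivial_limit_def eventually_sum_filter)
  fix P
  show "eventually P (sum_filter \<nu> f) \<or> (\<forall>\<^sub>F v in sum_filter \<nu> f. \<not> P v)"
  proof (cases "\<forall>\<^sub>F x in \<nu>. \<forall>\<^sub>F z in f x. P (enc (x, z))")
    case False
    then have "\<forall>\<^sub>F x in \<nu>. \<not> (\<forall>\<^sub>F z in f x. P (enc (x, z)))"
      using assms(1) by (auto simp: ultrafilter_def)
    then have "\<forall>\<^sub>F x in \<nu>. \<forall>\<^sub>F z in f x. \<not> P (enc (x, z))"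
      using assms(2) by eventually_elim (auto simp: ultrafilter_def)
    then show ?thesis by (simp add: eventually_sum_filter)
  qed (simp add: eventually_sum_filter)
qed

lemma bmu_obj_in:
  fixes Y :: "('u :: universe, ('u, 'o) bobj) bobj"
  assumes Y: "Y \<in> bObj (bcat C)"
  shows "bmu_obj Y \<in> bObj C"
proof (rule bObjI)
  have y: "val Y x \<in> bObj C" if "x \<in> idx Y" for x
    using bObjD(2)[OF Y that] by simp
  show "val (bmu_obj Y) z \<in> Obj C" if "z \<in> idx (bmu_obj Y)" for z
    using that bObjD(2)[OF y] by (auto simp: bmu_obj_simps)
  have "\<forall>\<^sub>F x in ult Y. \<forall>\<^sub>F z in ult (val Y x). enc (x, z) \<in> idx (bmu_obj Y)"
    using bObjD(1)[OF Y]
  proof eventually_elim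
    case (elim x)
    show ?case using bObjD(1)[OF y[OF elim]] by eventually_elim (use elim in \<open>auto simp: bmu_obj_simps\<close>)
  qed
  then show "\<forall>\<^sub>F v in ult (bmu_obj Y). v \<in> idx (bmu_obj Y)"
    by (simp add: bmu_obj_simps(3) eventually_sum_filter)
  show "ultrafilter (ult (bmu_obj Y))" unfolding bmu_obj_simps(3)
    by (rule ultrafilter_sum_filter[OF bObjD(3)[OF Y]])
      (use bObjD(1)[OF Y] in \<open>eventually_elim, simp add: bObjD(3)[OF y]\<close>)
  have "idx (bmu_obj Y) = (\<Union>x\<in>idx Y. (\<lambda>z. enc (x, z)) ` idx (val Y x))"
    by (auto simp: bmu_obj_simps)
  \<comment> \<open>Regularity of the universe: a small union of small sets is small. The pairing
    has moved all fibres into one type.\<close>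
  moreover have "(\<Union>x\<in>idx Y. (\<lambda>z. enc (x, z)) ` idx (val Y x)) \<prec> (UNIV :: 'u set)"
    using bObjD(4)[OF Y] small_image[OF bObjD(4)[OF y]] unfolding small_def by (intro universe_UN)
  ultimately show "small TYPE('u) (idx (bmu_obj Y))" by (simp add: small_def)
  show "val (bmu_obj Y) \<in> extensional (idx (bmu_obj Y))"
    by (simp add: bmu_obj_def Let_def)
qed

lemma val_bmu_obj_ext: "val (bmu_obj Y) \<in> extensional (idx (bmu_obj Y))"
  by (simp add: bmu_obj_def Let_def)

text \<open>\<beta>f changes neither index sets nor ultrafilters, so \<mu> is natural on objects up
  to equality, and no comparison isomorphism enters the later diagrams.\<close>

lemma bmap_bmu_obj:
  fixes Y :: "('u :: universe, ('u, 'o) bobj) bobj"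
  assumes Y: "Y \<in> bObj (bcat C)"
  shows "bmap f (bmu_obj Y) = bmu_obj (bmap (bmap f) Y)"
proof (rule bobj_eqI)
  show "idx (bmap f (bmu_obj Y)) = idx (bmu_obj (bmap (bmap f) Y))"
    by (auto simp: bmu_obj_simps)
  show "val (bmap f (bmu_obj Y)) z = val (bmu_obj (bmap (bmap f) Y)) z"
    if "z \<in> idx (bmu_obj (bmap (bmap f) Y))" for z
    using that by (auto simp: bmu_obj_simps)
  show "ult (bmap f (bmu_obj Y)) = ult (bmu_obj (bmap (bmap f) Y))"
    using bObjD(1)[OF Y] by (auto simp: bmu_obj_simps elim: eventually_mono intro!: sum_filter_cong)
  show "val (bmap f (bmu_obj Y)) \<in> extensional (idx (bmap f (bmu_obj Y)))"
    using val_bmap_ext[of f "bmu_obj Y"] by simp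
qed (rule val_bmu_obj_ext)

text \<open>Representatives are chosen on both levels, the inner ones for all indices y at once, so
  that the resulting double family can be substituted into \<open>bmu_el\<close>.\<close>

lemma bset2E:
  assumes "T \<in> bset (bset E) X Y" "\<forall>\<^sub>F y in ult Y. y \<in> idx Y"
  obtains p q \<gamma> where "T = bel_of X Y p (\<lambda>y. bel_of (val X (p y)) (val Y y) (q y) (\<gamma> y))"
    "p \<in> idx Y \<rightarrow> idx X" "filtermap p (ult Y) = ult X"
    "\<And>y. y \<in> idx Y \<Longrightarrow> q y \<in> idx (val Y y) \<rightarrow> idx (val X (p y))"
    "\<And>y. y \<in> idx Y \<Longrightarrow> filtermap (q y) (ult (val Y y)) = ult (val X (p y))"
    "\<And>y w. y \<in> idx Y \<Longrightarrow> w \<in> idx (val Y y) \<Longrightarrow> \<gamma> y w \<in> E (val (val X (p y)) (q y w)) (val (val Y y) w)"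
proof -
  obtain p \<zeta> where p: "T = bel_of X Y p \<zeta>" "p \<in> idx Y \<rightarrow> idx X" "filtermap p (ult Y) = ult X"
    "\<And>y. y \<in> idx Y \<Longrightarrow> \<zeta> y \<in> bset E (val X (p y)) (val Y y)"
    using assms(1) by (rule bsetE) blast
  define Q where "Q y q \<gamma> \<longleftrightarrow> \<zeta> y = bel_of (val X (p y)) (val Y y) q \<gamma> \<and>
     q \<in> idx (val Y y) \<rightarrow> idx (val X (p y)) \<and> filtermap q (ult (val Y y)) = ult (val X (p y)) \<and>
     (\<forall>w \<in> idx (val Y y). \<gamma> w \<in> E (val (val X (p y)) (q w)) (val (val Y y) w))" for y q \<gamma>
  have "\<forall>y. \<exists>q \<gamma>. y \<in> idx Y \<longrightarrow> Q y q \<gamma>"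
  proof (intro allI)
    fix y
    show "\<exists>q \<gamma>. y \<in> idx Y \<longrightarrow> Q y q \<gamma>"
    proof (cases "y \<in> idx Y")
      case True
      from p(4)[OF True] show ?thesis by (rule bsetE) (auto simp: Q_def)
    qed simp
  qed
  then obtain q \<gamma> where Q: "\<And>y. y \<in> idx Y \<Longrightarrow> Q y (q y) (\<gamma> y)" by metis
  have "T = bel_of X Y p (\<lambda>y. bel_of (val X (p y)) (val Y y) (q y) (\<gamma> y))"
    unfolding p(1) using Q by (intro bel_of_cong assms(2)) (auto simp: Q_def)
  then show thesis using p(2,3) Q by (intro that[of p q \<gamma>]) (auto simp: Q_def)
qed

text \<open>Agreement of the outer representatives for almost all y, and of the inner ones for
  almost all w over each such y, is by definition agreement almost everywhere for the sum
  ultrafilter.\<close>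

lemma bmu_el_bel_of:
  fixes X :: "('u :: universe, ('u, 'd) bobj) bobj" and Y :: "('u, ('u, 'c) bobj) bobj"
  shows "bmu_el (bel_of X Y p (\<lambda>y. bel_of (x y) (val Y y) (q y) (\<gamma> y))) =
    bel_of (bmu_obj X) (bmu_obj Y) (\<lambda>v. case dec v of (y, w) \<Rightarrow> enc (p y, q y w))
      (\<lambda>v. case dec v of (y, w) \<Rightarrow> \<gamma> y w)"
proof -
  let ?T = "bel_of X Y p (\<lambda>y. bel_of (x y) (val Y y) (q y) (\<gamma> y))"
  have "\<forall>\<^sub>F y in ult Y. \<forall>\<^sub>F w in ult (val Y y).
      enc (rmap ?T y, rmap (rcmp ?T y) w) = enc (p y, q y w) \<and> rcmp (rcmp ?T y) w = \<gamma> y w"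
    using rep_bel_of[of X Y p "\<lambda>y. bel_of (x y) (val Y y) (q y) (\<gamma> y)"]
  proof eventually_elim
    case (elim y)
    show ?case unfolding elim[THEN conjunct1] elim[THEN conjunct2]
      using rep_bel_of[of "x y" "val Y y" "q y" "\<gamma> y"] by eventually_elim simp
  qed
  then show ?thesis
    by (simp add: bmu_el_def bel_of_eq_iff bmu_obj_simps(3) eventually_sum_filter)
qed

text \<open>Change of variables in almost every fibre along q y, and in the base along p.\<close>

lemma filtermap_sum_filter:
  fixes p :: "'u :: universe \<Rightarrow> 'u"
  assumes p: "filtermap p \<nu> = \<xi>" and q: "\<forall>\<^sub>F y in \<nu>. filtermap (q y) (f y) = g (p y)"
  shows "filtermap (\<lambda>v. case dec v of (y, w) \<Rightarrow> enc (p y, q y w)) (sum_filter \<nu> f) = sum_filter \<xi> g"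
  unfolding filter_eq_iff eventually_filtermap eventually_sum_filter p[symmetric]
proof (intro allI eventually_subst)
  fix P :: "'u \<Rightarrow> bool"
  show "\<forall>\<^sub>F x in \<nu>. (\<forall>\<^sub>F z in f x. P (case dec (enc (x, z)) of (y, w) \<Rightarrow> enc (p y, q y w))) =
      (\<forall>\<^sub>F z in g (p x). P (enc (p x, z)))"
    using q
  proof eventually_elim
    case (elim x)
    show ?case unfolding elim[symmetric] by (simp add: eventually_filtermap)
  qed
qed

lemma bmu_el_in:
  fixes T :: "('u :: universe, ('u, 'd) bobj, ('u, 'c) bobj, ('u, 'd, 'c, 'e) bel) bel"
  assumes T: "T \<in> bset (bset E) X Y" and Y: "Y \<in> bObj (bcat C)"
  shows "bmu_el T \<in> bset E (bmu_obj X) (bmu_obj Y)"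
  using T bObjD(1)[OF Y]
proof (rule bset2E)
  fix p q \<gamma>
  assume T: "T = bel_of X Y p (\<lambda>y. bel_of (val X (p y)) (val Y y) (q y) (\<gamma> y))"
    and p: "p \<in> idx Y \<rightarrow> idx X" "filtermap p (ult Y) = ult X"
    and q: "\<And>y. y \<in> idx Y \<Longrightarrow> q y \<in> idx (val Y y) \<rightarrow> idx (val X (p y))"
      "\<And>y. y \<in> idx Y \<Longrightarrow> filtermap (q y) (ult (val Y y)) = ult (val X (p y))"
    and \<gamma>: "\<And>y w. y \<in> idx Y \<Longrightarrow> w \<in> idx (val Y y) \<Longrightarrow> \<gamma> y w \<in> E (val (val X (p y)) (q y w)) (val (val Y y) w)"
  show ?thesis unfolding T bmu_el_bel_of
  proof (rule bsetI)
    show "(\<lambda>v. case dec v of (y, w) \<Rightarrow> enc (p y, q y w)) \<in> idx (bmu_obj Y) \<rightarrow> idx (bmu_obj X)"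
      using funcset_mem[OF p(1)] funcset_mem[OF q(1)] by (auto simp: bmu_obj_simps)
    show "filtermap (\<lambda>v. case dec v of (y, w) \<Rightarrow> enc (p y, q y w)) (ult (bmu_obj Y)) = ult (bmu_obj X)"
      unfolding bmu_obj_simps(3)
      by (rule filtermap_sum_filter[OF p(2)]) (use bObjD(1)[OF Y] q(2) in \<open>auto elim: eventually_mono\<close>)
    show "(case dec v of (y, w) \<Rightarrow> \<gamma> y w) \<in>
        E (val (bmu_obj X) (case dec v of (y, w) \<Rightarrow> enc (p y, q y w))) (val (bmu_obj Y) v)"
      if v': "v \<in> idx (bmu_obj Y)" for v
    proof -
      obtain y w where v: "v = enc (y, w)" "y \<in> idx Y" "w \<in> idx (val Y y)"
        using v' by (auto simp: bmu_obj_simps)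
      then have "p y \<in> idx X" "q y w \<in> idx (val X (p y))" using p(1) q(1) by auto
      then show ?thesis using v \<gamma> by (simp add: bmu_obj_simps)
    qed
  qed
qed

lemma bmu_simps [simp]: "fobj bmu = bmu_obj" "farr bmu = bmu_el"
  by (simp_all add: bmu_def)

section \<open>The canonical comparison morphisms of \<beta>\<close>

lemma lunit_in:
  fixes x :: "('u :: universe, 'o) bobj"
  assumes "category C" "x \<in> bObj C"
  shows "lunit C x \<in> hom (bcat C) (bmu_obj (single x)) x"
proof -
  interpret category C by fact
  have x: "(single x :: ('u, ('u, 'o) bobj) bobj) \<in> bObj (bcat C)" using assms(2) by (auto intro: single_in)
  have "filtermap (\<lambda>z. enc (pt, z)) (ult x) = ult (bmu_obj (single x))"
    unfolding filter_eq_iff by (simp add: eventually_filtermap bmu_obj_simps(3) eventually_sum_filter eventually_principal)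
  then show ?thesis
    unfolding hom_bcat[OF bmu_obj_in[OF x] assms(2)] lunit_def
    by (intro bsetI) (auto simp: bmu_obj_simps Ide_in bObjD[OF assms(2)])
qed

lemma runit_in:
  fixes x :: "('u :: universe, 'o) bobj"
  assumes "category C" "x \<in> bObj C"
  shows "runit C x \<in> hom (bcat C) (bmu_obj (bmap single x)) x"
proof -
  interpret category C by fact
  have x: "(bmap single x :: ('u, ('u, 'o) bobj) bobj) \<in> bObj (bcat C)" by (rule bmap_in[OF assms(2)]) (simp add: single_in)
  have "ult (bmu_obj (bmap single x)) = sum_filter (ult x) (\<lambda>z. principal {pt})"
    unfolding bmu_obj_simps(3) bmap_simps
    using bObjD(1)[OF assms(2)] by (intro sum_filter_cong) (auto elim!: eventually_mono)
  then have "filtermap (\<lambda>z. enc (z, pt)) (ult x) = ult (bmu_obj (bmap single x))"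
    unfolding filter_eq_iff by (simp add: eventually_filtermap eventually_sum_filter eventually_principal)
  then show ?thesis
    unfolding hom_bcat[OF bmu_obj_in[OF x] assms(2)] runit_def
    by (intro bsetI) (auto simp: bmu_obj_simps Ide_in bObjD[OF assms(2)])
qed

lemma bassoc_in:
  fixes Z :: "('u :: universe, ('u, ('u, 'o) bobj) bobj) bobj"
  assumes "category C" "Z \<in> bObj (bcat (bcat C))"
  shows "bassoc C Z \<in> hom (bcat C) (bmu_obj (bmu_obj Z)) (bmu_obj (bmap bmu_obj Z))"
proof -
  interpret category C by fact
  have 1: "bmu_obj (bmu_obj Z) \<in> bObj C" by (intro bmu_obj_in assms)
  have "bmap bmu_obj Z \<in> bObj (bcat C)" by (rule bmap_in[OF assms(2)]) (simp add: bmu_obj_in)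
  then have 2: "bmu_obj (bmap bmu_obj Z) \<in> bObj C" by (rule bmu_obj_in)
  \<comment> \<open>This map only rebrackets a coded triple: both iterated sums of ultrafilters
    unfold to the same three nested quantifiers.\<close>
  let ?t = "\<lambda>v. case dec v of (x, w) \<Rightarrow> case dec w of (y, z) \<Rightarrow> enc (enc (x, y), z)"
  have "(\<forall>\<^sub>F v in ult (bmu_obj (bmap bmu_obj Z)). P (?t v)) = (\<forall>\<^sub>F v in ult (bmu_obj (bmu_obj Z)). P v)" for P
    unfolding bmu_obj_simps(3) eventually_sum_filter bmap_simps
  proof (rule eventually_subst, use bObjD(1)[OF assms(2)] in eventually_elim)
    case (elim x)
    then have v: "val (bmap bmu_obj Z) x = bmu_obj (val Z x)" by simp
    have "val Z x \<in> bObj (bcat C)" using bObjD(2)[OF assms(2) elim] by simp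
    from bObjD(1)[OF this] show ?case
      unfolding v bmu_obj_simps(3) eventually_sum_filter
    proof (intro eventually_subst, eventually_elim)
      case (elim y)
      then show ?case using \<open>x \<in> idx Z\<close> by (simp add: bmu_obj_simps)
    qed
  qed
  then have f: "filtermap ?t (ult (bmu_obj (bmap bmu_obj Z))) = ult (bmu_obj (bmu_obj Z))"
    unfolding filter_eq_iff by (simp add: eventually_filtermap)
  show ?thesis unfolding hom_bcat[OF 1 2] bassoc_def
  proof (rule bsetI[OF _ f])
    show "?t \<in> idx (bmu_obj (bmap bmu_obj Z)) \<rightarrow> idx (bmu_obj (bmu_obj Z))"
      by (force simp: bmu_obj_simps)
    show "Ide C (val (bmu_obj (bmap bmu_obj Z)) v) \<in>
        hom C (val (bmu_obj (bmu_obj Z)) (?t v)) (val (bmu_obj (bmap bmu_obj Z)) v)"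
      if v: "v \<in> idx (bmu_obj (bmap bmu_obj Z))" for v
    proof -
      have "val (bmu_obj (bmu_obj Z)) (?t v) = val (bmu_obj (bmap bmu_obj Z)) v"
        using v by (auto simp: bmu_obj_simps)
      then show ?thesis using Ide_in bObjD(2)[OF 2 v] by simp
    qed
  qed
qed

section \<open>Representable profunctors\<close>

lemma rep_prof_simps [simp]:
  "PEl (rep_prof D f) d c = hom D d (fobj f c)"
  "PAct (rep_prof D f) u v h = farr f v \<odot>\<^bsub>D\<^esub> h \<odot>\<^bsub>D\<^esub> u"
  by (simp_all add: rep_prof_def)

lemma pre_prof_rep_prof:
  assumes "category C" "category D" "is_functor C D f"
  shows "pre_prof C D (rep_prof D f)"
proof -
  interpret C: category C by fact
  interpret D: category D by fact
  interpret f: is_functor C D f by fact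
  show ?thesis
  proof
    fix u d' d v c c' e assume u: "u \<in> hom D d' d" and v: "v \<in> hom C c c'" and e: "e \<in> PEl (rep_prof D f) d c"
    then show "PAct (rep_prof D f) u v e \<in> PEl (rep_prof D f) d' c'"
      using D.Comp_in[OF f.farr_in[OF v] D.Comp_in[OF _ u]] by simp
  next
    fix d c e assume "d \<in> Obj D" "c \<in> Obj C" "e \<in> PEl (rep_prof D f) d c"
    then show "PAct (rep_prof D f) (Ide D d) (Ide C c) e = e"
      using homD[of e D] by (simp add: f.farr_Ide D.cat_simps)
  next
    fix u d' d u' d'' v c c' v' c'' e
    assume u: "u \<in> hom D d' d" "u' \<in> hom D d'' d'" and v: "v \<in> hom C c c'" "v' \<in> hom C c' c''"
      and e: "e \<in> PEl (rep_prof D f) d c"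
    then have e': "e \<in> hom D d (fobj f c)" by simp
    show "PAct (rep_prof D f) (u \<odot>\<^bsub>D\<^esub> u') (v' \<odot>\<^bsub>C\<^esub> v) e = PAct (rep_prof D f) u' v' (PAct (rep_prof D f) u v e)"
      using homD[OF u(1)] homD[OF u(2)] homD[OF v(1)] homD[OF v(2)] homD[OF e']
      by (simp add: f.functor_simps D.cat_simps)
  qed
qed

text \<open>With \<open>retgt_bset\<close>, this is the isomorphism between the extension of
  \<open>f\<^sub>\<diamond>\<close> and \<open>(\<beta>f)\<^sub>\<diamond>\<close>: a tuple of
  arrows into the objects f(Y z) is a morphism into \<beta>f(Y), and only the recorded target
  changes.\<close>

lemma retgt_hom:
  assumes f: "is_functor C D f" and x: "x \<in> bObj D" and Y: "Y \<in> bObj C"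
    and s: "s \<in> bset (PEl (rep_prof D f)) x Y"
  shows "retgt (bmap (fobj f) Y) s \<in> hom (bcat D) x (bmap (fobj f) Y)"
  using s
proof (rule bsetE)
  fix t \<zeta> assume *: "s = bel_of x Y t \<zeta>" "t \<in> idx Y \<rightarrow> idx x" "filtermap t (ult Y) = ult x"
    "\<And>z. z \<in> idx Y \<Longrightarrow> \<zeta> z \<in> PEl (rep_prof D f) (val x (t z)) (val Y z)"
  then show ?thesis
    unfolding hom_bcat[OF x is_functor_obj_bObj[OF f Y]] *(1) retgt_bel_of[of "bmap (fobj f) Y" Y, simplified]
    by (intro bsetI) auto
qed

lemma retgt_bset:
  assumes Y: "Y \<in> bObj C" and s: "s \<in> hom (bcat D) x (bmap (fobj f) Y)"
  shows "retgt Y s \<in> bset (PEl (rep_prof D f)) x Y" "retgt (bmap (fobj f) Y) (retgt Y s) = s"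
proof -
  obtain t \<zeta> where *: "s = bel_of x (bmap (fobj f) Y) t \<zeta>" "t \<in> idx Y \<rightarrow> idx x" "filtermap t (ult Y) = ult x"
    "\<And>z. z \<in> idx Y \<Longrightarrow> \<zeta> z \<in> hom D (val x (t z)) (val (bmap (fobj f) Y) z)"
    using hom_bcatD(3)[OF s] by (rule bsetE) auto
  show "retgt Y s \<in> bset (PEl (rep_prof D f)) x Y"
    unfolding *(1) using * by (auto simp: retgt_bel_of intro!: bsetI)
  show "retgt (bmap (fobj f) Y) (retgt Y s) = s"
    unfolding *(1) by (simp add: retgt_bel_of)
qed

text \<open>Naturality of that isomorphism in both variables; it turns the actions on the extension
  into composition in \<beta>D.\<close>

lemma retgt_act:
  assumes f: "is_functor C D f" and s: "s \<in> bset (PEl (rep_prof D f)) x Y"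
    and u: "u \<in> hom (bcat D) x' x" and v: "v \<in> hom (bcat C) Y Y'"
  shows "retgt (bmap (fobj f) Y') (PAct (bprof (rep_prof D f)) u v s) =
    farr (bfun f) v \<odot>\<^bsub>bcat D\<^esub> retgt (bmap (fobj f) Y) s \<odot>\<^bsub>bcat D\<^esub> u"
proof -
  obtain t \<zeta> where t: "s = bel_of x Y t \<zeta>" "filtermap t (ult Y) = ult x"
    using s by (rule bsetE) blast
  obtain p \<alpha> where p: "u = bel_of x' x p \<alpha>" using hom_bcatD(3)[OF u] by (rule bsetE) blast
  obtain q \<gamma> where q: "v = bel_of Y Y' q \<gamma>" "filtermap q (ult Y') = ult Y"
    using hom_bcatD(3)[OF v] by (rule bsetE) blast
  show ?thesis
    unfolding t(1) p(1) q(1) bprof_act_bel_of[OF q(2) t(2)] bfun_bel_of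
    using q(2) t(2) by (simp add: retgt_bel_of Comp_bel_of comp_assoc)
qed

lemma prof_natD:
  assumes "prof_nat C D F G \<alpha>"
  shows "d \<in> Obj D \<Longrightarrow> c \<in> Obj C \<Longrightarrow> e \<in> PEl F d c \<Longrightarrow> \<alpha> d c e \<in> PEl G d c"
    and "f \<in> hom D d' d \<Longrightarrow> g \<in> hom C c c' \<Longrightarrow> e \<in> PEl F d c \<Longrightarrow> \<alpha> d' c' (PAct F f g e) = PAct G f g (\<alpha> d c e)"
    and "\<alpha> \<in> (\<Pi>\<^sub>E d \<in> Obj D. \<Pi>\<^sub>E c \<in> Obj C. PEl F d c \<rightarrow>\<^sub>E PEl G d c)"
proof -
  show *: "\<alpha> \<in> (\<Pi>\<^sub>E d \<in> Obj D. \<Pi>\<^sub>E c \<in> Obj C. PEl F d c \<rightarrow>\<^sub>E PEl G d c)"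
    using assms by (simp add: prof_nat_def)
  show "d \<in> Obj D \<Longrightarrow> c \<in> Obj C \<Longrightarrow> e \<in> PEl F d c \<Longrightarrow> \<alpha> d c e \<in> PEl G d c"
    using * by (meson PiE_mem)
  show "f \<in> hom D d' d \<Longrightarrow> g \<in> hom C c c' \<Longrightarrow> e \<in> PEl F d c \<Longrightarrow> \<alpha> d' c' (PAct F f g e) = PAct G f g (\<alpha> d c e)"
    using assms by (auto simp: prof_nat_def hom_def)
qed

lemma prof_natI:
  assumes "\<alpha> \<in> (\<Pi>\<^sub>E d \<in> Obj D. \<Pi>\<^sub>E c \<in> Obj C. PEl F d c \<rightarrow>\<^sub>E PEl G d c)"
    and "\<And>f g d' d c c' e. f \<in> hom D d' d \<Longrightarrow> g \<in> hom C c c' \<Longrightarrow> e \<in> PEl F d c \<Longrightarrow>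
      \<alpha> d' c' (PAct F f g e) = PAct G f g (\<alpha> d c e)"
  shows "prof_nat C D F G \<alpha>"
  using assms by (auto simp: prof_nat_def hom_def)

lemma pull_prof_simps [simp]:
  "PEl (pull_prof G h k) d c = PEl G (fobj h d) (fobj k c)"
  "PAct (pull_prof G h k) u v = PAct G (farr h u) (farr k v)"
  by (simp_all add: pull_prof_def)

lemma hom_prof_simps [simp]:
  "PEl (hom_prof C) = hom C" "PAct (hom_prof C) f g h = g \<odot>\<^bsub>C\<^esub> h \<odot>\<^bsub>C\<^esub> f"
  by (simp_all add: hom_prof_def)

lemma yoneda_simps [simp]: "PS (yoneda D c) d = hom D d c" "PM (yoneda D c) f h = h \<odot>\<^bsub>D\<^esub> f"
  by (simp_all add: yoneda_def)

lemma small_colim_representable: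
  fixes D :: "('d, 'dm) cat"
  assumes "category D" "c \<in> Obj D"
    and P: "\<And>d. d \<in> Obj D \<Longrightarrow> PS P d = hom D d c"
      "\<And>u h. u \<in> Arr D \<Longrightarrow> h \<in> hom D (Cod D u) c \<Longrightarrow> PM P u h = h \<odot>\<^bsub>D\<^esub> u"
  shows "small_colim_of_reps TYPE('u :: universe) D P"
proof -
  interpret D: category D by fact
  \<comment> \<open>The terminal category: a representable is the colimit of the diagram consisting
    of itself alone.\<close>
  define I :: "('u, 'u) cat" where "I = \<lparr>Obj = {pt}, Arr = {pt}, Dom = (\<lambda>_. pt), Cod = (\<lambda>_. pt),
    Ide = (\<lambda>_. pt), Comp = (\<lambda>_ _. pt)\<rparr>"
  define H where "H = \<lparr>fobj = (\<lambda>_::'u. c), farr = (\<lambda>_::'u. Ide D c)\<rparr>"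
  define \<kappa> where "\<kappa> = (\<lambda>_::'u. \<lambda>d \<in> Obj D. \<lambda>h \<in> hom D d c. h)"
  have I: "category I" by unfold_locales (auto simp: I_def hom_def)
  have H: "is_functor I D H"
    by unfold_locales (auto simp: I_def H_def assms(2) D.Ide_in D.cat_simps)
  have \<kappa>: "rep_cocone D I H P \<kappa>"
    unfolding rep_cocone_def psh_nat_def
    by (auto simp: I_def H_def \<kappa>_def P D.Ide_Comp D.hom_Obj D.cat_simps hom_def)
  have "\<exists>!\<tau>. psh_nat D P Q \<tau> \<and>
              (\<forall>i \<in> Obj I. \<forall>d \<in> Obj D. \<forall>h \<in> hom D d (fobj H i). \<tau> d (\<kappa> i d h) = \<kappa>' i d h)"
    if "presheaf TYPE('u) D Q" and Q: "rep_cocone D I H Q \<kappa>'" for Q :: "('d, 'dm, 'u) psh" and \<kappa>'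
  proof
    have 1: "psh_nat D (yoneda D c) Q (\<kappa>' pt)"
      using Q by (simp add: rep_cocone_def I_def H_def)
    \<comment> \<open>\<open>PS P\<close> is known to be a hom-set only at objects of D, so the two
      product sets are identified by congruence instead of rewriting.\<close>
    have PE: "(\<Pi>\<^sub>E d\<in>Obj D. PS P d \<rightarrow>\<^sub>E PS Q d) = (\<Pi>\<^sub>E d\<in>Obj D. PS (yoneda D c) d \<rightarrow>\<^sub>E PS Q d)"
      by (rule PiE_cong) (simp add: P)
    from 1 show "psh_nat D P Q (\<kappa>' pt) \<and>
        (\<forall>i \<in> Obj I. \<forall>d \<in> Obj D. \<forall>h \<in> hom D d (fobj H i). \<kappa>' pt d (\<kappa> i d h) = \<kappa>' i d h)"
      unfolding psh_nat_def PE by (simp add: P I_def H_def \<kappa>_def D.cat_simps)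
    fix \<tau> assume \<tau>: "psh_nat D P Q \<tau> \<and>
              (\<forall>i \<in> Obj I. \<forall>d \<in> Obj D. \<forall>h \<in> hom D d (fobj H i). \<tau> d (\<kappa> i d h) = \<kappa>' i d h)"
    have eq: "\<tau> d h = \<kappa>' pt d h" if "d \<in> Obj D" "h \<in> hom D d c" for d h
      using \<tau> that by (simp add: I_def H_def \<kappa>_def)
    have "\<tau> d = \<kappa>' pt d" if d: "d \<in> Obj D" for d
    proof (rule extensionalityI[of _ "hom D d c"])
      have "\<tau> d \<in> PS P d \<rightarrow>\<^sub>E PS Q d" "\<kappa>' pt d \<in> PS (yoneda D c) d \<rightarrow>\<^sub>E PS Q d"
        using d \<tau> 1 unfolding psh_nat_def by (meson PiE_mem)+
      then show "\<tau> d \<in> extensional (hom D d c)" "\<kappa>' pt d \<in> extensional (hom D d c)"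
        using d by (auto simp: P PiE_def)
    qed (use d eq in auto)
    moreover have "\<tau> \<in> extensional (Obj D)" "\<kappa>' pt \<in> extensional (Obj D)"
      using \<tau> 1 by (auto simp: psh_nat_def PiE_def)
    ultimately show "\<tau> = \<kappa>' pt" by (auto intro: extensionalityI)
  qed
  then have "\<forall>(Q :: ('d, 'dm, 'u) psh) \<kappa>'. presheaf TYPE('u) D Q \<longrightarrow> rep_cocone D I H Q \<kappa>' \<longrightarrow>
      (\<exists>!\<tau>. psh_nat D P Q \<tau> \<and>
         (\<forall>i \<in> Obj I. \<forall>d \<in> Obj D. \<forall>h \<in> hom D d (fobj H i). \<tau> d (\<kappa> i d h) = \<kappa>' i d h))"
    by (intro allI impI)
  moreover have "small TYPE('u) (Obj I)" "small TYPE('u) (Arr I)"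
    by (simp_all add: I_def small_finite)
  ultimately show ?thesis
    unfolding small_colim_of_reps_def using I H \<kappa> by (intro exI conjI)
qed

text \<open>Evaluates the tuple on the right-hand side of the third lax algebra axiom: the
  compositor pairs \<gamma> at q z with \<tau> z in the coend, and \<Delta> of this class is
  \<open>delta\<close>. The endpoints of \<tau> z are prescribed because \<open>delta\<close> reads
  them off its argument.\<close>

lemma bprof_map_compositor:
  assumes q: "filtermap q (ult Z) = ult Y" and ae: "\<forall>\<^sub>F z in ult Z. z \<in> idx Z"
    and \<tau>: "\<And>z. z \<in> idx Z \<Longrightarrow> src (\<tau> z) = val Y (q z) \<and> tgt (\<tau> z) = val Z z"
  shows "bprof_map (lmult L) (compositor (bcat (bcat (lcat L))) (bcat (lcat L)) (lcat L) (lprof L) (bprof (lprof L))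
      (bel_of x Y p \<gamma>) (bel_of Y Z q \<tau>)) =
    bel_of x Z (p \<circ> q) (\<lambda>z. delta L (val x (p (q z))) (\<gamma> (q z)) (\<tau> z))"
proof -
  let ?s = "bel_of x Y p \<gamma>" and ?t = "bel_of Y Z q \<tau>"
  let ?cl = "\<lambda>z. coend_cls (bcat (bcat (lcat L))) (bcat (lcat L)) (lcat L) (lprof L) (bprof (lprof L))
      (val x (p (q z))) (val Z z) (val Y (q z), \<gamma> (q z), \<tau> z)"
  have s: "\<forall>\<^sub>F z in ult Z. rmap ?s (q z) = p (q z) \<and> rcmp ?s (q z) = \<gamma> (q z)"
    using rep_bel_of[of x Y p \<gamma>] unfolding q[symmetric] eventually_filtermap .
  have t: "\<forall>\<^sub>F z in ult Z. rmap ?t z = q z \<and> rcmp ?t z = \<tau> z" by (rule rep_bel_of)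
  have "compositor (bcat (bcat (lcat L))) (bcat (lcat L)) (lcat L) (lprof L) (bprof (lprof L)) ?s ?t =
      bel_of x Z (p \<circ> q) ?cl"
    unfolding compositor_def bel_of_eq_iff bel_of_simps
  proof (intro conjI refl)
    show "\<forall>\<^sub>F z in ult Z. (rmap ?s \<circ> rmap ?t) z = (p \<circ> q) z \<and>
        coend_cls (bcat (bcat (lcat L))) (bcat (lcat L)) (lcat L) (lprof L) (bprof (lprof L))
          (val x (rmap ?s (rmap ?t z))) (val Z z) (val Y (rmap ?t z), rcmp ?s (rmap ?t z), rcmp ?t z) = ?cl z"
      using s t by eventually_elim simp
  qed
  moreover have "bprof_map (lmult L) (bel_of x Z (p \<circ> q) ?cl) =
      bel_of x Z (p \<circ> q) (\<lambda>z. delta L (val x (p (q z))) (\<gamma> (q z)) (\<tau> z))"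
  proof -
    have r: "\<forall>\<^sub>F z in ult Z. rmap (bel_of x Z (p \<circ> q) ?cl) z = (p \<circ> q) z \<and> rcmp (bel_of x Z (p \<circ> q) ?cl) z = ?cl z"
      by (rule rep_bel_of)
    show ?thesis
      unfolding bprof_map_def bel_of_eq_iff bel_of_simps
    proof (intro conjI refl)
      show "\<forall>\<^sub>F z in ult Z. rmap (bel_of x Z (p \<circ> q) ?cl) z = (p \<circ> q) z \<and>
          lmult L (val x (rmap (bel_of x Z (p \<circ> q) ?cl) z)) (val Z z) (rcmp (bel_of x Z (p \<circ> q) ?cl) z) =
          delta L (val x (p (q z))) (\<gamma> (q z)) (\<tau> z)"
        using r ae by eventually_elim (simp add: delta_def \<tau>)
    qed
  qed
  ultimately show ?thesis by simp
qed

section \<open>Pseudoalgebras and lax algebras\<close>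

lemma bmu_el_hom:
  fixes Y :: "('u :: universe, ('u, 'o) bobj) bobj"
  assumes v: "v \<in> hom (bcat (bcat C)) Y Y'"
  shows "bmu_el v \<in> hom (bcat C) (bmu_obj Y) (bmu_obj Y')"
proof -
  note 1 = hom_bcatD[OF v]
  have "a \<in> bObj C" if "a \<in> val Y ` idx Y" for a using that bObjD(2)[OF 1(1)] by auto
  moreover have "a \<in> bObj C" if "a \<in> val Y' ` idx Y'" for a using that bObjD(2)[OF 1(2)] by auto
  ultimately have "v \<in> bset (bset (hom C)) Y Y'"
    by (intro bset_mono[OF 1(3)]) (simp add: hom_bcat)
  then show ?thesis using bmu_el_in[OF _ 1(2)] 1 by (simp add: hom_bcat bmu_obj_in)
qed

section \<open>The representable lax algebra of a pseudoalgebra\<close>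

locale pseudo_alg =
  fixes P :: "('u :: universe, 'o, 'm) palg"
  assumes pseudo_algebra: "pseudo_algebra P"
begin

abbreviation "A \<equiv> pcat P"
abbreviation "bA \<equiv> bcat A :: (('u, 'o) bobj, ('u, 'o, 'o, 'm) bel) cat"
abbreviation "bbA \<equiv> bcat bA :: (('u, ('u, 'o) bobj) bobj, _) cat"
abbreviation "\<Phi> \<equiv> pact P"
abbreviation "\<upsilon> \<equiv> punit P"
abbreviation "m \<equiv> pmult P"
abbreviation "\<Phi>\<eta> \<equiv> fcomp A \<Phi> (bunit A)"
abbreviation "\<Phi>\<beta>\<Phi> \<equiv> fcomp bbA \<Phi> (bfun \<Phi>)"
abbreviation "\<Phi>\<mu> \<equiv> fcomp bbA \<Phi> bmu"

lemmas axs = pseudo_algebra[unfolded pseudo_algebra_def Let_def]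

sublocale A: category A using axs by blast
sublocale bA: category bA by (rule category_bcat) (rule A.category_axioms)
sublocale bbA: category bbA by (rule category_bcat) (rule bA.category_axioms)

lemma ext_Phi: "ext_functor bA A \<Phi>" using axs by blast

sublocale Phi: is_functor bA A \<Phi> using ext_Phi by (simp add: ext_functor_def)

lemma loc_small: "locally_small TYPE('u) A" using axs by blast

lemma unit_nat: "nat_iso A A (fid A) \<Phi>\<eta> \<upsilon>" using axs by blast
lemma mult_nat: "nat_iso bbA A \<Phi>\<beta>\<Phi> \<Phi>\<mu> m" using axs by blast

lemma unit_hom: "a \<in> Obj A \<Longrightarrow> \<upsilon> a \<in> hom A a (fobj \<Phi> (single a))"
  using nat_transD(1)[of A A "fid A" \<Phi>\<eta> \<upsilon> a] unit_nat by (simp add: nat_iso_def fid_simps fcomp_simps)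

lemma unit_iso: "a \<in> Obj A \<Longrightarrow> iso_arr A (\<upsilon> a)"
  using unit_nat by (simp add: nat_iso_def)

lemma unit_natural: "h \<in> hom A a b \<Longrightarrow> \<upsilon> b \<odot>\<^bsub>A\<^esub> h = farr \<Phi> (bsingle a b h) \<odot>\<^bsub>A\<^esub> \<upsilon> a"
  using nat_transD(2)[of A A "fid A" \<Phi>\<eta> \<upsilon> h a b] unit_nat homD[of h A a b]
  by (simp add: nat_iso_def fid_simps fcomp_simps)

lemma mult_hom: "Y \<in> bObj bA \<Longrightarrow> m Y \<in> hom A (fobj \<Phi> (bmap (fobj \<Phi>) Y)) (fobj \<Phi> (bmu_obj Y))"
  using nat_transD(1)[of bbA A \<Phi>\<beta>\<Phi> \<Phi>\<mu> m Y] mult_nat by (simp add: nat_iso_def fcomp_simps)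

lemma mult_iso: "Y \<in> bObj bA \<Longrightarrow> iso_arr A (m Y)"
  using mult_nat by (simp add: nat_iso_def)

lemma mult_natural:
  "v \<in> hom bbA Y Y' \<Longrightarrow> m Y' \<odot>\<^bsub>A\<^esub> farr \<Phi> (farr (bfun \<Phi>) v) = farr \<Phi> (bmu_el v) \<odot>\<^bsub>A\<^esub> m Y"
  using nat_transD(2)[of bbA A \<Phi>\<beta>\<Phi> \<Phi>\<mu> m v Y Y'] mult_nat homD[of v bbA Y Y']
  by (simp add: nat_iso_def fcomp_simps)

lemma unit_ax1: "x \<in> bObj A \<Longrightarrow> farr \<Phi> (lunit A x) \<odot>\<^bsub>A\<^esub> m (single x) \<odot>\<^bsub>A\<^esub> \<upsilon> (fobj \<Phi> x) = Ide A (fobj \<Phi> x)"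
  using axs by simp

lemma unit_ax2: "x \<in> bObj A \<Longrightarrow>
    farr \<Phi> (runit A x) \<odot>\<^bsub>A\<^esub> m (bmap single x) \<odot>\<^bsub>A\<^esub> farr \<Phi> (bnt (fid A) \<Phi>\<eta> \<upsilon> x) = Ide A (fobj \<Phi> x)"
  using axs by simp

lemma assoc_ax: "Z \<in> bObj bbA \<Longrightarrow>
    farr \<Phi> (bassoc A Z) \<odot>\<^bsub>A\<^esub> m (bmu_obj Z) \<odot>\<^bsub>A\<^esub> m (bmap (bmap (fobj \<Phi>)) Z)
        = m (bmap bmu_obj Z) \<odot>\<^bsub>A\<^esub> farr \<Phi> (bnt \<Phi>\<beta>\<Phi> \<Phi>\<mu> m Z)"
  using axs by simp

abbreviation "R \<equiv> rep_prof A \<Phi>"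
abbreviation "L \<equiv> rep_lax P"

lemma lax_simps [simp]: "lcat L = A" "lprof L = R"
  by (simp_all add: rep_lax_def Let_def)

lemma lunitor_simp: "h \<in> hom A a a' \<Longrightarrow> lunitor L a a' h = \<upsilon> a' \<odot>\<^bsub>A\<^esub> h"
  using A.hom_Obj[of h a a'] by (simp add: rep_lax_def Let_def)

sublocale R: pre_prof bA A R
  by (rule pre_prof_rep_prof) (rule bA.category_axioms A.category_axioms Phi.is_functor_axioms)+

sublocale bR: pre_prof bbA bA "bprof R"
  by (rule pre_prof_bprof) (rule R.pre_prof_axioms)

sublocale K: coend bbA bA A R "bprof R" ..

lemma bmap_Phi_in: "Y \<in> bObj bA \<Longrightarrow> bmap (fobj \<Phi>) Y \<in> bObj A"
  by (rule is_functor_obj_bObj) (rule Phi.is_functor_axioms)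

lemma retgt_in:
  "x \<in> bObj A \<Longrightarrow> Y \<in> bObj bA \<Longrightarrow> s \<in> bset (PEl R) x Y \<Longrightarrow>
    retgt (bmap (fobj \<Phi>) Y) s \<in> hom bA x (bmap (fobj \<Phi>) Y)"
  by (rule retgt_hom) (rule Phi.is_functor_axioms)

text \<open>The value of \<Delta> on a representative, before passage to the coend.\<close>

definition dl where "dl Y r s = m Y \<odot>\<^bsub>A\<^esub> farr \<Phi> (retgt (bmap (fobj \<Phi>) Y) s) \<odot>\<^bsub>A\<^esub> r"

lemma dl_in:
  assumes r: "r \<in> hom A a (fobj \<Phi> x)" and x: "x \<in> bObj A" and Y: "Y \<in> bObj bA" and s: "s \<in> bset (PEl R) x Y"
  shows "dl Y r s \<in> hom A a (fobj \<Phi> (bmu_obj Y))"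
  unfolding dl_def by (rule A.Comp_in[OF mult_hom[OF Y] A.Comp_in[OF Phi.farr_in[OF retgt_in[OF x Y s]] r]])

text \<open>Once s is read as a morphism into \<beta>\<Phi>(Y), moving u from r to s amounts to
  \<Phi>(s u) = \<Phi>(s) \<Phi>(u).\<close>

lemma dl_coend:
  assumes u: "u \<in> hom bA x x'" and r: "r \<in> hom A a (fobj \<Phi> x)" and s: "s \<in> bset (PEl R) x' Y" and Y: "Y \<in> bObj bA"
  shows "dl Y (PAct R (Ide A a) u r) s = dl Y r (PAct (bprof R) u (Ide bbA Y) s)"
proof -
  have "x' \<in> bObj A" using bA.hom_Obj[OF u] by simp
  note s' = retgt_in[OF this Y s]
  have "farr (bfun \<Phi>) (Ide bbA Y) = Ide bA (bmap (fobj \<Phi>) Y)"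
    using is_functor.farr_Ide[OF is_functor_bfun[OF Phi.is_functor_axioms], of Y] Y by simp
  then have "retgt (bmap (fobj \<Phi>) Y) (PAct (bprof R) u (Ide bbA Y) s) = retgt (bmap (fobj \<Phi>) Y) s \<odot>\<^bsub>bA\<^esub> u"
    using retgt_act[OF Phi.is_functor_axioms s u bbA.Ide_in] Y bA.Ide_Comp[OF bA.Comp_in[OF s' u]] by simp
  then show ?thesis
    unfolding dl_def using homD[OF s'] homD[OF u] homD[OF r] homD[OF mult_hom[OF Y]]
    by (simp add: Phi.functor_simps A.cat_simps)
qed

lemma delta_rep:
  assumes r: "r \<in> hom A a (fobj \<Phi> x)" and x: "x \<in> bObj A" and Y: "Y \<in> bObj bA" and s: "s \<in> bset (PEl R) x Y"
  shows "delta L a r s = m Y \<odot>\<^bsub>A\<^esub> farr \<Phi> (retgt (bmap (fobj \<Phi>) Y) s) \<odot>\<^bsub>A\<^esub> r"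
    and "lmult L a Y (K.cl a Y (x, r, s)) = dl Y r s"
proof -
  have a: "a \<in> Obj A" using A.hom_Obj[OF r] by simp
  \<comment> \<open>\<open>lmult\<close> evaluates this function at a chosen representative;
    invariance under the coend relation moves the value to the given one.\<close>
  define \<phi> where "\<phi> = (\<lambda>(x :: ('u, 'o) bobj, r, s :: ('u, 'o, ('u, 'o) bobj, 'm) bel). dl Y r s)"
  have cl: "K.cl a Y (x, r, s) \<in> PEl (prof_comp bbA bA A R (bprof R)) a Y"
    using assms by (auto simp: K.PEl_prof_comp)
  have "\<phi> (SOME q. q \<in> K.cl a Y (x, r, s)) = \<phi> (x, r, s)"
    by (rule K.cl_invariant[OF _ K.some_cl]) (use dl_coend Y in \<open>auto simp: \<phi>_def\<close>)
  then show *: "lmult L a Y (K.cl a Y (x, r, s)) = dl Y r s"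
    using cl a Y by (simp add: rep_lax_def Let_def \<phi>_def dl_def case_prod_beta)
  show "delta L a r s = m Y \<odot>\<^bsub>A\<^esub> farr \<Phi> (retgt (bmap (fobj \<Phi>) Y) s) \<odot>\<^bsub>A\<^esub> r"
    using * bset_src_tgt[OF s] by (simp add: delta_def dl_def)
qed

text \<open>Normalization is where invertibility of \<upsilon> is used: it makes composition with
  \<upsilon> bijective.\<close>

lemma normalized_rep_lax: "normalized L"
  unfolding normalized_def
proof (intro ballI)
  fix a a' assume a: "a \<in> Obj (lcat L)" "a' \<in> Obj (lcat L)"
  then have "bij_betw (\<lambda>h. \<upsilon> a' \<odot>\<^bsub>A\<^esub> h) (hom A a a') (hom A a (fobj \<Phi> (single a')))"
    using A.iso_bij_post[OF unit_hom unit_iso, of a' a] by simp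
  moreover have "bij_betw (lunitor L a a') (hom A a a') S \<longleftrightarrow> bij_betw (\<lambda>h. \<upsilon> a' \<odot>\<^bsub>A\<^esub> h) (hom A a a') S" for S
    by (rule bij_betw_cong) (simp add: lunitor_simp)
  ultimately show "bij_betw (lunitor L a a') (hom (lcat L) a a') (PEl (lprof L) a (single a'))"
    by simp
qed

lemma small_profunctor_R: "small_profunctor TYPE('u) bA A R"
  unfolding small_profunctor_def
proof (intro conjI ballI)
  show "profunctor TYPE('u) bA A R"
    by (rule profunctorI[OF R.pre_prof_axioms]) (use loc_small in \<open>auto simp: locally_small_def Phi.fobj_in\<close>)
  fix x assume x: "x \<in> Obj bA"
  show "small_colim_of_reps TYPE('u) A \<lparr>PS = (\<lambda>d. PEl R d x), PM = (\<lambda>f. PAct R f (Ide bA x))\<rparr>"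
  proof (rule small_colim_representable[of _ "fobj \<Phi> x"])
    fix u h assume "u \<in> Arr A" "h \<in> hom A (Cod A u) (fobj \<Phi> x)"
    then show "PM \<lparr>PS = (\<lambda>d. PEl R d x), PM = (\<lambda>f. PAct R f (Ide bA x))\<rparr> u h = h \<odot>\<^bsub>A\<^esub> u"
      using Phi.farr_Ide[OF x] A.Ide_Comp[OF A.Comp_in[OF _ A.Arr_hom]] by simp
  qed (use x in \<open>auto simp: Phi.fobj_in A.category_axioms simp del: bcat_simps\<close>)
qed

lemma lunitor_nat: "prof_nat A A (hom_prof A) (pull_prof R (fid A) (bunit A)) (lunitor L)"
proof (rule prof_natI)
  have "\<upsilon> a' \<odot>\<^bsub>A\<^esub> h \<in> hom A a (fobj \<Phi> (single a'))" if "h \<in> hom A a a'" for a a' h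
    using A.Comp_in[OF unit_hom that] A.hom_Obj[OF that] by simp
  then show "lunitor L \<in> (\<Pi>\<^sub>E d\<in>Obj A. \<Pi>\<^sub>E c\<in>Obj A. PEl (hom_prof A) d c \<rightarrow>\<^sub>E PEl (pull_prof R (fid A) (bunit A)) d c)"
    by (auto simp: rep_lax_def Let_def fid_simps)
  fix f g d' d c c' e assume f: "f \<in> hom A d' d" and g: "g \<in> hom A c c'" and e: "e \<in> PEl (hom_prof A) d c"
  then have e: "e \<in> hom A d c" by simp
  note gef = A.Comp_in[OF g A.Comp_in[OF e f]]
  have "c \<in> Obj A" "c' \<in> Obj A" using A.hom_Obj[OF g] by auto
  note u = unit_hom[OF this(1)] unit_hom[OF this(2)]
  have bg: "bsingle c c' g \<in> hom bA (single c) (single c')"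
    using A.hom_Obj[OF g] g by (simp add: hom_bcat single_in bsingle_in)
  have "\<upsilon> c' \<odot>\<^bsub>A\<^esub> g \<odot>\<^bsub>A\<^esub> (e \<odot>\<^bsub>A\<^esub> f) = farr \<Phi> (bsingle c c' g) \<odot>\<^bsub>A\<^esub> \<upsilon> c \<odot>\<^bsub>A\<^esub> (e \<odot>\<^bsub>A\<^esub> f)"
    by (rule A.Comp_swap[OF unit_natural[OF g] g u(2) u(1) Phi.farr_in[OF bg] A.Comp_in[OF e f]])
  then show "lunitor L d' c' (PAct (hom_prof A) f g e) = PAct (pull_prof R (fid A) (bunit A)) f g (lunitor L d c e)"
    using lunitor_simp[OF gef] lunitor_simp[OF e] homD[OF f] homD[OF g] homD[OF e] homD[OF u(1)]
    by (simp add: fid_simps A.cat_simps)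
qed

text \<open>The action of v on s becomes composition with \<beta>\<Phi>(v), which naturality of m
  exchanges for \<mu>(v) on the other side; the action of f is precomposition and passes
  through.\<close>

lemma lmult_nat: "prof_nat bbA A (prof_comp bbA bA A R (bprof R)) (pull_prof R (fid A) bmu) (lmult L)"
proof (rule prof_natI)
  have "lmult L a Y k \<in> hom A a (fobj \<Phi> (bmu_obj Y))"
    if "a \<in> Obj A" "Y \<in> bObj bA" "k \<in> PEl (prof_comp bbA bA A R (bprof R)) a Y" for a Y k
    using that by (auto simp: K.PEl_prof_comp delta_rep(2) dl_in)
  moreover have "lmult L \<in> extensional (Obj A)"
    "\<And>a. a \<in> Obj A \<Longrightarrow> lmult L a \<in> extensional (Obj bbA)"
    "\<And>a Y. a \<in> Obj A \<Longrightarrow> Y \<in> Obj bbA \<Longrightarrow> lmult L a Y \<in> extensional (PEl (prof_comp bbA bA A R (bprof R)) a Y)"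
    by (simp_all add: rep_lax_def Let_def)
  ultimately show "lmult L \<in> (\<Pi>\<^sub>E d\<in>Obj A. \<Pi>\<^sub>E c\<in>Obj bbA. PEl (prof_comp bbA bA A R (bprof R)) d c \<rightarrow>\<^sub>E
      PEl (pull_prof R (fid A) bmu) d c)"
    unfolding PiE_iff by (auto simp: fid_simps)
  fix f v a' a Y Y' k assume f: "f \<in> hom A a' a" and v: "v \<in> hom bbA Y Y'"
    and "k \<in> PEl (prof_comp bbA bA A R (bprof R)) a Y"
  then obtain x r s where k: "k = K.cl a Y (x, r, s)" and x: "x \<in> bObj A" and r: "r \<in> hom A a (fobj \<Phi> x)"
    and s: "s \<in> bset (PEl R) x Y"
    by (auto simp: K.PEl_prof_comp)
  have Y: "Y \<in> bObj bA" "Y' \<in> bObj bA" using bbA.hom_Obj[OF v] by auto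
  have v': "farr (bfun \<Phi>) v \<in> hom bA (bmap (fobj \<Phi>) Y) (bmap (fobj \<Phi>) Y')"
    using is_functor.farr_in[OF is_functor_bfun[OF Phi.is_functor_axioms] v] by simp
  have mv: "bmu_el v \<in> hom bA (bmu_obj Y) (bmu_obj Y')"
    using v by (rule bmu_el_hom)
  note s' = retgt_in[OF x Y(1) s]
  have rs: "PAct (bprof R) (Ide bA x) v s \<in> bset (PEl R) x Y'"
    using bR.act_right_in[OF v, of x s] x s by simp
  have rs': "retgt (bmap (fobj \<Phi>) Y') (PAct (bprof R) (Ide bA x) v s) = farr (bfun \<Phi>) v \<odot>\<^bsub>bA\<^esub> retgt (bmap (fobj \<Phi>) Y) s"
    using retgt_act[OF Phi.is_functor_axioms s bA.Ide_in v] x bA.Comp_Ide[OF s'] by simp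
  have rf: "PAct R f (Ide bA x) r = r \<odot>\<^bsub>A\<^esub> f"
    using A.Ide_Comp[OF A.Comp_in[OF r f]] x Phi.farr_Ide[of x] by simp
  have "lmult L a' Y' (PAct (prof_comp bbA bA A R (bprof R)) f v k) = dl Y' (r \<odot>\<^bsub>A\<^esub> f) (PAct (bprof R) (Ide bA x) v s)"
    unfolding k using K.act_prof_comp[OF f v, of x r s] x r s rf delta_rep(2)[OF A.Comp_in[OF r f] x Y(2) rs] by simp
  also have "\<dots> = m Y' \<odot>\<^bsub>A\<^esub> farr \<Phi> (farr (bfun \<Phi>) v) \<odot>\<^bsub>A\<^esub> (farr \<Phi> (retgt (bmap (fobj \<Phi>) Y) s) \<odot>\<^bsub>A\<^esub> (r \<odot>\<^bsub>A\<^esub> f))"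
    unfolding dl_def rs' using homD[OF v'] homD[OF s'] homD[OF r] homD[OF f] by (simp add: Phi.functor_simps A.cat_simps)
  also have "\<dots> = farr \<Phi> (bmu_el v) \<odot>\<^bsub>A\<^esub> m Y \<odot>\<^bsub>A\<^esub> (farr \<Phi> (retgt (bmap (fobj \<Phi>) Y) s) \<odot>\<^bsub>A\<^esub> (r \<odot>\<^bsub>A\<^esub> f))"
    by (rule A.Comp_swap[OF mult_natural[OF v] Phi.farr_in[OF v'] mult_hom[OF Y(2)] mult_hom[OF Y(1)] Phi.farr_in[OF mv]
        A.Comp_in[OF Phi.farr_in[OF s'] A.Comp_in[OF r f]]])
  also have "\<dots> = farr \<Phi> (bmu_el v) \<odot>\<^bsub>A\<^esub> dl Y r s \<odot>\<^bsub>A\<^esub> f"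
    unfolding dl_def using homD[OF mult_hom[OF Y(1)]] homD[OF s'] homD[OF r] homD[OF f]
    by (simp add: Phi.functor_simps A.cat_simps)
  finally show "lmult L a' Y' (PAct (prof_comp bbA bA A R (bprof R)) f v k) = PAct (pull_prof R (fid A) bmu) f v (lmult L a Y k)"
    unfolding k using homD[OF f] delta_rep(2)[OF r x Y(1) s] by (simp add: fid_simps)
qed

lemma bmap_Phi_bmu: "Z \<in> bObj bbA \<Longrightarrow> bmap (fobj \<Phi>) (bmu_obj Z) = bmu_obj (bmap (bmap (fobj \<Phi>)) Z)"
  by (rule bmap_bmu_obj)

text \<open>With s and t read as morphisms s1 and t1 of \<beta>A and \<beta>\<beta>A, naturality of
  m at t1 brings the two multiplications on the left side next to each other. The pseudoalgebra
  axiom at Z replaces them, and what remains is \<Phi> of a single morphism of \<beta>A.\<close>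

lemma delta_assoc:
  assumes r: "r \<in> hom A a (fobj \<Phi> x)" and x: "x \<in> bObj A" and Y: "Y \<in> bObj bA" and Z: "Z \<in> bObj bbA"
    and s: "s \<in> bset (PEl R) x Y" and t: "t \<in> bset (bset (PEl R)) Y Z"
  shows "PAct R (Ide A a) (bassoc A Z) (delta L a (delta L a r s) (bmu_el t)) =
        delta L a r (retgt (bmap bmu_obj Z)
          (bprof_map (lmult L) (compositor bbA bA A R (bprof R) s t)))"
proof -
  let ?ZF = "bmap (bmap (fobj \<Phi>)) Z"
  obtain p \<gamma> where p: "s = bel_of x Y p \<gamma>" "p \<in> idx Y \<rightarrow> idx x" "filtermap p (ult Y) = ult x"
    "\<And>y. y \<in> idx Y \<Longrightarrow> \<gamma> y \<in> hom A (val x (p y)) (fobj \<Phi> (val Y y))"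
    using s by (rule bsetE) auto
  obtain q u \<eta> where t': "t = bel_of Y Z q (\<lambda>z. bel_of (val Y (q z)) (val Z z) (u z) (\<eta> z))"
    and q: "q \<in> idx Z \<rightarrow> idx Y" "filtermap q (ult Z) = ult Y"
    and u: "\<And>z. z \<in> idx Z \<Longrightarrow> u z \<in> idx (val Z z) \<rightarrow> idx (val Y (q z))"
      "\<And>z. z \<in> idx Z \<Longrightarrow> filtermap (u z) (ult (val Z z)) = ult (val Y (q z))"
      "\<And>z w. z \<in> idx Z \<Longrightarrow> w \<in> idx (val Z z) \<Longrightarrow> \<eta> z w \<in> PEl R (val (val Y (q z)) (u z w)) (val (val Z z) w)"
    using bset2E[OF t bObjD(1)[OF Z]] by blast
  define \<tau> where "\<tau> = (\<lambda>z. bel_of (val Y (q z)) (val Z z) (u z) (\<eta> z))"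
  have \<tau>: "\<tau> z \<in> bset (PEl R) (val Y (q z)) (val Z z)" if "z \<in> idx Z" for z
    unfolding \<tau>_def using u[OF that] by (rule bsetI)
  have zY: "val Z z \<in> bObj bA" "q z \<in> idx Y" "val Y (q z) \<in> bObj A" "p (q z) \<in> idx x" if "z \<in> idx Z" for z
    using that q(1) p(2) bObjD(2)[OF Z, of z] bObjD(2)[OF Y, of "q z"] by auto
  have ZF: "?ZF \<in> bObj bA"
    by (rule bmap_in[OF Z]) (simp add: bmap_Phi_in)
  have muZ: "bmu_obj Z \<in> bObj bA" by (rule bmu_obj_in[OF Z])
  have bmuZ: "bmap bmu_obj Z \<in> bObj bA" by (rule bmap_in[OF Z]) (simp add: bmu_obj_in)
  have muY: "bmu_obj Y \<in> bObj A" by (rule bmu_obj_in[OF Y])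
  \<comment> \<open>Changing the targets of the inner classes turns t into a morphism of
    \<beta>\<beta>A, to which naturality of m applies.\<close>
  define t1 where "t1 = bel_of Y ?ZF q (\<lambda>z. bel_of (val Y (q z)) (val ?ZF z) (u z) (\<eta> z))"
  have t1': "t1 = bel_of Y ?ZF q (\<lambda>z. retgt (bmap (fobj \<Phi>) (val Z z)) (\<tau> z))"
    unfolding t1_def by (rule bel_of_cong) (use bObjD(1)[OF Z] in \<open>auto simp: \<tau>_def retgt_bel_of\<close>)
  have t1: "t1 \<in> hom bbA Y ?ZF"
    unfolding t1' hom_bcat[OF Y ZF]
    by (rule bsetI) (use q retgt_in[OF zY(3) zY(1) \<tau>] in auto)
  have mut: "bmu_el t \<in> bset (PEl R) (bmu_obj Y) (bmu_obj Z)" by (rule bmu_el_in[OF t Z])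
  \<comment> \<open>Flattening commutes with the change of targets, because \<beta>\<Phi>(\<mu> Z)
    and \<mu>(\<beta>\<beta>\<Phi> Z) are the same object.\<close>
  have r_mut: "retgt (bmap (fobj \<Phi>) (bmu_obj Z)) (bmu_el t) = bmu_el t1"
    unfolding t' t1_def bmu_el_bel_of bmap_Phi_bmu[OF Z]
    by (rule retgt_bel_of) (simp flip: bmap_bmu_obj[OF Z])
  define s1 where "s1 = retgt (bmap (fobj \<Phi>) Y) s"
  have s1: "s1 \<in> hom bA x (bmap (fobj \<Phi>) Y)" unfolding s1_def by (rule retgt_in[OF x Y s])
  define d where "d = (\<lambda>z. delta L (val x (p (q z))) (\<gamma> (q z)) (\<tau> z))"
  have d: "d z = m (val Z z) \<odot>\<^bsub>A\<^esub> farr \<Phi> (retgt (bmap (fobj \<Phi>) (val Z z)) (\<tau> z)) \<odot>\<^bsub>A\<^esub> \<gamma> (q z)"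
    "d z \<in> hom A (val x (p (q z))) (fobj \<Phi> (bmu_obj (val Z z)))"
    if z: "z \<in> idx Z" for z
    using delta_rep(1)[OF p(4)[OF zY(2)[OF z]] zY(3)[OF z] zY(1)[OF z] \<tau>[OF z]]
      dl_in[OF p(4)[OF zY(2)[OF z]] zY(3)[OF z] zY(1)[OF z] \<tau>[OF z]] by (simp_all add: d_def dl_def)
  define s2 where "s2 = bel_of x (bmap bmu_obj Z) (p \<circ> q) d"
  have "bprof_map (lmult L) (compositor bbA bA A R (bprof R) s t) = bel_of x Z (p \<circ> q) d"
    using bprof_map_compositor[OF q(2) bObjD(1)[OF Z], of \<tau> L x p \<gamma>]
    by (simp add: p(1) t' \<tau>_def d_def)
  then have rhs: "retgt (bmap bmu_obj Z) (bprof_map (lmult L) (compositor bbA bA A R (bprof R) s t)) = s2"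
    by (simp add: s2_def retgt_bel_of)
  have s2: "s2 \<in> bset (PEl R) x (bmap bmu_obj Z)"
    unfolding s2_def
    by (rule bsetI) (use d(2) q p zY filtermap_comp[OF q(2) p(3)] in auto)
  define n where "n = bnt \<Phi>\<beta>\<Phi> \<Phi>\<mu> m Z"
  have n': "n = bel_of (bmap (fobj \<Phi>) ?ZF) (bmap (fobj \<Phi>) (bmap bmu_obj Z)) id (\<lambda>z. m (val Z z))"
    using Z by (simp add: n_def bnt_def bmap_fcomp)
  have n: "n \<in> hom bA (bmap (fobj \<Phi>) ?ZF) (bmap (fobj \<Phi>) (bmap bmu_obj Z))"
    unfolding hom_bcat[OF bmap_Phi_in[OF ZF] bmap_Phi_in[OF bmuZ]] n'
    by (rule bsetI) (use mult_hom zY in auto)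
  have f1: "farr (bfun \<Phi>) t1 \<in> hom bA (bmap (fobj \<Phi>) Y) (bmap (fobj \<Phi>) ?ZF)"
    using is_functor.farr_in[OF is_functor_bfun[OF Phi.is_functor_axioms] t1] by simp
  \<comment> \<open>The tuple of all \<open>delta\<close> values is, as a morphism of \<beta>A, the
    composite of s1, \<beta>\<Phi>(t1) and the component n of \<beta>m; in each component this is
    the formula for \<open>delta\<close>.\<close>
  have r_s2: "retgt (bmap (fobj \<Phi>) (bmap bmu_obj Z)) s2 = n \<odot>\<^bsub>bA\<^esub> farr (bfun \<Phi>) t1 \<odot>\<^bsub>bA\<^esub> s1"
    using q(2) p(3) d(1) bObjD(1)[OF Z]
    by (auto simp: s2_def s1_def n' t1' p(1) retgt_bel_of bfun_bel_of Comp_bel_of intro!: bel_of_cong)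
  note hs = homD[OF r] homD[OF s1] homD[OF f1] homD[OF n] homD[OF mult_hom[OF Y]] homD[OF mult_hom[OF ZF]]
    homD[OF mult_hom[OF muZ]] homD[OF mult_hom[OF bmuZ]] homD[OF t1] homD[OF bmu_el_hom[OF t1]]
    homD[OF bassoc_in[OF A.category_axioms Z]]
  let ?w = "farr \<Phi> s1 \<odot>\<^bsub>A\<^esub> r"
  have w: "?w \<in> hom A a (fobj \<Phi> (bmap (fobj \<Phi>) Y))" by (rule A.Comp_in[OF Phi.farr_in[OF s1] r])
  have in1: "m Y \<odot>\<^bsub>A\<^esub> ?w \<in> hom A a (fobj \<Phi> (bmu_obj Y))" by (rule A.Comp_in[OF mult_hom[OF Y] w])
  have mt1: "bmu_el t1 \<in> hom bA (bmu_obj Y) (bmap (fobj \<Phi>) (bmu_obj Z))"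
    using bmu_el_hom[OF t1] by (simp add: bmap_Phi_bmu[OF Z])
  note mn = mult_hom[OF ZF]
  have "PAct R (Ide A a) (bassoc A Z) (delta L a (delta L a r s) (bmu_el t)) =
      farr \<Phi> (bassoc A Z) \<odot>\<^bsub>A\<^esub> (m (bmu_obj Z) \<odot>\<^bsub>A\<^esub> (farr \<Phi> (bmu_el t1) \<odot>\<^bsub>A\<^esub> m Y \<odot>\<^bsub>A\<^esub> ?w))"
    using delta_rep(1)[OF r x Y s] delta_rep(1)[OF in1 muY muZ mut]
      A.Comp_Ide[OF A.Comp_in[OF mult_hom[OF muZ] A.Comp_in[OF Phi.farr_in[OF mt1] in1]]]
    by (simp add: r_mut flip: s1_def)
  also have "farr \<Phi> (bmu_el t1) \<odot>\<^bsub>A\<^esub> m Y \<odot>\<^bsub>A\<^esub> ?w = m ?ZF \<odot>\<^bsub>A\<^esub> farr \<Phi> (farr (bfun \<Phi>) t1) \<odot>\<^bsub>A\<^esub> ?w"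
    by (rule A.Comp_swap[OF mult_natural[OF t1, symmetric] mult_hom[OF Y] Phi.farr_in[OF bmu_el_hom[OF t1]]
        Phi.farr_in[OF f1] mult_hom[OF ZF] w])
  also have "farr \<Phi> (bassoc A Z) \<odot>\<^bsub>A\<^esub> (m (bmu_obj Z) \<odot>\<^bsub>A\<^esub> (m ?ZF \<odot>\<^bsub>A\<^esub> farr \<Phi> (farr (bfun \<Phi>) t1) \<odot>\<^bsub>A\<^esub> ?w)) =
      (farr \<Phi> (bassoc A Z) \<odot>\<^bsub>A\<^esub> m (bmu_obj Z) \<odot>\<^bsub>A\<^esub> m ?ZF) \<odot>\<^bsub>A\<^esub> farr \<Phi> (farr (bfun \<Phi>) t1) \<odot>\<^bsub>A\<^esub> ?w"
    using hs by (simp add: Phi.functor_simps A.cat_simps bmap_Phi_bmu[OF Z])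
  also have "\<dots> = m (bmap bmu_obj Z) \<odot>\<^bsub>A\<^esub> farr \<Phi> (retgt (bmap (fobj \<Phi>) (bmap bmu_obj Z)) s2) \<odot>\<^bsub>A\<^esub> r"
    unfolding assoc_ax[OF Z] r_s2 n_def[symmetric]
    using hs by (simp add: Phi.functor_simps A.cat_simps bA.cat_simps del: bcat_simps(4))
  also have "\<dots> = delta L a r s2" using delta_rep(1)[OF r x bmuZ s2] by simp
  finally show ?thesis by (simp add: rhs)
qed

lemma lax_algebra_rep_lax: "lax_algebra L"
  unfolding lax_algebra_def Let_def lax_simps
proof (intro conjI ballI)
  fix a x r assume a: "a \<in> Obj A" and x: "x \<in> Obj bA" and r: "r \<in> PEl R a x"
  then have x': "x \<in> bObj A" and r': "r \<in> hom A a (fobj \<Phi> x)" and Px: "fobj \<Phi> x \<in> Obj A"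
    using Phi.fobj_in by auto
  have sa: "(single a :: ('u, 'o) bobj) \<in> bObj A" "(single x :: ('u, ('u, 'o) bobj) bobj) \<in> bObj bA" using a x by (auto simp: single_in)
  have s: "bsingle a x r \<in> bset (PEl R) (single a :: ('u, 'o) bobj) (single x)" using r by (rule bsingle_in)
  have rs: "retgt (bmap (fobj \<Phi>) (single x :: ('u, ('u, 'o) bobj) bobj)) (bsingle a x r) = bsingle a (fobj \<Phi> x) r"
    by (simp add: bmap_single bsingle_def retgt_bel_of)
  have b: "bsingle a (fobj \<Phi> x) r \<in> hom bA (single a) (bmap (fobj \<Phi>) (single x))"
    using sa r' a Px by (simp add: bmap_single hom_bcat single_in bsingle_in)
  note mh = mult_hom[OF sa(2), unfolded bmap_single]
  note lh = Phi.farr_in[OF lunit_in[OF A.category_axioms x']]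
  have "PAct R (Ide A a) (lunit A x) (delta L a (lunitor L a a (Ide A a)) (bsingle a x r)) =
      farr \<Phi> (lunit A x) \<odot>\<^bsub>A\<^esub> m (single x) \<odot>\<^bsub>A\<^esub> (farr \<Phi> (bsingle a (fobj \<Phi> x) r) \<odot>\<^bsub>A\<^esub> \<upsilon> a)"
    using delta_rep(1)[OF unit_hom[OF a] sa s] lunitor_simp[OF A.Ide_in[OF a]]
      homD[OF unit_hom[OF a]] homD[OF b] homD[OF mh] homD[OF lh]
    by (simp add: rs[unfolded bmap_single] A.cat_simps Phi.functor_simps bmap_single)
  \<comment> \<open>Naturality of \<upsilon> at r brings r to the right end, so that the unit axiom
    at x applies to the rest.\<close>
  also have "farr \<Phi> (bsingle a (fobj \<Phi> x) r) \<odot>\<^bsub>A\<^esub> \<upsilon> a = \<upsilon> (fobj \<Phi> x) \<odot>\<^bsub>A\<^esub> r"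
    using unit_natural[OF r'] by simp
  also have "farr \<Phi> (lunit A x) \<odot>\<^bsub>A\<^esub> m (single x) \<odot>\<^bsub>A\<^esub> (\<upsilon> (fobj \<Phi> x) \<odot>\<^bsub>A\<^esub> r) =
      (farr \<Phi> (lunit A x) \<odot>\<^bsub>A\<^esub> m (single x) \<odot>\<^bsub>A\<^esub> \<upsilon> (fobj \<Phi> x)) \<odot>\<^bsub>A\<^esub> r"
    using homD[OF unit_hom[OF Px]] homD[OF mh] homD[OF lh] homD[OF r'] by (simp add: A.cat_simps)
  also have "\<dots> = r" unfolding unit_ax1[OF x'] using r' by (rule A.Ide_Comp)
  finally show "PAct R (Ide A a) (lunit A x) (delta L a (lunitor L a a (Ide A a)) (bsingle a x r)) = r" .
next
  fix a x r assume a: "a \<in> Obj A" and x: "x \<in> Obj bA" and r: "r \<in> PEl R a x"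
  then have x': "x \<in> bObj A" and r': "r \<in> hom A a (fobj \<Phi> x)" by auto
  let ?s = "bel_of x (bmap single x :: ('u, ('u, 'o) bobj) bobj) id (\<lambda>z. lunitor L (val x z) (val x z) (Ide A (val x z)))"
  have v: "val x z \<in> Obj A" if "z \<in> idx x" for z using bObjD(2)[OF x' that] .
  have bs: "bmap single x \<in> bObj bA" by (rule bmap_in[OF x']) (simp add: single_in)
  have s: "?s \<in> bset (PEl R) x (bmap single x)"
    by (rule bsetI) (use lunitor_simp[OF A.Ide_in] v unit_hom A.Comp_Ide[OF unit_hom] in auto)
  \<comment> \<open>The tuple of units \<Gamma>(id), read as a morphism into
    \<beta>\<Phi>(\<beta>\<eta> x), is the component of \<beta>\<upsilon> at x.\<close>
  have rs: "retgt (bmap (fobj \<Phi>) (bmap single x)) ?s = bnt (fid A) \<Phi>\<eta> \<upsilon> x"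
  proof -
    have 1: "bmap (fobj \<Phi>\<eta>) x = bmap (fobj \<Phi>) (bmap single x)" using bmap_fcomp[OF x', of \<Phi> "bunit A"] by simp
    show ?thesis unfolding bnt_def bmap_fid[OF x'] 1
      by (subst retgt_bel_of) (use bObjD(1)[OF x'] lunitor_simp[OF A.Ide_in] v A.Comp_Ide[OF unit_hom] in
          \<open>auto intro!: bel_of_cong\<close>)
  qed
  have b: "bnt (fid A) \<Phi>\<eta> \<upsilon> x \<in> hom bA x (bmap (fobj \<Phi>) (bmap single x))"
    unfolding rs[symmetric] by (rule retgt_in[OF x' bs s])
  have "PAct R (Ide A a) (runit A x) (delta L a r ?s) =
     (farr \<Phi> (runit A x) \<odot>\<^bsub>A\<^esub> m (bmap single x) \<odot>\<^bsub>A\<^esub> farr \<Phi> (bnt (fid A) \<Phi>\<eta> \<upsilon> x)) \<odot>\<^bsub>A\<^esub> r"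
    using delta_rep(1)[OF r' x' bs s] homD[OF b] homD[OF r'] homD[OF mult_hom[OF bs]]
      homD[OF runit_in[OF A.category_axioms x']]
    by (simp add: rs A.cat_simps Phi.functor_simps)
  also have "\<dots> = r" unfolding unit_ax2[OF x'] using r' by (rule A.Ide_Comp)
  finally show "PAct R (Ide A a) (runit A x) (delta L a r ?s) = r" .
next
  fix a x Y Z r s t assume "x \<in> Obj bA" "Y \<in> Obj bbA" "Z \<in> Obj (bcat bbA)"
    "r \<in> PEl R a x" "s \<in> PEl (bprof R) x Y" "t \<in> PEl (bprof (bprof R)) Y Z"
  then show "PAct R (Ide A a) (bassoc A Z) (delta L a (delta L a r s) (bmu_el t)) =
        delta L a r (retgt (bmap bmu_obj Z) (bprof_map (lmult L) (compositor bbA bA A R (bprof R) s t)))"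
    by (intro delta_assoc) auto
qed (rule A.category_axioms loc_small small_profunctor_R lunitor_nat lmult_nat)+

end

section \<open>The structure maps of a lax algebra\<close>

locale lax_alg =
  fixes L :: "('u :: universe, 'o, 'm, 'e) lax"
  assumes lax_algebra: "lax_algebra L"
begin

abbreviation "A \<equiv> lcat L"
abbreviation "bA \<equiv> bcat A :: (('u, 'o) bobj, ('u, 'o, 'o, 'm) bel) cat"
abbreviation "bbA \<equiv> bcat bA :: (('u, ('u, 'o) bobj) bobj, _) cat"
abbreviation "F \<equiv> lprof L"

lemmas axs = lax_algebra[unfolded lax_algebra_def Let_def]

sublocale A: category A using axs by blast
sublocale bA: category bA by (rule category_bcat) (rule A.category_axioms)
sublocale bbA: category bbA by (rule category_bcat) (rule bA.category_axioms)

sublocale F: pre_prof bA A F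
proof -
  have "profunctor TYPE('u) bA A F" using axs by (simp add: small_profunctor_def)
  then show "pre_prof bA A F"
    by (rule pre_prof_profunctor[OF bA.category_axioms A.category_axioms])
qed

sublocale bF: pre_prof bbA bA "bprof F"
  by (rule pre_prof_bprof) (rule F.pre_prof_axioms)

sublocale K: coend bbA bA A F "bprof F" ..

lemma unit_prof_nat: "prof_nat A A (hom_prof A) (pull_prof F (fid A) (bunit A)) (lunitor L)"
  using axs by blast

lemma mult_prof_nat: "prof_nat bbA A (prof_comp bbA bA A F (bprof F)) (pull_prof F (fid A) bmu) (lmult L)"
  using axs by blast

lemma unit_in: "h \<in> hom A a b \<Longrightarrow> lunitor L a b h \<in> PEl F a (single b)"
  using prof_natD(1)[OF unit_prof_nat, of a b h] A.hom_Obj[of h a b] by (simp add: fid_simps)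

lemma unit_natural:
  assumes "f \<in> hom A a' a" "g \<in> hom A b b'" "h \<in> hom A a b"
  shows "lunitor L a' b' (g \<odot>\<^bsub>A\<^esub> h \<odot>\<^bsub>A\<^esub> f) = PAct F f (bsingle b b' g) (lunitor L a b h)"
  using prof_natD(2)[OF unit_prof_nat assms(1,2), of h] assms(3) homD[OF assms(1)] homD[OF assms(2)]
  by (simp add: fid_simps)

lemma delta_cl: "s \<in> bset (PEl F) x Y \<Longrightarrow> delta L a r s = lmult L a Y (K.cl a Y (x, r, s))"
  by (simp add: delta_def bset_src_tgt)

lemma delta_in:
  assumes "a \<in> Obj A" "x \<in> bObj A" "Y \<in> bObj bA" "r \<in> PEl F a x" "s \<in> bset (PEl F) x Y"
  shows "delta L a r s \<in> PEl F a (bmu_obj Y)"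
  using prof_natD(1)[OF mult_prof_nat, of a Y "K.cl a Y (x, r, s)"] assms
  by (auto simp: delta_cl K.PEl_prof_comp fid_simps)

text \<open>Naturality of \<Delta> rewritten for pairs, by evaluating the action on the coend at the
  representative (x, r, s).\<close>

lemma delta_act:
  assumes f: "f \<in> hom A a' a" and v: "v \<in> hom bbA Y Y'" and x: "x \<in> bObj A"
    and r: "r \<in> PEl F a x" and s: "s \<in> bset (PEl F) x Y"
  shows "delta L a' (PAct F f (Ide bA x) r) (PAct (bprof F) (Ide bA x) v s) = PAct F f (bmu_el v) (delta L a r s)"
proof -
  have k: "K.cl a Y (x, r, s) \<in> PEl (prof_comp bbA bA A F (bprof F)) a Y"
    using x r s by (auto simp: K.PEl_prof_comp)
  have s': "PAct (bprof F) (Ide bA x) v s \<in> bset (PEl F) x Y'"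
    using bF.act_right_in[OF v, of x s] x s by simp
  show ?thesis
    using prof_natD(2)[OF mult_prof_nat f v k] K.act_prof_comp[OF f v, of x r s] homD[OF f] x r s
    unfolding delta_cl[OF s] delta_cl[OF s'] by (simp add: fid_simps)
qed

lemma delta_left:
  assumes f: "f \<in> hom A a' a" and x: "x \<in> bObj A" and Y: "Y \<in> bObj bA"
    and r: "r \<in> PEl F a x" and s: "s \<in> bset (PEl F) x Y"
  shows "delta L a' (PAct F f (Ide bA x) r) s = PAct F f (Ide bA (bmu_obj Y)) (delta L a r s)"
proof -
  \<comment> \<open>Restricting naturality to the left action puts the identity of Y in the place of
    v, and \<mu> has to turn it into an identity.\<close>
  have "bmu_el (Ide bbA Y) = Ide bA (bmu_obj Y)"
  proof -
    have "bmu_el (bel_of Y Y id (\<lambda>y. bel_of (val Y y) (val Y y) id (\<lambda>w. Ide A (val (val Y y) w)))) =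
        Ide bA (bmu_obj Y)"
      unfolding bmu_el_bel_of bcat_simps(4)
      by (rule bel_of_cong[OF bObjD(1)[OF bmu_obj_in[OF Y]]]) (auto simp: bmu_obj_simps)
    then show ?thesis by simp
  qed
  moreover have "PAct (bprof F) (Ide bA x) (Ide bbA Y) s = s"
    using bF.act_Ide[of x Y s] x Y s by simp
  ultimately show ?thesis
    using delta_act[OF f bbA.Ide_in x r s] Y by simp
qed

lemma delta_right:
  assumes a: "a \<in> Obj A" and v: "v \<in> hom bbA Y Y'" and x: "x \<in> bObj A"
    and r: "r \<in> PEl F a x" and s: "s \<in> bset (PEl F) x Y"
  shows "delta L a r (PAct (bprof F) (Ide bA x) v s) = PAct F (Ide A a) (bmu_el v) (delta L a r s)"
  using delta_act[OF A.Ide_in[OF a] v x r s] F.act_Ide[OF a _ r] x by simp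

text \<open>The two pairs are related by a generator of the coend, so \<Delta> receives the same
  class.\<close>

lemma delta_coend:
  assumes u: "u \<in> hom bA x x'" and r: "r \<in> PEl F a x" and s: "s \<in> bset (PEl F) x' Y" and Y: "Y \<in> bObj bA"
  shows "delta L a (PAct F (Ide A a) u r) s = delta L a r (PAct (bprof F) u (Ide bbA Y) s)"
proof -
  have s': "PAct (bprof F) u (Ide bbA Y) s \<in> bset (PEl F) x Y"
    using bF.act_left_in[OF u, of Y s] Y s by simp
  show ?thesis
    unfolding delta_cl[OF s] delta_cl[OF s'] using K.cl_rel[OF u r, of s Y] s by simp
qed

lemma ax1: "a \<in> Obj A \<Longrightarrow> x \<in> bObj A \<Longrightarrow> r \<in> PEl F a x \<Longrightarrow>
    PAct F (Ide A a) (lunit A x) (delta L a (lunitor L a a (Ide A a)) (bsingle a x r)) = r"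
  using axs by simp

lemma ax2: "a \<in> Obj A \<Longrightarrow> x \<in> bObj A \<Longrightarrow> r \<in> PEl F a x \<Longrightarrow>
    PAct F (Ide A a) (runit A x) (delta L a r
      (bel_of x (bmap single x) id (\<lambda>z. lunitor L (val x z) (val x z) (Ide A (val x z))))) = r"
  using axs by simp

lemma ax3: "a \<in> Obj A \<Longrightarrow> x \<in> bObj A \<Longrightarrow> Y \<in> bObj bA \<Longrightarrow> Z \<in> bObj bbA \<Longrightarrow>
    r \<in> PEl F a x \<Longrightarrow> s \<in> bset (PEl F) x Y \<Longrightarrow> t \<in> bset (bset (PEl F)) Y Z \<Longrightarrow>
    PAct F (Ide A a) (bassoc A Z) (delta L a (delta L a r s) (bmu_el t)) =
        delta L a r (retgt (bmap bmu_obj Z)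
          (bprof_map (lmult L) (compositor bbA bA A F (bprof F) s t)))"
  using axs by simp

end

section \<open>Two-categories whose 2-cells are natural transformations\<close>

text \<open>Both 2-categories have functors with extra structure as 1-cells and certain natural
  transformations as 2-cells, composed by the same formulas. The laws of 2-cells are therefore those
  of natural transformations. The assumptions collect what depends on the case: closure of the
  2-cells under composition, and the laws of 1-cells.\<close>

locale cell_two =
  fixes Os :: "'a set" and cat :: "'a \<Rightarrow> ('o, 'm) cat" and und :: "'f \<Rightarrow> ('o, 'm, 'o, 'm) func"
    and one :: "'a \<Rightarrow> 'a \<Rightarrow> 'f \<Rightarrow> bool" and two :: "'a \<Rightarrow> 'a \<Rightarrow> 'f \<Rightarrow> 'f \<Rightarrow> ('o \<Rightarrow> 'm) \<Rightarrow> bool"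
    and idn :: "'a \<Rightarrow> 'f" and cmp :: "'a \<Rightarrow> 'a \<Rightarrow> 'a \<Rightarrow> 'f \<Rightarrow> 'f \<Rightarrow> 'f"
  assumes cat: "P \<in> Os \<Longrightarrow> category (cat P)"
    and one_ext: "P \<in> Os \<Longrightarrow> Q \<in> Os \<Longrightarrow> one P Q F \<Longrightarrow> ext_functor (cat P) (cat Q) (und F)"
    and two_nat: "P \<in> Os \<Longrightarrow> Q \<in> Os \<Longrightarrow> two P Q F G \<sigma> \<Longrightarrow> nat_trans (cat P) (cat Q) (und F) (und G) \<sigma>"
    and two_id: "P \<in> Os \<Longrightarrow> Q \<in> Os \<Longrightarrow> one P Q F \<Longrightarrow>
      two P Q F F (restrict (\<lambda>a. Ide (cat Q) (fobj (und F) a)) (Obj (cat P)))"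
    and two_vcomp: "P \<in> Os \<Longrightarrow> Q \<in> Os \<Longrightarrow> one P Q F \<Longrightarrow> one P Q G \<Longrightarrow> one P Q H \<Longrightarrow>
      two P Q F G \<sigma> \<Longrightarrow> two P Q G H \<tau> \<Longrightarrow>
      two P Q F H (restrict (\<lambda>a. \<tau> a \<odot>\<^bsub>cat Q\<^esub> \<sigma> a) (Obj (cat P)))"
    and two_hcomp: "P \<in> Os \<Longrightarrow> Q \<in> Os \<Longrightarrow> R \<in> Os \<Longrightarrow> one P Q F \<Longrightarrow> one P Q F' \<Longrightarrow> one Q R G \<Longrightarrow> one Q R G' \<Longrightarrow>
      two P Q F F' \<sigma> \<Longrightarrow> two Q R G G' \<tau> \<Longrightarrow>
      two P R (cmp P Q R G F) (cmp P Q R G' F') (cell_hcomp (cat P) (cat R) (und F') (und G) \<tau> \<sigma>)"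
    and one_id: "P \<in> Os \<Longrightarrow> one P P (idn P)"
    and one_cmp: "P \<in> Os \<Longrightarrow> Q \<in> Os \<Longrightarrow> R \<in> Os \<Longrightarrow> one P Q F \<Longrightarrow> one Q R G \<Longrightarrow> one P R (cmp P Q R G F)"
    and und_id: "und (idn P) = fid (cat P)"
    and und_cmp: "und (cmp P Q R G F) = fcomp (cat P) (und G) (und F)"
    and cmp_id: "P \<in> Os \<Longrightarrow> Q \<in> Os \<Longrightarrow> one P Q F \<Longrightarrow> cmp P P Q F (idn P) = F"
      "P \<in> Os \<Longrightarrow> Q \<in> Os \<Longrightarrow> one P Q F \<Longrightarrow> cmp P Q Q (idn Q) F = F"
    and cmp_assoc: "P \<in> Os \<Longrightarrow> Q \<in> Os \<Longrightarrow> R \<in> Os \<Longrightarrow> S \<in> Os \<Longrightarrow> one P Q F \<Longrightarrow> one Q R G \<Longrightarrow> one R S H \<Longrightarrow>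
      cmp P Q S (cmp Q R S H G) F = cmp P R S H (cmp P Q R G F)"
begin

definition T where "T = \<lparr>Ob = Os,
  HOM = (\<lambda>P Q. cell_cat (cat P) (cat Q) und (one P Q) (two P Q)),
  Id1 = idn,
  HC = (\<lambda>P Q R. \<lparr>fobj = (\<lambda>(G, F). cmp P Q R G F),
       farr = (\<lambda>((G, G', \<tau>), (F, F', \<sigma>)). (cmp P Q R G F, cmp P Q R G' F',
         cell_hcomp (cat P) (cat R) (und F') (und G) \<tau> \<sigma>))\<rparr>)\<rparr>"

abbreviation hm where "hm P Q \<equiv> cell_cat (cat P) (cat Q) und (one P Q) (two P Q)"

lemma hm_simps:
  "Obj (hm P Q) = {F. one P Q F}"
  "Arr (hm P Q) = {(F, G, \<sigma>). one P Q F \<and> one P Q G \<and> two P Q F G \<sigma>}"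
  "Dom (hm P Q) (F, G, \<sigma>) = F" "Cod (hm P Q) (F, G, \<sigma>) = G"
  "Ide (hm P Q) F = (F, F, restrict (\<lambda>a. Ide (cat Q) (fobj (und F) a)) (Obj (cat P)))"
  "(F', G', \<tau>) \<odot>\<^bsub>hm P Q\<^esub> (F, G, \<sigma>) = (F, G', restrict (\<lambda>a. \<tau> a \<odot>\<^bsub>cat Q\<^esub> \<sigma> a) (Obj (cat P)))"
  by (simp_all add: cell_cat_def)

lemma two_nat':
  assumes "P \<in> Os" "Q \<in> Os" "two P Q F G \<sigma>"
  shows "a \<in> Obj (cat P) \<Longrightarrow> \<sigma> a \<in> hom (cat Q) (fobj (und F) a) (fobj (und G) a)"
    "\<sigma> \<in> extensional (Obj (cat P))"
    "f \<in> hom (cat P) a b \<Longrightarrow> \<sigma> b \<odot>\<^bsub>cat Q\<^esub> farr (und F) f = farr (und G) f \<odot>\<^bsub>cat Q\<^esub> \<sigma> a"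
  using nat_transD[OF two_nat[OF assms]] by auto

lemma one_functor: "P \<in> Os \<Longrightarrow> Q \<in> Os \<Longrightarrow> one P Q F \<Longrightarrow> is_functor (cat P) (cat Q) (und F)"
  using one_ext by (simp add: ext_functor_def)

lemma hm_hom: "s \<in> hom (hm P Q) F G \<longleftrightarrow> (\<exists>\<sigma>. s = (F, G, \<sigma>) \<and> one P Q F \<and> one P Q G \<and> two P Q F G \<sigma>)"
  by (auto simp: hom_def hm_simps)

lemma category_hm:
  assumes P: "P \<in> Os" and Q: "Q \<in> Os"
  shows "category (hm P Q)"
proof -
  interpret Q: category "cat Q" by (rule cat[OF Q])
  show ?thesis
  proof
    fix f F G assume "f \<in> hom (hm P Q) F G"
    then obtain \<sigma> where f: "f = (F, G, \<sigma>)" "two P Q F G \<sigma>" by (auto simp: hm_hom)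
    note \<sigma> = two_nat'[OF P Q f(2)]
    show "f \<odot>\<^bsub>hm P Q\<^esub> Ide (hm P Q) F = f" "Ide (hm P Q) G \<odot>\<^bsub>hm P Q\<^esub> f = f"
      using \<sigma>(2) Q.Comp_Ide[OF \<sigma>(1)] Q.Ide_Comp[OF \<sigma>(1)]
      by (auto simp: f hm_simps intro!: restrict_eqI)
  next
    fix h H K g G f F assume "h \<in> hom (hm P Q) H K" "g \<in> hom (hm P Q) G H" "f \<in> hom (hm P Q) F G"
    then obtain \<sigma> \<tau> \<upsilon> where *: "h = (H, K, \<upsilon>)" "g = (G, H, \<tau>)" "f = (F, G, \<sigma>)"
      "two P Q F G \<sigma>" "two P Q G H \<tau>" "two P Q H K \<upsilon>" by (auto simp: hm_hom)
    show "(h \<odot>\<^bsub>hm P Q\<^esub> g) \<odot>\<^bsub>hm P Q\<^esub> f = h \<odot>\<^bsub>hm P Q\<^esub> g \<odot>\<^bsub>hm P Q\<^esub> f"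
      using Q.Comp_assoc[OF two_nat'(1)[OF P Q *(6)] two_nat'(1)[OF P Q *(5)] two_nat'(1)[OF P Q *(4)]]
      by (auto simp: * hm_simps intro!: restrict_ext)
  next
    fix g G H f F assume "g \<in> hom (hm P Q) G H" "f \<in> hom (hm P Q) F G"
    then show "g \<odot>\<^bsub>hm P Q\<^esub> f \<in> hom (hm P Q) F H"
      by (auto simp: hm_hom hm_simps two_vcomp[OF P Q])
  next
    fix F assume "F \<in> Obj (hm P Q)"
    then show "Ide (hm P Q) F \<in> hom (hm P Q) F F"
      by (auto simp: hm_hom hm_simps two_id[OF P Q])
  qed (auto simp: hm_simps)
qed

lemma HC_functor:
  assumes P: "P \<in> Os" and Q: "Q \<in> Os" and R: "R \<in> Os"
  shows "is_functor (prod_cat (hm Q R) (hm P Q)) (hm P R) (HC T P Q R)"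
proof -
  interpret P: category "cat P" by (rule cat[OF P])
  interpret Q: category "cat Q" by (rule cat[OF Q])
  interpret R: category "cat R" by (rule cat[OF R])
  have hom: "s \<in> hom (prod_cat (hm Q R) (hm P Q)) X Y \<longleftrightarrow>
     (\<exists>G F G' F' \<sigma> \<tau>. s = ((G, G', \<tau>), (F, F', \<sigma>)) \<and> X = (G, F) \<and> Y = (G', F') \<and>
      one Q R G \<and> one Q R G' \<and> one P Q F \<and> one P Q F' \<and> two P Q F F' \<sigma> \<and> two Q R G G' \<tau>)" for s X Y
    by (auto simp: hom_def prod_cat_def hm_simps)
  show ?thesis
  proof
    fix X assume "X \<in> Obj (prod_cat (hm Q R) (hm P Q))"
    then obtain G F where X: "X = (G, F)" "one Q R G" "one P Q F" by (auto simp: prod_cat_def hm_simps)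
    show "fobj (HC T P Q R) X \<in> Obj (hm P R)"
      using X one_cmp[OF P Q R] by (simp add: T_def hm_simps)
    interpret F: is_functor "cat P" "cat Q" "und F" using one_functor X P Q by blast
    interpret G: is_functor "cat Q" "cat R" "und G" using one_functor X R Q by blast
    show "farr (HC T P Q R) (Ide (prod_cat (hm Q R) (hm P Q)) X) = Ide (hm P R) (fobj (HC T P Q R) X)"
      using X by (auto simp: T_def prod_cat_def hm_simps cell_hcomp_def und_cmp fcomp_simps
          F.functor_simps G.functor_simps R.cat_simps intro!: restrict_ext)
  next
    fix s X Y assume "s \<in> hom (prod_cat (hm Q R) (hm P Q)) X Y"
    then show "farr (HC T P Q R) s \<in> hom (hm P R) (fobj (HC T P Q R) X) (fobj (HC T P Q R) Y)"
      by (auto simp: hom hm_hom T_def one_cmp[OF P Q R] two_hcomp[OF P Q R])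
  next
    fix t Y Z s X
    assume "t \<in> hom (prod_cat (hm Q R) (hm P Q)) Y Z" "s \<in> hom (prod_cat (hm Q R) (hm P Q)) X Y"
    then obtain G F G' F' G'' F'' \<sigma> \<tau> \<sigma>' \<tau>' where s: "s = ((G, G', \<tau>), (F, F', \<sigma>))"
      and t: "t = ((G', G'', \<tau>'), (F', F'', \<sigma>'))"
      and one: "one Q R G" "one Q R G'" "one Q R G''" "one P Q F" "one P Q F'" "one P Q F''"
      and two: "two P Q F F' \<sigma>" "two P Q F' F'' \<sigma>'" "two Q R G G' \<tau>" "two Q R G' G'' \<tau>'"
      by (auto simp: hom)
    interpret F': is_functor "cat P" "cat Q" "und F'" using one_functor one P Q by blast
    interpret F'': is_functor "cat P" "cat Q" "und F''" using one_functor one P Q by blast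
    interpret G: is_functor "cat Q" "cat R" "und G" using one_functor one R Q by blast
    interpret G': is_functor "cat Q" "cat R" "und G'" using one_functor one R Q by blast
    have "(\<tau>' (fobj (und F'') a) \<odot>\<^bsub>cat R\<^esub> \<tau> (fobj (und F'') a)) \<odot>\<^bsub>cat R\<^esub> farr (und G) (\<sigma>' a \<odot>\<^bsub>cat Q\<^esub> \<sigma> a) =
      (\<tau>' (fobj (und F'') a) \<odot>\<^bsub>cat R\<^esub> farr (und G') (\<sigma>' a)) \<odot>\<^bsub>cat R\<^esub> (\<tau> (fobj (und F') a) \<odot>\<^bsub>cat R\<^esub> farr (und G) (\<sigma> a))"
      if a: "a \<in> Obj (cat P)" for a
    proof -
      note 1 = two_nat'(1)[OF P Q two(1) a] and 2 = two_nat'(1)[OF P Q two(2) a]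
      note 3 = two_nat'(1)[OF Q R two(3) F''.fobj_in[OF a]] and 4 = two_nat'(1)[OF Q R two(4) F''.fobj_in[OF a]]
        and 5 = two_nat'(1)[OF Q R two(3) F'.fobj_in[OF a]]
      \<comment> \<open>Interchange: the two composites differ by naturality of \<tau> at the
        component \<open>\<sigma>' a\<close>.\<close>
      have "\<tau> (fobj (und F'') a) \<odot>\<^bsub>cat R\<^esub> farr (und G) (\<sigma>' a) \<odot>\<^bsub>cat R\<^esub> farr (und G) (\<sigma> a) =
        farr (und G') (\<sigma>' a) \<odot>\<^bsub>cat R\<^esub> \<tau> (fobj (und F') a) \<odot>\<^bsub>cat R\<^esub> farr (und G) (\<sigma> a)"
        by (rule R.Comp_swap[OF two_nat'(3)[OF Q R two(3) 2] G.farr_in[OF 2] 3 5 G'.farr_in[OF 2] G.farr_in[OF 1]])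
      then show ?thesis
        using homD[OF 1] homD[OF 2] homD[OF 3] homD[OF 4] homD[OF 5]
        by (simp add: G.functor_simps G'.functor_simps R.cat_simps)
    qed
    then show "farr (HC T P Q R) (t \<odot>\<^bsub>prod_cat (hm Q R) (hm P Q)\<^esub> s) =
        farr (HC T P Q R) t \<odot>\<^bsub>hm P R\<^esub> farr (HC T P Q R) s"
      using F''.fobj_in by (auto simp: s t T_def prod_cat_def hm_simps cell_hcomp_def intro!: restrict_ext)
  qed
qed

lemma T_simps: "Ob T = Os" "HOM T P Q = hm P Q" "Id1 T = idn" "comp1 T P Q R G F = cmp P Q R G F"
  "comp2 T P Q R (G, G', \<tau>) (F, F', \<sigma>) =
    (cmp P Q R G F, cmp P Q R G' F', cell_hcomp (cat P) (cat R) (und F') (und G) \<tau> \<sigma>)"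
  by (simp_all add: T_def)

lemma two_category_T: "two_category T"
proof (rule two_category.intro; unfold T_simps)
  fix P Q F assume P: "P \<in> Os" and Q: "Q \<in> Os" and F: "F \<in> Obj (hm P Q)"
  then show "cmp P P Q F (idn P) = F \<and> cmp P Q Q (idn Q) F = F"
    using cmp_id by (simp add: hm_simps)
next
  fix P Q s assume P: "P \<in> Os" and Q: "Q \<in> Os" and "s \<in> Arr (hm P Q)"
  then obtain F F' \<sigma> where s: "s = (F, F', \<sigma>)" "one P Q F" "one P Q F'" "two P Q F F' \<sigma>"
    by (auto simp: hm_simps)
  interpret P: category "cat P" by (rule cat[OF P])
  interpret Q: category "cat Q" by (rule cat[OF Q])
  interpret F: is_functor "cat P" "cat Q" "und F" using one_functor s P Q by blast
  interpret F': is_functor "cat P" "cat Q" "und F'" using one_functor s P Q by blast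
  note \<sigma> = two_nat'[OF P Q s(4)]
  have "cell_hcomp (cat P) (cat Q) (und (idn P)) (und F) \<sigma> (restrict (\<lambda>a. Ide (cat P) (fobj (und (idn P)) a)) (Obj (cat P))) = \<sigma>"
    using \<sigma>(2) Q.Comp_Ide[OF \<sigma>(1)]
    by (auto simp: cell_hcomp_def und_id fid_simps F.functor_simps intro!: restrict_eqI)
  moreover have "cell_hcomp (cat P) (cat Q) (und F') (und (idn Q)) (restrict (\<lambda>a. Ide (cat Q) (fobj (und (idn Q)) a)) (Obj (cat Q))) \<sigma> = \<sigma>"
    using \<sigma>(2) Q.Ide_Comp[OF \<sigma>(1)] F'.fobj_in homD(1)[OF \<sigma>(1)]
    by (auto simp: cell_hcomp_def und_id fid_simps intro!: restrict_eqI)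
  ultimately show "comp2 T P P Q s (Ide (hm P P) (idn P)) = s \<and> comp2 T P Q Q (Ide (hm Q Q) (idn Q)) s = s"
    using s cmp_id[OF P Q] by (simp add: T_simps hm_simps)
next
  fix P Q R S F G H assume "P \<in> Os" "Q \<in> Os" "R \<in> Os" "S \<in> Os" "F \<in> Obj (hm P Q)" "G \<in> Obj (hm Q R)" "H \<in> Obj (hm R S)"
  then show "cmp P Q S (cmp Q R S H G) F = cmp P R S H (cmp P Q R G F)"
    using cmp_assoc by (simp add: hm_simps)
next
  fix P Q R S s t u assume P: "P \<in> Os" and Q: "Q \<in> Os" and R: "R \<in> Os" and S: "S \<in> Os"
    and "s \<in> Arr (hm P Q)" "t \<in> Arr (hm Q R)" "u \<in> Arr (hm R S)"
  then obtain F F' \<sigma> G G' \<tau> H H' \<upsilon> where s: "s = (F, F', \<sigma>)" and t: "t = (G, G', \<tau>)" and u: "u = (H, H', \<upsilon>)"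
    and one: "one P Q F" "one P Q F'" "one Q R G" "one Q R G'" "one R S H" "one R S H'"
    and two: "two P Q F F' \<sigma>" "two Q R G G' \<tau>" "two R S H H' \<upsilon>"
    by (auto simp: hm_simps)
  interpret S: category "cat S" by (rule cat[OF S])
  interpret R: category "cat R" by (rule cat[OF R])
  interpret F': is_functor "cat P" "cat Q" "und F'" using one_functor one P Q by blast
  interpret G: is_functor "cat Q" "cat R" "und G" using one_functor one R Q by blast
  interpret G': is_functor "cat Q" "cat R" "und G'" using one_functor one R Q by blast
  interpret H: is_functor "cat R" "cat S" "und H" using one_functor one R S by blast
  have "(\<upsilon> (fobj (und G') (fobj (und F') a)) \<odot>\<^bsub>cat S\<^esub> farr (und H) (\<tau> (fobj (und F') a))) \<odot>\<^bsub>cat S\<^esub>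
      farr (fcomp (cat Q) (und H) (und G)) (\<sigma> a) =
      \<upsilon> (fobj (fcomp (cat P) (und G') (und F')) a) \<odot>\<^bsub>cat S\<^esub>
      farr (und H) (\<tau> (fobj (und F') a) \<odot>\<^bsub>cat R\<^esub> farr (und G) (\<sigma> a))" if a: "a \<in> Obj (cat P)" for a
  proof -
    note 1 = two_nat'(1)[OF P Q two(1) a] and 2 = two_nat'(1)[OF Q R two(2) F'.fobj_in[OF a]]
      and 3 = two_nat'(1)[OF R S two(3) G'.fobj_in[OF F'.fobj_in[OF a]]]
    show ?thesis
      using homD[OF 1] homD[OF 2] homD[OF 3] a
      by (simp add: fcomp_simps H.functor_simps G.functor_simps S.cat_simps)
  qed
  then show "comp2 T P Q S (comp2 T Q R S u t) s = comp2 T P R S u (comp2 T P Q R t s)"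
    using cmp_assoc[OF P Q R S] one F'.fobj_in
    by (auto simp: s t u T_simps und_cmp cell_hcomp_def intro!: restrict_ext)
qed (auto simp: category_hm HC_functor hm_simps one_id)

end

section \<open>The 2-category of ultraconvergence spaces\<close>

lemma theta_push_bel_of:
  "theta_push f \<Theta> (bel_of x Y t \<zeta>) =
    bel_of (bmap (fobj f) x) (bmap (bmap (fobj f)) Y) t (\<lambda>y. \<Theta> (val x (t y)) (val Y y) (\<zeta> y))"
proof -
  have "\<forall>\<^sub>F y in ult Y. rmap (bel_of x Y t \<zeta>) y = t y \<and> rcmp (bel_of x Y t \<zeta>) y = \<zeta> y"
    by (rule rep_bel_of)
  then show ?thesis
    unfolding theta_push_def by (auto simp: bel_of_eq_iff elim!: eventually_mono)
qed

lemma theta_ext: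
  assumes "\<Theta> \<in> (\<Pi>\<^sub>E a \<in> S. \<Pi>\<^sub>E x \<in> T. E a x \<rightarrow>\<^sub>E G a x)" "\<Theta>' \<in> (\<Pi>\<^sub>E a \<in> S. \<Pi>\<^sub>E x \<in> T. E a x \<rightarrow>\<^sub>E G' a x)"
    and "\<And>a x r. a \<in> S \<Longrightarrow> x \<in> T \<Longrightarrow> r \<in> E a x \<Longrightarrow> \<Theta> a x r = \<Theta>' a x r"
  shows "\<Theta> = \<Theta>'"
proof (rule extensionalityI[of _ S])
  show "\<Theta> \<in> extensional S" "\<Theta>' \<in> extensional S" using assms(1,2) by (auto simp: PiE_iff)
  fix a assume a: "a \<in> S"
  show "\<Theta> a = \<Theta>' a"
  proof (rule extensionalityI[of _ T])
    show "\<Theta> a \<in> extensional T" "\<Theta>' a \<in> extensional T" using a assms(1,2) by (auto simp: PiE_iff)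
    fix x assume x: "x \<in> T"
    show "\<Theta> a x = \<Theta>' a x"
    proof (rule extensionalityI[of _ "E a x"])
      show "\<Theta> a x \<in> extensional (E a x)" "\<Theta>' a x \<in> extensional (E a x)"
        using a x assms(1,2) by (auto simp: PiE_iff)
    qed (use assms(3) a x in auto)
  qed
qed

section \<open>Morphisms of lax algebras: identities and composites\<close>

locale rcolax_mor = L: lax_alg L + M: lax_alg M
  for L M :: "('u :: universe, 'o, 'm, 'e) lax" +
  fixes F :: "('u, 'o, 'm, 'e) rcolax"
  assumes mor: "rcolax_morphism L M F"
begin

abbreviation "f \<equiv> rfun F"
abbreviation "\<Theta> \<equiv> rnat F"

lemmas mor' = mor[unfolded rcolax_morphism_def Let_def]

lemma ext: "ext_functor L.A M.A f" using mor' by blast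

sublocale f: is_functor L.A M.A f using ext by (simp add: ext_functor_def)
sublocale bf: is_functor L.bA M.bA "bfun f" by (rule is_functor_bfun) (rule f.is_functor_axioms)

lemma theta_prof_nat: "prof_nat L.bA L.A L.F (pull_prof M.F f (bfun f)) \<Theta>" using mor' by blast

lemma bf_obj: "x \<in> bObj L.A \<Longrightarrow> bmap (fobj f) x \<in> bObj M.A"
  by (rule is_functor_obj_bObj) (rule f.is_functor_axioms)

lemma bbf_obj: "Y \<in> bObj L.bA \<Longrightarrow> bmap (bmap (fobj f)) Y \<in> bObj M.bA"
  by (rule bmap_in) (auto simp: bf_obj)

lemma theta_in: "a \<in> Obj L.A \<Longrightarrow> x \<in> bObj L.A \<Longrightarrow> r \<in> PEl L.F a x \<Longrightarrow> \<Theta> a x r \<in> PEl M.F (fobj f a) (bmap (fobj f) x)"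
  using prof_natD(1)[OF theta_prof_nat, of a x r] by simp

lemma theta_nat: "h \<in> hom L.A a' a \<Longrightarrow> v \<in> hom L.bA x x' \<Longrightarrow> r \<in> PEl L.F a x \<Longrightarrow>
    \<Theta> a' x' (PAct L.F h v r) = PAct M.F (farr f h) (farr (bfun f) v) (\<Theta> a x r)"
  using prof_natD(2)[OF theta_prof_nat, of h a' a v x x' r] by simp

lemma theta_ext_in: "\<Theta> \<in> (\<Pi>\<^sub>E a \<in> Obj L.A. \<Pi>\<^sub>E x \<in> bObj L.A. PEl L.F a x \<rightarrow>\<^sub>E PEl M.F (fobj f a) (bmap (fobj f) x))"
  using prof_natD(3)[OF theta_prof_nat] by simp

lemma theta_left: "h \<in> hom L.A a' a \<Longrightarrow> x \<in> bObj L.A \<Longrightarrow> r \<in> PEl L.F a x \<Longrightarrow>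
    \<Theta> a' x (PAct L.F h (Ide L.bA x) r) = PAct M.F (farr f h) (Ide M.bA (bmap (fobj f) x)) (\<Theta> a x r)"
  using theta_nat[OF _ L.bA.Ide_in, of h a' a x r] bf.farr_Ide[of x] by simp

lemma theta_right: "a \<in> Obj L.A \<Longrightarrow> v \<in> hom L.bA x x' \<Longrightarrow> r \<in> PEl L.F a x \<Longrightarrow>
    \<Theta> a x' (PAct L.F (Ide L.A a) v r) = PAct M.F (Ide M.A (fobj f a)) (farr (bfun f) v) (\<Theta> a x r)"
  using theta_nat[OF L.A.Ide_in, of a v x x' r] f.farr_Ide[of a] by simp

lemma theta_unit: "a \<in> Obj L.A \<Longrightarrow>
    \<Theta> a (single a) (lunitor L a a (Ide L.A a)) = lunitor M (fobj f a) (fobj f a) (Ide M.A (fobj f a))"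
  using mor' by simp

lemma theta_mult: "a \<in> Obj L.A \<Longrightarrow> x \<in> bObj L.A \<Longrightarrow> Y \<in> bObj L.bA \<Longrightarrow> r \<in> PEl L.F a x \<Longrightarrow> s \<in> bset (PEl L.F) x Y \<Longrightarrow>
    \<Theta> a (bmu_obj Y) (delta L a r s) = delta M (fobj f a) (\<Theta> a x r) (theta_push f \<Theta> s)"
  using mor' by simp

lemma theta_push_in:
  assumes x: "x \<in> bObj L.A" and Y: "Y \<in> bObj L.bA" and s: "s \<in> bset (PEl L.F) x Y"
  shows "theta_push f \<Theta> s \<in> bset (PEl M.F) (bmap (fobj f) x) (bmap (bmap (fobj f)) Y)"
proof -
  obtain t \<zeta> where t: "s = bel_of x Y t \<zeta>" "t \<in> idx Y \<rightarrow> idx x" "filtermap t (ult Y) = ult x"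
    "\<And>z. z \<in> idx Y \<Longrightarrow> \<zeta> z \<in> PEl L.F (val x (t z)) (val Y z)"
    using s by (rule bsetE) blast
  have "\<Theta> (val x (t z)) (val Y z) (\<zeta> z) \<in> PEl M.F (fobj f (val x (t z))) (bmap (fobj f) (val Y z))" if "z \<in> idx Y" for z
    using theta_in[OF bObjD(2)[OF x] _ t(4)[OF that]] bObjD(2)[OF Y that] t(2) that by auto
  then show ?thesis
    unfolding t(1) theta_push_bel_of using t(2,3) by (intro bsetI) (auto simp: Pi_iff)
qed

end

lemma rcolax_morphismI:
  assumes "ext_functor (lcat L) (lcat M) (rfun F)"
    and "prof_nat (bcat (lcat L)) (lcat L) (lprof L) (pull_prof (lprof M) (rfun F) (bfun (rfun F))) (rnat F)"
    and "\<And>a. a \<in> Obj (lcat L) \<Longrightarrow> rnat F a (single a) (lunitor L a a (Ide (lcat L) a))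
        = lunitor M (fobj (rfun F) a) (fobj (rfun F) a) (Ide (lcat M) (fobj (rfun F) a))"
    and "\<And>a x Y r s. a \<in> Obj (lcat L) \<Longrightarrow> x \<in> bObj (lcat L) \<Longrightarrow> Y \<in> bObj (bcat (lcat L)) \<Longrightarrow>
        r \<in> PEl (lprof L) a x \<Longrightarrow> s \<in> bset (PEl (lprof L)) x Y \<Longrightarrow>
        rnat F a (bmu_obj Y) (delta L a r s) = delta M (fobj (rfun F) a) (rnat F a x r) (theta_push (rfun F) (rnat F) s)"
  shows "rcolax_morphism L M F"
  using assms by (simp add: rcolax_morphism_def Let_def)

lemma rcolax_morphism_id:
  fixes L :: "('u :: universe, 'o, 'm, 'e) lax"
  assumes "lax_algebra L"
  shows "rcolax_morphism L L (rcolax_id L)"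
proof -
  interpret L: lax_alg L by unfold_locales fact
  have f: "rfun (rcolax_id L) = fid L.A" by (simp add: rcolax_id_def)
  have th: "rnat (rcolax_id L) a x r = r" if "a \<in> Obj L.A" "x \<in> bObj L.A" "r \<in> PEl L.F a x" for a x r
    using that by (simp add: rcolax_id_def)
  show ?thesis
  proof (rule rcolax_morphismI; unfold f)
    show "ext_functor L.A L.A (fid L.A)" by (rule ext_functor_fid) (rule L.A.category_axioms)
    show "prof_nat L.bA L.A L.F (pull_prof L.F (fid L.A) (bfun (fid L.A))) (rnat (rcolax_id L))"
    proof (rule prof_natI)
      show "rnat (rcolax_id L) \<in> (\<Pi>\<^sub>E d\<in>Obj L.A. \<Pi>\<^sub>E c\<in>Obj L.bA. PEl L.F d c \<rightarrow>\<^sub>E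
          PEl (pull_prof L.F (fid L.A) (bfun (fid L.A))) d c)"
        by (auto simp: rcolax_id_def fid_simps bmap_fid)
      fix h v d' d x x' r assume h: "h \<in> hom L.A d' d" and v: "v \<in> hom L.bA x x'" and r: "r \<in> PEl L.F d x"
      then show "rnat (rcolax_id L) d' x' (PAct L.F h v r) =
          PAct (pull_prof L.F (fid L.A) (bfun (fid L.A))) h v (rnat (rcolax_id L) d x r)"
        using L.F.act_in[OF h v r] L.A.hom_Obj[OF h] L.bA.hom_Obj[OF v]
        by (simp add: th fid_simps homD[OF h] bfun_fid[OF homD(1)[OF v]])
    qed
    fix a assume a: "a \<in> Obj L.A"
    then show "rnat (rcolax_id L) a (single a) (lunitor L a a (Ide L.A a)) =
        lunitor L (fobj (fid L.A) a) (fobj (fid L.A) a) (Ide L.A (fobj (fid L.A) a))"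
      using L.unit_in[OF L.A.Ide_in[OF a]] by (simp add: th fid_simps single_in)
    fix x Y r s assume x: "x \<in> bObj L.A" and Y: "Y \<in> bObj L.bA" and r: "r \<in> PEl L.F a x" and s: "s \<in> bset (PEl L.F) x Y"
    have "theta_push (fid L.A) (rnat (rcolax_id L)) s = s"
    proof -
      obtain t \<zeta> where t: "s = bel_of x Y t \<zeta>" "t \<in> idx Y \<rightarrow> idx x"
        "\<And>z. z \<in> idx Y \<Longrightarrow> \<zeta> z \<in> PEl L.F (val x (t z)) (val Y z)"
        using s by (rule bsetE) blast
      have bb: "bmap (bmap (fobj (fid L.A))) Y = Y" by (rule bmap_ident[OF Y]) (simp add: bmap_fid)
      have "rnat (rcolax_id L) (val x (t z)) (val Y z) (\<zeta> z) = \<zeta> z" if "z \<in> idx Y" for z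
        using th[OF bObjD(2)[OF x] _ t(3)[OF that]] bObjD(2)[OF Y that] t(2) that by auto
      then show ?thesis
        unfolding t(1) theta_push_bel_of bmap_fid[OF x] bb
        using bObjD(1)[OF Y] by (intro bel_of_cong) auto
    qed
    then show "rnat (rcolax_id L) a (bmu_obj Y) (delta L a r s) =
        delta L (fobj (fid L.A) a) (rnat (rcolax_id L) a x r) (theta_push (fid L.A) (rnat (rcolax_id L)) s)"
      using a x Y r s by (simp add: th L.delta_in bmu_obj_in fid_simps)
  qed
qed

lemma rcolax_morphism_comp:
  fixes L M N :: "('u :: universe, 'o, 'm, 'e) lax"
  assumes alg: "lax_algebra L" "lax_algebra M" "lax_algebra N"
    and F: "rcolax_morphism L M F" and G: "rcolax_morphism M N G"
  shows "rcolax_morphism L N (rcolax_comp L G F)"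
proof -
  interpret F: rcolax_mor L M F by (unfold_locales) fact+
  interpret G: rcolax_mor M N G by (unfold_locales) fact+
  let ?H = "rcolax_comp L G F"
  have f: "rfun ?H = fcomp F.L.A G.f F.f" by (simp add: rcolax_comp_def)
  have th: "rnat ?H a x r = rnat G (fobj F.f a) (bmap (fobj F.f) x) (rnat F a x r)"
    if "a \<in> Obj F.L.A" "x \<in> bObj F.L.A" "r \<in> PEl F.L.F a x" for a x r
    using that by (simp add: rcolax_comp_def)
  show ?thesis
  proof (rule rcolax_morphismI; unfold f)
    show "ext_functor F.L.A G.M.A (fcomp F.L.A G.f F.f)"
      by (rule ext_functor_fcomp[OF F.L.A.category_axioms F.ext G.ext])
    show "prof_nat F.L.bA F.L.A F.L.F (pull_prof G.M.F (fcomp F.L.A G.f F.f) (bfun (fcomp F.L.A G.f F.f))) (rnat ?H)"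
    proof (rule prof_natI)
      show "rnat ?H \<in> (\<Pi>\<^sub>E d\<in>Obj F.L.A. \<Pi>\<^sub>E c\<in>Obj F.L.bA. PEl F.L.F d c \<rightarrow>\<^sub>E
          PEl (pull_prof G.M.F (fcomp F.L.A G.f F.f) (bfun (fcomp F.L.A G.f F.f))) d c)"
        by (auto simp: rcolax_comp_def fcomp_simps bmap_fcomp F.theta_in F.f.fobj_in F.bf_obj G.theta_in)
      fix h v d' d x x' r assume h: "h \<in> hom F.L.A d' d" and v: "v \<in> hom F.L.bA x x'" and r: "r \<in> PEl F.L.F d x"
      have o: "d \<in> Obj F.L.A" "d' \<in> Obj F.L.A" "x \<in> bObj F.L.A" "x' \<in> bObj F.L.A"
        using F.L.A.hom_Obj[OF h] F.L.bA.hom_Obj[OF v] by auto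
      have v': "farr (bfun F.f) v \<in> hom F.M.bA (bmap (fobj F.f) x) (bmap (fobj F.f) x')"
        using F.bf.farr_in[OF v] by simp
      show "rnat ?H d' x' (PAct F.L.F h v r) =
          PAct (pull_prof G.M.F (fcomp F.L.A G.f F.f) (bfun (fcomp F.L.A G.f F.f))) h v (rnat ?H d x r)"
        using F.L.F.act_in[OF h v r] o r F.theta_nat[OF h v r]
          G.theta_nat[OF F.f.farr_in[OF h] v' F.theta_in[OF o(1,3) r]]
        by (simp add: th fcomp_simps homD[OF h] bfun_fcomp[OF homD(1)[OF v]])
    qed
    fix a assume a: "a \<in> Obj F.L.A"
    then show "rnat ?H a (single a) (lunitor L a a (Ide F.L.A a)) =
        lunitor N (fobj (fcomp F.L.A G.f F.f) a) (fobj (fcomp F.L.A G.f F.f) a) (Ide G.M.A (fobj (fcomp F.L.A G.f F.f) a))"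
      using F.L.unit_in[OF F.L.A.Ide_in[OF a]] F.theta_unit[OF a] G.theta_unit[OF F.f.fobj_in[OF a]]
      by (simp add: th fcomp_simps single_in bmap_single)
    fix x Y r s assume x: "x \<in> bObj F.L.A" and Y: "Y \<in> bObj F.L.bA" and r: "r \<in> PEl F.L.F a x" and s: "s \<in> bset (PEl F.L.F) x Y"
    \<comment> \<open>Applying structure maps to tuples respects composition, so the
      multiplicativity of G can be used on the tuple already pushed along F.\<close>
    have push: "theta_push (fcomp F.L.A G.f F.f) (rnat ?H) s = theta_push G.f G.\<Theta> (theta_push F.f F.\<Theta> s)"
    proof -
      obtain t \<zeta> where t: "s = bel_of x Y t \<zeta>" "t \<in> idx Y \<rightarrow> idx x"
        "\<And>z. z \<in> idx Y \<Longrightarrow> \<zeta> z \<in> PEl F.L.F (val x (t z)) (val Y z)"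
        using s by (rule bsetE) blast
      have bb: "bmap (bmap (fobj (fcomp F.L.A G.f F.f))) Y = bmap (bmap (fobj G.f)) (bmap (bmap (fobj F.f)) Y)"
        by (rule sym, rule bmap_bmap) (use bObjD(2)[OF Y] in \<open>auto simp: bmap_fcomp\<close>)
      have "rnat ?H (val x (t z)) (val Y z) (\<zeta> z) =
          rnat G (fobj F.f (val x (t z))) (bmap (fobj F.f) (val Y z)) (rnat F (val x (t z)) (val Y z) (\<zeta> z))"
        if "z \<in> idx Y" for z
        using th[OF bObjD(2)[OF x] _ t(3)[OF that]] bObjD(2)[OF Y that] t(2) that by auto
      then show ?thesis
        unfolding t(1) theta_push_bel_of bmap_fcomp[OF x] bb
        using bObjD(1)[OF Y] t(2) by (intro bel_of_cong) (auto simp: Pi_iff)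
    qed
    show "rnat ?H a (bmu_obj Y) (delta L a r s) =
        delta N (fobj (fcomp F.L.A G.f F.f) a) (rnat ?H a x r) (theta_push (fcomp F.L.A G.f F.f) (rnat ?H) s)"
      using F.theta_mult[OF a x Y r s] a x r
        G.theta_mult[OF F.f.fobj_in[OF a] F.bf_obj[OF x] F.bbf_obj[OF Y] F.theta_in[OF a x r] F.theta_push_in[OF x Y s]]
      by (simp add: push th F.L.delta_in[OF a x Y r s] bmu_obj_in[OF Y] fcomp_simps bmap_bmu_obj[OF Y])
  qed
qed

section \<open>2-cells between morphisms of lax algebras\<close>

lemma rcolax_2cellD:
  assumes "rcolax_2cell L M F G \<sigma>"
  shows "nat_trans (lcat L) (lcat M) (rfun F) (rfun G) \<sigma>"
    "a \<in> Obj (lcat L) \<Longrightarrow> x \<in> bObj (lcat L) \<Longrightarrow> r \<in> PEl (lprof L) a x \<Longrightarrow>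
      PAct (lprof M) (Ide (lcat M) (fobj (rfun F) a)) (bnt (rfun F) (rfun G) \<sigma> x) (rnat F a x r)
        = PAct (lprof M) (\<sigma> a) (Ide (bcat (lcat M)) (bmap (fobj (rfun G)) x)) (rnat G a x r)"
  using assms by (simp_all add: rcolax_2cell_def)

lemma rcolax_2cellI:
  assumes "nat_trans (lcat L) (lcat M) (rfun F) (rfun G) \<sigma>"
    "\<And>a x r. a \<in> Obj (lcat L) \<Longrightarrow> x \<in> bObj (lcat L) \<Longrightarrow> r \<in> PEl (lprof L) a x \<Longrightarrow>
      PAct (lprof M) (Ide (lcat M) (fobj (rfun F) a)) (bnt (rfun F) (rfun G) \<sigma> x) (rnat F a x r)
        = PAct (lprof M) (\<sigma> a) (Ide (bcat (lcat M)) (bmap (fobj (rfun G)) x)) (rnat G a x r)"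
  shows "rcolax_2cell L M F G \<sigma>"
  unfolding rcolax_2cell_def using assms by simp

lemma rcolax_2cell_id:
  fixes L M :: "('u :: universe, 'o, 'm, 'e) lax"
  assumes "lax_algebra L" "lax_algebra M" "rcolax_morphism L M F"
  shows "rcolax_2cell L M F F (restrict (\<lambda>a. Ide (lcat M) (fobj (rfun F) a)) (Obj (lcat L)))"
proof -
  interpret F: rcolax_mor L M F by (unfold_locales) fact+
  show ?thesis
  proof (rule rcolax_2cellI)
    show "nat_trans F.L.A F.M.A F.f F.f (restrict (\<lambda>a. Ide F.M.A (fobj F.f a)) (Obj F.L.A))"
      by (rule nat_trans_id) (rule F.L.A.category_axioms F.M.A.category_axioms F.f.is_functor_axioms)+
    fix a r and x :: "('u, 'o) bobj" assume a: "a \<in> Obj F.L.A" and x: "x \<in> bObj F.L.A"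
    have "bnt F.f F.f (restrict (\<lambda>a. Ide F.M.A (fobj F.f a)) (Obj F.L.A)) x = Ide F.M.bA (bmap (fobj F.f) x)"
      by (rule bnt_Ide[OF x]) simp
    then show "PAct F.M.F (Ide F.M.A (fobj F.f a)) (bnt F.f F.f (restrict (\<lambda>a. Ide F.M.A (fobj F.f a)) (Obj F.L.A)) x) (F.\<Theta> a x r) =
        PAct F.M.F (restrict (\<lambda>a. Ide F.M.A (fobj F.f a)) (Obj F.L.A) a) (Ide F.M.bA (bmap (fobj F.f) x)) (F.\<Theta> a x r)"
      using a by simp
  qed
qed

text \<open>\<beta> of the composite acts as \<beta>\<sigma> followed by \<beta>\<tau>. The
  condition for \<sigma> converts the first action into a left action, which commutes with the right
  action of \<beta>\<tau>, and then the condition for \<tau> applies.\<close>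

lemma rcolax_2cell_vcomp:
  fixes L M :: "('u :: universe, 'o, 'm, 'e) lax"
  assumes "lax_algebra L" "lax_algebra M" "rcolax_morphism L M F" "rcolax_morphism L M G" "rcolax_morphism L M H"
    and \<sigma>: "rcolax_2cell L M F G \<sigma>" and \<tau>: "rcolax_2cell L M G H \<tau>"
  shows "rcolax_2cell L M F H (restrict (\<lambda>a. \<tau> a \<odot>\<^bsub>lcat M\<^esub> \<sigma> a) (Obj (lcat L)))"
proof -
  interpret F: rcolax_mor L M F by (unfold_locales) fact+
  interpret G: rcolax_mor L M G by (unfold_locales) fact+
  interpret H: rcolax_mor L M H by (unfold_locales) fact+
  note \<sigma>' = rcolax_2cellD[OF \<sigma>] and \<tau>' = rcolax_2cellD[OF \<tau>]
  let ?\<rho> = "restrict (\<lambda>a. \<tau> a \<odot>\<^bsub>F.M.A\<^esub> \<sigma> a) (Obj F.L.A)"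
  show ?thesis
  proof (rule rcolax_2cellI)
    show "nat_trans F.L.A F.M.A F.f H.f ?\<rho>"
      by (rule nat_trans_vcomp[OF _ _ _ _ _ \<sigma>'(1) \<tau>'(1)])
        (rule F.L.A.category_axioms F.M.A.category_axioms F.f.is_functor_axioms G.f.is_functor_axioms H.f.is_functor_axioms)+
    fix a x r assume a: "a \<in> Obj F.L.A" and x: "x \<in> bObj F.L.A" and r: "r \<in> PEl F.L.F a x"
    note 1 = bnt_hom[OF F.f.is_functor_axioms G.f.is_functor_axioms x nat_transD(1)[OF \<sigma>'(1)]]
      and 2 = bnt_hom[OF G.f.is_functor_axioms H.f.is_functor_axioms x nat_transD(1)[OF \<tau>'(1)]]
    have b: "bnt F.f H.f ?\<rho> x = bnt G.f H.f \<tau> x \<odot>\<^bsub>F.M.bA\<^esub> bnt F.f G.f \<sigma> x"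
      by (rule bnt_Comp[OF x, symmetric]) simp
    have "PAct F.M.F (Ide F.M.A (fobj F.f a)) (bnt F.f H.f ?\<rho> x) (F.\<Theta> a x r) =
       PAct F.M.F (Ide F.M.A (fobj F.f a)) (bnt G.f H.f \<tau> x) (PAct F.M.F (Ide F.M.A (fobj F.f a)) (bnt F.f G.f \<sigma> x) (F.\<Theta> a x r))"
      unfolding b by (rule F.M.F.act_right_Comp[OF 1 2 F.f.fobj_in[OF a] F.theta_in[OF a x r]])
    also have "\<dots> = PAct F.M.F (Ide F.M.A (fobj F.f a)) (bnt G.f H.f \<tau> x) (PAct F.M.F (\<sigma> a) (Ide F.M.bA (bmap (fobj G.f) x)) (G.\<Theta> a x r))"
      unfolding \<sigma>'(2)[OF a x r] ..
    also have "\<dots> = PAct F.M.F (\<sigma> a) (Ide F.M.bA (bmap (fobj H.f) x)) (PAct F.M.F (Ide F.M.A (fobj G.f a)) (bnt G.f H.f \<tau> x) (G.\<Theta> a x r))"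
      by (rule F.M.F.act_comm[OF nat_transD(1)[OF \<sigma>'(1) a] 2 G.theta_in[OF a x r], symmetric])
    also have "\<dots> = PAct F.M.F (?\<rho> a) (Ide F.M.bA (bmap (fobj H.f) x)) (H.\<Theta> a x r)"
      using F.M.F.act_left_Comp[OF nat_transD(1)[OF \<tau>'(1) a] nat_transD(1)[OF \<sigma>'(1) a] _ H.theta_in[OF a x r]]
        H.bf_obj[OF x] a unfolding \<tau>'(2)[OF a x r] by simp
    finally show "PAct F.M.F (Ide F.M.A (fobj F.f a)) (bnt F.f H.f ?\<rho> x) (F.\<Theta> a x r) =
      PAct F.M.F (?\<rho> a) (Ide F.M.bA (bmap (fobj H.f) x)) (H.\<Theta> a x r)" .
  qed
qed

text \<open>Naturality of the structure map of G in its second variable moves \<beta>\<sigma> inside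
  it, where the condition for \<sigma> is applied; naturality in the first variable brings out
  g(\<sigma>). The condition for \<tau> then enters as in the vertical case.\<close>

lemma rcolax_2cell_hcomp:
  fixes L M N :: "('u :: universe, 'o, 'm, 'e) lax"
  assumes "lax_algebra L" "lax_algebra M" "lax_algebra N"
    "rcolax_morphism L M F" "rcolax_morphism L M F'" "rcolax_morphism M N G" "rcolax_morphism M N G'"
    and \<sigma>: "rcolax_2cell L M F F' \<sigma>" and \<tau>: "rcolax_2cell M N G G' \<tau>"
  shows "rcolax_2cell L N (rcolax_comp L G F) (rcolax_comp L G' F')
    (cell_hcomp (lcat L) (lcat N) (rfun F') (rfun G) \<tau> \<sigma>)"
proof -
  interpret F: rcolax_mor L M F by (unfold_locales) fact+
  interpret F': rcolax_mor L M F' by (unfold_locales) fact+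
  interpret G: rcolax_mor M N G by (unfold_locales) fact+
  interpret G': rcolax_mor M N G' by (unfold_locales) fact+
  note \<sigma>' = rcolax_2cellD[OF \<sigma>] and \<tau>' = rcolax_2cellD[OF \<tau>]
  let ?\<rho> = "cell_hcomp F.L.A G.M.A F'.f G.f \<tau> \<sigma>"
  have r: "rfun (rcolax_comp L G F) = fcomp F.L.A G.f F.f" "rfun (rcolax_comp L G' F') = fcomp F.L.A G'.f F'.f"
    by (simp_all add: rcolax_comp_def)
  show ?thesis
  proof (rule rcolax_2cellI; unfold r)
    show "nat_trans F.L.A G.M.A (fcomp F.L.A G.f F.f) (fcomp F.L.A G'.f F'.f) ?\<rho>"
      by (rule nat_trans_hcomp[OF _ _ _ _ _ _ _ \<sigma>'(1) \<tau>'(1)])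
        (rule F.L.A.category_axioms F.M.A.category_axioms G.M.A.category_axioms F.f.is_functor_axioms
          F'.f.is_functor_axioms G.f.is_functor_axioms G'.f.is_functor_axioms)+
    fix a x r assume a: "a \<in> Obj F.L.A" and x: "x \<in> bObj F.L.A" and r: "r \<in> PEl F.L.F a x"
    let ?I = "Ide G.M.A (fobj G.f (fobj F.f a))" and ?fx = "bmap (fobj F.f) x" and ?fx' = "bmap (fobj F'.f) x"
    note q = F.theta_in[OF a x r] and q' = F'.theta_in[OF a x r] and fa = F.f.fobj_in[OF a] and fa' = F'.f.fobj_in[OF a]
      and fx = F.bf_obj[OF x] and fx' = F'.bf_obj[OF x]
    note sa = nat_transD(1)[OF \<sigma>'(1) a] and ta = nat_transD(1)[OF \<tau>'(1) fa']
    note 1 = bnt_hom[OF F.f.is_functor_axioms F'.f.is_functor_axioms x nat_transD(1)[OF \<sigma>'(1)]]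
      and 2 = bnt_hom[OF G.f.is_functor_axioms G'.f.is_functor_axioms fx' nat_transD(1)[OF \<tau>'(1)]]
    have 3: "farr (bfun G.f) (bnt F.f F'.f \<sigma> x) \<in> hom G.M.bA (bmap (fobj G.f) ?fx) (bmap (fobj G.f) ?fx')"
      using G.bf.farr_in[OF 1] by simp
    have b: "bnt (fcomp F.L.A G.f F.f) (fcomp F.L.A G'.f F'.f) ?\<rho> x =
        bnt G.f G'.f \<tau> ?fx' \<odot>\<^bsub>G.M.bA\<^esub> farr (bfun G.f) (bnt F.f F'.f \<sigma> x)"
      by (rule bnt_hcomp[OF x F.f.is_functor_axioms F'.f.is_functor_axioms, symmetric]) (simp add: cell_hcomp_def)
    have "PAct G.M.F ?I (bnt G.f G'.f \<tau> ?fx' \<odot>\<^bsub>G.M.bA\<^esub> farr (bfun G.f) (bnt F.f F'.f \<sigma> x)) (G.\<Theta> (fobj F.f a) ?fx (F.\<Theta> a x r)) =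
       PAct G.M.F ?I (bnt G.f G'.f \<tau> ?fx') (PAct G.M.F ?I (farr (bfun G.f) (bnt F.f F'.f \<sigma> x)) (G.\<Theta> (fobj F.f a) ?fx (F.\<Theta> a x r)))"
      by (rule G.M.F.act_right_Comp[OF 3 2 G.f.fobj_in[OF fa] G.theta_in[OF fa fx q]])
    also have "PAct G.M.F ?I (farr (bfun G.f) (bnt F.f F'.f \<sigma> x)) (G.\<Theta> (fobj F.f a) ?fx (F.\<Theta> a x r)) =
       G.\<Theta> (fobj F.f a) ?fx' (PAct F.M.F (Ide F.M.A (fobj F.f a)) (bnt F.f F'.f \<sigma> x) (F.\<Theta> a x r))"
      by (rule G.theta_right[OF fa 1 q, symmetric])
    also have "\<dots> = PAct G.M.F (farr G.f (\<sigma> a)) (Ide G.M.bA (bmap (fobj G.f) ?fx')) (G.\<Theta> (fobj F'.f a) ?fx' (F'.\<Theta> a x r))"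
      unfolding \<sigma>'(2)[OF a x r] by (rule G.theta_left[OF sa fx' q'])
    also have "PAct G.M.F ?I (bnt G.f G'.f \<tau> ?fx') \<dots> =
      PAct G.M.F (farr G.f (\<sigma> a)) (Ide G.M.bA (bmap (fobj G'.f) ?fx'))
        (PAct G.M.F (Ide G.M.A (fobj G.f (fobj F'.f a))) (bnt G.f G'.f \<tau> ?fx') (G.\<Theta> (fobj F'.f a) ?fx' (F'.\<Theta> a x r)))"
      by (rule G.M.F.act_comm[OF G.f.farr_in[OF sa] 2 G.theta_in[OF fa' fx' q'], symmetric])
    also have "\<dots> = PAct G.M.F (\<tau> (fobj F'.f a) \<odot>\<^bsub>G.M.A\<^esub> farr G.f (\<sigma> a)) (Ide G.M.bA (bmap (fobj G'.f) ?fx'))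
        (G'.\<Theta> (fobj F'.f a) ?fx' (F'.\<Theta> a x r))"
      using G.M.F.act_left_Comp[OF ta G.f.farr_in[OF sa] _ G'.theta_in[OF fa' fx' q']] G'.bf_obj[OF fx']
      unfolding \<tau>'(2)[OF fa' fx' q'] by simp
    finally show "PAct G.M.F (Ide G.M.A (fobj (fcomp F.L.A G.f F.f) a)) (bnt (fcomp F.L.A G.f F.f) (fcomp F.L.A G'.f F'.f) ?\<rho> x)
         (rnat (rcolax_comp L G F) a x r) =
        PAct G.M.F (?\<rho> a) (Ide G.M.bA (bmap (fobj (fcomp F.L.A G'.f F'.f)) x)) (rnat (rcolax_comp L G' F') a x r)"
      unfolding b using a x r by (simp add: fcomp_simps rcolax_comp_def cell_hcomp_def bmap_fcomp del: bcat_simps(4))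
  qed
qed

section \<open>The 2-category laws of \<open>UltSp\<close>\<close>

lemma rcolax_eqI: "rfun F = rfun G \<Longrightarrow> rnat F = rnat G \<Longrightarrow> F = (G :: ('u, 'o, 'm, 'e) rcolax)"
  by (rule rcolax.equality) auto

lemma rcolax_comp_id:
  fixes L M :: "('u :: universe, 'o, 'm, 'e) lax"
  assumes "lax_algebra L" "lax_algebra M" "rcolax_morphism L M F"
  shows "rcolax_comp L F (rcolax_id L) = F" "rcolax_comp L (rcolax_id M) F = F"
proof -
  interpret F: rcolax_mor L M F by (unfold_locales) fact+
  interpret C1: rcolax_mor L M "rcolax_comp L F (rcolax_id L)"
    using rcolax_morphism_comp[OF assms(1,1,2) rcolax_morphism_id assms(3)] assms by unfold_locales blast
  interpret C2: rcolax_mor L M "rcolax_comp L (rcolax_id M) F"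
    using rcolax_morphism_comp[OF assms(1,2,2,3) rcolax_morphism_id] assms by unfold_locales blast
  show "rcolax_comp L F (rcolax_id L) = F"
  proof (rule rcolax_eqI)
    show "C1.f = F.f"
      using fcomp_fid[OF F.L.A.category_axioms F.ext] by (simp add: rcolax_comp_def rcolax_id_def)
    show "C1.\<Theta> = F.\<Theta>"
      by (rule theta_ext[OF C1.theta_ext_in F.theta_ext_in])
        (simp add: rcolax_comp_def rcolax_id_def fid_simps bmap_fid)
  qed
  show "rcolax_comp L (rcolax_id M) F = F"
  proof (rule rcolax_eqI)
    show "C2.f = F.f"
      using fcomp_fid[OF F.L.A.category_axioms F.ext] by (simp add: rcolax_comp_def rcolax_id_def)
    show "C2.\<Theta> = F.\<Theta>"
      by (rule theta_ext[OF C2.theta_ext_in F.theta_ext_in])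
        (simp add: rcolax_comp_def rcolax_id_def F.f.fobj_in F.bf_obj F.theta_in)
  qed
qed

lemma rcolax_comp_assoc:
  fixes K L M N :: "('u :: universe, 'o, 'm, 'e) lax"
  assumes "lax_algebra K" "lax_algebra L" "lax_algebra M" "lax_algebra N"
    "rcolax_morphism K L F" "rcolax_morphism L M G" "rcolax_morphism M N H"
  shows "rcolax_comp K (rcolax_comp L H G) F = rcolax_comp K H (rcolax_comp K G F)"
proof -
  interpret F: rcolax_mor K L F by (unfold_locales) fact+
  interpret C1: rcolax_mor K N "rcolax_comp K (rcolax_comp L H G) F"
    by unfold_locales
      (use assms rcolax_morphism_comp[OF assms(1,2,4,5) rcolax_morphism_comp[OF assms(2-4,6,7)]] in blast)+
  interpret C2: rcolax_mor K N "rcolax_comp K H (rcolax_comp K G F)"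
    by unfold_locales
      (use assms rcolax_morphism_comp[OF assms(1,3,4) rcolax_morphism_comp[OF assms(1-3,5,6)] assms(7)] in blast)+
  show ?thesis
  proof (rule rcolax_eqI)
    show "C1.f = C2.f"
      using fcomp_assoc[OF F.f.is_functor_axioms] by (simp add: rcolax_comp_def)
    show "C1.\<Theta> = C2.\<Theta>"
      by (rule theta_ext[OF C1.theta_ext_in C2.theta_ext_in])
        (simp add: rcolax_comp_def fcomp_simps bmap_fcomp F.f.fobj_in F.bf_obj F.theta_in)
  qed
qed

lemma cell_two_UltSp:
  "cell_two {L :: ('u :: universe, 'o, 'm, 'e) lax. lax_algebra L \<and> normalized L}
    lcat rfun rcolax_morphism rcolax_2cell rcolax_id (\<lambda>L M N. rcolax_comp L)"
proof (rule cell_two.intro)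
  fix L :: "('u, 'o, 'm, 'e) lax" assume "L \<in> {L. lax_algebra L \<and> normalized L}"
  then interpret lax_alg L by unfold_locales simp
  show "category (lcat L)" by (rule A.category_axioms)
next
  fix L M :: "('u, 'o, 'm, 'e) lax" and F assume "rcolax_morphism L M F"
  then show "ext_functor (lcat L) (lcat M) (rfun F)" by (simp add: rcolax_morphism_def Let_def)
next
  show "rfun (rcolax_id L) = fid (lcat L)" for L :: "('u, 'o, 'm, 'e) lax" by (simp add: rcolax_id_def)
  show "rfun (rcolax_comp L G F) = fcomp (lcat L) (rfun G) (rfun F)"
    for L :: "('u, 'o, 'm, 'e) lax" and G F :: "('u, 'o, 'm, 'e) rcolax" by (simp add: rcolax_comp_def)
next
  fix K L M N :: "('u, 'o, 'm, 'e) lax" and F G H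
  assume "K \<in> {L. lax_algebra L \<and> normalized L}" "L \<in> {L. lax_algebra L \<and> normalized L}"
    "M \<in> {L. lax_algebra L \<and> normalized L}" "N \<in> {L. lax_algebra L \<and> normalized L}"
    "rcolax_morphism K L F" "rcolax_morphism L M G" "rcolax_morphism M N H"
  then show "rcolax_comp K (rcolax_comp L H G) F = rcolax_comp K H (rcolax_comp K G F)"
    by (intro rcolax_comp_assoc) auto
qed (auto simp: rcolax_2cellD rcolax_2cell_id rcolax_2cell_vcomp rcolax_2cell_hcomp
    rcolax_morphism_id rcolax_morphism_comp rcolax_comp_id)

lemma two_category_UltSp: "two_category (UltSp :: (('u :: universe, 'o, 'm, 'e) lax, _, _) two_cat)"
proof -
  interpret cell_two "{L :: ('u, 'o, 'm, 'e) lax. lax_algebra L \<and> normalized L}"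
    lcat rfun rcolax_morphism rcolax_2cell rcolax_id "\<lambda>L M N. rcolax_comp L"
    by (rule cell_two_UltSp)
  have "UltSp = T" by (simp add: UltSp_def T_def)
  then show ?thesis using two_category_T by simp
qed

section \<open>Colax morphisms as morphisms of representable lax algebras\<close>

text \<open>The typing of a colax morphism without naturality and coherence. \<open>yon\<close>
  makes sense on such data, so composites can be compared through it before they are known to be
  colax morphisms.\<close>

definition colax_data :: "('u, 'o, 'm) palg \<Rightarrow> ('u, 'o, 'm) palg \<Rightarrow> ('u, 'o, 'm) colax \<Rightarrow> bool" where
  "colax_data P Q F \<longleftrightarrow> ext_functor (pcat P) (pcat Q) (cfun F) \<and>
     cnat F \<in> (\<Pi>\<^sub>E x \<in> bObj (pcat P).
       hom (pcat Q) (fobj (cfun F) (fobj (pact P) x)) (fobj (pact Q) (bmap (fobj (cfun F)) x)))"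

definition yon :: "('u, 'o, 'm) palg \<Rightarrow> ('u, 'o, 'm) palg \<Rightarrow> ('u, 'o, 'm) colax \<Rightarrow> ('u, 'o, 'm, 'm) rcolax" where
  "yon P Q F = \<lparr>rfun = cfun F,
     rnat = (\<lambda>a \<in> Obj (pcat P). \<lambda>x \<in> bObj (pcat P). \<lambda>r \<in> hom (pcat P) a (fobj (pact P) x).
       cnat F x \<odot>\<^bsub>pcat Q\<^esub> farr (cfun F) r)\<rparr>"

lemma rfun_yon [simp]: "rfun (yon P Q F) = cfun F"
  by (simp add: yon_def)

locale colax_dat = P: pseudo_alg P + Q: pseudo_alg Q
  for P Q :: "('u :: universe, 'o, 'm) palg" +
  fixes F :: "('u, 'o, 'm) colax"
  assumes data: "colax_data P Q F"
begin

abbreviation "f \<equiv> cfun F"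
abbreviation "\<phi> \<equiv> cnat F"
abbreviation "\<Theta> \<equiv> rnat (yon P Q F)"
abbreviation "f\<Phi> \<equiv> fcomp P.bA f P.\<Phi>"
abbreviation "\<Psi>\<beta>f \<equiv> fcomp P.bA Q.\<Phi> (bfun f)"

lemma ext: "ext_functor P.A Q.A f" using data by (simp add: colax_data_def)

sublocale f: is_functor P.A Q.A f using ext by (simp add: ext_functor_def)
sublocale bf: is_functor P.bA Q.bA "bfun f" by (rule is_functor_bfun) (rule f.is_functor_axioms)

lemma phi_hom: "x \<in> bObj P.A \<Longrightarrow> \<phi> x \<in> hom Q.A (fobj f (fobj P.\<Phi> x)) (fobj Q.\<Phi> (bmap (fobj f) x))"
  using data by (auto simp: colax_data_def)

lemma phi_ext: "\<phi> \<in> extensional (bObj P.A)"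
  using data by (auto simp: colax_data_def PiE_iff)

lemma bf_obj: "x \<in> bObj P.A \<Longrightarrow> bmap (fobj f) x \<in> bObj Q.A"
  by (rule is_functor_obj_bObj) (rule f.is_functor_axioms)

lemma bbf_obj: "Y \<in> bObj P.bA \<Longrightarrow> bmap (bmap (fobj f)) Y \<in> bObj Q.bA"
  by (rule bmap_in) (auto simp: bf_obj)

lemma theta: "x \<in> bObj P.A \<Longrightarrow> r \<in> hom P.A a (fobj P.\<Phi> x) \<Longrightarrow> \<Theta> a x r = \<phi> x \<odot>\<^bsub>Q.A\<^esub> farr f r"
  using P.A.hom_Obj[of r a] by (simp add: yon_def)

lemma theta_hom: "x \<in> bObj P.A \<Longrightarrow> r \<in> hom P.A a (fobj P.\<Phi> x) \<Longrightarrow>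
    \<phi> x \<odot>\<^bsub>Q.A\<^esub> farr f r \<in> hom Q.A (fobj f a) (fobj Q.\<Phi> (bmap (fobj f) x))"
  by (rule Q.A.Comp_in[OF phi_hom f.farr_in])

lemma theta_ext_in: "\<Theta> \<in> (\<Pi>\<^sub>E a \<in> Obj P.A. \<Pi>\<^sub>E x \<in> bObj P.A.
    hom P.A a (fobj P.\<Phi> x) \<rightarrow>\<^sub>E hom Q.A (fobj f a) (fobj Q.\<Phi> (bmap (fobj f) x)))"
  by (auto simp: yon_def theta_hom)

lemma nat_iff: "nat_trans P.bA Q.A f\<Phi> \<Psi>\<beta>f \<phi> \<longleftrightarrow>
    (\<forall>x x' v. v \<in> hom P.bA x x' \<longrightarrow> \<phi> x' \<odot>\<^bsub>Q.A\<^esub> farr f (farr P.\<Phi> v) = farr Q.\<Phi> (farr (bfun f) v) \<odot>\<^bsub>Q.A\<^esub> \<phi> x)"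
proof
  assume n: "nat_trans P.bA Q.A f\<Phi> \<Psi>\<beta>f \<phi>"
  show "\<forall>x x' v. v \<in> hom P.bA x x' \<longrightarrow> \<phi> x' \<odot>\<^bsub>Q.A\<^esub> farr f (farr P.\<Phi> v) = farr Q.\<Phi> (farr (bfun f) v) \<odot>\<^bsub>Q.A\<^esub> \<phi> x"
  proof (intro allI impI)
    fix x x' v assume v: "v \<in> hom P.bA x x'"
    show "\<phi> x' \<odot>\<^bsub>Q.A\<^esub> farr f (farr P.\<Phi> v) = farr Q.\<Phi> (farr (bfun f) v) \<odot>\<^bsub>Q.A\<^esub> \<phi> x"
      using nat_transD(2)[OF n v] homD(1)[OF v] by (simp add: fcomp_simps)
  qed
next
  assume n: "\<forall>x x' v. v \<in> hom P.bA x x' \<longrightarrow> \<phi> x' \<odot>\<^bsub>Q.A\<^esub> farr f (farr P.\<Phi> v) = farr Q.\<Phi> (farr (bfun f) v) \<odot>\<^bsub>Q.A\<^esub> \<phi> x"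
  show "nat_trans P.bA Q.A f\<Phi> \<Psi>\<beta>f \<phi>"
  proof (rule nat_transI)
    fix v x x' assume v: "v \<in> hom P.bA x x'"
    show "\<phi> x' \<odot>\<^bsub>Q.A\<^esub> farr f\<Phi> v = farr \<Psi>\<beta>f v \<odot>\<^bsub>Q.A\<^esub> \<phi> x"
      using n v homD(1)[OF v] by (simp add: fcomp_simps)
  qed (simp_all add: phi_ext phi_hom fcomp_simps)
qed

text \<open>Naturality of \<Theta> in a is automatic, as f preserves composition. Naturality in x is
  that of \<phi>: evaluate at the identity of \<Phi> x for one direction, precompose with an arrow
  f(r) for the other.\<close>

lemma prof_nat_iff:
  "prof_nat P.bA P.A P.R (pull_prof Q.R f (bfun f)) \<Theta> \<longleftrightarrow> nat_trans P.bA Q.A f\<Phi> \<Psi>\<beta>f \<phi>"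
proof
  assume n: "prof_nat P.bA P.A P.R (pull_prof Q.R f (bfun f)) \<Theta>"
  show "nat_trans P.bA Q.A f\<Phi> \<Psi>\<beta>f \<phi>"
    unfolding nat_iff
  proof (intro allI impI)
    fix x x' v assume v: "v \<in> hom P.bA x x'"
    have x: "x \<in> bObj P.A" "x' \<in> bObj P.A" using P.bA.hom_Obj[OF v] by auto
    have Px: "fobj P.\<Phi> x \<in> Obj P.A" using P.Phi.fobj_in x by simp
    note i = P.A.Ide_in[OF Px] and pv = P.Phi.farr_in[OF v]
    have bv: "farr (bfun f) v \<in> hom Q.bA (bmap (fobj f) x) (bmap (fobj f) x')"
      using bf.farr_in[OF v] by simp
    have "\<Theta> (fobj P.\<Phi> x) x' (PAct P.R (Ide P.A (fobj P.\<Phi> x)) v (Ide P.A (fobj P.\<Phi> x))) =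
        PAct (pull_prof Q.R f (bfun f)) (Ide P.A (fobj P.\<Phi> x)) v (\<Theta> (fobj P.\<Phi> x) x (Ide P.A (fobj P.\<Phi> x)))"
      by (rule prof_natD(2)[OF n i v]) (simp add: i)
    then show "\<phi> x' \<odot>\<^bsub>Q.A\<^esub> farr f (farr P.\<Phi> v) = farr Q.\<Phi> (farr (bfun f) v) \<odot>\<^bsub>Q.A\<^esub> \<phi> x"
      using theta[OF x(1) i] theta[OF x(2) pv] homD[OF pv] homD[OF phi_hom[OF x(1)]] homD[OF bv] Px
      by (simp add: P.A.cat_simps Q.A.cat_simps f.functor_simps Q.Phi.functor_simps)
  qed
next
  assume "nat_trans P.bA Q.A f\<Phi> \<Psi>\<beta>f \<phi>"
  note n = this[unfolded nat_iff, rule_format]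
  show "prof_nat P.bA P.A P.R (pull_prof Q.R f (bfun f)) \<Theta>"
  proof (rule prof_natI)
    show "\<Theta> \<in> (\<Pi>\<^sub>E d\<in>Obj P.A. \<Pi>\<^sub>E c\<in>Obj P.bA. PEl P.R d c \<rightarrow>\<^sub>E PEl (pull_prof Q.R f (bfun f)) d c)"
      using theta_ext_in by simp
    fix h v a' a x x' r assume h: "h \<in> hom P.A a' a" and v: "v \<in> hom P.bA x x'" and "r \<in> PEl P.R a x"
    then have r: "r \<in> hom P.A a (fobj P.\<Phi> x)" by simp
    have x: "x \<in> bObj P.A" "x' \<in> bObj P.A" using P.bA.hom_Obj[OF v] by auto
    have bv: "farr (bfun f) v \<in> hom Q.bA (bmap (fobj f) x) (bmap (fobj f) x')"
      using bf.farr_in[OF v] by simp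
    note pv = P.Phi.farr_in[OF v]
    note rh = P.A.Comp_in[OF r h]
    have "\<phi> x' \<odot>\<^bsub>Q.A\<^esub> farr f (farr P.\<Phi> v) \<odot>\<^bsub>Q.A\<^esub> farr f (r \<odot>\<^bsub>P.A\<^esub> h) =
        farr Q.\<Phi> (farr (bfun f) v) \<odot>\<^bsub>Q.A\<^esub> \<phi> x \<odot>\<^bsub>Q.A\<^esub> farr f (r \<odot>\<^bsub>P.A\<^esub> h)"
      by (rule Q.A.Comp_swap[OF n[OF v] f.farr_in[OF pv] phi_hom[OF x(2)] phi_hom[OF x(1)] Q.Phi.farr_in[OF bv] f.farr_in[OF rh]])
    then show "\<Theta> a' x' (PAct P.R h v r) = PAct (pull_prof Q.R f (bfun f)) h v (\<Theta> a x r)"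
      using theta[OF x(1) r] theta[OF x(2) P.A.Comp_in[OF pv rh]] homD[OF pv] homD[OF phi_hom[OF x(1)]] homD[OF bv] homD[OF r] homD[OF h]
      by (simp add: P.A.cat_simps Q.A.cat_simps f.functor_simps Q.Phi.functor_simps)
  qed
qed

lemma unit_iff:
  assumes a: "a \<in> Obj P.A"
  shows "\<Theta> a (single a) (lunitor P.L a a (Ide P.A a)) = lunitor Q.L (fobj f a) (fobj f a) (Ide Q.A (fobj f a)) \<longleftrightarrow>
    \<phi> (single a) \<odot>\<^bsub>Q.A\<^esub> farr f (P.\<upsilon> a) = Q.\<upsilon> (fobj f a)"
proof -
  have "lunitor P.L a a (Ide P.A a) = P.\<upsilon> a"
    using P.lunitor_simp[OF P.A.Ide_in[OF a]] P.A.Comp_Ide[OF P.unit_hom[OF a]] by simp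
  moreover have "lunitor Q.L (fobj f a) (fobj f a) (Ide Q.A (fobj f a)) = Q.\<upsilon> (fobj f a)"
    using Q.lunitor_simp[OF Q.A.Ide_in[OF f.fobj_in[OF a]]] Q.A.Comp_Ide[OF Q.unit_hom[OF f.fobj_in[OF a]]] by simp
  ultimately show ?thesis
    using theta[OF single_in[OF a] P.unit_hom[OF a]] by simp
qed

text \<open>The formula \<phi> f(r), applied in every component of a tuple and read in the
  ultracompletion, is \<beta>f followed by \<beta>\<phi>.\<close>

lemma retgt_theta_push:
  assumes x: "x \<in> bObj P.A" and Y: "Y \<in> bObj P.bA" and s: "s \<in> bset (PEl P.R) x Y"
  shows "retgt (bmap (fobj Q.\<Phi>) (bmap (bmap (fobj f)) Y)) (theta_push f \<Theta> s) =
    bnt f\<Phi> \<Psi>\<beta>f \<phi> Y \<odot>\<^bsub>Q.bA\<^esub> farr (bfun f) (retgt (bmap (fobj P.\<Phi>) Y) s)"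
    and "theta_push f \<Theta> s \<in> bset (PEl Q.R) (bmap (fobj f) x) (bmap (bmap (fobj f)) Y)"
proof -
  obtain t \<zeta> where t: "s = bel_of x Y t \<zeta>" "t \<in> idx Y \<rightarrow> idx x" "filtermap t (ult Y) = ult x"
    "\<And>z. z \<in> idx Y \<Longrightarrow> \<zeta> z \<in> hom P.A (val x (t z)) (fobj P.\<Phi> (val Y z))"
    using s by (rule bsetE) auto
  have Yz: "val Y z \<in> bObj P.A" if "z \<in> idx Y" for z using bObjD(2)[OF Y that] by simp
  have b: "bmap (fobj f\<Phi>) Y = bmap (fobj f) (bmap (fobj P.\<Phi>) Y)"
    "bmap (fobj \<Psi>\<beta>f) Y = bmap (fobj Q.\<Phi>) (bmap (bmap (fobj f)) Y)"
    using bmap_fcomp[OF Y, of f P.\<Phi>] bmap_fcomp[OF Y, of Q.\<Phi> "bfun f"] by simp_all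
  show "theta_push f \<Theta> s \<in> bset (PEl Q.R) (bmap (fobj f) x) (bmap (bmap (fobj f)) Y)"
    unfolding t(1) theta_push_bel_of
    by (rule bsetI) (use t(2,3) theta[OF Yz t(4)] theta_hom[OF Yz t(4)] in \<open>auto simp: Pi_iff\<close>)
  show "retgt (bmap (fobj Q.\<Phi>) (bmap (bmap (fobj f)) Y)) (theta_push f \<Theta> s) =
    bnt f\<Phi> \<Psi>\<beta>f \<phi> Y \<odot>\<^bsub>Q.bA\<^esub> farr (bfun f) (retgt (bmap (fobj P.\<Phi>) Y) s)"
    using theta[OF Yz t(4)] bObjD(1)[OF Y]
    by (auto simp: t(1) theta_push_bel_of retgt_bel_of bnt_def b bfun_bel_of Comp_bel_of intro!: bel_of_cong)
qed

text \<open>Both sides of the multiplicativity condition factor through one arrow w depending on r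
  and s, and the remaining factors are the two sides of the colax axiom at Y. So that axiom implies
  the condition, and it follows from the condition when w is an identity.\<close>

lemma mult_eqs:
  assumes n: "nat_trans P.bA Q.A f\<Phi> \<Psi>\<beta>f \<phi>"
    and x: "x \<in> bObj P.A" and Y: "Y \<in> bObj P.bA" and r: "r \<in> hom P.A a (fobj P.\<Phi> x)" and s: "s \<in> bset (PEl P.R) x Y"
  defines "w \<equiv> farr f (farr P.\<Phi> (retgt (bmap (fobj P.\<Phi>) Y) s) \<odot>\<^bsub>P.A\<^esub> r)"
  shows "\<Theta> a (bmu_obj Y) (delta P.L a r s) = (\<phi> (bmu_obj Y) \<odot>\<^bsub>Q.A\<^esub> farr f (P.m Y)) \<odot>\<^bsub>Q.A\<^esub> w"
    and "delta Q.L (fobj f a) (\<Theta> a x r) (theta_push f \<Theta> s) =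
      (Q.m (bmap (bmap (fobj f)) Y) \<odot>\<^bsub>Q.A\<^esub> farr Q.\<Phi> (bnt f\<Phi> \<Psi>\<beta>f \<phi> Y) \<odot>\<^bsub>Q.A\<^esub> \<phi> (bmap (fobj P.\<Phi>) Y)) \<odot>\<^bsub>Q.A\<^esub> w"
proof -
  note n' = n[unfolded nat_iff, rule_format]
  have PY: "bmap (fobj P.\<Phi>) Y \<in> bObj P.A" by (rule P.bmap_Phi_in[OF Y])
  have muY: "bmu_obj Y \<in> bObj P.A" by (rule bmu_obj_in[OF Y])
  define s1 where "s1 = retgt (bmap (fobj P.\<Phi>) Y) s"
  have s1: "s1 \<in> hom P.bA x (bmap (fobj P.\<Phi>) Y)" unfolding s1_def by (rule P.retgt_in[OF x Y s])
  note ps = P.Phi.farr_in[OF s1]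
  have bs: "farr (bfun f) s1 \<in> hom Q.bA (bmap (fobj f) x) (bmap (fobj f) (bmap (fobj P.\<Phi>) Y))"
    using bf.farr_in[OF s1] by simp
  have fP: "is_functor P.bA Q.A f\<Phi>" by (rule is_functor_fcomp[OF P.bA.category_axioms P.Phi.is_functor_axioms f.is_functor_axioms])
  have Pf: "is_functor P.bA Q.A \<Psi>\<beta>f" by (rule is_functor_fcomp[OF P.bA.category_axioms bf.is_functor_axioms Q.Phi.is_functor_axioms])
  have b: "bmap (fobj f\<Phi>) Y = bmap (fobj f) (bmap (fobj P.\<Phi>) Y)"
    "bmap (fobj \<Psi>\<beta>f) Y = bmap (fobj Q.\<Phi>) (bmap (bmap (fobj f)) Y)"
    using bmap_fcomp[OF Y, of f P.\<Phi>] bmap_fcomp[OF Y, of Q.\<Phi> "bfun f"] by simp_all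
  have bn: "bnt f\<Phi> \<Psi>\<beta>f \<phi> Y \<in> hom Q.bA (bmap (fobj f) (bmap (fobj P.\<Phi>) Y)) (bmap (fobj Q.\<Phi>) (bmap (bmap (fobj f)) Y))"
    using bnt_hom[OF fP Pf Y nat_transD(1)[OF n]] by (simp add: b)
  have mQ: "Q.m (bmap (bmap (fobj f)) Y) \<in> hom Q.A (fobj Q.\<Phi> (bmap (fobj Q.\<Phi>) (bmap (bmap (fobj f)) Y))) (fobj Q.\<Phi> (bmap (fobj f) (bmu_obj Y)))"
    using Q.mult_hom[OF bbf_obj[OF Y]] by (simp add: bmap_bmu_obj[OF Y])
  note hs = homD[OF P.mult_hom[OF Y]] homD[OF phi_hom[OF muY]] homD[OF phi_hom[OF PY]] homD[OF phi_hom[OF x]] homD[OF s1] homD[OF r] homD[OF bs] homD[OF bn]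
    homD[OF mQ]
  have w: "w = farr f (farr P.\<Phi> s1) \<odot>\<^bsub>Q.A\<^esub> farr f r"
    unfolding w_def s1_def[symmetric] by (rule f.farr_Comp[OF ps r])
  have d: "delta P.L a r s \<in> hom P.A a (fobj P.\<Phi> (bmu_obj Y))"
    using P.delta_rep(1)[OF r x Y s] P.dl_in[OF r x Y s] by (simp add: P.dl_def)
  show "\<Theta> a (bmu_obj Y) (delta P.L a r s) = (\<phi> (bmu_obj Y) \<odot>\<^bsub>Q.A\<^esub> farr f (P.m Y)) \<odot>\<^bsub>Q.A\<^esub> w"
    using hs unfolding theta[OF muY d] unfolding P.delta_rep(1)[OF r x Y s] w s1_def[symmetric]
    by (simp add: P.A.cat_simps Q.A.cat_simps f.functor_simps P.Phi.functor_simps)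
  have "delta Q.L (fobj f a) (\<Theta> a x r) (theta_push f \<Theta> s) =
      Q.m (bmap (bmap (fobj f)) Y) \<odot>\<^bsub>Q.A\<^esub> farr Q.\<Phi> (bnt f\<Phi> \<Psi>\<beta>f \<phi> Y \<odot>\<^bsub>Q.bA\<^esub> farr (bfun f) s1) \<odot>\<^bsub>Q.A\<^esub> (\<phi> x \<odot>\<^bsub>Q.A\<^esub> farr f r)"
    using Q.delta_rep(1)[OF theta_hom[OF x r] bf_obj[OF x] bbf_obj[OF Y] retgt_theta_push(2)[OF x Y s]]
    by (simp add: theta[OF x r] retgt_theta_push(1)[OF x Y s] s1_def)
  also have "\<dots> = Q.m (bmap (bmap (fobj f)) Y) \<odot>\<^bsub>Q.A\<^esub> farr Q.\<Phi> (bnt f\<Phi> \<Psi>\<beta>f \<phi> Y) \<odot>\<^bsub>Q.A\<^esub>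
      (farr Q.\<Phi> (farr (bfun f) s1) \<odot>\<^bsub>Q.A\<^esub> \<phi> x \<odot>\<^bsub>Q.A\<^esub> farr f r)"
    using hs by (simp add: Q.A.cat_simps Q.Phi.functor_simps f.functor_simps)
  also have "farr Q.\<Phi> (farr (bfun f) s1) \<odot>\<^bsub>Q.A\<^esub> \<phi> x \<odot>\<^bsub>Q.A\<^esub> farr f r = \<phi> (bmap (fobj P.\<Phi>) Y) \<odot>\<^bsub>Q.A\<^esub> farr f (farr P.\<Phi> s1) \<odot>\<^bsub>Q.A\<^esub> farr f r"
    by (rule Q.A.Comp_swap[OF n'[OF s1, symmetric] phi_hom[OF x] Q.Phi.farr_in[OF bs] f.farr_in[OF ps] phi_hom[OF PY] f.farr_in[OF r]])
  finally show "delta Q.L (fobj f a) (\<Theta> a x r) (theta_push f \<Theta> s) =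
      (Q.m (bmap (bmap (fobj f)) Y) \<odot>\<^bsub>Q.A\<^esub> farr Q.\<Phi> (bnt f\<Phi> \<Psi>\<beta>f \<phi> Y) \<odot>\<^bsub>Q.A\<^esub> \<phi> (bmap (fobj P.\<Phi>) Y)) \<odot>\<^bsub>Q.A\<^esub> w"
    using hs w by (simp add: Q.A.cat_simps Q.Phi.functor_simps f.functor_simps P.Phi.functor_simps)
qed

lemma yon_iff: "rcolax_morphism P.L Q.L (yon P Q F) \<longleftrightarrow> colax_morphism P Q F"
proof
  assume mor: "rcolax_morphism P.L Q.L (yon P Q F)"
  interpret M: rcolax_mor P.L Q.L "yon P Q F"
    by (unfold_locales) (rule P.lax_algebra_rep_lax Q.lax_algebra_rep_lax mor)+
  have n: "nat_trans P.bA Q.A f\<Phi> \<Psi>\<beta>f \<phi>"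
    using M.theta_prof_nat prof_nat_iff by simp
  have "\<phi> (bmu_obj Y) \<odot>\<^bsub>Q.A\<^esub> farr f (P.m Y) =
      Q.m (bmap (bmap (fobj f)) Y) \<odot>\<^bsub>Q.A\<^esub> farr Q.\<Phi> (bnt f\<Phi> \<Psi>\<beta>f \<phi> Y) \<odot>\<^bsub>Q.A\<^esub> \<phi> (bmap (fobj P.\<Phi>) Y)"
    if Y: "Y \<in> bObj P.bA" for Y
  proof -
    \<comment> \<open>With x = \<beta>\<Phi>(Y), r the identity of \<Phi> x and s the tuple of
      identities, the common factor w becomes an identity.\<close>
    let ?x = "bmap (fobj P.\<Phi>) Y" and ?a = "fobj P.\<Phi> (bmap (fobj P.\<Phi>) Y)"
    have x: "?x \<in> bObj P.A" by (rule P.bmap_Phi_in[OF Y])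
    have a: "?a \<in> Obj P.A" using P.Phi.fobj_in x by simp
    have r: "Ide P.A ?a \<in> hom P.A ?a ?a" by (rule P.A.Ide_in[OF a])
    have i: "Ide P.bA ?x \<in> hom P.bA ?x ?x" using P.bA.Ide_in x by simp
    note s = retgt_bset[OF Y i]
    have w: "farr f (farr P.\<Phi> (retgt (bmap (fobj P.\<Phi>) Y) (retgt Y (Ide P.bA ?x))) \<odot>\<^bsub>P.A\<^esub> Ide P.A ?a) = Ide Q.A (fobj f ?a)"
      unfolding s(2) using a x P.Phi.farr_Ide[of ?x] by (simp add: P.A.cat_simps f.farr_Ide)
    have 1: "\<phi> (bmu_obj Y) \<odot>\<^bsub>Q.A\<^esub> farr f (P.m Y) \<in> hom Q.A (fobj f ?a) (fobj Q.\<Phi> (bmap (fobj f) (bmu_obj Y)))"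
      by (rule Q.A.Comp_in[OF phi_hom[OF bmu_obj_in[OF Y]] f.farr_in[OF P.mult_hom[OF Y]]])
    have fP: "is_functor P.bA Q.A f\<Phi>" by (rule is_functor_fcomp[OF P.bA.category_axioms P.Phi.is_functor_axioms f.is_functor_axioms])
    have Pf: "is_functor P.bA Q.A \<Psi>\<beta>f" by (rule is_functor_fcomp[OF P.bA.category_axioms bf.is_functor_axioms Q.Phi.is_functor_axioms])
    have bn: "bnt f\<Phi> \<Psi>\<beta>f \<phi> Y \<in> hom Q.bA (bmap (fobj f) (bmap (fobj P.\<Phi>) Y)) (bmap (fobj Q.\<Phi>) (bmap (bmap (fobj f)) Y))"
      using bnt_hom[OF fP Pf Y nat_transD(1)[OF n]] bmap_fcomp[OF Y, of f P.\<Phi>] bmap_fcomp[OF Y, of Q.\<Phi> "bfun f"] by simp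
    have 2: "Q.m (bmap (bmap (fobj f)) Y) \<odot>\<^bsub>Q.A\<^esub> farr Q.\<Phi> (bnt f\<Phi> \<Psi>\<beta>f \<phi> Y) \<odot>\<^bsub>Q.A\<^esub> \<phi> ?x \<in>
        hom Q.A (fobj f ?a) (fobj Q.\<Phi> (bmu_obj (bmap (bmap (fobj f)) Y)))"
      by (rule Q.A.Comp_in[OF Q.mult_hom[OF bbf_obj[OF Y]] Q.A.Comp_in[OF Q.Phi.farr_in[OF bn] phi_hom[OF x]]])
    have "\<Theta> ?a (bmu_obj Y) (delta P.L ?a (Ide P.A ?a) (retgt Y (Ide P.bA ?x))) =
        delta Q.L (fobj f ?a) (\<Theta> ?a ?x (Ide P.A ?a)) (theta_push f \<Theta> (retgt Y (Ide P.bA ?x)))"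
      using M.theta_mult[of ?a ?x Y "Ide P.A ?a"] a x Y r s by simp
    then show ?thesis
      unfolding mult_eqs[OF n x Y r s(1)] w Q.A.Comp_Ide[OF 1] Q.A.Comp_Ide[OF 2] .
  qed
  moreover have "\<phi> (single a) \<odot>\<^bsub>Q.A\<^esub> farr f (P.\<upsilon> a) = Q.\<upsilon> (fobj f a)" if "a \<in> Obj P.A" for a
    using M.theta_unit that unit_iff[OF that] by simp
  ultimately show "colax_morphism P Q F"
    using ext n unfolding colax_morphism_def Let_def by simp
next
  assume "colax_morphism P Q F"
  note c = this[unfolded colax_morphism_def Let_def]
  have n: "nat_trans P.bA Q.A f\<Phi> \<Psi>\<beta>f \<phi>" using c by blast
  show "rcolax_morphism P.L Q.L (yon P Q F)"
  proof (rule rcolax_morphismI; unfold P.lax_simps Q.lax_simps rfun_yon)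
    show "prof_nat P.bA P.A P.R (pull_prof Q.R f (bfun f)) \<Theta>" using n prof_nat_iff by simp
    fix a assume a: "a \<in> Obj P.A"
    show "\<Theta> a (single a) (lunitor P.L a a (Ide P.A a)) = lunitor Q.L (fobj f a) (fobj f a) (Ide Q.A (fobj f a))"
      using c a unit_iff by simp
    fix x Y r s assume x: "x \<in> bObj P.A" and Y: "Y \<in> bObj P.bA" and r: "r \<in> PEl P.R a x" and s: "s \<in> bset (PEl P.R) x Y"
    then have r': "r \<in> hom P.A a (fobj P.\<Phi> x)" by simp
    show "\<Theta> a (bmu_obj Y) (delta P.L a r s) = delta Q.L (fobj f a) (\<Theta> a x r) (theta_push f \<Theta> s)"
      unfolding mult_eqs[OF n x Y r' s] using c Y by simp
  qed (rule ext)
qed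

end

lemma colax_data_morphism:
  assumes "colax_morphism P Q F"
  shows "colax_data P Q F"
proof -
  note c = assms[unfolded colax_morphism_def Let_def]
  then have n: "nat_trans (bcat (pcat P)) (pcat Q) (fcomp (bcat (pcat P)) (cfun F) (pact P))
      (fcomp (bcat (pcat P)) (pact Q) (bfun (cfun F))) (cnat F)" by blast
  show ?thesis
    using c nat_transD(1)[OF n] nat_transD(3)[OF n] by (auto simp: colax_data_def fcomp_simps PiE_iff)
qed

lemma yon_inj:
  fixes P Q :: "('u :: universe, 'o, 'm) palg"
  assumes "pseudo_algebra P" "pseudo_algebra Q" "colax_data P Q F" "colax_data P Q G" "yon P Q F = yon P Q G"
  shows "F = G"
proof -
  interpret F: colax_dat P Q F by unfold_locales fact+
  interpret G: colax_dat P Q G by unfold_locales fact+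
  have f: "F.f = G.f" using assms(5) rfun_yon by metis
  have "F.\<phi> = G.\<phi>"
  proof (rule extensionalityI[OF F.phi_ext G.phi_ext])
    fix x :: "('u, 'o) bobj" assume x: "x \<in> bObj F.P.A"
    have i: "Ide F.P.A (fobj F.P.\<Phi> x) \<in> hom F.P.A (fobj F.P.\<Phi> x) (fobj F.P.\<Phi> x)"
      using F.P.A.Ide_in F.P.Phi.fobj_in x by simp
    have "F.\<Theta> (fobj F.P.\<Phi> x) x (Ide F.P.A (fobj F.P.\<Phi> x)) = G.\<Theta> (fobj F.P.\<Phi> x) x (Ide F.P.A (fobj F.P.\<Phi> x))"
      by (simp add: assms(5))
    then show "F.\<phi> x = G.\<phi> x"
      unfolding F.theta[OF x i] G.theta[OF x i]
      using F.Q.A.Comp_Ide[OF F.phi_hom[OF x]] F.Q.A.Comp_Ide[OF G.phi_hom[OF x]]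
        F.f.farr_Ide[of "fobj F.P.\<Phi> x"] F.P.Phi.fobj_in[of x] x f by simp
  qed
  with f show ?thesis by (intro colax.equality) auto
qed

lemma yon_surj:
  fixes P Q :: "('u :: universe, 'o, 'm) palg"
  assumes "pseudo_algebra P" "pseudo_algebra Q" "rcolax_morphism (rep_lax P) (rep_lax Q) G"
  obtains F where "colax_data P Q F" "yon P Q F = G"
proof -
  interpret P: pseudo_alg P by unfold_locales fact
  interpret Q: pseudo_alg Q by unfold_locales fact
  interpret M: rcolax_mor P.L Q.L G
    by (unfold_locales) (rule P.lax_algebra_rep_lax Q.lax_algebra_rep_lax assms)+
  \<comment> \<open>By Yoneda, the only candidate for \<phi> at x is the image of the identity of
    \<Phi> x.\<close>
  define F :: "('u, 'o, 'm) colax" where "F = \<lparr>cfun = rfun G,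
    cnat = (\<lambda>x \<in> bObj P.A. rnat G (fobj P.\<Phi> x) x (Ide P.A (fobj P.\<Phi> x)))\<rparr>"
  have i: "Ide P.A (fobj P.\<Phi> x) \<in> hom P.A (fobj P.\<Phi> x) (fobj P.\<Phi> x)" "fobj P.\<Phi> x \<in> Obj P.A" if "x \<in> bObj P.A" for x
    using P.A.Ide_in P.Phi.fobj_in that by simp_all
  have "cnat F x \<in> hom Q.A (fobj (rfun G) (fobj P.\<Phi> x)) (fobj Q.\<Phi> (bmap (fobj (rfun G)) x))" if "x \<in> bObj P.A" for x
    using M.theta_in[of "fobj P.\<Phi> x" x "Ide P.A (fobj P.\<Phi> x)"] i that by (simp add: F_def)
  then have d: "colax_data P Q F"
    using M.ext by (auto simp: colax_data_def F_def)
  interpret F: colax_dat P Q F by unfold_locales (rule d)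
  have "yon P Q F = G"
  proof (rule rcolax_eqI)
    show "rnat (yon P Q F) = rnat G"
    proof (rule theta_ext[OF F.theta_ext_in])
      show "rnat G \<in> (\<Pi>\<^sub>E a\<in>Obj P.A. \<Pi>\<^sub>E x\<in>bObj P.A. hom P.A a (fobj P.\<Phi> x) \<rightarrow>\<^sub>E
          hom Q.A (fobj (rfun G) a) (fobj Q.\<Phi> (bmap (fobj (rfun G)) x)))"
        using M.theta_ext_in by simp
      fix a x r assume a: "a \<in> Obj P.A" and x: "x \<in> bObj P.A" and r: "r \<in> hom P.A a (fobj P.\<Phi> x)"
      have x': "bmap (fobj (rfun G)) x \<in> bObj Q.A" using M.bf_obj x by simp
      have fr: "farr (rfun G) r \<in> hom Q.A (fobj (rfun G) a) (fobj (rfun G) (fobj P.\<Phi> x))"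
        using M.f.farr_in[of r a "fobj P.\<Phi> x"] r by simp
      \<comment> \<open>Every r is the identity of \<Phi> x acted on by r, so naturality in the
        first variable determines its image.\<close>
      have 1: "PAct P.R r (Ide P.bA x) (Ide P.A (fobj P.\<Phi> x)) = r"
        using P.Phi.farr_Ide[of x] x r i[OF x] P.A.Ide_Comp[OF r] by (simp add: P.A.cat_simps)
      have "rnat G a x r = PAct Q.R (farr (rfun G) r) (Ide Q.bA (bmap (fobj (rfun G)) x)) (cnat F x)"
        using M.theta_left[of r a "fobj P.\<Phi> x" x "Ide P.A (fobj P.\<Phi> x)"] r x i[OF x] 1 by (simp add: F_def)
      also have "\<dots> = cnat F x \<odot>\<^bsub>Q.A\<^esub> farr (rfun G) r"
        using Q.Phi.farr_Ide[of "bmap (fobj (rfun G)) x"] x' Q.A.Ide_Comp[OF Q.A.Comp_in[OF F.phi_hom[OF x]]] fr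
        by (simp add: F_def)
      finally show "F.\<Theta> a x r = rnat G a x r"
        unfolding F.theta[OF x r] by (simp add: F_def)
    qed
  qed (simp add: F_def)
  with d show thesis by (rule that)
qed

lemma yon_2cell_iff:
  fixes P Q :: "('u :: universe, 'o, 'm) palg"
  assumes "pseudo_algebra P" "pseudo_algebra Q" "colax_data P Q F" "colax_data P Q G"
  shows "rcolax_2cell (rep_lax P) (rep_lax Q) (yon P Q F) (yon P Q G) \<sigma> \<longleftrightarrow> colax_2cell P Q F G \<sigma>"
proof -
  interpret F: colax_dat P Q F by unfold_locales fact+
  interpret G: colax_dat P Q G by unfold_locales fact+
  let ?b = "\<lambda>x :: ('u, 'o) bobj. bnt F.f G.f \<sigma> x"
  show ?thesis
  proof (cases "nat_trans F.P.A F.Q.A F.f G.f \<sigma>")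
    case n: True
    \<comment> \<open>Both notions of 2-cell include naturality of \<sigma>, so it may be assumed.
      The sides of the condition between lax algebras are then those of the colax condition
      precomposed with f(r), and r = id gives the converse.\<close>
    have lhs: "PAct F.Q.R (Ide F.Q.A (fobj F.f a)) (?b x) (F.\<Theta> a x r) =
        (farr F.Q.\<Phi> (?b x) \<odot>\<^bsub>F.Q.A\<^esub> F.\<phi> x) \<odot>\<^bsub>F.Q.A\<^esub> farr F.f r"
      and rhs: "PAct F.Q.R (\<sigma> a) (Ide F.Q.bA (bmap (fobj G.f) x)) (G.\<Theta> a x r) =
        (G.\<phi> x \<odot>\<^bsub>F.Q.A\<^esub> \<sigma> (fobj F.P.\<Phi> x)) \<odot>\<^bsub>F.Q.A\<^esub> farr F.f r"
      and X: "farr F.Q.\<Phi> (?b x) \<odot>\<^bsub>F.Q.A\<^esub> F.\<phi> x \<in> hom F.Q.A (fobj F.f (fobj F.P.\<Phi> x)) (fobj F.Q.\<Phi> (bmap (fobj G.f) x))"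
      and X': "G.\<phi> x \<odot>\<^bsub>F.Q.A\<^esub> \<sigma> (fobj F.P.\<Phi> x) \<in> hom F.Q.A (fobj F.f (fobj F.P.\<Phi> x)) (fobj F.Q.\<Phi> (bmap (fobj G.f) x))"
      if x: "x \<in> bObj F.P.A" and r: "r \<in> hom F.P.A a (fobj F.P.\<Phi> x)" for x a r
    proof -
      have o: "a \<in> Obj F.P.A" "fobj F.P.\<Phi> x \<in> Obj F.P.A" using F.P.A.hom_Obj[OF r] by auto
      note b = bnt_hom[OF F.f.is_functor_axioms G.f.is_functor_axioms x nat_transD(1)[OF n]]
      note s = nat_transD(1)[OF n o(1)] nat_transD(1)[OF n o(2)]
      note hs = homD[OF b] homD[OF s(1)] homD[OF s(2)] homD[OF F.phi_hom[OF x]] homD[OF G.phi_hom[OF x]] homD[OF r]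
      show "PAct F.Q.R (Ide F.Q.A (fobj F.f a)) (?b x) (F.\<Theta> a x r) =
        (farr F.Q.\<Phi> (?b x) \<odot>\<^bsub>F.Q.A\<^esub> F.\<phi> x) \<odot>\<^bsub>F.Q.A\<^esub> farr F.f r"
        using hs by (simp add: F.theta[OF x r] F.Q.A.cat_simps F.Q.Phi.functor_simps F.f.functor_simps)
      have "PAct F.Q.R (\<sigma> a) (Ide F.Q.bA (bmap (fobj G.f) x)) (G.\<Theta> a x r) = G.\<phi> x \<odot>\<^bsub>F.Q.A\<^esub> (farr G.f r \<odot>\<^bsub>F.Q.A\<^esub> \<sigma> a)"
        using hs F.Q.Phi.farr_Ide[of "bmap (fobj G.f) x"] G.bf_obj[OF x] o
        by (simp add: G.theta[OF x r] F.Q.A.cat_simps F.Q.Phi.functor_simps G.f.functor_simps)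
      also have "\<dots> = (G.\<phi> x \<odot>\<^bsub>F.Q.A\<^esub> \<sigma> (fobj F.P.\<Phi> x)) \<odot>\<^bsub>F.Q.A\<^esub> farr F.f r"
        using hs unfolding nat_transD(2)[OF n r, symmetric] by (simp add: F.Q.A.cat_simps F.f.functor_simps)
      finally show "PAct F.Q.R (\<sigma> a) (Ide F.Q.bA (bmap (fobj G.f) x)) (G.\<Theta> a x r) =
        (G.\<phi> x \<odot>\<^bsub>F.Q.A\<^esub> \<sigma> (fobj F.P.\<Phi> x)) \<odot>\<^bsub>F.Q.A\<^esub> farr F.f r" .
      show "farr F.Q.\<Phi> (?b x) \<odot>\<^bsub>F.Q.A\<^esub> F.\<phi> x \<in> hom F.Q.A (fobj F.f (fobj F.P.\<Phi> x)) (fobj F.Q.\<Phi> (bmap (fobj G.f) x))"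
        by (rule F.Q.A.Comp_in[OF F.Q.Phi.farr_in[OF b] F.phi_hom[OF x]])
      show "G.\<phi> x \<odot>\<^bsub>F.Q.A\<^esub> \<sigma> (fobj F.P.\<Phi> x) \<in> hom F.Q.A (fobj F.f (fobj F.P.\<Phi> x)) (fobj F.Q.\<Phi> (bmap (fobj G.f) x))"
        by (rule F.Q.A.Comp_in[OF G.phi_hom[OF x] s(2)])
    qed
    show ?thesis
    proof
      assume c: "rcolax_2cell F.P.L F.Q.L (yon P Q F) (yon P Q G) \<sigma>"
      have "farr F.Q.\<Phi> (?b x) \<odot>\<^bsub>F.Q.A\<^esub> F.\<phi> x = G.\<phi> x \<odot>\<^bsub>F.Q.A\<^esub> \<sigma> (fobj F.P.\<Phi> x)" if x: "x \<in> bObj F.P.A" for x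
      proof -
        let ?a = "fobj F.P.\<Phi> x"
        have a: "?a \<in> Obj F.P.A" using F.P.Phi.fobj_in x by simp
        note i = F.P.A.Ide_in[OF a]
        have "PAct F.Q.R (Ide F.Q.A (fobj F.f ?a)) (?b x) (F.\<Theta> ?a x (Ide F.P.A ?a)) =
            PAct F.Q.R (\<sigma> ?a) (Ide F.Q.bA (bmap (fobj G.f) x)) (G.\<Theta> ?a x (Ide F.P.A ?a))"
          using rcolax_2cellD(2)[OF c, of ?a x "Ide F.P.A ?a"] a x i by simp
        then show ?thesis
          unfolding lhs[OF x i] rhs[OF x i]
          using F.Q.A.Comp_Ide[OF X[OF x i]] F.Q.A.Comp_Ide[OF X'[OF x i]] by (simp add: F.f.farr_Ide[OF a])
      qed
      then show "colax_2cell P Q F G \<sigma>" using n by (simp add: colax_2cell_def)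
    next
      assume "colax_2cell P Q F G \<sigma>"
      then have c: "farr F.Q.\<Phi> (?b x) \<odot>\<^bsub>F.Q.A\<^esub> F.\<phi> x = G.\<phi> x \<odot>\<^bsub>F.Q.A\<^esub> \<sigma> (fobj F.P.\<Phi> x)" if "x \<in> bObj F.P.A" for x
        using that by (simp add: colax_2cell_def)
      show "rcolax_2cell F.P.L F.Q.L (yon P Q F) (yon P Q G) \<sigma>"
      proof (rule rcolax_2cellI; unfold F.P.lax_simps F.Q.lax_simps rfun_yon)
        fix a x r assume x: "x \<in> bObj F.P.A" and "r \<in> PEl F.P.R a x"
        then have r: "r \<in> hom F.P.A a (fobj F.P.\<Phi> x)" by simp
        show "PAct F.Q.R (Ide F.Q.A (fobj F.f a)) (?b x) (F.\<Theta> a x r) =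
            PAct F.Q.R (\<sigma> a) (Ide F.Q.bA (bmap (fobj G.f) x)) (G.\<Theta> a x r)"
          unfolding lhs[OF x r] rhs[OF x r] c[OF x] ..
      qed (rule n)
    qed
  next
    case False
    then show ?thesis by (simp add: rcolax_2cell_def colax_2cell_def)
  qed
qed

definition colax_id :: "('u, 'o, 'm) palg \<Rightarrow> ('u, 'o, 'm) colax" where
  "colax_id P = \<lparr>cfun = fid (pcat P),
       cnat = restrict (\<lambda>x. Ide (pcat P) (fobj (pact P) x)) (Obj (bcat (pcat P)))\<rparr>"

lemma yon_id:
  fixes P :: "('u :: universe, 'o, 'm) palg"
  assumes "pseudo_algebra P"
  shows "colax_data P P (colax_id P)" "yon P P (colax_id P) = rcolax_id (rep_lax P)"
proof -
  interpret P: pseudo_alg P by unfold_locales fact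
  show "colax_data P P (colax_id P)"
    using ext_functor_fid[OF P.A.category_axioms] P.Phi.fobj_in P.A.Ide_in
    by (auto simp: colax_data_def colax_id_def bmap_fid fid_simps)
  have "cnat (colax_id P) x \<odot>\<^bsub>P.A\<^esub> farr (fid P.A) r = r"
    if "x \<in> bObj P.A" "r \<in> hom P.A a (fobj P.\<Phi> x)" for a x r
    using that P.A.Ide_Comp[OF that(2)] homD[OF that(2)] by (simp add: colax_id_def fid_simps)
  then show "yon P P (colax_id P) = rcolax_id (rep_lax P)"
    by (intro rcolax_eqI) (auto simp: yon_def rcolax_id_def colax_id_def[THEN arg_cong[of _ _ cfun]] intro!: restrict_ext)
qed

text \<open>Write \<phi> and \<psi> for the families of F and G. By functoriality of g, applying
  \<psi> g(-) to \<phi> f(r) gives (\<psi> g(\<phi>)) g(f(r)), the transform of the composite. This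
  compatibility later pulls the laws of \<open>UltCat\<close> back from
  \<open>UltSp\<close>.\<close>

lemma yon_comp:
  fixes P Q R :: "('u :: universe, 'o, 'm) palg"
  assumes "pseudo_algebra P" "pseudo_algebra Q" "pseudo_algebra R" "colax_data P Q F" "colax_data Q R G"
  shows "colax_data P R (colax_comp P R G F)"
    "yon P R (colax_comp P R G F) = rcolax_comp (rep_lax P) (yon Q R G) (yon P Q F)"
proof -
  interpret F: colax_dat P Q F by unfold_locales fact+
  interpret G: colax_dat Q R G by unfold_locales fact+
  let ?H = "colax_comp P R G F"
  have f: "cfun ?H = fcomp F.P.A G.f F.f" by (simp add: colax_comp_def)
  have c: "cnat ?H x = G.\<phi> (bmap (fobj F.f) x) \<odot>\<^bsub>G.Q.A\<^esub> farr G.f (F.\<phi> x)"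
    "G.\<phi> (bmap (fobj F.f) x) \<odot>\<^bsub>G.Q.A\<^esub> farr G.f (F.\<phi> x) \<in>
      hom G.Q.A (fobj G.f (fobj F.f (fobj F.P.\<Phi> x))) (fobj G.Q.\<Phi> (bmap (fobj G.f) (bmap (fobj F.f) x)))"
    if x: "x \<in> bObj F.P.A" for x
    using x G.Q.A.Comp_in[OF G.phi_hom[OF F.bf_obj[OF x]] G.f.farr_in[OF F.phi_hom[OF x]]]
    by (simp_all add: colax_comp_def)
  have "cnat ?H \<in> extensional (bObj F.P.A)" by (simp add: colax_comp_def)
  then show d: "colax_data P R ?H"
    using ext_functor_fcomp[OF F.P.A.category_axioms F.ext G.ext] c F.P.Phi.fobj_in
    by (auto simp: colax_data_def f fcomp_simps bmap_fcomp PiE_iff)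
  interpret H: colax_dat P R ?H by unfold_locales (rule d)
  show "yon P R ?H = rcolax_comp (rep_lax P) (yon Q R G) (yon P Q F)"
  proof (rule rcolax_eqI)
    have "H.\<Theta> a x r = rnat (yon Q R G) (fobj F.f a) (bmap (fobj F.f) x) (rnat (yon P Q F) a x r)"
      if x: "x \<in> bObj F.P.A" and r: "r \<in> hom F.P.A a (fobj F.P.\<Phi> x)" for a x r
      unfolding H.theta[OF x r] F.theta[OF x r] G.theta[OF F.bf_obj[OF x] F.theta_hom[OF x r]] c(1)[OF x]
      using homD[OF r] homD[OF F.phi_hom[OF x]] homD[OF G.phi_hom[OF F.bf_obj[OF x]]]
      by (simp add: f fcomp_simps F.f.functor_simps G.f.functor_simps G.Q.A.cat_simps)
    then show "H.\<Theta> = rnat (rcolax_comp (rep_lax P) (yon Q R G) (yon P Q F))"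
      by (intro theta_ext[OF H.theta_ext_in, where G' = "\<lambda>a x. hom G.Q.A (fobj G.f (fobj F.f a)) (fobj G.Q.\<Phi> (bmap (fobj G.f) (bmap (fobj F.f) x)))"])
        (auto simp: rcolax_comp_def F.theta G.theta F.theta_hom G.theta_hom F.bf_obj)
  qed (simp add: f rcolax_comp_def)
qed

section \<open>The 2-category of ultracategories and its embedding\<close>

lemma rep_lax_simps:
  fixes P :: "('u :: universe, 'o, 'm) palg"
  assumes "pseudo_algebra P"
  shows "lax_algebra (rep_lax P)" "normalized (rep_lax P)" "lcat (rep_lax P) = pcat P" "category (pcat P)"
proof -
  interpret pseudo_alg P by unfold_locales fact
  show "lax_algebra (rep_lax P)" "normalized (rep_lax P)" "lcat (rep_lax P) = pcat P" "category (pcat P)"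
    by (rule lax_algebra_rep_lax normalized_rep_lax lax_simps A.category_axioms)+
qed

lemma yon_mor_iff:
  fixes P Q :: "('u :: universe, 'o, 'm) palg"
  assumes "pseudo_algebra P" "pseudo_algebra Q" "colax_data P Q F"
  shows "rcolax_morphism (rep_lax P) (rep_lax Q) (yon P Q F) \<longleftrightarrow> colax_morphism P Q F"
proof -
  interpret colax_dat P Q F by unfold_locales fact+
  show ?thesis by (rule yon_iff)
qed

lemma yon_mor:
  fixes P Q :: "('u :: universe, 'o, 'm) palg"
  assumes "pseudo_algebra P" "pseudo_algebra Q" "colax_morphism P Q F"
  shows "rcolax_morphism (rep_lax P) (rep_lax Q) (yon P Q F)"
  using yon_mor_iff[OF assms(1,2) colax_data_morphism[OF assms(3)]] assms(3) by simp

lemma colax_morphism_id: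
  fixes P :: "('u :: universe, 'o, 'm) palg"
  assumes "pseudo_algebra P"
  shows "colax_morphism P P (colax_id P)"
  using yon_mor_iff[OF assms assms yon_id(1)[OF assms]] yon_id(2)[OF assms]
    rcolax_morphism_id[OF rep_lax_simps(1)[OF assms]] by simp

lemma colax_morphism_comp:
  fixes P Q R :: "('u :: universe, 'o, 'm) palg"
  assumes P: "pseudo_algebra P" "pseudo_algebra Q" "pseudo_algebra R"
    and F: "colax_morphism P Q F" and G: "colax_morphism Q R G"
  shows "colax_morphism P R (colax_comp P R G F)"
  using yon_mor_iff[OF P(1,3) yon_comp(1)[OF P colax_data_morphism[OF F] colax_data_morphism[OF G]]]
    yon_comp(2)[OF P colax_data_morphism[OF F] colax_data_morphism[OF G]]
    rcolax_morphism_comp[OF rep_lax_simps(1)[OF P(1)] rep_lax_simps(1)[OF P(2)] rep_lax_simps(1)[OF P(3)]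
      yon_mor[OF P(1,2) F] yon_mor[OF P(2,3) G]]
  by simp

text \<open>No diagram is pasted: \<open>yon\<close> reflects 1-cells and 2-cells, is injective on
  data, and preserves identities and composites, so closure properties and composition laws are read
  off from their counterparts in \<open>UltSp\<close>.\<close>

lemma cell_two_UltCat:
  "cell_two {P :: ('u :: universe, 'o, 'm) palg. pseudo_algebra P}
    pcat cfun colax_morphism colax_2cell colax_id (\<lambda>P Q R. colax_comp P R)"
proof (rule cell_two.intro, unfold mem_Collect_eq)
  fix P Q :: "('u, 'o, 'm) palg" and F assume P: "pseudo_algebra P" and Q: "pseudo_algebra Q" and F: "colax_morphism P Q F"
  note d = colax_data_morphism[OF F]
  then show "ext_functor (pcat P) (pcat Q) (cfun F)" by (simp add: colax_data_def)
  show "colax_2cell P Q F F (restrict (\<lambda>a. Ide (pcat Q) (fobj (cfun F) a)) (Obj (pcat P)))"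
    using rcolax_2cell_id[OF rep_lax_simps(1)[OF P] rep_lax_simps(1)[OF Q] yon_mor[OF P Q F]] yon_2cell_iff[OF P Q d d]
    by (simp add: rep_lax_simps P Q)
  have "yon P Q (colax_comp P Q F (colax_id P)) = yon P Q F"
    using yon_comp(2)[OF P P Q yon_id(1)[OF P] d] yon_id(2)[OF P]
      rcolax_comp_id(1)[OF rep_lax_simps(1)[OF P] rep_lax_simps(1)[OF Q] yon_mor[OF P Q F]] by simp
  then show "colax_comp P Q F (colax_id P) = F"
    by (rule yon_inj[OF P Q yon_comp(1)[OF P P Q yon_id(1)[OF P] d] d])
  have "yon P Q (colax_comp P Q (colax_id Q) F) = yon P Q F"
    using yon_comp(2)[OF P Q Q d yon_id(1)[OF Q]] yon_id(2)[OF Q]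
      rcolax_comp_id(2)[OF rep_lax_simps(1)[OF P] rep_lax_simps(1)[OF Q] yon_mor[OF P Q F]] by simp
  then show "colax_comp P Q (colax_id Q) F = F"
    by (rule yon_inj[OF P Q yon_comp(1)[OF P Q Q d yon_id(1)[OF Q]] d])
next
  fix P Q :: "('u, 'o, 'm) palg" and F G H \<sigma> \<tau>
  assume P: "pseudo_algebra P" and Q: "pseudo_algebra Q"
    and F: "colax_morphism P Q F" and G: "colax_morphism P Q G" and H: "colax_morphism P Q H"
    and \<sigma>: "colax_2cell P Q F G \<sigma>" and \<tau>: "colax_2cell P Q G H \<tau>"
  note d = colax_data_morphism[OF F] colax_data_morphism[OF G] colax_data_morphism[OF H]
  show "colax_2cell P Q F H (restrict (\<lambda>a. \<tau> a \<odot>\<^bsub>pcat Q\<^esub> \<sigma> a) (Obj (pcat P)))"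
    using rcolax_2cell_vcomp[OF rep_lax_simps(1)[OF P] rep_lax_simps(1)[OF Q] yon_mor[OF P Q F] yon_mor[OF P Q G] yon_mor[OF P Q H],
        of \<sigma> \<tau>] \<sigma> \<tau> by (simp add: yon_2cell_iff P Q d rep_lax_simps)
next
  fix P Q R :: "('u, 'o, 'm) palg" and F F' G G' \<sigma> \<tau>
  assume P: "pseudo_algebra P" and Q: "pseudo_algebra Q" and R: "pseudo_algebra R"
    and F: "colax_morphism P Q F" and F': "colax_morphism P Q F'" and G: "colax_morphism Q R G" and G': "colax_morphism Q R G'"
    and \<sigma>: "colax_2cell P Q F F' \<sigma>" and \<tau>: "colax_2cell Q R G G' \<tau>"
  note d = colax_data_morphism[OF F] colax_data_morphism[OF F'] colax_data_morphism[OF G] colax_data_morphism[OF G']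
  have "rcolax_2cell (rep_lax P) (rep_lax R) (yon P R (colax_comp P R G F)) (yon P R (colax_comp P R G' F'))
      (cell_hcomp (pcat P) (pcat R) (cfun F') (cfun G) \<tau> \<sigma>)"
    using rcolax_2cell_hcomp[OF rep_lax_simps(1)[OF P] rep_lax_simps(1)[OF Q] rep_lax_simps(1)[OF R]
        yon_mor[OF P Q F] yon_mor[OF P Q F'] yon_mor[OF Q R G] yon_mor[OF Q R G'], of \<sigma> \<tau>] \<sigma> \<tau>
    by (simp add: yon_2cell_iff P Q R d rep_lax_simps yon_comp(2)[OF P Q R d(1,3)] yon_comp(2)[OF P Q R d(2,4)])
  then show "colax_2cell P R (colax_comp P R G F) (colax_comp P R G' F') (cell_hcomp (pcat P) (pcat R) (cfun F') (cfun G) \<tau> \<sigma>)"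
    using yon_2cell_iff[OF P R yon_comp(1)[OF P Q R d(1,3)] yon_comp(1)[OF P Q R d(2,4)]] by simp
next
  fix P Q R S :: "('u, 'o, 'm) palg" and F G H
  assume P: "pseudo_algebra P" and Q: "pseudo_algebra Q" and R: "pseudo_algebra R" and S: "pseudo_algebra S"
    and F: "colax_morphism P Q F" and G: "colax_morphism Q R G" and H: "colax_morphism R S H"
  note d = colax_data_morphism[OF F] colax_data_morphism[OF G] colax_data_morphism[OF H]
  note GF = yon_comp[OF P Q R d(1,2)] and HG = yon_comp[OF Q R S d(2,3)]
  show "colax_comp P S (colax_comp Q S H G) F = colax_comp P S H (colax_comp P R G F)"
  proof (rule yon_inj[OF P S yon_comp(1)[OF P Q S d(1) HG(1)] yon_comp(1)[OF P R S GF(1) d(3)]])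
    show "yon P S (colax_comp P S (colax_comp Q S H G) F) = yon P S (colax_comp P S H (colax_comp P R G F))"
      unfolding yon_comp(2)[OF P Q S d(1) HG(1)] yon_comp(2)[OF P R S GF(1) d(3)] GF(2) HG(2)
      by (rule rcolax_comp_assoc[OF rep_lax_simps(1)[OF P] rep_lax_simps(1)[OF Q] rep_lax_simps(1)[OF R] rep_lax_simps(1)[OF S]
          yon_mor[OF P Q F] yon_mor[OF Q R G] yon_mor[OF R S H]])
  qed
qed (auto simp: rep_lax_simps colax_2cell_def colax_morphism_id colax_morphism_comp,
    simp_all add: colax_id_def colax_comp_def)

lemma UltCat_eq: "UltCat = cell_two.T {P :: ('u :: universe, 'o, 'm) palg. pseudo_algebra P}
    pcat cfun colax_morphism colax_2cell colax_id (\<lambda>P Q R. colax_comp P R)"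
  unfolding cell_two.T_def[OF cell_two_UltCat] by (simp add: UltCat_def colax_id_def[abs_def])

lemma two_category_UltCat: "two_category (UltCat :: (('u :: universe, 'o, 'm) palg, _, _) two_cat)"
  unfolding UltCat_eq by (rule cell_two.two_category_T[OF cell_two_UltCat])

lemma UltCat_simps:
  "Ob UltCat = {P. pseudo_algebra P}"
  "Obj (HOM UltCat P Q) = {F. colax_morphism P Q F}"
  "Arr (HOM UltCat P Q) = {(F, G, \<sigma>). colax_morphism P Q F \<and> colax_morphism P Q G \<and> colax_2cell P Q F G \<sigma>}"
  "Dom (HOM UltCat P Q) (F, G, \<sigma>) = F" "Cod (HOM UltCat P Q) (F, G, \<sigma>) = G"
  "Ide (HOM UltCat P Q) F = (F, F, restrict (\<lambda>a. Ide (pcat Q) (fobj (cfun F) a)) (Obj (pcat P)))"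
  "(F', G', \<tau>) \<odot>\<^bsub>HOM UltCat P Q\<^esub> (F, G, \<sigma>) = (F, G', restrict (\<lambda>a. \<tau> a \<odot>\<^bsub>pcat Q\<^esub> \<sigma> a) (Obj (pcat P)))"
  "Id1 UltCat P = colax_id P"
  "comp1 UltCat P Q R G F = colax_comp P R G F"
  "comp2 UltCat P Q R (G, G', \<tau>) (F, F', \<sigma>) = (colax_comp P R G F, colax_comp P R G' F',
         cell_hcomp (pcat P) (pcat R) (cfun F') (cfun G) \<tau> \<sigma>)"
  by (simp_all add: UltCat_def cell_cat_def colax_id_def)

lemma UltSp_simps:
  "Ob UltSp = {L. lax_algebra L \<and> normalized L}"
  "Obj (HOM UltSp L M) = {F. rcolax_morphism L M F}"
  "Arr (HOM UltSp L M) = {(F, G, \<sigma>). rcolax_morphism L M F \<and> rcolax_morphism L M G \<and> rcolax_2cell L M F G \<sigma>}"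
  "Dom (HOM UltSp L M) (F, G, \<sigma>) = F" "Cod (HOM UltSp L M) (F, G, \<sigma>) = G"
  "Ide (HOM UltSp L M) F = (F, F, restrict (\<lambda>a. Ide (lcat M) (fobj (rfun F) a)) (Obj (lcat L)))"
  "(F', G', \<tau>) \<odot>\<^bsub>HOM UltSp L M\<^esub> (F, G, \<sigma>) = (F, G', restrict (\<lambda>a. \<tau> a \<odot>\<^bsub>lcat M\<^esub> \<sigma> a) (Obj (lcat L)))"
  "Id1 UltSp L = rcolax_id L"
  "comp1 UltSp L M N G F = rcolax_comp L G F"
  "comp2 UltSp L M N (G, G', \<tau>) (F, F', \<sigma>) = (rcolax_comp L G F, rcolax_comp L G' F',
         cell_hcomp (lcat L) (lcat N) (rfun F') (rfun G) \<tau> \<sigma>)"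
  by (simp_all add: UltSp_def cell_cat_def)

section \<open>The embedding as a 2-functor\<close>

definition emb :: "(('u, 'o, 'm) palg, ('u, 'o, 'm) colax, ('u, 'o, 'm) colax \<times> ('u, 'o, 'm) colax \<times> ('o \<Rightarrow> 'm),
    ('u, 'o, 'm, 'm) lax, ('u, 'o, 'm, 'm) rcolax, ('u, 'o, 'm, 'm) rcolax \<times> ('u, 'o, 'm, 'm) rcolax \<times> ('o \<Rightarrow> 'm)) two_func" where
  "emb = \<lparr>jobj = rep_lax,
     jhom = (\<lambda>P Q. \<lparr>fobj = yon P Q, farr = (\<lambda>(F, G, \<sigma>). (yon P Q F, yon P Q G, \<sigma>))\<rparr>)\<rparr>"

lemma emb_simps:
  "jobj emb = rep_lax" "fobj (jhom emb P Q) F = yon P Q F"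
  "farr (jhom emb P Q) (F, G, \<sigma>) = (yon P Q F, yon P Q G, \<sigma>)"
  by (simp_all add: emb_def)

lemma two_functor_emb: "two_functor UltCat UltSp (emb :: (('u :: universe, 'o, 'm) palg, _, _, _, _, _) two_func)"
proof (rule two_functor.intro[OF two_category_UltCat two_category_UltSp two_functor_axioms.intro])
  fix P Q :: "('u, 'o, 'm) palg" assume "P \<in> Ob UltCat" "Q \<in> Ob UltCat"
  then have P: "pseudo_algebra P" and Q: "pseudo_algebra Q" by (auto simp: UltCat_simps)
  show "is_functor (HOM UltCat P Q) (HOM UltSp (jobj emb P) (jobj emb Q)) (jhom emb P Q)"
  proof
    fix s F G assume "s \<in> hom (HOM UltCat P Q) F G"
    then show "farr (jhom emb P Q) s \<in> hom (HOM UltSp (jobj emb P) (jobj emb Q)) (fobj (jhom emb P Q) F) (fobj (jhom emb P Q) G)"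
      by (auto simp: hom_def UltCat_simps UltSp_simps emb_simps yon_mor P Q yon_2cell_iff colax_data_morphism)
  next
    fix t G H s F assume "t \<in> hom (HOM UltCat P Q) G H" "s \<in> hom (HOM UltCat P Q) F G"
    then show "farr (jhom emb P Q) (t \<odot>\<^bsub>HOM UltCat P Q\<^esub> s) =
        farr (jhom emb P Q) t \<odot>\<^bsub>HOM UltSp (jobj emb P) (jobj emb Q)\<^esub> farr (jhom emb P Q) s"
      by (auto simp: hom_def UltCat_simps UltSp_simps emb_simps rep_lax_simps P Q)
  qed (auto simp: UltCat_simps UltSp_simps emb_simps yon_mor P Q rep_lax_simps)
next
  fix P Q R :: "('u, 'o, 'm) palg" and F G assume "P \<in> Ob UltCat" "Q \<in> Ob UltCat" "R \<in> Ob UltCat"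
    "F \<in> Obj (HOM UltCat P Q)" "G \<in> Obj (HOM UltCat Q R)"
  then show "fobj (jhom emb P R) (comp1 UltCat P Q R G F) =
      comp1 UltSp (jobj emb P) (jobj emb Q) (jobj emb R) (fobj (jhom emb Q R) G) (fobj (jhom emb P Q) F)"
    using yon_comp(2)[of P Q R F G] by (simp add: UltCat_simps UltSp_simps emb_simps colax_data_morphism)
next
  fix P Q R :: "('u, 'o, 'm) palg" and s t assume "P \<in> Ob UltCat" "Q \<in> Ob UltCat" "R \<in> Ob UltCat"
    "s \<in> Arr (HOM UltCat P Q)" "t \<in> Arr (HOM UltCat Q R)"
  then show "farr (jhom emb P R) (comp2 UltCat P Q R t s) =
      comp2 UltSp (jobj emb P) (jobj emb Q) (jobj emb R) (farr (jhom emb Q R) t) (farr (jhom emb P Q) s)"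
    by (auto simp: UltCat_simps UltSp_simps emb_simps colax_data_morphism yon_comp(2) rep_lax_simps)
qed (auto simp: UltCat_simps UltSp_simps emb_simps rep_lax_simps yon_id)

lemma two_fully_faithful_emb:
  "two_fully_faithful UltCat UltSp (emb :: (('u :: universe, 'o, 'm) palg, _, _, _, _, _) two_func)"
  unfolding two_fully_faithful_def
proof (intro ballI)
  fix P Q :: "('u, 'o, 'm) palg" assume "P \<in> Ob UltCat" "Q \<in> Ob UltCat"
  then have P: "pseudo_algebra P" and Q: "pseudo_algebra Q" by (auto simp: UltCat_simps)
  note inj = yon_inj[OF P Q colax_data_morphism colax_data_morphism]
  \<comment> \<open>A preimage found by Yoneda is only data at first; \<open>yon_mor_iff\<close>
    makes it a colax morphism.\<close>
  have surj: "\<exists>F. colax_morphism P Q F \<and> yon P Q F = G" if "rcolax_morphism (rep_lax P) (rep_lax Q) G" for G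
    using yon_surj[OF P Q that] yon_mor_iff[OF P Q] that by metis
  have "bij_betw (yon P Q) {F. colax_morphism P Q F} {F. rcolax_morphism (rep_lax P) (rep_lax Q) F}"
    unfolding bij_betw_def inj_on_def using inj surj yon_mor[OF P Q] by (auto simp: image_iff) metis
  moreover have "bij_betw (\<lambda>(F, G, \<sigma>). (yon P Q F, yon P Q G, \<sigma>))
      {(F, G, \<sigma>). colax_morphism P Q F \<and> colax_morphism P Q G \<and> colax_2cell P Q F G \<sigma>}
      {(F, G, \<sigma>). rcolax_morphism (rep_lax P) (rep_lax Q) F \<and> rcolax_morphism (rep_lax P) (rep_lax Q) G \<and>
        rcolax_2cell (rep_lax P) (rep_lax Q) F G \<sigma>}" (is "bij_betw ?j ?S ?T")
    unfolding bij_betw_def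
  proof
    show "inj_on ?j ?S" unfolding inj_on_def using inj by auto
    show "?j ` ?S = ?T"
    proof (intro set_eqI iffI)
      fix s assume "s \<in> ?T"
      then obtain F' G' \<sigma> where s: "s = (F', G', \<sigma>)" "rcolax_morphism (rep_lax P) (rep_lax Q) F'"
        "rcolax_morphism (rep_lax P) (rep_lax Q) G'" "rcolax_2cell (rep_lax P) (rep_lax Q) F' G' \<sigma>" by auto
      obtain F G where "colax_morphism P Q F" "yon P Q F = F'" "colax_morphism P Q G" "yon P Q G = G'"
        using surj s by metis
      then show "s \<in> ?j ` ?S"
        using s yon_2cell_iff[OF P Q colax_data_morphism colax_data_morphism, of F G \<sigma>]
        by (intro image_eqI[of _ _ "(F, G, \<sigma>)"]) auto
    qed (auto simp: yon_mor P Q yon_2cell_iff colax_data_morphism)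
  qed
  ultimately show "bij_betw (fobj (jhom emb P Q)) (Obj (HOM UltCat P Q)) (Obj (HOM UltSp (jobj emb P) (jobj emb Q))) \<and>
      bij_betw (farr (jhom emb P Q)) (Arr (HOM UltCat P Q)) (Arr (HOM UltSp (jobj emb P) (jobj emb Q)))"
    by (simp add: UltCat_simps UltSp_simps emb_def)
qed

text \<open>Everything is read off at identities: \<Phi> x is the codomain of the identity of \<Phi>
  x as an element over x, \<Phi> v is the action of v on that identity, and \<upsilon> and m are
  values of \<Gamma> and \<Delta> at identities. As the data are extensional, these values determine
  the pseudoalgebra.\<close>

lemma inj_rep_lax:
  fixes P Q :: "('u :: universe, 'o, 'm) palg"
  assumes "pseudo_algebra P" "pseudo_algebra Q" "rep_lax P = rep_lax Q"
  shows "P = Q"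
proof -
  interpret P: pseudo_alg P by unfold_locales fact
  interpret Q: pseudo_alg Q by unfold_locales fact
  have A: "Q.A = P.A" using P.lax_simps(1) Q.lax_simps(1) assms(3) by metis
  have R: "rep_prof P.A Q.\<Phi> = P.R" using P.lax_simps(2) Q.lax_simps(2) assms(3) A by metis
  have i: "Ide P.A (fobj P.\<Phi> x) \<in> hom P.A (fobj P.\<Phi> x) (fobj P.\<Phi> x)" if "x \<in> bObj P.A" for x
    using P.A.Ide_in P.Phi.fobj_in that by simp
  have obj: "fobj P.\<Phi> x = fobj Q.\<Phi> x" if x: "x \<in> bObj P.A" for x :: "('u, 'o) bobj"
  proof -
    have "PEl (rep_prof P.A Q.\<Phi>) (fobj P.\<Phi> x) x = PEl P.R (fobj P.\<Phi> x) x" by (simp only: R)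
    then have "Ide P.A (fobj P.\<Phi> x) \<in> hom P.A (fobj P.\<Phi> x) (fobj Q.\<Phi> x)" using i[OF x] by simp
    then show ?thesis using homD(3)[OF i[OF x]] by (simp add: homD(3))
  qed
  have "P.\<Phi> = Q.\<Phi>"
  proof (rule func_eqI[OF P.ext_Phi])
    show "ext_functor P.bA P.A Q.\<Phi>" using Q.ext_Phi by (simp only: A)
    fix v assume v: "v \<in> Arr P.bA"
    note s = Arr_bcatD[OF v]
    have "PAct (rep_prof P.A Q.\<Phi>) (Ide P.A (fobj P.\<Phi> (src v))) v (Ide P.A (fobj P.\<Phi> (src v))) =
        PAct P.R (Ide P.A (fobj P.\<Phi> (src v))) v (Ide P.A (fobj P.\<Phi> (src v)))" by (simp only: R)
    moreover have "farr Q.\<Phi> v \<in> Arr P.A" "Dom P.A (farr Q.\<Phi> v) = fobj P.\<Phi> (src v)"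
      using Q.Phi.farr_simps[of v] v obj[OF s(1)] A by simp_all
    ultimately show "farr P.\<Phi> v = farr Q.\<Phi> v"
      using v s(1) P.Phi.fobj_in[of "src v"] P.Phi.farr_simps[of v] by (simp add: P.A.cat_simps)
  qed (simp add: obj)
  moreover have "P.\<upsilon> = Q.\<upsilon>"
  proof (rule extensionalityI[of _ "Obj P.A"])
    show "P.\<upsilon> \<in> extensional (Obj P.A)" using P.unit_nat by (simp add: nat_iso_def nat_trans_def)
    show "Q.\<upsilon> \<in> extensional (Obj P.A)" using Q.unit_nat A by (simp add: nat_iso_def nat_trans_def)
    fix a assume a: "a \<in> Obj P.A"
    have "lunitor P.L a a (Ide P.A a) = lunitor Q.L a a (Ide P.A a)" using assms(3) by simp
    then show "P.\<upsilon> a = Q.\<upsilon> a"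
      using a P.lunitor_simp[OF P.A.Ide_in[OF a]] Q.lunitor_simp[of "Ide P.A a" a a] A P.A.Ide_in[OF a]
        P.A.Comp_Ide[OF P.unit_hom[OF a]] P.A.Comp_Ide[of "Q.\<upsilon> a"] Q.unit_hom[of a] by simp
  qed
  moreover have "P.m = Q.m"
  proof (rule extensionalityI[of _ "bObj P.bA"])
    show "P.m \<in> extensional (bObj P.bA)" using P.mult_nat by (simp add: nat_iso_def nat_trans_def)
    show "Q.m \<in> extensional (bObj P.bA)" using Q.mult_nat A by (simp add: nat_iso_def nat_trans_def)
    fix Y :: "('u, ('u, 'o) bobj) bobj" assume Y: "Y \<in> bObj P.bA"
    let ?x = "bmap (fobj P.\<Phi>) Y"
    have x: "?x \<in> bObj P.A" by (rule P.bmap_Phi_in[OF Y])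
    have j: "Ide P.bA ?x \<in> hom P.bA ?x ?x" using P.bA.Ide_in x by simp
    note s = retgt_bset[OF Y j]
    have "P.m Y = delta P.L (fobj P.\<Phi> ?x) (Ide P.A (fobj P.\<Phi> ?x)) (retgt Y (Ide P.bA ?x))"
      using P.delta_rep(1)[OF i[OF x] x Y s(1)] s(2) P.Phi.farr_Ide[of ?x] x P.A.Comp_Ide[OF P.mult_hom[OF Y]]
        P.Phi.fobj_in[of ?x] by (simp add: P.A.cat_simps)
    moreover have "Q.m Y = delta Q.L (fobj Q.\<Phi> ?x) (Ide Q.A (fobj Q.\<Phi> ?x)) (retgt Y (Ide Q.bA ?x))"
    proof -
      have Y': "Y \<in> bObj Q.bA" and eq: "bmap (fobj Q.\<Phi>) Y = ?x" "Q.A = P.A" "Q.\<Phi> = P.\<Phi>"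
        using Y A \<open>P.\<Phi> = Q.\<Phi>\<close> by simp_all
      then show ?thesis
        using Q.delta_rep(1)[OF _ _ Y', of "Ide P.A (fobj P.\<Phi> ?x)" "fobj P.\<Phi> ?x" ?x "retgt Y (Ide P.bA ?x)"]
          i[OF x] x s P.Phi.farr_Ide[of ?x] P.A.Comp_Ide[of "Q.m Y"] Q.mult_hom[OF Y']
          P.Phi.fobj_in[of ?x] by (simp add: P.A.cat_simps)
    qed
    ultimately show "P.m Y = Q.m Y" using assms(3) A \<open>P.\<Phi> = Q.\<Phi>\<close> by simp
  qed
  ultimately show ?thesis using A by (intro palg.equality) auto
qed

text \<open>The structure maps of F are injective, so each law for their inverses can be checked
  after applying them, where it becomes the law for F. Since F is the identity on the underlying
  category, no object has to be transported.\<close>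

lemma rcolax_inverse:
  fixes L M :: "('u :: universe, 'o, 'm, 'e) lax"
  assumes alg: "lax_algebra L" "lax_algebra M" and mor: "rcolax_morphism L M F"
    and F: "lcat M = lcat L" "rfun F = fid (lcat L)"
    and bij: "\<And>a x. a \<in> Obj (lcat L) \<Longrightarrow> x \<in> bObj (lcat L) \<Longrightarrow>
      bij_betw (rnat F a x) (PEl (lprof L) a x) (PEl (lprof M) a x)"
  obtains G where "rcolax_morphism M L G" "rcolax_comp L G F = rcolax_id L" "rcolax_comp M F G = rcolax_id M"
proof -
  interpret F: rcolax_mor L M F by unfold_locales fact+
  define \<Psi> where "\<Psi> a x = inv_into (PEl F.L.F a x) (F.\<Theta> a x)" for a x
  have \<Psi>: "\<Psi> a x r \<in> PEl F.L.F a x" "F.\<Theta> a x (\<Psi> a x r) = r"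
    if "a \<in> Obj F.L.A" "x \<in> bObj F.L.A" "r \<in> PEl F.M.F a x" for a x r
    using bij[OF that(1,2)] that(3) unfolding \<Psi>_def
    by (auto simp: bij_betw_def inv_into_into f_inv_into_f)
  have \<Psi>': "\<Psi> a x q = r" if "a \<in> Obj F.L.A" "x \<in> bObj F.L.A" "r \<in> PEl F.L.F a x" "F.\<Theta> a x r = q" for a x r q
    using bij[OF that(1,2)] that(3,4) unfolding \<Psi>_def by (auto simp: bij_betw_def)
  define G where "G = \<lparr>rfun = fid F.L.A,
    rnat = (\<lambda>a \<in> Obj F.L.A. \<lambda>x \<in> bObj F.L.A. \<lambda>r \<in> PEl F.M.F a x. \<Psi> a x r)\<rparr>"
  have th: "rnat G a x r = \<Psi> a x r" if "a \<in> Obj F.L.A" "x \<in> bObj F.L.A" "r \<in> PEl F.M.F a x" for a x r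
    using that by (simp add: G_def)
  have G_f: "rfun G = fid F.L.A" by (simp add: G_def)
  have bm: "bmap (fobj (fid F.L.A)) x = x" if "x \<in> bObj F.L.A" for x :: "('u, 'o) bobj"
    using that by (rule bmap_fid)
  have mor_G: "rcolax_morphism M L G"
  proof (rule rcolax_morphismI; unfold G_f F(1))
    show "ext_functor F.L.A F.L.A (fid F.L.A)" by (rule ext_functor_fid) (rule F.L.A.category_axioms)
    show "prof_nat F.L.bA F.L.A F.M.F (pull_prof F.L.F (fid F.L.A) (bfun (fid F.L.A))) (rnat G)"
    proof (rule prof_natI)
      show "rnat G \<in> (\<Pi>\<^sub>E d\<in>Obj F.L.A. \<Pi>\<^sub>E c\<in>Obj F.L.bA. PEl F.M.F d c \<rightarrow>\<^sub>E
          PEl (pull_prof F.L.F (fid F.L.A) (bfun (fid F.L.A))) d c)"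
        by (auto simp: G_def fid_simps bm \<Psi>)
      fix h v a' a x x' r assume h: "h \<in> hom F.L.A a' a" and v: "v \<in> hom F.L.bA x x'" and r: "r \<in> PEl F.M.F a x"
      have o: "a \<in> Obj F.L.A" "a' \<in> Obj F.L.A" "x \<in> bObj F.L.A" "x' \<in> bObj F.L.A"
        using F.L.A.hom_Obj[OF h] F.L.bA.hom_Obj[OF v] by auto
      have hvr: "PAct F.M.F h v r \<in> PEl F.M.F a' x'"
        by (rule F.M.F.act_in[unfolded F(1), OF h v r])
      have "\<Psi> a' x' (PAct F.M.F h v r) = PAct F.L.F h v (\<Psi> a x r)"
        by (rule \<Psi>'[OF o(2,4) F.L.F.act_in[OF h v \<Psi>(1)[OF o(1,3) r]]])
          (use F.theta_nat[OF h v \<Psi>(1)[OF o(1,3) r]] \<Psi>(2)[OF o(1,3) r] homD(1)[OF h] homD(1)[OF v] in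
            \<open>simp add: F(2) fid_simps bfun_fid\<close>)
      then show "rnat G a' x' (PAct F.M.F h v r) =
          PAct (pull_prof F.L.F (fid F.L.A) (bfun (fid F.L.A))) h v (rnat G a x r)"
        using o r hvr homD(1)[OF h] homD(1)[OF v] by (simp add: th fid_simps bfun_fid)
    qed
    fix a assume a: "a \<in> Obj F.L.A"
    have u: "lunitor L a a (Ide F.L.A a) \<in> PEl F.L.F a (single a)" by (rule F.L.unit_in[OF F.L.A.Ide_in[OF a]])
    have u': "lunitor M a a (Ide F.L.A a) \<in> PEl F.M.F a (single a)"
      using F.M.unit_in[of "Ide F.L.A a" a a] F.L.A.Ide_in[OF a] F(1) by simp
    have "\<Psi> a (single a) (lunitor M a a (Ide F.L.A a)) = lunitor L a a (Ide F.L.A a)"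
      by (rule \<Psi>'[OF a single_in[OF a] u]) (use F.theta_unit[OF a] a in \<open>simp add: F fid_simps\<close>)
    then show "rnat G a (single a) (lunitor M a a (Ide F.L.A a)) =
        lunitor L (fobj (fid F.L.A) a) (fobj (fid F.L.A) a) (Ide F.L.A (fobj (fid F.L.A) a))"
      using a th[OF a single_in[OF a] u'] by (simp add: fid_simps)
    fix x Y r s assume x: "x \<in> bObj F.L.A" and Y: "Y \<in> bObj F.L.bA" and r: "r \<in> PEl F.M.F a x" and s: "s \<in> bset (PEl F.M.F) x Y"
    obtain t \<zeta> where t: "s = bel_of x Y t \<zeta>" "t \<in> idx Y \<rightarrow> idx x" "filtermap t (ult Y) = ult x"
      "\<And>z. z \<in> idx Y \<Longrightarrow> \<zeta> z \<in> PEl F.M.F (val x (t z)) (val Y z)"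
      using s by (rule bsetE) blast
    have o: "val x (t z) \<in> Obj F.L.A" "val Y z \<in> bObj F.L.A" if "z \<in> idx Y" for z
      using bObjD(2)[OF x] bObjD(2)[OF Y] that t(2) by auto
    have bb: "bmap (bmap (fobj (fid F.L.A))) Y = Y" by (rule bmap_ident[OF Y]) (simp add: bm)
    have push: "theta_push (fid F.L.A) (rnat G) s = bel_of x Y t (\<lambda>z. \<Psi> (val x (t z)) (val Y z) (\<zeta> z))"
      unfolding t(1) theta_push_bel_of bm[OF x] bb
      by (rule bel_of_cong[OF bObjD(1)[OF Y]]) (use th[OF o t(4)] in auto)
    have push_in: "bel_of x Y t (\<lambda>z. \<Psi> (val x (t z)) (val Y z) (\<zeta> z)) \<in> bset (PEl F.L.F) x Y"
      by (rule bsetI[OF t(2,3)]) (rule \<Psi>(1)[OF o t(4)])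
    have push2: "theta_push (fid F.L.A) F.\<Theta> (bel_of x Y t (\<lambda>z. \<Psi> (val x (t z)) (val Y z) (\<zeta> z))) = s"
      unfolding t(1) theta_push_bel_of bm[OF x] bb
      by (rule bel_of_cong[OF bObjD(1)[OF Y]]) (use \<Psi>(2)[OF o t(4)] in auto)
    have d: "delta M a r s \<in> PEl F.M.F a (bmu_obj Y)"
      by (rule F.M.delta_in[unfolded F(1), OF a x Y r s])
    have "\<Psi> a (bmu_obj Y) (delta M a r s) = delta L a (\<Psi> a x r) (bel_of x Y t (\<lambda>z. \<Psi> (val x (t z)) (val Y z) (\<zeta> z)))"
    proof (rule \<Psi>'[OF a bmu_obj_in[OF Y] F.L.delta_in[OF a x Y \<Psi>(1)[OF a x r] push_in]])
      show "F.\<Theta> a (bmu_obj Y) (delta L a (\<Psi> a x r) (bel_of x Y t (\<lambda>z. \<Psi> (val x (t z)) (val Y z) (\<zeta> z)))) = delta M a r s"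
        using F.theta_mult[OF a x Y \<Psi>(1)[OF a x r] push_in] a \<Psi>(2)[OF a x r] push2 by (simp add: F fid_simps)
    qed
    then show "rnat G a (bmu_obj Y) (delta M a r s) =
        delta L (fobj (fid F.L.A) a) (rnat G a x r) (theta_push (fid F.L.A) (rnat G) s)"
      using th[OF a x r] th[OF a bmu_obj_in[OF Y] d] a by (simp add: fid_simps push)
  qed
  moreover have "rcolax_comp L G F = rcolax_id L"
  proof (rule rcolax_eqI)
    have "rnat G (fobj (fid F.L.A) a) (bmap (fobj (fid F.L.A)) x) (F.\<Theta> a x r) = r"
      if "a \<in> Obj F.L.A" "x \<in> bObj F.L.A" "r \<in> PEl F.L.F a x" for a x r
      using that F.theta_in[OF that] th[OF that(1,2)] \<Psi>'[OF that refl] by (simp add: F fid_simps bm)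
    then show "rnat (rcolax_comp L G F) = rnat (rcolax_id L)"
      by (auto simp: rcolax_comp_def rcolax_id_def F intro!: restrict_ext)
  qed (use fcomp_fid[OF F.L.A.category_axioms ext_functor_fid[OF F.L.A.category_axioms]] in
      \<open>simp add: rcolax_comp_def rcolax_id_def F G_f\<close>)
  moreover have "rcolax_comp M F G = rcolax_id M"
  proof (rule rcolax_eqI)
    have "F.\<Theta> (fobj (fid F.L.A) a) (bmap (fobj (fid F.L.A)) x) (rnat G a x r) = r"
      if "a \<in> Obj F.L.A" "x \<in> bObj F.L.A" "r \<in> PEl F.M.F a x" for a x r
      using that th[OF that] \<Psi>[OF that] by (simp add: fid_simps bm)
    then show "rnat (rcolax_comp M F G) = rnat (rcolax_id M)"
      by (auto simp: rcolax_comp_def rcolax_id_def F G_f intro!: restrict_ext)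
  qed (use fcomp_fid[OF F.L.A.category_axioms ext_functor_fid[OF F.L.A.category_axioms]] in
      \<open>simp add: rcolax_comp_def rcolax_id_def F G_f\<close>)
  ultimately show thesis by (rule that)
qed

lemma equivalent_rep_lax:
  fixes L :: "('u :: universe, 'o, 'm, 'm) lax"
  assumes L: "lax_algebra L" "normalized L" and P: "pseudo_algebra P" and rep: "is_rep_lax L P"
  shows "equivalent UltSp (rep_lax P) L"
proof -
  obtain \<Theta> where c: "lcat L = pcat P" and mor: "rcolax_morphism L (rep_lax P) \<lparr>rfun = fid (lcat L), rnat = \<Theta>\<rparr>"
    and bij: "\<And>a x. a \<in> Obj (lcat L) \<Longrightarrow> x \<in> bObj (lcat L) \<Longrightarrow>
        bij_betw (\<Theta> a x) (PEl (lprof L) a x) (PEl (lprof (rep_lax P)) a x)"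
    using rep unfolding is_rep_lax_def by auto
  obtain G where G: "rcolax_morphism (rep_lax P) L G"
    "rcolax_comp L G \<lparr>rfun = fid (lcat L), rnat = \<Theta>\<rparr> = rcolax_id L"
    "rcolax_comp (rep_lax P) \<lparr>rfun = fid (lcat L), rnat = \<Theta>\<rparr> G = rcolax_id (rep_lax P)"
    using rcolax_inverse[OF L(1) rep_lax_simps(1)[OF P] mor] c bij by (auto simp: rep_lax_simps[OF P])
  \<comment> \<open>The composites are equal to identities, so identity 2-cells witness the two
    isomorphisms of the equivalence.\<close>
  have "isomorphic (HOM UltSp M M) (rcolax_id M) (rcolax_id M)" if "lax_algebra M" "normalized M" for M :: "('u, 'o, 'm, 'm) lax"
  proof -
    have M: "M \<in> Ob UltSp" using that by (simp add: UltSp_simps)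
    interpret two_category "UltSp :: (('u, 'o, 'm, 'm) lax, _, _) two_cat" by (rule two_category_UltSp)
    interpret C: category "HOM UltSp M M" by (rule HOM_category[OF M M])
    have "rcolax_id M \<in> Obj (HOM UltSp M M)" using Id1_in[OF M] by (simp add: UltSp_simps)
    then show ?thesis unfolding isomorphic_def using C.Ide_in C.iso_Ide by blast
  qed
  note iso = this
  show ?thesis
    unfolding equivalent_def UltSp_simps
    by (rule bexI[of _ G], rule bexI[of _ "\<lparr>rfun = fid (lcat L), rnat = \<Theta>\<rparr>"])
      (use G mor L rep_lax_simps[OF P] iso in auto)
qed

section \<open>Lax algebras equivalent to representable ones\<close>

text \<open>The 2-cell condition for \<tau> says that r sent through G and F, then acted on by
  \<beta>\<tau>, is r acted on by \<tau> a. The latter action is injective, hence so is the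
  structure map of G.\<close>

lemma theta_comp_inj:
  fixes L M :: "('u :: universe, 'o, 'm, 'e) lax"
  assumes alg: "lax_algebra L" "lax_algebra M" and F: "rcolax_morphism M L F" and G: "rcolax_morphism L M G"
    and \<tau>: "rcolax_2cell L L (rcolax_comp L F G) (rcolax_id L) \<tau>" and iso: "\<And>a. a \<in> Obj (lcat L) \<Longrightarrow> iso_arr (lcat L) (\<tau> a)"
    and a: "a \<in> Obj (lcat L)" and x: "x \<in> bObj (lcat L)"
  shows "inj_on (rnat G a x) (PEl (lprof L) a x)"
    and "r \<in> PEl (lprof L) a x \<Longrightarrow>
      PAct (lprof L) (Ide (lcat L) (fobj (rfun F) (fobj (rfun G) a))) (bnt (fcomp (lcat L) (rfun F) (rfun G)) (fid (lcat L)) \<tau> x)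
        (rnat F (fobj (rfun G) a) (bmap (fobj (rfun G)) x) (rnat G a x r))
      = PAct (lprof L) (\<tau> a) (Ide (bcat (lcat L)) x) r"
proof -
  interpret L: lax_alg L by unfold_locales fact
  show eq: "PAct L.F (Ide L.A (fobj (rfun F) (fobj (rfun G) a))) (bnt (fcomp L.A (rfun F) (rfun G)) (fid L.A) \<tau> x)
        (rnat F (fobj (rfun G) a) (bmap (fobj (rfun G)) x) (rnat G a x r))
      = PAct L.F (\<tau> a) (Ide L.bA x) r" if r: "r \<in> PEl L.F a x" for r
    using rcolax_2cellD(2)[OF \<tau> a x r] a x r
    by (simp add: rcolax_comp_def rcolax_id_def fcomp_simps bmap_fid del: bcat_simps(4))
  have t: "\<tau> a \<in> hom L.A (fobj (rfun F) (fobj (rfun G) a)) a"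
    using nat_transD(1)[OF rcolax_2cellD(1)[OF \<tau>] a] a by (simp add: rcolax_comp_def rcolax_id_def fcomp_simps fid_simps)
  have "inj_on (PAct L.F (\<tau> a) (Ide L.bA x)) (PEl L.F a x)"
    using L.F.bij_act_left[OF t iso[OF a], of x] x by (simp add: bij_betw_def)
  then show "inj_on (rnat G a x) (PEl L.F a x)"
    unfolding inj_on_def by (metis eq)
qed

text \<open>For surjectivity, send q through F, act by \<beta>\<tau>, and solve for r with the
  invertible \<tau> a. Then q and the image of r under G agree after F and the action of
  \<beta>\<tau>. That action is bijective, and the structure map of F is injective by the previous
  lemma with the roles of F and G exchanged.\<close>

lemma theta_bij:
  fixes L M :: "('u :: universe, 'o, 'm, 'e) lax"
  assumes alg: "lax_algebra L" "lax_algebra M" and F: "rcolax_morphism M L F" and G: "rcolax_morphism L M G"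
    and \<tau>: "rcolax_2cell L L (rcolax_comp L F G) (rcolax_id L) \<tau>" "\<And>a. a \<in> Obj (lcat L) \<Longrightarrow> iso_arr (lcat L) (\<tau> a)"
    and \<sigma>: "rcolax_2cell M M (rcolax_comp M G F) (rcolax_id M) \<sigma>" "\<And>a. a \<in> Obj (lcat M) \<Longrightarrow> iso_arr (lcat M) (\<sigma> a)"
    and a: "a \<in> Obj (lcat L)" and x: "x \<in> bObj (lcat L)"
  shows "bij_betw (rnat G a x) (PEl (lprof L) a x) (PEl (lprof M) (fobj (rfun G) a) (bmap (fobj (rfun G)) x))"
proof -
  interpret F: rcolax_mor M L F by unfold_locales fact+
  interpret G: rcolax_mor L M G by unfold_locales fact+
  have ga: "fobj G.f a \<in> Obj F.L.A" and gx: "bmap (fobj G.f) x \<in> bObj F.L.A"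
    using G.f.fobj_in[OF a] G.bf_obj[OF x] .
  have t: "\<tau> b \<in> hom F.M.A (fobj (fcomp F.M.A F.f G.f) b) (fobj (fid F.M.A) b)" if "b \<in> Obj F.M.A" for b
    using nat_transD(1)[OF rcolax_2cellD(1)[OF \<tau>(1)] that] by (simp add: rcolax_comp_def rcolax_id_def)
  have ta: "\<tau> a \<in> hom F.M.A (fobj F.f (fobj G.f a)) a" using t[OF a] a by (simp add: fcomp_simps fid_simps)
  have fu: "is_functor F.M.A F.M.A (fcomp F.M.A F.f G.f)" "is_functor F.M.A F.M.A (fid F.M.A)"
    using is_functor_fcomp[OF F.M.A.category_axioms G.f.is_functor_axioms F.f.is_functor_axioms]
      ext_functor_fid[OF F.M.A.category_axioms] by (auto simp: ext_functor_def)
  let ?b = "bnt (fcomp F.M.A F.f G.f) (fid F.M.A) \<tau> x"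
  have b: "?b \<in> hom F.M.bA (bmap (fobj F.f) (bmap (fobj G.f) x)) x" "iso_arr F.M.bA ?b"
    using bnt_hom[OF fu x t] iso_bnt[OF F.M.A.category_axioms fu x t \<tau>(2)] by (simp_all add: bmap_fcomp[OF x] bmap_fid[OF x])
  show ?thesis
    unfolding bij_betw_def
  proof
    show "inj_on (G.\<Theta> a x) (PEl F.M.F a x)" by (rule theta_comp_inj(1)[OF alg F G \<tau> a x])
    show "G.\<Theta> a x ` PEl F.M.F a x = PEl F.L.F (fobj G.f a) (bmap (fobj G.f) x)"
    proof (intro set_eqI iffI)
      fix q assume q: "q \<in> PEl F.L.F (fobj G.f a) (bmap (fobj G.f) x)"
      let ?q = "F.\<Theta> (fobj G.f a) (bmap (fobj G.f) x) q"
      have q': "?q \<in> PEl F.M.F (fobj F.f (fobj G.f a)) (bmap (fobj F.f) (bmap (fobj G.f) x))"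
        by (rule F.theta_in[OF ga gx q])
      have 1: "PAct F.M.F (Ide F.M.A (fobj F.f (fobj G.f a))) ?b ?q \<in> PEl F.M.F (fobj F.f (fobj G.f a)) x"
        using F.M.F.act_right_in[OF b(1) _ q'] F.f.fobj_in[OF ga] by simp
      have "PAct F.M.F (\<tau> a) (Ide F.M.bA x) ` PEl F.M.F a x = PEl F.M.F (fobj F.f (fobj G.f a)) x"
        using F.M.F.bij_act_left[OF ta \<tau>(2)[OF a], of x] x by (simp add: bij_betw_def)
      from 1[folded this] obtain r where
        r: "PAct F.M.F (Ide F.M.A (fobj F.f (fobj G.f a))) ?b ?q = PAct F.M.F (\<tau> a) (Ide F.M.bA x) r" "r \<in> PEl F.M.F a x"
        by (rule imageE)
      have "PAct F.M.F (Ide F.M.A (fobj F.f (fobj G.f a))) ?b (F.\<Theta> (fobj G.f a) (bmap (fobj G.f) x) (G.\<Theta> a x r)) =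
          PAct F.M.F (Ide F.M.A (fobj F.f (fobj G.f a))) ?b ?q"
        using theta_comp_inj(2)[OF alg F G \<tau> a x r(2)] unfolding r(1) .
      moreover have "inj_on (PAct F.M.F (Ide F.M.A (fobj F.f (fobj G.f a))) ?b)
          (PEl F.M.F (fobj F.f (fobj G.f a)) (bmap (fobj F.f) (bmap (fobj G.f) x)))"
        using F.M.F.bij_act_right[OF b F.f.fobj_in[OF ga]] by (simp add: bij_betw_def)
      ultimately have "F.\<Theta> (fobj G.f a) (bmap (fobj G.f) x) (G.\<Theta> a x r) = ?q"
        using F.theta_in[OF ga gx G.theta_in[OF a x r(2)]] q' by (auto dest: inj_onD)
      then have "G.\<Theta> a x r = q"
        using theta_comp_inj(1)[OF alg(2,1) G F \<sigma> ga gx] G.theta_in[OF a x r(2)] q by (auto dest: inj_onD)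
      then show "q \<in> G.\<Theta> a x ` PEl F.M.F a x" using r(2) by auto
    qed (use G.theta_in[OF a x] in auto)
  qed
qed

text \<open>
  \<open>G\<close> is one half of an equivalence.  Below, \<open>univ\<close> asks that the image under \<open>G\<close> be invertible, instead of
  the universal property that this implies, because \<open>\<Delta>\<close> evidently preserves the former.
\<close>

locale repr = G: rcolax_mor L "rep_lax P" G + P: pseudo_alg P
  for L :: "('u :: universe, 'o, 'm, 'm) lax" and P :: "('u, 'o, 'm) palg" and G +
  assumes normalized: "normalized L" and locally_small: "locally_small TYPE('u) (lcat L)"
    and bij: "a \<in> Obj (lcat L) \<Longrightarrow> x \<in> bObj (lcat L) \<Longrightarrow>
      bij_betw (rnat G a x) (PEl (lprof L) a x) (hom P.A (fobj (rfun G) a) (fobj P.\<Phi> (bmap (fobj (rfun G)) x)))"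
    and ess: "b \<in> Obj P.A \<Longrightarrow> \<exists>a \<in> Obj (lcat L). \<exists>i \<in> hom P.A (fobj (rfun G) a) b. iso_arr P.A i"
begin

abbreviation "A \<equiv> lcat L"
abbreviation "bA \<equiv> bcat A :: (('u, 'o) bobj, ('u, 'o, 'o, 'm) bel) cat"
abbreviation "bbA \<equiv> bcat bA :: (('u, ('u, 'o) bobj) bobj, _) cat"
abbreviation "F \<equiv> lprof L"
abbreviation "g \<equiv> rfun G"
abbreviation "\<Theta> \<equiv> rnat G"

sublocale g: is_functor A P.A g using G.f.is_functor_axioms by simp

lemma bg_obj: "x \<in> bObj A \<Longrightarrow> bmap (fobj g) x \<in> bObj P.A"
  using G.bf_obj by simp

lemma theta_hom: "a \<in> Obj A \<Longrightarrow> x \<in> bObj A \<Longrightarrow> r \<in> PEl F a x \<Longrightarrow>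
    \<Theta> a x r \<in> hom P.A (fobj g a) (fobj P.\<Phi> (bmap (fobj g) x))"
  using G.theta_in by simp

lemma theta_left:
  assumes h: "h \<in> hom A b a" and x: "x \<in> bObj A" and r: "r \<in> PEl F a x"
  shows "\<Theta> b x (PAct F h (Ide bA x) r) = \<Theta> a x r \<odot>\<^bsub>P.A\<^esub> farr g h"
  using G.theta_left[OF h x r] P.Phi.farr_Ide[of "bmap (fobj g) x"] bg_obj[OF x]
    P.A.Ide_Comp[OF P.A.Comp_in[OF theta_hom[OF _ x r] g.farr_in[OF h]]] G.L.A.hom_Obj[OF h] by simp

lemma theta_unit: "a \<in> Obj A \<Longrightarrow> \<Theta> a (single a) (lunitor L a a (Ide A a)) = P.\<upsilon> (fobj g a)"
  using G.theta_unit[of a] P.lunitor_simp[OF P.A.Ide_in[OF g.fobj_in[of a]]]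
    P.A.Comp_Ide[OF P.unit_hom[OF g.fobj_in[of a]]] by simp

text \<open>Normalization of L identifies hom(a, b) with L(a, single b), the structure map of G
  takes this to hom(g a, \<Phi>(single (g b))), and composition with the invertible \<upsilon>
  identifies hom(g a, g b) with the same set. Cancelling \<upsilon> leaves the action of g.\<close>

lemma g_ff:
  assumes a: "a \<in> Obj A" and b: "b \<in> Obj A"
  shows "bij_betw (farr g) (hom A a b) (hom P.A (fobj g a) (fobj g b))"
proof -
  let ?u = "\<lambda>h. lunitor L a b h" and ?v = "\<lambda>k. P.\<upsilon> (fobj g b) \<odot>\<^bsub>P.A\<^esub> k"
  have sb: "(single b :: ('u, 'o) bobj) \<in> bObj A" by (rule single_in[OF b])
  have gb: "fobj g b \<in> Obj P.A" "fobj g a \<in> Obj P.A" using g.fobj_in a b by auto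
  have eq: "\<Theta> a (single b) (?u h) = ?v (farr g h)" if h: "h \<in> hom A a b" for h
  proof -
    note i = G.L.A.Ide_in[OF b]
    \<comment> \<open>By naturality, every \<Gamma>(h) is \<Gamma>(id) acted on by h, and the image
      of \<Gamma>(id) under G is known.\<close>
    have "?u h = PAct F h (Ide bA (single b)) (lunitor L b b (Ide A b))"
      using G.L.unit_natural[OF h i i] G.L.A.Ide_Comp[OF h] by (simp add: bsingle_Ide del: bcat_simps(4))
    then show ?thesis
      using theta_left[OF h sb G.L.unit_in[OF i]] theta_unit[OF b] by simp
  qed
  have "bij_betw (\<Theta> a (single b) \<circ> ?u) (hom A a b) (hom P.A (fobj g a) (fobj P.\<Phi> (single (fobj g b))))"
    by (rule bij_betw_trans) (use normalized a b bij[OF a sb] in \<open>auto simp: normalized_def bmap_single\<close>)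
  moreover have "bij_betw (\<Theta> a (single b) \<circ> ?u) (hom A a b) S \<longleftrightarrow> bij_betw (?v \<circ> farr g) (hom A a b) S" for S
    by (rule bij_betw_cong) (simp add: eq)
  ultimately have "bij_betw (?v \<circ> farr g) (hom A a b) (hom P.A (fobj g a) (fobj P.\<Phi> (single (fobj g b))))" by simp
  moreover have "farr g ` hom A a b \<subseteq> hom P.A (fobj g a) (fobj g b)" using g.farr_in by auto
  ultimately show ?thesis
    using bij_betw_comp_iff2[OF P.A.iso_bij_post[OF P.unit_hom[OF gb(1)] P.unit_iso[OF gb(1)] gb(2)]] by blast
qed

lemma g_reflects_iso:
  assumes h: "h \<in> hom A a b" and iso: "iso_arr P.A (farr g h)"
  shows "iso_arr A h"
proof -
  have a: "a \<in> Obj A" and b: "b \<in> Obj A" using G.L.A.hom_Obj[OF h] by auto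
  obtain k' where k': "k' \<in> hom P.A (fobj g b) (fobj g a)" "k' \<odot>\<^bsub>P.A\<^esub> farr g h = Ide P.A (fobj g a)"
    "farr g h \<odot>\<^bsub>P.A\<^esub> k' = Ide P.A (fobj g b)" using P.A.iso_arrE[OF iso g.farr_in[OF h]] by blast
  obtain k where k: "k \<in> hom A b a" "farr g k = k'" using g_ff[OF b a] k'(1) by (metis bij_betw_imp_surj_on imageE)
  have "k \<odot>\<^bsub>A\<^esub> h = Ide A a"
    by (rule inj_onD[OF bij_betw_imp_inj_on[OF g_ff[OF a a]]])
      (use k k' h a in \<open>auto simp: g.farr_Comp[OF k(1) h] g.farr_Ide intro!: G.L.A.Comp_in G.L.A.Ide_in\<close>)
  moreover have "h \<odot>\<^bsub>A\<^esub> k = Ide A b"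
    by (rule inj_onD[OF bij_betw_imp_inj_on[OF g_ff[OF b b]]])
      (use k k' h b in \<open>auto simp: g.farr_Comp[OF h k(1)] g.farr_Ide intro!: G.L.A.Comp_in G.L.A.Ide_in\<close>)
  ultimately show ?thesis using G.L.A.iso_arrI[OF h k(1)] by blast
qed

definition univ :: "'o \<Rightarrow> ('u, 'o) bobj \<Rightarrow> 'm \<Rightarrow> bool" where
  "univ a x r \<longleftrightarrow> a \<in> Obj A \<and> r \<in> PEl F a x \<and> iso_arr P.A (\<Theta> a x r)"

text \<open>Under G, acting by h on r becomes composition of the invertible image of r with g h,
  which is bijective in h because g is fully faithful. The structure map of G is bijective too and
  can be cancelled.\<close>

lemma univ_bij:
  assumes x: "x \<in> bObj A" and r: "univ a x r" and b: "b \<in> Obj A"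
  shows "bij_betw (\<lambda>h. PAct F h (Ide bA x) r) (hom A b a) (PEl F b x)"
proof -
  have a: "a \<in> Obj A" and r': "r \<in> PEl F a x" "iso_arr P.A (\<Theta> a x r)" using r by (auto simp: univ_def)
  let ?p = "\<lambda>h. PAct F h (Ide bA x) r" and ?q = "\<lambda>k. \<Theta> a x r \<odot>\<^bsub>P.A\<^esub> k"
  have "bij_betw (?q \<circ> farr g) (hom A b a) (hom P.A (fobj g b) (fobj P.\<Phi> (bmap (fobj g) x)))"
    by (rule bij_betw_trans[OF g_ff[OF b a] P.A.iso_bij_post[OF theta_hom[OF a x r'(1)] r'(2) g.fobj_in[OF b]]])
  moreover have "bij_betw (\<Theta> b x \<circ> ?p) (hom A b a) S \<longleftrightarrow> bij_betw (?q \<circ> farr g) (hom A b a) S" for S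
    by (rule bij_betw_cong) (simp add: theta_left x r' del: bcat_simps(4))
  ultimately have "bij_betw (\<Theta> b x \<circ> ?p) (hom A b a) (hom P.A (fobj g b) (fobj P.\<Phi> (bmap (fobj g) x)))" by simp
  moreover have "?p ` hom A b a \<subseteq> PEl F b x" using G.L.F.act_left_in r' x by auto
  ultimately show ?thesis
    using bij_betw_comp_iff2[OF bij[OF b x]] by blast
qed

lemma univ_ex:
  assumes x: "x \<in> bObj A"
  shows "\<exists>a r. univ a x r"
proof -
  have "fobj P.\<Phi> (bmap (fobj g) x) \<in> Obj P.A" using P.Phi.fobj_in bg_obj[OF x] by simp
  then obtain a i where a: "a \<in> Obj A" and i: "i \<in> hom P.A (fobj g a) (fobj P.\<Phi> (bmap (fobj g) x))" "iso_arr P.A i"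
    using ess by blast
  then obtain r where "r \<in> PEl F a x" "\<Theta> a x r = i"
    using bij[OF a x] unfolding bij_betw_def by (metis imageE)
  then show ?thesis using a i by (auto simp: univ_def)
qed

definition ob :: "('u, 'o) bobj \<Rightarrow> 'o" where "ob x = (SOME a. \<exists>r. univ a x r)"
definition un :: "('u, 'o) bobj \<Rightarrow> 'm" where "un x = (SOME r. univ (ob x) x r)"

lemma univ_un: "x \<in> bObj A \<Longrightarrow> univ (ob x) x (un x)"
  unfolding un_def ob_def by (rule someI_ex, rule someI_ex) (rule univ_ex)

lemma ob_in: "x \<in> bObj A \<Longrightarrow> ob x \<in> Obj A" and un_in: "x \<in> bObj A \<Longrightarrow> un x \<in> PEl F (ob x) x"
  and un_iso: "x \<in> bObj A \<Longrightarrow> iso_arr P.A (\<Theta> (ob x) x (un x))"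
  using univ_un by (auto simp: univ_def)

text \<open>The Yoneda bijection given by the universal element; \<open>fc\<close> is its inverse.
  Equations between arrows into \<open>ob x\<close> are proved below by applying \<open>ap\<close>
  and cancelling it.\<close>

definition ap :: "'m \<Rightarrow> ('u, 'o) bobj \<Rightarrow> 'm" where "ap h x = PAct F h (Ide bA x) (un x)"
definition fc :: "'o \<Rightarrow> ('u, 'o) bobj \<Rightarrow> 'm \<Rightarrow> 'm" where
  "fc a x r = inv_into (hom A a (ob x)) (\<lambda>h. ap h x) r"

lemma ap_bij: "x \<in> bObj A \<Longrightarrow> a \<in> Obj A \<Longrightarrow> bij_betw (\<lambda>h. ap h x) (hom A a (ob x)) (PEl F a x)"
  unfolding ap_def by (rule univ_bij[OF _ univ_un])

lemma ap_in: "x \<in> bObj A \<Longrightarrow> h \<in> hom A a (ob x) \<Longrightarrow> ap h x \<in> PEl F a x"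
  using ap_bij[of x a] G.L.A.hom_Obj[of h a] by (auto simp: bij_betw_def)

lemma ap_cancel: "x \<in> bObj A \<Longrightarrow> h \<in> hom A a (ob x) \<Longrightarrow> h' \<in> hom A a (ob x) \<Longrightarrow> ap h x = ap h' x \<Longrightarrow> h = h'"
  using ap_bij[of x a] G.L.A.hom_Obj[of h a] by (auto simp: bij_betw_def dest: inj_onD)

lemma fc_in: "x \<in> bObj A \<Longrightarrow> a \<in> Obj A \<Longrightarrow> r \<in> PEl F a x \<Longrightarrow> fc a x r \<in> hom A a (ob x)"
  and ap_fc: "x \<in> bObj A \<Longrightarrow> a \<in> Obj A \<Longrightarrow> r \<in> PEl F a x \<Longrightarrow> ap (fc a x r) x = r"
  unfolding fc_def using ap_bij[of x a] f_inv_into_f[of r "\<lambda>h. ap h x" "hom A a (ob x)"]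
  by (auto simp: bij_betw_def inv_into_into)

lemma fc_ap: "x \<in> bObj A \<Longrightarrow> h \<in> hom A a (ob x) \<Longrightarrow> fc a x (ap h x) = h"
  by (meson ap_cancel ap_fc ap_in fc_in G.L.A.hom_Obj(1))

lemma ap_Ide: "x \<in> bObj A \<Longrightarrow> ap (Ide A (ob x)) x = un x"
  unfolding ap_def using G.L.F.act_Ide[of "ob x" x "un x"] ob_in un_in by simp

lemma ap_left:
  "x \<in> bObj A \<Longrightarrow> h \<in> hom A a (ob x) \<Longrightarrow> k \<in> hom A b a \<Longrightarrow> PAct F k (Ide bA x) (ap h x) = ap (h \<odot>\<^bsub>A\<^esub> k) x"
  unfolding ap_def using G.L.F.act_left_Comp[of h a "ob x" k b x "un x"] un_in by simp

section \<open>The functor, unit and multiplication on the chosen representing objects\<close>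

definition \<Phi>' :: "(('u, 'o) bobj, ('u, 'o, 'o, 'm) bel, 'o, 'm) func" where
  "\<Phi>' = \<lparr>fobj = restrict ob (bObj A),
    farr = restrict (\<lambda>v. fc (ob (src v)) (tgt v) (PAct F (Ide A (ob (src v))) v (un (src v)))) (Arr bA)\<rparr>"

lemma Phi_obj: "x \<in> bObj A \<Longrightarrow> fobj \<Phi>' x = ob x"
  by (simp add: \<Phi>'_def)

lemma Phi_arr:
  assumes v: "v \<in> hom bA x y"
  shows "farr \<Phi>' v \<in> hom A (ob x) (ob y)" "ap (farr \<Phi>' v) y = PAct F (Ide A (ob x)) v (un x)"
proof -
  have x: "x \<in> bObj A" "y \<in> bObj A" using G.L.bA.hom_Obj[OF v] by auto
  have e: "PAct F (Ide A (ob x)) v (un x) \<in> PEl F (ob x) y"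
    by (rule G.L.F.act_right_in[OF v ob_in[OF x(1)] un_in[OF x(1)]])
  have "farr \<Phi>' v = fc (ob x) y (PAct F (Ide A (ob x)) v (un x))"
    using homD[OF v] by (simp add: \<Phi>'_def)
  then show "farr \<Phi>' v \<in> hom A (ob x) (ob y)" "ap (farr \<Phi>' v) y = PAct F (Ide A (ob x)) v (un x)"
    using fc_in[OF x(2) ob_in[OF x(1)] e] ap_fc[OF x(2) ob_in[OF x(1)] e] by simp_all
qed

text \<open>The definition of \<open>\<Phi>'\<close> is the case of an identity h; the general case
  follows since the left action of h commutes with the right action of v.\<close>

lemma ap_right:
  assumes v: "v \<in> hom bA x y" and h: "h \<in> hom A a (ob x)"
  shows "PAct F (Ide A a) v (ap h x) = ap (farr \<Phi>' v \<odot>\<^bsub>A\<^esub> h) y"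
proof -
  have x: "x \<in> bObj A" "y \<in> bObj A" using G.L.bA.hom_Obj[OF v] by auto
  have "PAct F (Ide A a) v (ap h x) = PAct F h (Ide bA y) (PAct F (Ide A (ob x)) v (un x))"
    unfolding ap_def by (rule G.L.F.act_comm[OF h v un_in[OF x(1)], symmetric])
  also have "\<dots> = ap (farr \<Phi>' v \<odot>\<^bsub>A\<^esub> h) y"
    unfolding Phi_arr(2)[OF v, symmetric] by (rule ap_left[OF x(2) Phi_arr(1)[OF v] h])
  finally show ?thesis .
qed

lemma ext_Phi': "ext_functor bA A \<Phi>'"
  unfolding ext_functor_def
proof (intro conjI)
  show "is_functor bA A \<Phi>'"
  proof
    fix v x y assume v: "v \<in> hom bA x y"
    have x: "x \<in> bObj A" "y \<in> bObj A" using G.L.bA.hom_Obj[OF v] by auto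
    then show "farr \<Phi>' v \<in> hom A (fobj \<Phi>' x) (fobj \<Phi>' y)" using Phi_arr[OF v] by (simp add: Phi_obj)
  next
    fix x assume x': "x \<in> Obj bA"
    then have x: "x \<in> bObj A" by simp
    have i: "Ide bA x \<in> hom bA x x" by (rule G.L.bA.Ide_in[OF x'])
    have "ap (farr \<Phi>' (Ide bA x)) x = ap (Ide A (ob x)) x"
      unfolding Phi_arr(2)[OF i] ap_Ide[OF x] by (rule G.L.F.act_Ide[OF ob_in[OF x] x' un_in[OF x]])
    then show "farr \<Phi>' (Ide bA x) = Ide A (fobj \<Phi>' x)"
      using ap_cancel[OF x Phi_arr(1)[OF i] G.L.A.Ide_in[OF ob_in[OF x]]] by (simp add: Phi_obj x)
  next
    fix w y z v x assume w: "w \<in> hom bA y z" and v: "v \<in> hom bA x y"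
    have x: "x \<in> bObj A" "z \<in> bObj A" using G.L.bA.hom_Obj[OF v] G.L.bA.hom_Obj[OF w] by auto
    note wv = G.L.bA.Comp_in[OF w v]
    have "ap (farr \<Phi>' (w \<odot>\<^bsub>bA\<^esub> v)) z = PAct F (Ide A (ob x)) w (PAct F (Ide A (ob x)) v (un x))"
      unfolding Phi_arr(2)[OF wv] by (rule G.L.F.act_right_Comp[OF v w ob_in[OF x(1)] un_in[OF x(1)]])
    also have "\<dots> = ap (farr \<Phi>' w \<odot>\<^bsub>A\<^esub> farr \<Phi>' v) z"
      unfolding Phi_arr(2)[OF v, symmetric] by (rule ap_right[OF w Phi_arr(1)[OF v]])
    finally show "farr \<Phi>' (w \<odot>\<^bsub>bA\<^esub> v) = farr \<Phi>' w \<odot>\<^bsub>A\<^esub> farr \<Phi>' v"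
      by (rule ap_cancel[OF x(2) Phi_arr(1)[OF wv] G.L.A.Comp_in[OF Phi_arr(1)[OF w] Phi_arr(1)[OF v]]])
  qed (simp add: Phi_obj ob_in)
qed (simp_all add: \<Phi>'_def)

sublocale Phi': is_functor bA A \<Phi>' using ext_Phi' by (simp add: ext_functor_def)

lemma bPhi_in: "Y \<in> bObj bA \<Longrightarrow> bmap (fobj \<Phi>') Y \<in> bObj A"
  by (rule is_functor_obj_bObj) (rule Phi'.is_functor_axioms)

lemma val_bPhi: "Y \<in> bObj bA \<Longrightarrow> y \<in> idx Y \<Longrightarrow> val (bmap (fobj \<Phi>') Y) y = ob (val Y y)"
  using bObjD(2)[of Y bA y] by (simp add: Phi_obj)

text \<open>The universal element of the extension at Y: tuples factored componentwise arise from it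
  by a left action, as in \<open>delta_ap\<close>.\<close>

definition UU :: "('u, ('u, 'o) bobj) bobj \<Rightarrow> ('u, 'o, ('u, 'o) bobj, 'm) bel" where
  "UU Y = bel_of (bmap (fobj \<Phi>') Y) Y id (\<lambda>y. un (val Y y))"

lemma UU_in: "Y \<in> bObj bA \<Longrightarrow> UU Y \<in> bset (PEl F) (bmap (fobj \<Phi>') Y) Y"
  unfolding UU_def by (rule bsetI) (use bObjD(2)[of Y bA] in \<open>auto simp: Phi_obj un_in\<close>)

definition \<upsilon>' :: "'o \<Rightarrow> 'm" where
  "\<upsilon>' = restrict (\<lambda>a. fc a (single a) (lunitor L a a (Ide A a))) (Obj A)"

definition m' :: "('u, ('u, 'o) bobj) bobj \<Rightarrow> 'm" where
  "m' = restrict (\<lambda>Y. fc (ob (bmap (fobj \<Phi>') Y)) (bmu_obj Y)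
     (delta L (ob (bmap (fobj \<Phi>') Y)) (un (bmap (fobj \<Phi>') Y)) (UU Y))) (bObj bA)"

lemma unit':
  assumes a: "a \<in> Obj A"
  shows "\<upsilon>' a \<in> hom A a (ob (single a))" "ap (\<upsilon>' a) (single a) = lunitor L a a (Ide A a)"
  using fc_in[OF single_in[OF a] a G.L.unit_in[OF G.L.A.Ide_in[OF a]]]
    ap_fc[OF single_in[OF a] a G.L.unit_in[OF G.L.A.Ide_in[OF a]]] a by (simp_all add: \<upsilon>'_def)

lemma mult':
  assumes Y: "Y \<in> bObj bA"
  shows "m' Y \<in> hom A (ob (bmap (fobj \<Phi>') Y)) (ob (bmu_obj Y))"
    "ap (m' Y) (bmu_obj Y) = delta L (ob (bmap (fobj \<Phi>') Y)) (un (bmap (fobj \<Phi>') Y)) (UU Y)"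
proof -
  note x = bPhi_in[OF Y]
  have "delta L (ob (bmap (fobj \<Phi>') Y)) (un (bmap (fobj \<Phi>') Y)) (UU Y) \<in> PEl F (ob (bmap (fobj \<Phi>') Y)) (bmu_obj Y)"
    by (rule G.L.delta_in[OF ob_in[OF x] x Y un_in[OF x] UU_in[OF Y]])
  then show "m' Y \<in> hom A (ob (bmap (fobj \<Phi>') Y)) (ob (bmu_obj Y))"
    "ap (m' Y) (bmu_obj Y) = delta L (ob (bmap (fobj \<Phi>') Y)) (un (bmap (fobj \<Phi>') Y)) (UU Y)"
    using Y by (simp_all add: m'_def fc_in ap_fc bmu_obj_in ob_in x)
qed

text \<open>The tuple is \<open>UU Y\<close> acted on by the morphism with components \<eta>.
  Naturality pulls h out of \<open>delta\<close>, the coend relation moves that morphism onto the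
  universal element of x, where it becomes its image under \<open>\<Phi>'\<close>, and the defining
  equation of \<open>m'\<close> is left. The axioms of the pseudoalgebra are read off from this
  formula.\<close>

lemma delta_ap:
  assumes h: "h \<in> hom A a (ob x)" and Y: "Y \<in> bObj bA"
    and s: "bel_of x (bmap (fobj \<Phi>') Y) t \<eta> \<in> hom bA x (bmap (fobj \<Phi>') Y)" and t: "filtermap t (ult Y) = ult x"
  shows "delta L a (ap h x) (bel_of x Y t (\<lambda>z. ap (\<eta> z) (val Y z))) =
    ap (m' Y \<odot>\<^bsub>A\<^esub> farr \<Phi>' (bel_of x (bmap (fobj \<Phi>') Y) t \<eta>) \<odot>\<^bsub>A\<^esub> h) (bmu_obj Y)"
proof -
  let ?s = "bel_of x (bmap (fobj \<Phi>') Y) t \<eta>" and ?y = "bmap (fobj \<Phi>') Y"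
  have x: "x \<in> bObj A" and y: "?y \<in> bObj A" using G.L.bA.hom_Obj[OF s] by auto
  have a: "a \<in> Obj A" using G.L.A.hom_Obj[OF h] by simp
  have muY: "bmu_obj Y \<in> bObj A" by (rule bmu_obj_in[OF Y])
  have act: "PAct (bprof F) ?s (Ide bbA Y) (UU Y) = bel_of x Y t (\<lambda>z. ap (\<eta> z) (val Y z))"
    unfolding UU_def by (simp add: bprof_act_bel_of ap_def)
  have s': "PAct (bprof F) ?s (Ide bbA Y) (UU Y) \<in> bset (PEl F) x Y"
    using G.L.bF.act_left_in[OF s _, of Y "UU Y"] Y UU_in[OF Y] by simp
  have "delta L a (ap h x) (PAct (bprof F) ?s (Ide bbA Y) (UU Y)) =
      PAct F h (Ide bA (bmu_obj Y)) (delta L (ob x) (un x) (PAct (bprof F) ?s (Ide bbA Y) (UU Y)))"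
    unfolding ap_def by (rule G.L.delta_left[OF h x Y un_in[OF x] s'])
  also have "delta L (ob x) (un x) (PAct (bprof F) ?s (Ide bbA Y) (UU Y)) =
      delta L (ob x) (PAct F (farr \<Phi>' ?s) (Ide bA ?y) (un ?y)) (UU Y)"
    using G.L.delta_coend[OF s un_in[OF x] UU_in[OF Y] Y] Phi_arr(2)[OF s] by (simp add: ap_def)
  also have "\<dots> = PAct F (farr \<Phi>' ?s) (Ide bA (bmu_obj Y)) (ap (m' Y) (bmu_obj Y))"
    unfolding mult'(2)[OF Y] by (rule G.L.delta_left[OF Phi_arr(1)[OF s] y Y un_in[OF y] UU_in[OF Y]])
  also have "\<dots> = ap (m' Y \<odot>\<^bsub>A\<^esub> farr \<Phi>' ?s) (bmu_obj Y)"
    by (rule ap_left[OF muY mult'(1)[OF Y] Phi_arr(1)[OF s]])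
  also have "PAct F h (Ide bA (bmu_obj Y)) \<dots> = ap ((m' Y \<odot>\<^bsub>A\<^esub> farr \<Phi>' ?s) \<odot>\<^bsub>A\<^esub> h) (bmu_obj Y)"
    by (rule ap_left[OF muY G.L.A.Comp_in[OF mult'(1)[OF Y] Phi_arr(1)[OF s]] h])
  also have "(m' Y \<odot>\<^bsub>A\<^esub> farr \<Phi>' ?s) \<odot>\<^bsub>A\<^esub> h = m' Y \<odot>\<^bsub>A\<^esub> farr \<Phi>' ?s \<odot>\<^bsub>A\<^esub> h"
    by (rule G.L.A.Comp_assoc[OF mult'(1)[OF Y] Phi_arr(1)[OF s] h])
  finally show ?thesis unfolding act .
qed

text \<open>The image under G of \<open>ap h x\<close> is the invertible image of the universal
  element composed with g h. Cancelling the former makes g h invertible, and g reflects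
  isomorphisms.\<close>

lemma iso_theta_ap:
  assumes x: "x \<in> bObj A" and h: "h \<in> hom A a (ob x)" and iso: "iso_arr P.A (\<Theta> a x (ap h x))"
  shows "iso_arr A h"
proof (rule g_reflects_iso[OF h])
  have "\<Theta> a x (ap h x) = \<Theta> (ob x) x (un x) \<odot>\<^bsub>P.A\<^esub> farr g h"
    unfolding ap_def by (rule theta_left[OF h x un_in[OF x]])
  then show "iso_arr P.A (farr g h)"
    using P.A.iso_cancel_left[OF theta_hom[OF ob_in[OF x] x un_in[OF x]] un_iso[OF x] g.farr_in[OF h]] iso by simp
qed

lemma iso_unit': "a \<in> Obj A \<Longrightarrow> iso_arr A (\<upsilon>' a)"
  by (rule iso_theta_ap[OF single_in unit'(1)]) (simp_all add: unit' theta_unit P.unit_iso g.fobj_in)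

text \<open>Compatibility of G with \<Delta> makes the image of \<Delta>(u, (u_i)) a composite of
  the multiplication of P, \<Phi> of a tuple of invertible arrows, and the image of u. All three are
  invertible.\<close>

lemma iso_mult':
  assumes Y: "Y \<in> bObj bA"
  shows "iso_arr A (m' Y)"
proof (rule iso_theta_ap[OF bmu_obj_in[OF Y] mult'(1)[OF Y]])
  let ?x = "bmap (fobj \<Phi>') Y" and ?Y = "bmap (bmap (fobj g)) Y"
  have x: "?x \<in> bObj A" by (rule bPhi_in[OF Y])
  have Yy: "val Y y \<in> bObj A" if "y \<in> idx Y" for y using bObjD(2)[OF Y that] by simp
  have gY: "?Y \<in> bObj P.bA" using G.bbf_obj[OF Y] by simp
  let ?s = "bel_of (bmap (fobj g) ?x) (bmap (fobj P.\<Phi>) ?Y) id (\<lambda>y. \<Theta> (ob (val Y y)) (val Y y) (un (val Y y)))"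
  have push: "theta_push g \<Theta> (UU Y) = bel_of (bmap (fobj g) ?x) ?Y id (\<lambda>y. \<Theta> (ob (val Y y)) (val Y y) (un (val Y y)))"
    unfolding UU_def theta_push_bel_of by (rule bel_of_cong) (use bObjD(1)[OF Y] Yy in \<open>auto simp: Phi_obj\<close>)
  have ret: "retgt (bmap (fobj P.\<Phi>) ?Y) (theta_push g \<Theta> (UU Y)) = ?s"
    unfolding push by (rule retgt_bel_of) simp
  have push_in: "theta_push g \<Theta> (UU Y) \<in> bset (PEl P.R) (bmap (fobj g) ?x) ?Y"
    using G.theta_push_in[OF x Y UU_in[OF Y]] by simp
  have s: "?s \<in> hom P.bA (bmap (fobj g) ?x) (bmap (fobj P.\<Phi>) ?Y)"
    using P.retgt_in[OF bg_obj[OF x] gY push_in] ret by simp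
  have s_iso: "iso_arr P.bA ?s"
    by (rule iso_bel_of[OF P.A.category_axioms bg_obj[OF x] P.bmap_Phi_in[OF gY]])
      (use theta_hom ob_in un_in un_iso Yy in \<open>auto simp: Phi_obj\<close>)
  have "iso_arr P.A (farr P.\<Phi> ?s)"
    by (rule P.Phi.iso_farr[OF P.bA.category_axioms P.A.category_axioms homD(1)[OF s] s_iso])
  then have "iso_arr P.A (farr P.\<Phi> ?s \<odot>\<^bsub>P.A\<^esub> \<Theta> (ob ?x) ?x (un ?x))"
    by (rule P.A.iso_Comp[OF theta_hom[OF ob_in[OF x] x un_in[OF x]] un_iso[OF x] P.Phi.farr_in[OF s]])
  then have "iso_arr P.A (P.m ?Y \<odot>\<^bsub>P.A\<^esub> farr P.\<Phi> ?s \<odot>\<^bsub>P.A\<^esub> \<Theta> (ob ?x) ?x (un ?x))"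
    by (rule P.A.iso_Comp[OF P.A.Comp_in[OF P.Phi.farr_in[OF s] theta_hom[OF ob_in[OF x] x un_in[OF x]]] _
          P.mult_hom[OF gY] P.mult_iso[OF gY]])
  then show "iso_arr P.A (\<Theta> (ob ?x) (bmu_obj Y) (ap (m' Y) (bmu_obj Y)))"
    unfolding mult'(2)[OF Y] G.theta_mult[OF ob_in[OF x] x Y un_in[OF x] UU_in[OF Y]]
    using P.delta_rep(1)[OF theta_hom[OF ob_in[OF x] x un_in[OF x]] bg_obj[OF x] gY push_in] ret by simp
qed

section \<open>The axioms of the new pseudoalgebra\<close>

definition P' :: "('u, 'o, 'm) palg" where
  "P' = \<lparr>pcat = A, pact = \<Phi>', punit = \<upsilon>', pmult = m'\<rparr>"

lemma unit'_nat: "nat_iso A A (fid A) (fcomp A \<Phi>' (bunit A)) \<upsilon>'"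
  unfolding nat_iso_def
proof (intro conjI ballI nat_transI)
  fix h a b assume h: "h \<in> hom A a b"
  have a: "a \<in> Obj A" "b \<in> Obj A" using G.L.A.hom_Obj[OF h] by auto
  have s: "(single a :: ('u, 'o) bobj) \<in> bObj A" "(single b :: ('u, 'o) bobj) \<in> bObj A" using a by (auto intro: single_in)
  have bh: "bsingle a b h \<in> hom bA (single a) (single b)" using h s by (simp add: hom_bcat bsingle_in)
  note ia = G.L.A.Ide_in[OF a(1)] and ib = G.L.A.Ide_in[OF a(2)]
  \<comment> \<open>Both composites factor \<Gamma>(h), by naturality of \<Gamma> in its first and
    in its second variable.\<close>
  have "ap (\<upsilon>' b \<odot>\<^bsub>A\<^esub> h) (single b) = PAct F h (Ide bA (single b)) (lunitor L b b (Ide A b))"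
    using ap_left[OF s(2) unit'(1)[OF a(2)] h] unit'(2)[OF a(2)] by simp
  also have "\<dots> = lunitor L a b h"
    using G.L.unit_natural[OF h ib ib] G.L.A.Ide_Comp[OF h] by (simp add: bsingle_Ide del: bcat_simps(4))
  also have "\<dots> = PAct F (Ide A a) (bsingle a b h) (lunitor L a a (Ide A a))"
    using G.L.unit_natural[OF ia h ia] G.L.A.Comp_Ide[OF h] G.L.A.Ide_Comp[OF ia] by simp
  also have "\<dots> = ap (farr \<Phi>' (bsingle a b h) \<odot>\<^bsub>A\<^esub> \<upsilon>' a) (single b)"
    unfolding unit'(2)[OF a(1), symmetric] by (rule ap_right[OF bh unit'(1)[OF a(1)]])
  finally have "\<upsilon>' b \<odot>\<^bsub>A\<^esub> h = farr \<Phi>' (bsingle a b h) \<odot>\<^bsub>A\<^esub> \<upsilon>' a"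
    by (rule ap_cancel[OF s(2) G.L.A.Comp_in[OF unit'(1)[OF a(2)] h] G.L.A.Comp_in[OF Phi_arr(1)[OF bh] unit'(1)[OF a(1)]]])
  then show "\<upsilon>' b \<odot>\<^bsub>A\<^esub> farr (fid A) h = farr (fcomp A \<Phi>' (bunit A)) h \<odot>\<^bsub>A\<^esub> \<upsilon>' a"
    using homD[OF h] by (simp add: fid_simps fcomp_simps)
next
  fix a assume "a \<in> Obj A"
  then show "\<upsilon>' a \<in> hom A (fobj (fid A) a) (fobj (fcomp A \<Phi>' (bunit A)) a)"
    using unit'(1) by (simp add: fid_simps fcomp_simps Phi_obj single_in)
qed (auto simp: \<upsilon>'_def[THEN arg_cong[of _ _ "\<lambda>f. f \<in> extensional (Obj A)"]] iso_unit')

lemma mult'_nat: "nat_iso bbA A (fcomp bbA \<Phi>' (bfun \<Phi>')) (fcomp bbA \<Phi>' bmu) m'"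
  unfolding nat_iso_def
proof (intro conjI ballI nat_transI)
  fix v Y Y' assume v: "v \<in> hom bbA Y Y'"
  have Y: "Y \<in> bObj bA" "Y' \<in> bObj bA" using G.L.bbA.hom_Obj[OF v] by auto
  let ?x = "bmap (fobj \<Phi>') Y"
  have x: "?x \<in> bObj A" by (rule bPhi_in[OF Y(1)])
  obtain q \<gamma> where q: "v = bel_of Y Y' q \<gamma>" "q \<in> idx Y' \<rightarrow> idx Y" "filtermap q (ult Y') = ult Y"
    "\<And>i. i \<in> idx Y' \<Longrightarrow> \<gamma> i \<in> hom bA (val Y (q i)) (val Y' i)"
    using hom_bcatD(3)[OF v] by (rule bsetE) blast
  have Yq: "val Y (q i) \<in> bObj A" "q i \<in> idx Y" if "i \<in> idx Y'" for i
    using bObjD(2)[OF Y(1), of "q i"] q(2) that by auto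
  have bv': "farr (bfun \<Phi>') v = bel_of ?x (bmap (fobj \<Phi>') Y') q (\<lambda>i. farr \<Phi>' (\<gamma> i))"
    unfolding q(1) by (rule bfun_bel_of)
  have bv: "farr (bfun \<Phi>') v \<in> hom bA ?x (bmap (fobj \<Phi>') Y')"
    using is_functor.farr_in[OF is_functor_bfun[OF Phi'.is_functor_axioms] v] by simp
  have mv: "bmu_el v \<in> hom bA (bmu_obj Y) (bmu_obj Y')" by (rule bmu_el_hom[OF v])
  \<comment> \<open>In each component, the right action on a universal element is the defining
    property of \<open>\<Phi>'\<close>; so v takes \<open>UU Y\<close> to a tuple of factored
    elements, as \<open>delta_ap\<close> requires.\<close>
  have act: "PAct (bprof F) (Ide bA ?x) v (UU Y) = bel_of ?x Y' q (\<lambda>i. ap (farr \<Phi>' (\<gamma> i)) (val Y' i))"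
    unfolding UU_def q(1) bcat_simps(4)
    using q(3) by (subst bprof_act_bel_of) (auto simp: bObjD(1)[OF Y(2)] Yq Phi_arr(2)[OF q(4)] Phi_obj intro!: bel_of_cong)
  note i = G.L.A.Ide_in[OF ob_in[OF x]]
  have "ap (m' Y' \<odot>\<^bsub>A\<^esub> farr \<Phi>' (farr (bfun \<Phi>') v)) (bmu_obj Y') =
      ap (m' Y' \<odot>\<^bsub>A\<^esub> farr \<Phi>' (farr (bfun \<Phi>') v) \<odot>\<^bsub>A\<^esub> Ide A (ob ?x)) (bmu_obj Y')"
    using G.L.A.Comp_Ide[OF Phi_arr(1)[OF bv]] by simp
  also have "\<dots> = delta L (ob ?x) (un ?x) (PAct (bprof F) (Ide bA ?x) v (UU Y))"
    using delta_ap[OF i Y(2) bv[unfolded bv']] q(3) unfolding bv'[symmetric] act ap_Ide[OF x] by simp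
  also have "\<dots> = PAct F (Ide A (ob ?x)) (bmu_el v) (ap (m' Y) (bmu_obj Y))"
    unfolding mult'(2)[OF Y(1)] by (rule G.L.delta_right[OF ob_in[OF x] v x un_in[OF x] UU_in[OF Y(1)]])
  also have "\<dots> = ap (farr \<Phi>' (bmu_el v) \<odot>\<^bsub>A\<^esub> m' Y) (bmu_obj Y')"
    by (rule ap_right[OF mv mult'(1)[OF Y(1)]])
  finally have "m' Y' \<odot>\<^bsub>A\<^esub> farr \<Phi>' (farr (bfun \<Phi>') v) = farr \<Phi>' (bmu_el v) \<odot>\<^bsub>A\<^esub> m' Y"
    by (rule ap_cancel[OF bmu_obj_in[OF Y(2)] G.L.A.Comp_in[OF mult'(1)[OF Y(2)] Phi_arr(1)[OF bv]]
        G.L.A.Comp_in[OF Phi_arr(1)[OF mv] mult'(1)[OF Y(1)]]])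
  then show "m' Y' \<odot>\<^bsub>A\<^esub> farr (fcomp bbA \<Phi>' (bfun \<Phi>')) v = farr (fcomp bbA \<Phi>' bmu) v \<odot>\<^bsub>A\<^esub> m' Y"
    using homD[OF v] by (simp add: fcomp_simps)
next
  fix Y assume "Y \<in> Obj bbA"
  then show "m' Y \<in> hom A (fobj (fcomp bbA \<Phi>' (bfun \<Phi>')) Y) (fobj (fcomp bbA \<Phi>' bmu) Y)"
    using mult'(1) by (simp add: fcomp_simps Phi_obj bPhi_in bmu_obj_in)
qed (auto simp: m'_def[THEN arg_cong[of _ _ "\<lambda>f. f \<in> extensional (bObj bA)"]] iso_mult')

lemma unit'_ax1:
  assumes x: "x \<in> bObj A"
  shows "farr \<Phi>' (lunit A x) \<odot>\<^bsub>A\<^esub> m' (single x) \<odot>\<^bsub>A\<^esub> \<upsilon>' (ob x) = Ide A (ob x)"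
proof -
  let ?a = "ob x" and ?Y = "single x :: ('u, ('u, 'o) bobj) bobj" and ?s = "single (ob x) :: ('u, 'o) bobj"
  have a: "?a \<in> Obj A" by (rule ob_in[OF x])
  have Y: "?Y \<in> bObj bA" using single_in[of x bA] x by simp
  have s: "?s \<in> bObj A" by (rule single_in[OF a])
  have sY: "bmap (fobj \<Phi>') ?Y = ?s" by (simp add: bmap_single Phi_obj x)
  have b: "bel_of ?s ?s id (\<lambda>_. Ide A ?a) = Ide bA ?s" by (simp add: bel_of_single_eq_iff)
  have bh: "bel_of ?s (bmap (fobj \<Phi>') ?Y) id (\<lambda>_. Ide A ?a) \<in> hom bA ?s (bmap (fobj \<Phi>') ?Y)"
    unfolding sY b using G.L.bA.Ide_in[of ?s] s by simp
  \<comment> \<open>The universal element is factored by an identity, so \<open>delta_ap\<close>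
    will contribute only \<open>\<Phi>'\<close> of an identity in the middle.\<close>
  have bs: "bsingle ?a x (un x) = bel_of ?s ?Y id (\<lambda>z. ap (Ide A ?a) (val ?Y z))"
    by (simp add: bsingle_def bel_of_single_eq_iff ap_Ide x)
  have l: "lunit A x \<in> hom bA (bmu_obj ?Y) x" by (rule lunit_in[OF G.L.A.category_axioms x])
  note u = unit'(1)[OF a]
  have m: "m' ?Y \<in> hom A (ob ?s) (ob (bmu_obj ?Y))" using mult'(1)[OF Y] unfolding sY .
  have "delta L ?a (lunitor L ?a ?a (Ide A ?a)) (bsingle ?a x (un x)) =
      ap (m' ?Y \<odot>\<^bsub>A\<^esub> farr \<Phi>' (Ide bA ?s) \<odot>\<^bsub>A\<^esub> \<upsilon>' ?a) (bmu_obj ?Y)"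
    using delta_ap[OF u Y bh] unfolding bs unit'(2)[OF a] sY b by simp
  also have "farr \<Phi>' (Ide bA ?s) \<odot>\<^bsub>A\<^esub> \<upsilon>' ?a = \<upsilon>' ?a"
    using Phi'.farr_Ide[of ?s] s G.L.A.Ide_Comp[OF u] by (simp add: Phi_obj)
  finally have "PAct F (Ide A ?a) (lunit A x) (ap (m' ?Y \<odot>\<^bsub>A\<^esub> \<upsilon>' ?a) (bmu_obj ?Y)) = un x"
    using G.L.ax1[OF a x un_in[OF x]] by simp
  then have "ap (farr \<Phi>' (lunit A x) \<odot>\<^bsub>A\<^esub> m' ?Y \<odot>\<^bsub>A\<^esub> \<upsilon>' ?a) x = ap (Ide A ?a) x"
    using ap_right[OF l G.L.A.Comp_in[OF m u]] ap_Ide[OF x] by simp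
  then show ?thesis
    by (rule ap_cancel[OF x G.L.A.Comp_in[OF Phi_arr(1)[OF l] G.L.A.Comp_in[OF m u]] G.L.A.Ide_in[OF a]])
qed

lemma unit'_ax2:
  assumes x: "x \<in> bObj A"
  shows "farr \<Phi>' (runit A x) \<odot>\<^bsub>A\<^esub> m' (bmap single x) \<odot>\<^bsub>A\<^esub> farr \<Phi>' (bnt (fid A) (fcomp A \<Phi>' (bunit A)) \<upsilon>' x) = Ide A (ob x)"
proof -
  let ?Y = "bmap single x :: ('u, ('u, 'o) bobj) bobj" and ?n = "bnt (fid A) (fcomp A \<Phi>' (bunit A)) \<upsilon>' x"
  have v: "val x z \<in> Obj A" if "z \<in> idx x" for z using bObjD(2)[OF x that] .
  have Y: "?Y \<in> bObj bA" by (rule bmap_in[OF x]) (simp add: single_in)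
  have n': "?n = bel_of x (bmap (fobj \<Phi>') ?Y) id (\<lambda>z. \<upsilon>' (val x z))"
    using bmap_fcomp[OF x, of \<Phi>' "bunit A"] by (simp add: bnt_def bmap_fid[OF x])
  have n: "?n \<in> hom bA x (bmap (fobj \<Phi>') ?Y)"
    unfolding n' hom_bcat[OF x bPhi_in[OF Y]]
    by (rule bsetI) (use unit'(1) v in \<open>auto simp: Phi_obj single_in\<close>)
  \<comment> \<open>Each \<Gamma>(id) factors through the universal element as
    \<open>\<upsilon>'\<close>, so the tuple of the second axiom is the one that
    \<open>delta_ap\<close> associates with the component ?n of
    \<open>\<beta>\<upsilon>'\<close>.\<close>
  have s: "bel_of x ?Y id (\<lambda>z. lunitor L (val x z) (val x z) (Ide A (val x z))) = bel_of x ?Y id (\<lambda>z. ap (\<upsilon>' (val x z)) (val ?Y z))"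
    by (rule bel_of_cong) (use bObjD(1)[OF x] unit'(2) v in auto)
  have r: "runit A x \<in> hom bA (bmu_obj ?Y) x" by (rule runit_in[OF G.L.A.category_axioms x])
  note i = G.L.A.Ide_in[OF ob_in[OF x]]
  note c = G.L.A.Comp_in[OF mult'(1)[OF Y] Phi_arr(1)[OF n]]
  have "delta L (ob x) (un x) (bel_of x ?Y id (\<lambda>z. lunitor L (val x z) (val x z) (Ide A (val x z)))) =
      ap (m' ?Y \<odot>\<^bsub>A\<^esub> farr \<Phi>' ?n \<odot>\<^bsub>A\<^esub> Ide A (ob x)) (bmu_obj ?Y)"
    using delta_ap[OF i Y n[unfolded n']] unfolding s n' ap_Ide[OF x] by simp
  then have "PAct F (Ide A (ob x)) (runit A x) (ap (m' ?Y \<odot>\<^bsub>A\<^esub> farr \<Phi>' ?n) (bmu_obj ?Y)) = un x"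
    using G.L.ax2[OF ob_in[OF x] x un_in[OF x]] G.L.A.Comp_Ide[OF Phi_arr(1)[OF n]] by simp
  then have "ap (farr \<Phi>' (runit A x) \<odot>\<^bsub>A\<^esub> m' ?Y \<odot>\<^bsub>A\<^esub> farr \<Phi>' ?n) x = ap (Ide A (ob x)) x"
    using ap_right[OF r c] ap_Ide[OF x] by simp
  then show ?thesis
    by (rule ap_cancel[OF x G.L.A.Comp_in[OF Phi_arr(1)[OF r] c] i])
qed

text \<open>The third lax algebra axiom, taken at universal elements on all levels: u, the tuple
  \<open>UU\<close>, and the tuple t of tuples \<open>UU\<close>. Both sides are factored by
  \<open>delta_ap\<close> and the factors compared.\<close>

lemma assoc'_ax:
  assumes Z: "Z \<in> bObj bbA"
  shows "farr \<Phi>' (bassoc A Z) \<odot>\<^bsub>A\<^esub> m' (bmu_obj Z) \<odot>\<^bsub>A\<^esub> m' (bmap (bmap (fobj \<Phi>')) Z) =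
    m' (bmap bmu_obj Z) \<odot>\<^bsub>A\<^esub> farr \<Phi>' (bnt (fcomp bbA \<Phi>' (bfun \<Phi>')) (fcomp bbA \<Phi>' bmu) m' Z)"
proof -
  let ?Y = "bmap (bmap (fobj \<Phi>')) Z" and ?n = "bnt (fcomp bbA \<Phi>' (bfun \<Phi>')) (fcomp bbA \<Phi>' bmu) m' Z"
  let ?x = "bmap (fobj \<Phi>') ?Y" and ?W = "bmap bmu_obj Z"
  have Zz: "val Z z \<in> bObj bA" if "z \<in> idx Z" for z using bObjD(2)[OF Z that] by simp
  have Y: "?Y \<in> bObj bA" by (rule bmap_in[OF Z]) (simp add: bPhi_in)
  have x: "?x \<in> bObj A" by (rule bPhi_in[OF Y])
  have W: "?W \<in> bObj bA" by (rule bmap_in[OF Z]) (simp add: bmu_obj_in)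
  have muZ: "bmu_obj Z \<in> bObj bA" by (rule bmu_obj_in[OF Z])
  have muY: "bmu_obj ?Y \<in> bObj A" by (rule bmu_obj_in[OF Y])
  have YZ: "bmap (fobj \<Phi>') (bmu_obj Z) = bmu_obj ?Y" by (rule bmap_bmu_obj[OF Z])
  define t where "t = bel_of ?Y Z id (\<lambda>z. UU (val Z z))"
  have t: "t \<in> bset (bset (PEl F)) ?Y Z"
    unfolding t_def by (rule bsetI) (use UU_in Zz in auto)
  \<comment> \<open>The universal element chosen for an object is the same wherever the object
    occurs, so flattening t gives the tuple of universal elements over \<mu> Z.\<close>
  have tU: "bmu_el t = UU (bmu_obj Z)"
  proof -
    have "t = bel_of ?Y Z id (\<lambda>z. bel_of (bmap (fobj \<Phi>') (val Z z)) (val Z z) id (\<lambda>w. un (val (val Z z) w)))"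
      by (simp add: t_def UU_def)
    then have "bmu_el t = bel_of (bmu_obj ?Y) (bmu_obj Z) (\<lambda>v. case dec v of (y, w) \<Rightarrow> enc (id y, id w))
        (\<lambda>v. case dec v of (z, w) \<Rightarrow> un (val (val Z z) w))"
      using bmu_el_bel_of[of ?Y Z id _ "\<lambda>_. id" "\<lambda>z w. un (val (val Z z) w)"] by simp
    also have "\<dots> = UU (bmu_obj Z)"
      unfolding UU_def YZ by (rule bel_of_cong) (use bObjD(1)[OF muZ] in \<open>auto simp: bmu_obj_simps\<close>)
    finally show ?thesis .
  qed
  have as: "bassoc A Z \<in> hom bA (bmu_obj (bmu_obj Z)) (bmu_obj ?W)" by (rule bassoc_in[OF G.L.A.category_axioms Z])
  note i = G.L.A.Ide_in[OF ob_in[OF x]]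
  have mY: "m' ?Y \<in> hom A (ob ?x) (ob (bmu_obj ?Y))" by (rule mult'(1)[OF Y])
  have mZ: "m' (bmu_obj Z) \<in> hom A (ob (bmu_obj ?Y)) (ob (bmu_obj (bmu_obj Z)))" using mult'(1)[OF muZ] unfolding YZ .
  \<comment> \<open>\<open>delta_ap\<close> expects factored components; universal elements are
    factored by identities, which form an identity of \<beta>A.\<close>
  have UZ: "UU (bmu_obj Z) = bel_of (bmu_obj ?Y) (bmu_obj Z) id (\<lambda>v. ap (Ide A (ob (val (bmu_obj Z) v))) (val (bmu_obj Z) v))"
    unfolding UU_def YZ
    by (rule bel_of_cong) (use bObjD(1)[OF muZ] bObjD(2)[OF muZ] in \<open>auto simp: ap_Ide simp del: bmu_obj_simps\<close>)
  have I: "bel_of (bmu_obj ?Y) (bmap (fobj \<Phi>') (bmu_obj Z)) id (\<lambda>v. Ide A (ob (val (bmu_obj Z) v))) = Ide bA (bmu_obj ?Y)"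
    unfolding YZ[symmetric] bcat_simps(4)
    by (rule bel_of_cong) (use bObjD(1)[OF muZ] val_bPhi[OF muZ] in \<open>auto simp del: bmu_obj_simps\<close>)
  have Ih: "bel_of (bmu_obj ?Y) (bmap (fobj \<Phi>') (bmu_obj Z)) id (\<lambda>v. Ide A (ob (val (bmu_obj Z) v))) \<in>
      hom bA (bmu_obj ?Y) (bmap (fobj \<Phi>') (bmu_obj Z))"
  proof -
    have "bel_of (bmu_obj ?Y) (bmap (fobj \<Phi>') (bmu_obj Z)) id (\<lambda>v. Ide A (ob (val (bmu_obj Z) v))) \<in>
        hom bA (bmu_obj ?Y) (bmu_obj ?Y)"
      unfolding I by (rule G.L.bA.Ide_in) (use muY in simp)
    then show ?thesis unfolding YZ .
  qed
  have ultYZ: "ult (bmu_obj ?Y) = ult (bmu_obj Z)" unfolding YZ[symmetric] by simp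
  have IY: "farr \<Phi>' (Ide bA (bmu_obj ?Y)) \<odot>\<^bsub>A\<^esub> m' ?Y = m' ?Y"
    using Phi'.farr_Ide[of "bmu_obj ?Y"] muY G.L.A.Ide_Comp[OF mY] by (simp add: Phi_obj)
  have d1: "delta L (ob ?x) (delta L (ob ?x) (un ?x) (UU ?Y)) (bmu_el t) = ap (m' (bmu_obj Z) \<odot>\<^bsub>A\<^esub> m' ?Y) (bmu_obj (bmu_obj Z))"
    using delta_ap[OF mY muZ Ih] ultYZ unfolding tU UZ I IY mult'(2)[OF Y] by simp
  have lhs: "PAct F (Ide A (ob ?x)) (bassoc A Z) (delta L (ob ?x) (delta L (ob ?x) (un ?x) (UU ?Y)) (bmu_el t)) =
      ap (farr \<Phi>' (bassoc A Z) \<odot>\<^bsub>A\<^esub> m' (bmu_obj Z) \<odot>\<^bsub>A\<^esub> m' ?Y) (bmu_obj ?W)"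
    unfolding d1 by (rule ap_right[OF as G.L.A.Comp_in[OF mZ mY]])
  have n': "?n = bel_of ?x (bmap (fobj \<Phi>') ?W) id (\<lambda>z. m' (val Z z))"
    using bmap_fcomp[OF Z, of \<Phi>' "bfun \<Phi>'"] bmap_fcomp[OF Z, of \<Phi>' bmu] by (simp add: bnt_def)
  have n: "?n \<in> hom bA ?x (bmap (fobj \<Phi>') ?W)"
    unfolding n' hom_bcat[OF x bPhi_in[OF W]]
    by (rule bsetI) (use mult'(1) Zz in \<open>auto simp: Phi_obj bPhi_in bmu_obj_in\<close>)
  \<comment> \<open>Each component is \<Delta> of universal elements, which \<open>m'\<close>
    factors by definition; the resulting tuple is the one belonging to
    \<open>\<beta>m'\<close>.\<close>
  have "bprof_map (lmult L) (compositor bbA bA A F (bprof F) (UU ?Y) t) =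
      bel_of ?x Z (id \<circ> id) (\<lambda>z. delta L (val ?x (id (id z))) (un (val ?Y (id z))) (UU (val Z z)))"
    unfolding UU_def[of ?Y] t_def
    by (rule bprof_map_compositor) (use bObjD(1)[OF Z] in \<open>auto simp: UU_def\<close>)
  also have "\<dots> = bel_of ?x Z id (\<lambda>z. ap (m' (val Z z)) (val ?W z))"
    by (rule bel_of_cong) (use bObjD(1)[OF Z] Zz mult'(2)[OF Zz] in \<open>auto simp: Phi_obj bPhi_in\<close>)
  finally have c: "retgt ?W (bprof_map (lmult L) (compositor bbA bA A F (bprof F) (UU ?Y) t)) =
      bel_of ?x ?W id (\<lambda>z. ap (m' (val Z z)) (val ?W z))"
    by (simp add: retgt_bel_of)
  have rhs: "delta L (ob ?x) (un ?x) (retgt ?W (bprof_map (lmult L) (compositor bbA bA A F (bprof F) (UU ?Y) t))) =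
      ap (m' ?W \<odot>\<^bsub>A\<^esub> farr \<Phi>' ?n) (bmu_obj ?W)"
    using delta_ap[OF i W n[unfolded n']] G.L.A.Comp_Ide[OF Phi_arr(1)[OF n]] unfolding c n'[symmetric] ap_Ide[OF x] by simp
  have "ap (farr \<Phi>' (bassoc A Z) \<odot>\<^bsub>A\<^esub> m' (bmu_obj Z) \<odot>\<^bsub>A\<^esub> m' ?Y) (bmu_obj ?W) = ap (m' ?W \<odot>\<^bsub>A\<^esub> farr \<Phi>' ?n) (bmu_obj ?W)"
    using G.L.ax3[OF ob_in[OF x] x Y Z un_in[OF x] UU_in[OF Y] t] lhs rhs by simp
  then show ?thesis
    by (rule ap_cancel[OF bmu_obj_in[OF W] G.L.A.Comp_in[OF Phi_arr(1)[OF as] G.L.A.Comp_in[OF mZ mY]]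
        G.L.A.Comp_in[OF mult'(1)[OF W] Phi_arr(1)[OF n]]])
qed

lemma pseudo_algebra_P': "pseudo_algebra P'"
  unfolding pseudo_algebra_def Let_def P'_def palg.simps
proof (intro conjI ballI)
  fix x assume "x \<in> Obj bA"
  then show "farr \<Phi>' (lunit A x) \<odot>\<^bsub>A\<^esub> m' (single x) \<odot>\<^bsub>A\<^esub> \<upsilon>' (fobj \<Phi>' x) = Ide A (fobj \<Phi>' x)"
    "farr \<Phi>' (runit A x) \<odot>\<^bsub>A\<^esub> m' (bmap single x) \<odot>\<^bsub>A\<^esub> farr \<Phi>' (bnt (fid A) (fcomp A \<Phi>' (bunit A)) \<upsilon>' x) = Ide A (fobj \<Phi>' x)"
    using unit'_ax1 unit'_ax2 by (simp_all add: Phi_obj)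
next
  fix Z :: "('u, ('u, ('u, 'o) bobj) bobj) bobj" assume "Z \<in> Obj (bcat bbA)"
  then show "farr \<Phi>' (bassoc A Z) \<odot>\<^bsub>A\<^esub> m' (bmu_obj Z) \<odot>\<^bsub>A\<^esub> m' (bmap (bmap (fobj \<Phi>')) Z) =
    m' (bmap bmu_obj Z) \<odot>\<^bsub>A\<^esub> farr \<Phi>' (bnt (fcomp bbA \<Phi>' (bfun \<Phi>')) (fcomp bbA \<Phi>' bmu) m' Z)"
    using assoc'_ax by simp
qed (rule G.L.A.category_axioms locally_small ext_Phi' unit'_nat mult'_nat)+

text \<open>Factorization through the universal elements is the required identification. Every
  element is \<open>ap\<close> of its factor, so the laws reduce to \<open>ap_left\<close>,
  \<open>ap_right\<close> and \<open>delta_ap\<close>.\<close>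

lemma is_rep_lax_P': "is_rep_lax L P'"
proof -
  interpret P': pseudo_alg P' by unfold_locales (rule pseudo_algebra_P')
  have P': "P'.A = A" "P'.\<Phi> = \<Phi>'" "P'.\<upsilon> = \<upsilon>'" "P'.m = m'" by (simp_all add: P'_def)
  define \<Xi> where "\<Xi> = (\<lambda>a \<in> Obj A. \<lambda>x \<in> bObj A. \<lambda>r \<in> PEl F a x. fc a x r)"
  have xi: "\<Xi> a x r = fc a x r" if "a \<in> Obj A" "x \<in> bObj A" "r \<in> PEl F a x" for a x r
    using that by (simp add: \<Xi>_def)
  have xi_ap: "\<Xi> a x (ap h x) = h" if "x \<in> bObj A" "h \<in> hom A a (ob x)" for a x h
    using xi[OF _ that(1) ap_in[OF that]] fc_ap[OF that] G.L.A.hom_Obj[OF that(2)] by simp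
  have ex_ap: "\<exists>h \<in> hom A a (ob x). r = ap h x" if "a \<in> Obj A" "x \<in> bObj A" "r \<in> PEl F a x" for a x r
    using fc_in[OF that(2,1,3)] ap_fc[OF that(2,1,3)] by metis
  have bm: "bmap (fobj (fid A)) x = x" if "x \<in> bObj A" for x :: "('u, 'o) bobj" using that by (rule bmap_fid)
  let ?X = "\<lparr>rfun = fid A, rnat = \<Xi>\<rparr>"
  have "rcolax_morphism L P'.L ?X"
  proof (rule rcolax_morphismI; unfold P'.lax_simps P' rcolax.simps)
    show "ext_functor A A (fid A)" by (rule ext_functor_fid) (rule G.L.A.category_axioms)
    show "prof_nat bA A F (pull_prof (rep_prof A \<Phi>') (fid A) (bfun (fid A))) \<Xi>"
    proof (rule prof_natI)
      show "\<Xi> \<in> (\<Pi>\<^sub>E d\<in>Obj A. \<Pi>\<^sub>E c\<in>Obj bA. PEl F d c \<rightarrow>\<^sub>E PEl (pull_prof (rep_prof A \<Phi>') (fid A) (bfun (fid A))) d c)"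
        by (auto simp: \<Xi>_def fid_simps bm Phi_obj fc_in)
      fix h v a' a x x' r assume h: "h \<in> hom A a' a" and v: "v \<in> hom bA x x'" and r: "r \<in> PEl F a x"
      have o: "a \<in> Obj A" "a' \<in> Obj A" "x \<in> bObj A" "x' \<in> bObj A"
        using G.L.A.hom_Obj[OF h] G.L.bA.hom_Obj[OF v] by auto
      obtain k where k: "k \<in> hom A a (ob x)" "r = ap k x" using ex_ap[OF o(1,3) r] by blast
      note kh = G.L.A.Comp_in[OF k(1) h]
      have "PAct F h v r = PAct F (Ide A a') v (PAct F h (Ide bA x) r)"
        using G.L.F.act_split(2)[OF h v r] by simp
      also have "\<dots> = ap (farr \<Phi>' v \<odot>\<^bsub>A\<^esub> k \<odot>\<^bsub>A\<^esub> h) x'"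
        unfolding k(2) ap_left[OF o(3) k(1) h] by (rule ap_right[OF v kh])
      finally show "\<Xi> a' x' (PAct F h v r) = PAct (pull_prof (rep_prof A \<Phi>') (fid A) (bfun (fid A))) h v (\<Xi> a x r)"
        using xi_ap[OF o(4) G.L.A.Comp_in[OF Phi_arr(1)[OF v] kh]] xi_ap[OF o(3) k(1)] k(2) homD(1)[OF h] homD(1)[OF v]
        by (simp add: fid_simps bfun_fid)
    qed
    fix a assume a: "a \<in> Obj A"
    have "lunitor P'.L a a (Ide A a) = \<upsilon>' a"
      using P'.lunitor_simp[of "Ide A a" a a] G.L.A.Ide_in[OF a] G.L.A.Comp_Ide[OF unit'(1)[OF a]] by (simp add: P')
    then show "\<Xi> a (single a) (lunitor L a a (Ide A a)) = lunitor P'.L (fobj (fid A) a) (fobj (fid A) a) (Ide A (fobj (fid A) a))"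
      using xi_ap[OF single_in[OF a] unit'(1)[OF a]] unit'(2)[OF a] a by (simp add: fid_simps)
    fix x Y r s assume x: "x \<in> bObj A" and Y: "Y \<in> bObj bA" and r: "r \<in> PEl F a x" and s: "s \<in> bset (PEl F) x Y"
    obtain k where k: "k \<in> hom A a (ob x)" "r = ap k x" using ex_ap[OF a x r] by blast
    obtain t \<zeta> where t: "s = bel_of x Y t \<zeta>" "t \<in> idx Y \<rightarrow> idx x" "filtermap t (ult Y) = ult x"
      "\<And>z. z \<in> idx Y \<Longrightarrow> \<zeta> z \<in> PEl F (val x (t z)) (val Y z)"
      using s by (rule bsetE) blast
    have o: "val x (t z) \<in> Obj A" "val Y z \<in> bObj A" if "z \<in> idx Y" for z
      using bObjD(2)[OF x] bObjD(2)[OF Y] that t(2) by auto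
    define \<eta> where "\<eta> z = fc (val x (t z)) (val Y z) (\<zeta> z)" for z
    \<comment> \<open>Factoring every component brings an arbitrary s into the form on which
      \<open>delta_ap\<close> computes.\<close>
    have s': "s = bel_of x Y t (\<lambda>z. ap (\<eta> z) (val Y z))"
      unfolding t(1) by (rule bel_of_cong[OF bObjD(1)[OF Y]]) (use ap_fc[OF o(2,1) t(4)] in \<open>auto simp: \<eta>_def\<close>)
    have e: "bel_of x (bmap (fobj \<Phi>') Y) t \<eta> \<in> hom bA x (bmap (fobj \<Phi>') Y)"
      unfolding hom_bcat[OF x bPhi_in[OF Y]]
      by (rule bsetI) (use t(2,3) fc_in[OF o(2,1) t(4)] o(2) in \<open>auto simp: \<eta>_def Phi_obj\<close>)
    have bb: "bmap (bmap (fobj (fid A))) Y = Y" by (rule bmap_ident[OF Y]) (simp add: bm)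
    have push: "theta_push (fid A) \<Xi> s = retgt Y (bel_of x (bmap (fobj \<Phi>') Y) t \<eta>)"
      unfolding t(1) theta_push_bel_of bm[OF x] bb
      by (subst retgt_bel_of) (use bObjD(1)[OF Y] xi[OF o t(4)] in \<open>auto simp: \<eta>_def intro!: bel_of_cong\<close>)
    note ret = retgt_bset[OF Y e]
    have "delta P'.L a k (theta_push (fid A) \<Xi> s) = m' Y \<odot>\<^bsub>A\<^esub> farr \<Phi>' (bel_of x (bmap (fobj \<Phi>') Y) t \<eta>) \<odot>\<^bsub>A\<^esub> k"
      using P'.delta_rep(1)[of k a x Y "theta_push (fid A) \<Xi> s"] k(1) x Y ret unfolding push by (simp add: P' Phi_obj)
    then show "\<Xi> a (bmu_obj Y) (delta L a r s) = delta P'.L (fobj (fid A) a) (\<Xi> a x r) (theta_push (fid A) \<Xi> s)"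
      using delta_ap[OF k(1) Y e t(3)] xi_ap[OF x k(1)] a k(2)
        xi_ap[OF bmu_obj_in[OF Y] G.L.A.Comp_in[OF mult'(1)[OF Y] G.L.A.Comp_in[OF Phi_arr(1)[OF e] k(1)]]]
      by (simp add: fid_simps flip: s')
  qed
  moreover have "bij_betw (\<Xi> a x) (PEl F a x) (hom A a (ob x))" if "a \<in> Obj A" "x \<in> bObj A" for a x
    by (rule bij_betwI[where g = "\<lambda>h. ap h x"])
      (use that xi fc_in ap_in ap_fc fc_ap in auto)
  ultimately show ?thesis
    unfolding is_rep_lax_def using P' by (auto simp: P'.lax_simps Phi_obj intro!: exI[of _ \<Xi>])
qed

end

text \<open>Vertical composition is pointwise, so an inverse 2-cell inverts every component.\<close>

lemma iso_2cell:
  fixes L M :: "('u :: universe, 'o, 'm, 'e) lax"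
  assumes LM: "lax_algebra L" "lax_algebra M" and iso: "isomorphic (HOM UltSp L M) F G"
  obtains \<sigma> where "rcolax_2cell L M F G \<sigma>" "\<And>a. a \<in> Obj (lcat L) \<Longrightarrow> iso_arr (lcat M) (\<sigma> a)"
proof -
  interpret M: lax_alg M by unfold_locales fact
  obtain s where "s \<in> hom (HOM UltSp L M) F G" "iso_arr (HOM UltSp L M) s"
    using iso unfolding isomorphic_def by blast
  then obtain \<sigma> t where s: "s = (F, G, \<sigma>)" "rcolax_2cell L M F G \<sigma>" "t \<in> hom (HOM UltSp L M) G F"
    "t \<odot>\<^bsub>HOM UltSp L M\<^esub> s = Ide (HOM UltSp L M) F" "s \<odot>\<^bsub>HOM UltSp L M\<^esub> t = Ide (HOM UltSp L M) G"
    by (auto simp: hom_def iso_arr_def UltSp_simps)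
  then obtain \<tau> where t: "t = (G, F, \<tau>)" "rcolax_2cell L M G F \<tau>"
    by (auto simp: hom_def UltSp_simps)
  have eq: "restrict (\<lambda>a. \<tau> a \<odot>\<^bsub>lcat M\<^esub> \<sigma> a) (Obj (lcat L)) = restrict (\<lambda>a. Ide (lcat M) (fobj (rfun F) a)) (Obj (lcat L))"
    "restrict (\<lambda>a. \<sigma> a \<odot>\<^bsub>lcat M\<^esub> \<tau> a) (Obj (lcat L)) = restrict (\<lambda>a. Ide (lcat M) (fobj (rfun G) a)) (Obj (lcat L))"
    using s(4,5) unfolding s(1) t(1) by (simp_all add: UltSp_simps)
  have "iso_arr (lcat M) (\<sigma> a)" if a: "a \<in> Obj (lcat L)" for a
  proof (rule M.A.iso_arrI)
    show "\<sigma> a \<in> hom M.A (fobj (rfun F) a) (fobj (rfun G) a)" "\<tau> a \<in> hom M.A (fobj (rfun G) a) (fobj (rfun F) a)"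
      using nat_transD(1)[OF rcolax_2cellD(1)[OF s(2)] a] nat_transD(1)[OF rcolax_2cellD(1)[OF t(2)] a] .
    show "\<tau> a \<odot>\<^bsub>M.A\<^esub> \<sigma> a = Ide M.A (fobj (rfun F) a)" "\<sigma> a \<odot>\<^bsub>M.A\<^esub> \<tau> a = Ide M.A (fobj (rfun G) a)"
      using fun_cong[OF eq(1), of a] fun_cong[OF eq(2), of a] a by simp_all
  qed
  then show thesis using that[OF s(2)] by blast
qed

lemma is_rep_lax_of_equivalent:
  fixes L :: "('u :: universe, 'o, 'm, 'm) lax"
  assumes L: "lax_algebra L" "normalized L" and P: "pseudo_algebra P" and eq: "equivalent UltSp (rep_lax P) L"
  shows "\<exists>P'. pseudo_algebra P' \<and> is_rep_lax L P'"
proof -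
  note M = rep_lax_simps[OF P]
  obtain F G where F: "rcolax_morphism (rep_lax P) L F" and G: "rcolax_morphism L (rep_lax P) G"
    and iso: "isomorphic (HOM UltSp (rep_lax P) (rep_lax P)) (rcolax_comp (rep_lax P) G F) (rcolax_id (rep_lax P))"
      "isomorphic (HOM UltSp L L) (rcolax_comp L F G) (rcolax_id L)"
    using eq unfolding equivalent_def by (auto simp: UltSp_simps)
  obtain \<sigma> where \<sigma>: "rcolax_2cell (rep_lax P) (rep_lax P) (rcolax_comp (rep_lax P) G F) (rcolax_id (rep_lax P)) \<sigma>"
    "\<And>a. a \<in> Obj (lcat (rep_lax P)) \<Longrightarrow> iso_arr (lcat (rep_lax P)) (\<sigma> a)"
    using iso_2cell[OF M(1,1) iso(1)] by blast
  obtain \<tau> where \<tau>: "rcolax_2cell L L (rcolax_comp L F G) (rcolax_id L) \<tau>"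
    "\<And>a. a \<in> Obj (lcat L) \<Longrightarrow> iso_arr (lcat L) (\<tau> a)"
    using iso_2cell[OF L(1,1) iso(2)] by blast
  interpret P: pseudo_alg P by unfold_locales fact
  interpret F: rcolax_mor "rep_lax P" L F by unfold_locales (rule M L F)+
  interpret repr L P G
  proof
    show "rcolax_morphism L (rep_lax P) G" "normalized L"
      by (rule L G)+
    show "locally_small TYPE('u) (lcat L)" using L(1) by (simp add: lax_algebra_def Let_def)
    show "bij_betw (rnat G a x) (PEl (lprof L) a x) (hom P.A (fobj (rfun G) a) (fobj P.\<Phi> (bmap (fobj (rfun G)) x)))"
      if "a \<in> Obj (lcat L)" "x \<in> bObj (lcat L)" for a x
      using theta_bij[OF L(1) M(1) F G \<tau> \<sigma> that] by simp
    \<comment> \<open>The witness for b is its image under F, since \<sigma> at b is an isomorphism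
      from G(F b) to b.\<close>
    show "\<exists>a \<in> Obj (lcat L). \<exists>i \<in> hom P.A (fobj (rfun G) a) b. iso_arr P.A i" if b: "b \<in> Obj P.A" for b
    proof (intro bexI)
      show "iso_arr P.A (\<sigma> b)" using \<sigma>(2) b by simp
      show "\<sigma> b \<in> hom P.A (fobj (rfun G) (fobj (rfun F) b)) b"
        using nat_transD(1)[OF rcolax_2cellD(1)[OF \<sigma>(1)], of b] b
        by (simp add: rcolax_comp_def rcolax_id_def fcomp_simps fid_simps)
      show "fobj (rfun F) b \<in> Obj (lcat L)" using F.f.fobj_in b by simp
    qed
  qed
  show ?thesis using pseudo_algebra_P' is_rep_lax_P' by blast
qed

text \<open>Beyond full faithfulness, this makes the 2-functor an embedding in the strict
  sense.\<close>

lemma inj_emb: "inj_on (jobj (emb :: (('u :: universe, 'o, 'm) palg, _, _, _, _, _) two_func)) (Ob UltCat)"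
  by (rule inj_onI) (auto simp: emb_simps UltCat_simps intro: inj_rep_lax)

lemma essential_image_emb:
  "essential_image UltCat UltSp (emb :: (('u :: universe, 'o, 'm) palg, _, _, _, _, _) two_func) =
    {L \<in> Ob UltSp. \<exists>P. pseudo_algebra P \<and> is_rep_lax L P}"
proof (intro set_eqI iffI)
  fix L assume "L \<in> essential_image UltCat UltSp (emb :: (('u, 'o, 'm) palg, _, _, _, _, _) two_func)"
  then obtain P where "lax_algebra L" "normalized L" "pseudo_algebra P" "equivalent UltSp (rep_lax P) L"
    by (auto simp: essential_image_def UltCat_simps UltSp_simps emb_simps)
  from this(1,2) is_rep_lax_of_equivalent[OF this]
  show "L \<in> {L \<in> Ob UltSp. \<exists>P. pseudo_algebra P \<and> is_rep_lax L P}" by (simp add: UltSp_simps)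
next
  fix L :: "('u, 'o, 'm, 'm) lax" assume "L \<in> {L \<in> Ob UltSp. \<exists>P. pseudo_algebra P \<and> is_rep_lax L P}"
  then obtain P where "lax_algebra L" "normalized L" "pseudo_algebra P" "is_rep_lax L P"
    by (auto simp: UltSp_simps)
  with equivalent_rep_lax[OF this]
  show "L \<in> essential_image UltCat UltSp (emb :: (('u, 'o, 'm) palg, _, _, _, _, _) two_func)"
    by (auto simp: essential_image_def UltCat_simps UltSp_simps emb_simps)
qed

theorem corollary5p26:
  shows "\<exists>J :: (('u :: universe, 'o, 'm) palg, ('u, 'o, 'm) colax,
                  ('u, 'o, 'm) colax \<times> ('u, 'o, 'm) colax \<times> ('o \<Rightarrow> 'm),
                ('u, 'o, 'm, 'm) lax, ('u, 'o, 'm, 'm) rcolax,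
                  ('u, 'o, 'm, 'm) rcolax \<times> ('u, 'o, 'm, 'm) rcolax \<times> ('o \<Rightarrow> 'm)) two_func.
    two_functor UltCat UltSp J \<and>
    two_fully_faithful UltCat UltSp J \<and>
    inj_on (jobj J) (Ob UltCat) \<and>
    essential_image UltCat UltSp J = {L \<in> Ob UltSp. \<exists>P. pseudo_algebra P \<and> is_rep_lax L P}"
  by (intro exI[of _ emb] conjI two_functor_emb two_fully_faithful_emb inj_emb essential_image_emb)

end
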